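(* Consider the hidden-source key agreement model described in the context, with finite alphabets $\mathcal{X},\widetilde{\mathcal{X}},\mathcal{A},\mathcal{Y},\mathcal{Z}$, source $P_X$, encoder measurement channel $P_{\widetilde{X}|X}$, decoder/eavesdropper measurement channel $P_{YZ|X\widetilde{X}A}$ and action cost $\Gamma$. For random variables with joint distribution of the form $P_XP_{\widetilde{X}|X}P_{A|\widetilde{X}}P_{YZ|X\widetilde{X}A}P_{V|\widetilde{X}A}P_{U|V}$ (with $U,V$ on finite alphabets) define \[R_{\ell,1} = I(V,X;Z|A)+I(X;A,V,Y)-I(V,X;Y|A),\] \[R_{\ell,2} = I(V,X;Z|A,U)+I(X;A,V,Y)-I(V,X;Y|A,U),\] \[R_{\ell,3} = I(X;A,U,Z).\] Then: (i) Every tuple $(R_{\mathrm{s}},R_\ell,R_{\mathrm{w}},C)$ for which there exist $P_{A|\widetilde{X}}$, $P_{V|\widetilde{X}A}$, $P_{U|V}$ with $\mathbb{E}[\Gamma(A)]\le C$ and \[0\le R_{\mathrm{s}}\le I(V;Y|A,U)-I(V;Z|A,U),\quad R_\ell\ge \max\{R_{\ell,1},R_{\ell,2},R_{\ell,3}\},\quad R_{\mathrm{w}}\ge I(\widetilde{X};A)+I(V;\widetilde{X}|A,Y)\] belongs to the key-leakage-storage-cost region $\mathcal{R}_{\mathrm{gs}}$ of the generated-secret model. (ii) Every tuple $(R_{\mathrm{s}},R_\ell,R_{\mathrm{w}},C)$ for which there exist $P_{A|\widetilde{X}}$, $P_{V|\widetilde{X}A}$, $P_{U|V}$ with $\mathbb{E}[\Gamma(A)]\le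 C$ and \[0\le R_{\mathrm{s}}\le I(V;Y|A,U)-I(V;Z|A,U),\quad R_\ell\ge \max\{R_{\ell,1},R_{\ell,2},R_{\ell,3}\},\quad R_{\mathrm{w}}\ge I(\widetilde{X};A,V)-I(U;Y|A)-I(V;Z|A,U)\] belongs to the key-leakage-storage-cost region $\mathcal{R}_{\mathrm{cs}}$ of the chosen-secret model.
   Context: Model: all alphabets are finite. The source $X^n$ is i.i.d. according to $P_X$. The encoder observes $\widetilde{X}^n$, the output of the memoryless channel $P_{\widetilde{X}|X}$ with input $X^n$. Generated-secret (GS) model: the encoder computes $(W,S)=f_1(\widetilde{X}^n)$ (helper data $W\in\mathcal{W}$, secret key $S\in\mathcal{S}$). Chosen-secret (CS) model: a secret key $S$ independent of $(X^n,\widetilde{X}^n,Y^n,Z^n)$ is given and the encoder computes $W=f_2(\widetilde{X}^n,S)$. In both models an action encoder computes $A^n=f_{\mathrm{a}}(W)$; then $(Y^n,Z^n)$ are generated from $(X^n,\widetilde{X}^n,A^n)$ through the memoryless channel $P_{YZ|X\widetilde{X}A}$, i.e. $\prod_{i=1}^n P_{YZ|X\widetilde{X}A}(y_i,z_i|x_i,\widetilde{x}_i,a_i)$. The decoder observes $(W,Y^n)$ and outputs $\hat S=g(W,Y^n)$; an eavesdropper observes $(W,Z^n)$. A cost function $\Gamma:\mathcal{A}\to[0,\infty)$ is given and $\Gamma(A^n)=\frac1n\sum_{i=1}^n\Gamma(A_i)$. A tuple $(R_{\mathrm{s}},R_\ell,R_{\mathrm{w}},C)$ is achievable (for the GS or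 CS model) if for every $\delta>0$ there exist $n\ge1$, encoders and a decoder with $R_{\mathrm{s}}=\frac{\log|\mathcal{S}|}{n}$ and $\Pr[\hat S\ne S]\le\delta$, $I(S;W,Z^n)\le\delta$, $\frac1n H(S)\ge R_{\mathrm{s}}-\delta$, $\frac1n I(X^n;W,Z^n)\le R_\ell+\delta$, $\frac1n\log|\mathcal{W}|\le R_{\mathrm{w}}+\delta$, and $\mathbb{E}[\Gamma(A^n)]\le C+\delta$. The regions $\mathcal{R}_{\mathrm{gs}}$ and $\mathcal{R}_{\mathrm{cs}}$ are the closures of the sets of achievable tuples for the GS and CS models, respectively. *)

theory Defs
  imports "HOL-Analysis.Analysis"
begin

text \<open>A finite probability space is given by a finite carrier Om and a weight function p.
  Random variables are functions on Om.  Logarithms are to base 2.\<close>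

definition prb :: "'w set \<Rightarrow> ('w \<Rightarrow> real) \<Rightarrow> ('w \<Rightarrow> 'b) \<Rightarrow> 'b \<Rightarrow> real" where
  "prb Om p f b = (\<Sum>w\<in>{w\<in>Om. f w = b}. p w)"

definition ent :: "'w set \<Rightarrow> ('w \<Rightarrow> real) \<Rightarrow> ('w \<Rightarrow> 'b) \<Rightarrow> real" where
  "ent Om p f = - (\<Sum>b\<in>f ` Om. (if prb Om p f b = 0 then 0
                      else prb Om p f b * log 2 (prb Om p f b)))"

definition cmi :: "'w set \<Rightarrow> ('w \<Rightarrow> real) \<Rightarrow> ('w \<Rightarrow> 'b) \<Rightarrow> ('w \<Rightarrow> 'c) \<Rightarrow> ('w \<Rightarrow> 'd) \<Rightarrow> real" where
  "cmi Om p X Y Z = ent Om p (\<lambda>w. (X w, Z w)) + ent Om p (\<lambda>w. (Y w, Z w))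
                    - ent Om p (\<lambda>w. (X w, Y w, Z w)) - ent Om p Z"

definition mi :: "'w set \<Rightarrow> ('w \<Rightarrow> real) \<Rightarrow> ('w \<Rightarrow> 'b) \<Rightarrow> ('w \<Rightarrow> 'c) \<Rightarrow> real" where
  "mi Om p X Y = cmi Om p X Y (\<lambda>_. ())"

definition expect :: "'w set \<Rightarrow> ('w \<Rightarrow> real) \<Rightarrow> ('w \<Rightarrow> real) \<Rightarrow> real" where
  "expect Om p f = (\<Sum>w\<in>Om. p w * f w)"

definition pair2 :: "('w \<Rightarrow> 'b) \<Rightarrow> ('w \<Rightarrow> 'c) \<Rightarrow> 'w \<Rightarrow> 'b \<times> 'c" where
  "pair2 f g = (\<lambda>w. (f w, g w))"

definition pair3 :: "('w \<Rightarrow> 'b) \<Rightarrow> ('w \<Rightarrow> 'c) \<Rightarrow> ('w \<Rightarrow> 'd) \<Rightarrow> 'w \<Rightarrow> 'b \<times> 'c \<times> 'd" where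
  "pair3 f g h = (\<lambda>w. (f w, g w, h w))"

definition is_pmf :: "('a::finite \<Rightarrow> real) \<Rightarrow> bool" where
  "is_pmf P \<longleftrightarrow> (\<forall>a. 0 \<le> P a) \<and> (\<Sum>a\<in>UNIV. P a) = 1"

definition stoch :: "('i \<Rightarrow> 'o::finite \<Rightarrow> real) \<Rightarrow> bool" where
  "stoch W \<longleftrightarrow> (\<forall>i. is_pmf (W i))"

definition joint1 ::
  "('x \<Rightarrow> real) \<Rightarrow> ('x \<Rightarrow> 'xt \<Rightarrow> real) \<Rightarrow> ('xt \<Rightarrow> 'a \<Rightarrow> real)
   \<Rightarrow> ('x \<times> 'xt \<times> 'a \<Rightarrow> 'y \<times> 'z \<Rightarrow> real) \<Rightarrow> ('xt \<times> 'a \<Rightarrow> 'v \<Rightarrow> real) \<Rightarrow> ('v \<Rightarrow> 'u \<Rightarrow> real)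
   \<Rightarrow> 'x \<times> 'xt \<times> 'a \<times> 'y \<times> 'z \<times> 'v \<times> 'u \<Rightarrow> real" where
  "joint1 PX PXt PA PYZ PV PU = (\<lambda>(x, xt, a, y, z, v, u).
     PX x * PXt x xt * PA xt a * PYZ (x, xt, a) (y, z) * PV (xt, a) v * PU v u)"

definition sX :: "'x \<times> 'xt \<times> 'a \<times> 'y \<times> 'z \<times> 'v \<times> 'u \<Rightarrow> 'x" where
  "sX = (\<lambda>(x, xt, a, y, z, v, u). x)"
definition sXt :: "'x \<times> 'xt \<times> 'a \<times> 'y \<times> 'z \<times> 'v \<times> 'u \<Rightarrow> 'xt" where
  "sXt = (\<lambda>(x, xt, a, y, z, v, u). xt)"
definition sA :: "'x \<times> 'xt \<times> 'a \<times> 'y \<times> 'z \<times> 'v \<times> 'u \<Rightarrow> 'a" where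
  "sA = (\<lambda>(x, xt, a, y, z, v, u). a)"
definition sY :: "'x \<times> 'xt \<times> 'a \<times> 'y \<times> 'z \<times> 'v \<times> 'u \<Rightarrow> 'y" where
  "sY = (\<lambda>(x, xt, a, y, z, v, u). y)"
definition sZ :: "'x \<times> 'xt \<times> 'a \<times> 'y \<times> 'z \<times> 'v \<times> 'u \<Rightarrow> 'z" where
  "sZ = (\<lambda>(x, xt, a, y, z, v, u). z)"
definition sV :: "'x \<times> 'xt \<times> 'a \<times> 'y \<times> 'z \<times> 'v \<times> 'u \<Rightarrow> 'v" where
  "sV = (\<lambda>(x, xt, a, y, z, v, u). v)"
definition sU :: "'x \<times> 'xt \<times> 'a \<times> 'y \<times> 'z \<times> 'v \<times> 'u \<Rightarrow> 'u" where
  "sU = (\<lambda>(x, xt, a, y, z, v, u). u)"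

text \<open>Outcome (x^n, xt^n, y^n, z^n).  Helper data and key sets are {..<L} and {..<K};
  f1 xt^n = (W, S); the action sequence is fa W.\<close>
definition gs_space :: "nat \<Rightarrow> ('x list \<times> 'xt list \<times> 'y list \<times> 'z list) set" where
  "gs_space n = {(xs, xts, ys, zs). length xs = n \<and> length xts = n \<and> length ys = n \<and> length zs = n}"

definition gs_prob ::
  "('x \<Rightarrow> real) \<Rightarrow> ('x \<Rightarrow> 'xt \<Rightarrow> real) \<Rightarrow> ('x \<times> 'xt \<times> 'a \<Rightarrow> 'y \<times> 'z \<Rightarrow> real)
   \<Rightarrow> nat \<Rightarrow> ('xt list \<Rightarrow> nat \<times> nat) \<Rightarrow> (nat \<Rightarrow> 'a list)
   \<Rightarrow> 'x list \<times> 'xt list \<times> 'y list \<times> 'z list \<Rightarrow> real" where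
  "gs_prob PX PXt PYZ n f1 fa = (\<lambda>(xs, xts, ys, zs).
     (\<Prod>i<n. PX (xs ! i) * PXt (xs ! i) (xts ! i)
             * PYZ (xs ! i, xts ! i, fa (fst (f1 xts)) ! i) (ys ! i, zs ! i)))"

definition achievable_gs ::
  "('x::finite \<Rightarrow> real) \<Rightarrow> ('x \<Rightarrow> 'xt::finite \<Rightarrow> real)
   \<Rightarrow> ('x \<times> 'xt \<times> 'a::finite \<Rightarrow> 'y::finite \<times> 'z::finite \<Rightarrow> real) \<Rightarrow> ('a \<Rightarrow> real)
   \<Rightarrow> real \<times> real \<times> real \<times> real \<Rightarrow> bool" where
  "achievable_gs PX PXt PYZ \<Gamma> = (\<lambda>(Rs, Rl, Rw, C).
     \<forall>\<delta>>0. \<exists>n\<ge>1. \<exists>(K::nat) (L::nat) (f1 :: 'xt list \<Rightarrow> nat \<times> nat) (fa :: nat \<Rightarrow> 'a list)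
        (g :: nat \<Rightarrow> 'y list \<Rightarrow> nat).
       (\<forall>xts. length xts = n \<longrightarrow> fst (f1 xts) < L \<and> snd (f1 xts) < K) \<and>
       (\<forall>w<L. length (fa w) = n) \<and>
       (let Om = (gs_space n :: ('x list \<times> 'xt list \<times> 'y list \<times> 'z list) set);
            p = gs_prob PX PXt PYZ n f1 fa;
            Xn = (\<lambda>(xs, xts, ys, zs). xs);
            Zn = (\<lambda>(xs, xts, ys, zs). zs);
            W = (\<lambda>(xs, xts, ys, zs). fst (f1 xts));
            S = (\<lambda>(xs, xts, ys, zs). snd (f1 xts));
            Shat = (\<lambda>(xs, xts, ys, zs). g (fst (f1 xts)) ys);
            cost = (\<lambda>(xs, xts, ys, zs). (\<Sum>i<n. \<Gamma> (fa (fst (f1 xts)) ! i)) / real n)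
        in Rs = log 2 (real K) / real n
         \<and> prb Om p (\<lambda>w. Shat w \<noteq> S w) True \<le> \<delta>
         \<and> mi Om p S (pair2 W Zn) \<le> \<delta>
         \<and> ent Om p S / real n \<ge> Rs - \<delta>
         \<and> mi Om p Xn (pair2 W Zn) / real n \<le> Rl + \<delta>
         \<and> log 2 (real L) / real n \<le> Rw + \<delta>
         \<and> expect Om p cost \<le> C + \<delta>))"

definition region_gs ::
  "('x::finite \<Rightarrow> real) \<Rightarrow> ('x \<Rightarrow> 'xt::finite \<Rightarrow> real)
   \<Rightarrow> ('x \<times> 'xt \<times> 'a::finite \<Rightarrow> 'y::finite \<times> 'z::finite \<Rightarrow> real) \<Rightarrow> ('a \<Rightarrow> real)
   \<Rightarrow> (real \<times> real \<times> real \<times> real) set" where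
  "region_gs PX PXt PYZ \<Gamma> = closure {R. achievable_gs PX PXt PYZ \<Gamma> R}"

text \<open>Outcome (s, x^n, xt^n, y^n, z^n); the key s is uniform on {..<K} and independent of
  the source and channels; W = f2 xt^n s; the action sequence is fa W.\<close>
definition cs_space :: "nat \<Rightarrow> nat \<Rightarrow> (nat \<times> 'x list \<times> 'xt list \<times> 'y list \<times> 'z list) set" where
  "cs_space n K = {(s, xs, xts, ys, zs). s < K \<and> length xs = n \<and> length xts = n
                     \<and> length ys = n \<and> length zs = n}"

definition cs_prob ::
  "('x \<Rightarrow> real) \<Rightarrow> ('x \<Rightarrow> 'xt \<Rightarrow> real) \<Rightarrow> ('x \<times> 'xt \<times> 'a \<Rightarrow> 'y \<times> 'z \<Rightarrow> real)
   \<Rightarrow> nat \<Rightarrow> nat \<Rightarrow> ('xt list \<Rightarrow> nat \<Rightarrow> nat) \<Rightarrow> (nat \<Rightarrow> 'a list)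
   \<Rightarrow> nat \<times> 'x list \<times> 'xt list \<times> 'y list \<times> 'z list \<Rightarrow> real" where
  "cs_prob PX PXt PYZ n K f2 fa = (\<lambda>(s, xs, xts, ys, zs).
     (1 / real K) * (\<Prod>i<n. PX (xs ! i) * PXt (xs ! i) (xts ! i)
             * PYZ (xs ! i, xts ! i, fa (f2 xts s) ! i) (ys ! i, zs ! i)))"

definition achievable_cs ::
  "('x::finite \<Rightarrow> real) \<Rightarrow> ('x \<Rightarrow> 'xt::finite \<Rightarrow> real)
   \<Rightarrow> ('x \<times> 'xt \<times> 'a::finite \<Rightarrow> 'y::finite \<times> 'z::finite \<Rightarrow> real) \<Rightarrow> ('a \<Rightarrow> real)
   \<Rightarrow> real \<times> real \<times> real \<times> real \<Rightarrow> bool" where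
  "achievable_cs PX PXt PYZ \<Gamma> = (\<lambda>(Rs, Rl, Rw, C).
     \<forall>\<delta>>0. \<exists>n\<ge>1. \<exists>(K::nat) (L::nat) (f2 :: 'xt list \<Rightarrow> nat \<Rightarrow> nat) (fa :: nat \<Rightarrow> 'a list)
        (g :: nat \<Rightarrow> 'y list \<Rightarrow> nat).
       K \<ge> 1 \<and>
       (\<forall>xts s. length xts = n \<longrightarrow> s < K \<longrightarrow> f2 xts s < L) \<and>
       (\<forall>w<L. length (fa w) = n) \<and>
       (let Om = (cs_space n K :: (nat \<times> 'x list \<times> 'xt list \<times> 'y list \<times> 'z list) set);
            p = cs_prob PX PXt PYZ n K f2 fa;
            Xn = (\<lambda>(s, xs, xts, ys, zs). xs);
            Zn = (\<lambda>(s, xs, xts, ys, zs). zs);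
            W = (\<lambda>(s, xs, xts, ys, zs). f2 xts s);
            S = (\<lambda>(s, xs, xts, ys, zs). s);
            Shat = (\<lambda>(s, xs, xts, ys, zs). g (f2 xts s) ys);
            cost = (\<lambda>(s, xs, xts, ys, zs). (\<Sum>i<n. \<Gamma> (fa (f2 xts s) ! i)) / real n)
        in Rs = log 2 (real K) / real n
         \<and> prb Om p (\<lambda>w. Shat w \<noteq> S w) True \<le> \<delta>
         \<and> mi Om p S (pair2 W Zn) \<le> \<delta>
         \<and> ent Om p S / real n \<ge> Rs - \<delta>
         \<and> mi Om p Xn (pair2 W Zn) / real n \<le> Rl + \<delta>
         \<and> log 2 (real L) / real n \<le> Rw + \<delta>
         \<and> expect Om p cost \<le> C + \<delta>))"

definition region_cs ::
  "('x::finite \<Rightarrow> real) \<Rightarrow> ('x \<Rightarrow> 'xt::finite \<Rightarrow> real)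
   \<Rightarrow> ('x \<times> 'xt \<times> 'a::finite \<Rightarrow> 'y::finite \<times> 'z::finite \<Rightarrow> real) \<Rightarrow> ('a \<Rightarrow> real)
   \<Rightarrow> (real \<times> real \<times> real \<times> real) set" where
  "region_cs PX PXt PYZ \<Gamma> = closure {R. achievable_cs PX PXt PYZ \<Gamma> R}"

end

theory Submission
  imports Defs
begin

text \<open>
  A two-level code. The inner code maps a block \<open>xt^n\<close> deterministically to words \<open>(a,u,v)^n\<close> by a
  greedy covering in three nested stages, so that the average letter law is close to the target law
  and the number of codewords is controlled; Gibbs' inequality and the chain rule then pin down the
  block entropies of the induced \<open>(A,U,V,X,Y,Z)\<close>. The outer code treats these blocks as letters of
  an i.i.d. source: \<open>A\<close> is sent in full, \<open>U\<close> and \<open>V\<close> are randomly binned as in Slepian--Wolf coding,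
  and a second bin index of \<open>V\<close> is the key, nearly uniform given \<open>(W,Z)\<close> by privacy amplification.
  The leakage \<open>I(X;W,Z)\<close> is \<open>I(X;A,U,Z)\<close> plus what the bin index of \<open>V\<close> adds to it, whose two regimes give
  \<open>R_l3\<close> and \<open>R_l2\<close>. A chosen key is conveyed by a one-time pad
  with the generated key. The code has rational key rates only, so the boundary is reached by closure.
\<close>

section \<open>Entropy on finite probability spaces\<close>

text \<open>The encoder has no local randomness, and its actions feed back into the law of
  \<open>Y\<close> and \<open>Z\<close>. A deterministic quantiser makes the letters of a block
  dependent and meets the target law only on average, so binning cannot be applied letter by letter;
  independent repetition of the whole block restores an i.i.d. source, at the price that its
  entropies must be computed. Quantisation lowers the entropy of a block variable containing code
  letters G by n H(G|B), with B the observation, because G is now a function of the observed block.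
  Every rate in the theorem is a combination in which these losses cancel, once the \<open>A\<close>
  codebook is counted with exponent I(B;A). The required lower bounds on block entropy hold because,
  given observation and action, the channel law is known exactly and enters linearly in the averaged
  letter law. Achievability demands \<open>Rs = log 2 K / n\<close> exactly, with the same
  \<open>Rs\<close> for all \<open>\<delta>\<close>; this is met at \<open>Rs = j / m\<close> by
  taking \<open>K\<close> a power of two and a block length divisible by \<open>m\<close>.\<close>

definition fprob :: "'w set \<Rightarrow> ('w \<Rightarrow> real) \<Rightarrow> bool" where
  "fprob Om p \<longleftrightarrow> finite Om \<and> (\<forall>w\<in>Om. 0 \<le> p w) \<and> sum p Om = 1"

lemma fprobD:
  assumes "fprob Om p"
  shows "finite Om" "\<And>w. w \<in> Om \<Longrightarrow> 0 \<le> p w" "sum p Om = 1" "Om \<noteq> {}"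
  using assms by (auto simp: fprob_def)

lemma prb_nonneg: "fprob Om p \<Longrightarrow> 0 \<le> prb Om p f b"
  unfolding prb_def by (rule sum_nonneg) (auto dest: fprobD)

lemma prb_ge:
  assumes "fprob Om p" "w \<in> Om"
  shows "p w \<le> prb Om p f (f w)"
  unfolding prb_def using assms by (intro member_le_sum) (auto dest: fprobD)

lemma prb_eq_sum_if: "finite Om \<Longrightarrow> prb Om p f b = (\<Sum>w\<in>Om. if f w = b then p w else 0)"
  unfolding prb_def by (simp add: sum.inter_filter)

lemma prb_mono:
  assumes "fprob Om p" "\<And>w. w \<in> Om \<Longrightarrow> f w = b \<Longrightarrow> g w = c"
  shows "prb Om p f b \<le> prb Om p g c"
  unfolding prb_def using assms by (intro sum_mono2) (auto dest: fprobD)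

lemma sum_prb:
  assumes "finite Om"
  shows "(\<Sum>b\<in>f ` Om. prb Om p f b * \<phi> b) = (\<Sum>w\<in>Om. p w * \<phi> (f w))"
proof -
  have "(\<Sum>w\<in>Om. p w * \<phi> (f w)) = (\<Sum>b\<in>f ` Om. \<Sum>w\<in>{w\<in>Om. f w = b}. p w * \<phi> (f w))"
    by (rule sum.image_gen[OF assms])
  also have "\<dots> = (\<Sum>b\<in>f ` Om. prb Om p f b * \<phi> b)"
    unfolding prb_def by (intro sum.cong refl) (auto simp: sum_distrib_right)
  finally show ?thesis by simp
qed

lemma sum_prb_eq_1: "fprob Om p \<Longrightarrow> (\<Sum>b\<in>f ` Om. prb Om p f b) = 1"
  using sum_prb[of Om p f "\<lambda>_. 1"] fprobD[of Om p] by simp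

lemma ent_eq_sum:
  assumes "finite Om"
  shows "ent Om p f = - (\<Sum>w\<in>Om. p w * log 2 (prb Om p f (f w)))"
proof -
  have "ent Om p f = - (\<Sum>b\<in>f ` Om. prb Om p f b * log 2 (prb Om p f b))"
    unfolding ent_def by (intro arg_cong[where f=uminus] sum.cong) auto
  then show ?thesis using sum_prb[OF assms, of p f "\<lambda>b. log 2 (prb Om p f b)"] by simp
qed

lemma prb_cong:
  assumes "\<And>w. w \<in> Om \<Longrightarrow> (f w = b) = (g w = c)"
  shows "prb Om p f b = prb Om p g c"
proof -
  have "{w\<in>Om. f w = b} = {w\<in>Om. g w = c}" using assms by auto
  then show ?thesis by (simp add: prb_def)
qed

text \<open>Entropy only sees the partition of \<open>Om\<close> into level sets. Every reordering,
  padding or re-encoding of tuples later on is an instance.\<close>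

lemma ent_cong:
  assumes "finite Om" "\<And>w w'. w \<in> Om \<Longrightarrow> w' \<in> Om \<Longrightarrow> (f w = f w') = (g w = g w')"
  shows "ent Om p f = ent Om p g"
proof -
  have "prb Om p f (f w) = prb Om p g (g w)" if "w \<in> Om" for w
    using assms(2) that by (intro prb_cong) auto
  then show ?thesis using assms(1) by (simp add: ent_eq_sum)
qed

lemma prb_bij:
  assumes "bij_betw h Om' Om" "\<And>w. w \<in> Om' \<Longrightarrow> p' w = p (h w)"
  shows "prb Om' p' (\<lambda>w. f (h w)) b = prb Om p f b"
proof -
  have "bij_betw h {w\<in>Om'. f (h w) = b} {w\<in>Om. f w = b}"
    using assms(1) by (auto simp: bij_betw_def inj_on_def)
  from sum.reindex_bij_betw[OF this, of p] show ?thesis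
    unfolding prb_def using assms(2) by (metis (mono_tags, lifting) mem_Collect_eq sum.cong)
qed

lemma ent_bij:
  assumes "bij_betw h Om' Om" "\<And>w. w \<in> Om' \<Longrightarrow> p' w = p (h w)"
  shows "ent Om' p' (\<lambda>w. f (h w)) = ent Om p f"
proof -
  have "(\<lambda>w. f (h w)) ` Om' = f ` Om" using assms(1) by (auto simp: bij_betw_def)
  then show ?thesis unfolding ent_def by (simp only: prb_bij[where f=f and h=h and p'=p' and p=p, OF assms])
qed

text \<open>The tangent line of \<open>ln\<close> at \<open>m\<close>,
  \<open>ln x \<le> ln m + x / m - 1\<close>, is averaged with the weights. Positivity of
  \<open>x i\<close> is asked only where \<open>w i > 0\<close>, because the ratios inserted later
  are meaningless on null outcomes.\<close>

lemma jensen_log2: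
  assumes "finite S" "\<And>i. i \<in> S \<Longrightarrow> 0 \<le> w i" "sum w S = 1"
    and "\<And>i. i \<in> S \<Longrightarrow> w i > 0 \<Longrightarrow> x i > 0" and "(\<Sum>i\<in>S. w i * x i) \<le> m"
  shows "(\<Sum>i\<in>S. w i * log 2 (x i)) \<le> log 2 m" and "m > 0"
proof -
  obtain j where j: "j \<in> S" "w j > 0"
  proof -
    have "\<exists>j\<in>S. w j \<noteq> 0" using assms(3) by (metis sum.neutral zero_neq_one)
    then show ?thesis using that assms(2) by (metis less_eq_real_def)
  qed
  have "0 < w j * x j" using assms(4) j by simp
  also have "\<dots> \<le> (\<Sum>i\<in>S. w i * x i)"
    using assms j by (intro member_le_sum) (fastforce simp: less_eq_real_def)+
  finally show m: "m > 0" using assms(5) by linarith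
  have "(\<Sum>i\<in>S. w i * ln (x i)) \<le> (\<Sum>i\<in>S. w i * (ln m + x i / m - 1))"
  proof (rule sum_mono)
    fix i assume i: "i \<in> S"
    show "w i * ln (x i) \<le> w i * (ln m + x i / m - 1)"
    proof (cases "w i > 0")
      case True
      then have "x i > 0" using assms(4) i by simp
      then have "ln (x i / m) \<le> x i / m - 1" using m by (intro ln_le_minus_one) simp
      then show ?thesis using True m \<open>x i > 0\<close> by (intro mult_left_mono) (auto simp: ln_div)
    next
      case False then show ?thesis using assms(2)[OF i] by simp
    qed
  qed
  also have "\<dots> = ln m * sum w S + (\<Sum>i\<in>S. w i * x i) / m - sum w S"
    by (simp add: algebra_simps sum.distrib sum_subtractf sum_distrib_left sum_divide_distrib)
  also have "\<dots> \<le> ln m" using assms(3,5) m by (simp add: divide_le_eq_1)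
  finally have "(\<Sum>i\<in>S. w i * ln (x i)) / ln 2 \<le> ln m / ln 2"
    by (rule divide_right_mono) simp
  then show "(\<Sum>i\<in>S. w i * log 2 (x i)) \<le> log 2 m"
    by (simp add: log_def sum_divide_distrib)
qed

text \<open>Gibbs' inequality for conditional entropy; every upper bound on an entropy below is an
  instance with a suitable kernel \<open>r\<close>.\<close>
lemma cond_ent_le:
  assumes P: "fprob Om p"
    and pos: "\<And>w. w \<in> Om \<Longrightarrow> p w > 0 \<Longrightarrow> r (T w) (G w) > 0"
    and nn: "\<And>t g. t \<in> T ` Om \<Longrightarrow> g \<in> G ` Om \<Longrightarrow> r t g \<ge> 0"
    and sub: "\<And>g. g \<in> G ` Om \<Longrightarrow> (\<Sum>t\<in>T ` Om. r t g) \<le> 1"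
  shows "ent Om p (\<lambda>w. (T w, G w)) - ent Om p G \<le> - (\<Sum>w\<in>Om. p w * log 2 (r (T w) (G w)))"
proof -
  note f = fprobD[OF P]
  let ?TG = "\<lambda>w. (T w, G w)"
  define a where "a w = prb Om p ?TG (?TG w)" for w
  define b where "b w = prb Om p G (G w)" for w
  have ap: "a w > 0" "b w > 0" if "w \<in> Om" "p w > 0" for w
    unfolding a_def b_def using prb_ge[OF P that(1)] that(2) by (metis less_le_trans)+
  \<comment> \<open>\<open>\<psi>\<close> is the density of the law
    \<open>r t g * prb Om p G g\<close> with respect to the true joint law. Its mean is at most 1
    because \<open>r\<close> is a subkernel, and Jensen turns this into the claim.\<close>
  define \<psi> where "\<psi> = (\<lambda>(t,g). r t g * prb Om p G g / prb Om p ?TG (t,g))"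
  have "(\<Sum>w\<in>Om. p w * (r (T w) (G w) * b w / a w)) = (\<Sum>w\<in>Om. p w * \<psi> (?TG w))"
    by (simp add: \<psi>_def a_def b_def)
  also have "\<dots> = (\<Sum>c\<in>?TG ` Om. prb Om p ?TG c * \<psi> c)" by (rule sum_prb[OF f(1), symmetric])
  also have "\<dots> \<le> (\<Sum>c\<in>?TG ` Om. case c of (t,g) \<Rightarrow> r t g * prb Om p G g)"
  proof (rule sum_mono)
    fix c assume "c \<in> ?TG ` Om"
    then obtain w where w: "w \<in> Om" "c = ?TG w" by auto
    have "0 \<le> r (T w) (G w) * prb Om p G (G w)" using nn w by (intro mult_nonneg_nonneg prb_nonneg[OF P]) auto
    then show "prb Om p ?TG c * \<psi> c \<le> (case c of (t,g) \<Rightarrow> r t g * prb Om p G g)"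
      using w by (cases "prb Om p ?TG c = 0") (auto simp: \<psi>_def)
  qed
  also have "\<dots> \<le> (\<Sum>c\<in>T ` Om \<times> G ` Om. case c of (t,g) \<Rightarrow> r t g * prb Om p G g)"
    using f(1) nn by (intro sum_mono2) (auto intro!: mult_nonneg_nonneg prb_nonneg[OF P])
  also have "\<dots> = (\<Sum>g\<in>G ` Om. prb Om p G g * (\<Sum>t\<in>T ` Om. r t g))"
    by (subst sum.cartesian_product[symmetric], subst sum.swap)
       (simp add: sum_distrib_left mult.commute)
  also have "\<dots> \<le> (\<Sum>g\<in>G ` Om. prb Om p G g * 1)"
    using sub by (intro sum_mono mult_left_mono prb_nonneg[OF P]) auto
  also have "\<dots> = 1" using sum_prb_eq_1[OF P] by simp
  finally have le: "(\<Sum>w\<in>Om. p w * (r (T w) (G w) * b w / a w)) \<le> 1" .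
  have "(\<Sum>w\<in>Om. p w * log 2 (r (T w) (G w) * b w / a w)) \<le> log 2 1"
    by (rule jensen_log2(1)[OF f(1,2,3) _ le]) (use pos ap in auto)
  moreover have "(\<Sum>w\<in>Om. p w * log 2 (r (T w) (G w) * b w / a w))
     = (\<Sum>w\<in>Om. p w * log 2 (r (T w) (G w)) + p w * log 2 (b w) - p w * log 2 (a w))"
  proof (rule sum.cong[OF refl])
    fix w assume w: "w \<in> Om"
    show "p w * log 2 (r (T w) (G w) * b w / a w)
      = p w * log 2 (r (T w) (G w)) + p w * log 2 (b w) - p w * log 2 (a w)"
    proof (cases "p w > 0")
      case True
      then show ?thesis using pos[OF w True] ap[OF w True]
        by (simp add: log_mult log_divide algebra_simps)
    next
      case False then show ?thesis using f(2)[OF w] by simp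
    qed
  qed
  ultimately have "(\<Sum>w\<in>Om. p w * log 2 (r (T w) (G w)) + p w * log 2 (b w) - p w * log 2 (a w)) \<le> 0"
    by simp
  then have "(\<Sum>w\<in>Om. p w * log 2 (r (T w) (G w))) + (\<Sum>w\<in>Om. p w * log 2 (b w))
      - (\<Sum>w\<in>Om. p w * log 2 (a w)) \<le> 0"
    by (simp only: sum.distrib sum_subtractf)
  moreover have "ent Om p ?TG = - (\<Sum>w\<in>Om. p w * log 2 (a w))"
      "ent Om p G = - (\<Sum>w\<in>Om. p w * log 2 (b w))"
    unfolding a_def b_def by (rule ent_eq_sum[OF f(1)])+
  ultimately show ?thesis by linarith
qed

text \<open>Equality case of Gibbs' inequality: when \<open>r\<close> is the true conditional law
  the logarithms subtract pointwise, and only outcomes of positive weight matter.\<close>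

lemma cond_ent_eq:
  assumes P: "fprob Om p"
    and r: "\<And>w. w \<in> Om \<Longrightarrow> p w > 0 \<Longrightarrow>
        prb Om p (\<lambda>w. (T w, G w)) (T w, G w) = prb Om p G (G w) * r (T w) (G w)"
  shows "ent Om p (\<lambda>w. (T w, G w)) - ent Om p G = - (\<Sum>w\<in>Om. p w * log 2 (r (T w) (G w)))"
proof -
  note f = fprobD[OF P]
  have key: "p w * log 2 (prb Om p (\<lambda>w. (T w, G w)) (T w, G w)) - p w * log 2 (prb Om p G (G w))
    = p w * log 2 (r (T w) (G w))" if w: "w \<in> Om" for w
  proof (cases "p w > 0")
    case True
    have "prb Om p (\<lambda>w. (T w, G w)) (T w, G w) > 0" "prb Om p G (G w) > 0"
      using prb_ge[OF P w, of "\<lambda>w. (T w, G w)"] prb_ge[OF P w, of G] True by linarith+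
    then show ?thesis using r[OF w True]
      by (simp add: log_mult algebra_simps zero_less_mult_iff)
  next
    case False then show ?thesis using f(2)[OF w] by simp
  qed
  have "(\<Sum>w\<in>Om. p w * log 2 (prb Om p (\<lambda>w. (T w, G w)) (T w, G w))) - (\<Sum>w\<in>Om. p w * log 2 (prb Om p G (G w)))
    = (\<Sum>w\<in>Om. p w * log 2 (r (T w) (G w)))"
    unfolding sum_subtractf[symmetric] by (intro sum.cong refl key)
  then show ?thesis unfolding ent_eq_sum[OF f(1)] by simp
qed

text \<open>When \<open>g\<close> is a function of \<open>f\<close>, each level set of
  \<open>f\<close> lies inside one of \<open>g\<close>, so the probabilities under the logarithm can
  only grow.\<close>

lemma ent_le_ent:
  assumes P: "fprob Om p" and fg: "\<And>w w'. w \<in> Om \<Longrightarrow> w' \<in> Om \<Longrightarrow> f w = f w' \<Longrightarrow> g w = g w'"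
  shows "ent Om p g \<le> ent Om p f"
proof -
  note f = fprobD[OF P]
  have "p w * log 2 (prb Om p f (f w)) \<le> p w * log 2 (prb Om p g (g w))" if w: "w \<in> Om" for w
  proof (cases "p w > 0")
    case True
    have "prb Om p f (f w) \<le> prb Om p g (g w)" using w by (intro prb_mono[OF P] fg)
    moreover have "prb Om p f (f w) > 0" using prb_ge[OF P w, of f] True by linarith
    ultimately show ?thesis using True by (intro mult_left_mono) auto
  next
    case False then show ?thesis using f(2)[OF w] by simp
  qed
  then show ?thesis unfolding ent_eq_sum[OF f(1)] by (simp add: sum_mono)
qed

text \<open>The conditional probability of the value of \<open>V\<close> given that of
  \<open>Y\<close>, read as a random variable. Its mean negative logarithm is H(V|Y), and its
  moments with small exponents control both decoding error and secrecy.\<close>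

definition post :: "'w set \<Rightarrow> ('w \<Rightarrow> real) \<Rightarrow> ('w \<Rightarrow> 'v) \<Rightarrow> ('w \<Rightarrow> 'y) \<Rightarrow> 'w \<Rightarrow> real" where
  "post Om p V Y w = prb Om p (\<lambda>w. (V w, Y w)) (V w, Y w) / prb Om p Y (Y w)"

lemma sum_prb_pair:
  assumes "finite Om"
  shows "(\<Sum>v\<in>V ` Om. prb Om p (\<lambda>w. (V w, Y w)) (v, y)) = prb Om p Y y"
proof -
  have "(\<Sum>v\<in>V ` Om. prb Om p (\<lambda>w. (V w, Y w)) (v, y)) = (\<Sum>v\<in>V ` Om. \<Sum>w\<in>{w\<in>{w\<in>Om. Y w = y}. V w = v}. p w)"
    unfolding prb_def by (intro sum.cong) auto
  also have "\<dots> = prb Om p Y y" unfolding prb_def using assms by (intro sum.group) auto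
  finally show ?thesis .
qed

lemma post_pos:
  assumes "fprob Om p" "w \<in> Om" "p w > 0"
  shows "prb Om p Y (Y w) > 0" "prb Om p (\<lambda>w. (V w, Y w)) (V w, Y w) > 0" "post Om p V Y w > 0"
  using prb_ge[OF assms(1,2), of Y] prb_ge[OF assms(1,2), of "\<lambda>w. (V w, Y w)"] assms(3)
  by (auto simp: post_def)

lemma post_nonneg: "fprob Om p \<Longrightarrow> post Om p V Y w \<ge> 0"
  by (simp add: post_def prb_nonneg)

lemma cond_ent_post:
  assumes "fprob Om p"
  shows "ent Om p (\<lambda>w. (V w, Y w)) - ent Om p Y = - (\<Sum>w\<in>Om. p w * log 2 (post Om p V Y w))"
proof -
  have "ent Om p (\<lambda>w. (V w, Y w)) - ent Om p Y = - (\<Sum>w\<in>Om. p w * log 2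
     ((\<lambda>v y. prb Om p (\<lambda>w. (V w, Y w)) (v, y) / prb Om p Y y) (V w) (Y w)))"
    using post_pos(1)[OF assms, of _ Y] by (intro cond_ent_eq[OF assms]) fastforce
  then show ?thesis by (simp add: post_def)
qed

text \<open>Gibbs' inequality with the conditional law of \<open>T\<close> given the coarser
  variable \<open>G\<close> as kernel. Pairing \<open>H\<close> with \<open>G\<close> lets that
  kernel be written as a function of the condition.\<close>

lemma cond_ent_antimono:
  assumes P: "fprob Om p"
    and GH: "\<And>w w'. w \<in> Om \<Longrightarrow> w' \<in> Om \<Longrightarrow> H w = H w' \<Longrightarrow> G w = G w'"
  shows "ent Om p (\<lambda>w. (T w, H w)) - ent Om p H \<le> ent Om p (\<lambda>w. (T w, G w)) - ent Om p G"
proof -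
  note f = fprobD[OF P]
  let ?TG = "\<lambda>w. (T w, G w)"
  let ?r = "\<lambda>t h. prb Om p ?TG (t, snd h) / prb Om p G (snd h)"
  have sub: "(\<Sum>t\<in>T ` Om. prb Om p ?TG (t, g) / prb Om p G g) \<le> 1" for g
    using sum_prb_pair[OF f(1), of p T G g]
    by (simp add: sum_divide_distrib[symmetric] divide_le_eq_1 prb_nonneg[OF P])
  have pos: "prb Om p ?TG (T w, G w) > 0 \<and> prb Om p G (G w) > 0" if "w \<in> Om" "p w > 0" for w
    using prb_ge[OF P that(1), of ?TG] prb_ge[OF P that(1), of G] that(2) by auto
  have "ent Om p (\<lambda>w. (T w, (H w, G w))) - ent Om p (\<lambda>w. (H w, G w))
     \<le> - (\<Sum>w\<in>Om. p w * log 2 (?r (T w) (H w, G w)))"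
    using pos sub by (intro cond_ent_le[OF P]) (auto intro!: divide_nonneg_nonneg prb_nonneg[OF P])
  also have "\<dots> = ent Om p ?TG - ent Om p G"
    unfolding cond_ent_post[OF P] by (simp add: post_def)
  also have "ent Om p (\<lambda>w. (T w, (H w, G w))) = ent Om p (\<lambda>w. (T w, H w))"
    by (rule ent_cong[OF f(1)]) (use GH in blast)
  also have "ent Om p (\<lambda>w. (H w, G w)) = ent Om p H"
    by (rule ent_cong[OF f(1)]) (use GH in blast)
  finally show ?thesis .
qed

text \<open>Gibbs' inequality with the uniform kernel on \<open>S\<close>.\<close>

lemma cond_ent_le_log_card:
  assumes P: "fprob Om p" and S: "T ` Om \<subseteq> S" "finite S"
  shows "ent Om p (\<lambda>w. (T w, G w)) - ent Om p G \<le> log 2 (real (card S))"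
proof -
  note f = fprobD[OF P]
  have ne: "card S > 0" using S f(4) by (auto simp: card_gt_0_iff)
  have "ent Om p (\<lambda>w. (T w, G w)) - ent Om p G
      \<le> - (\<Sum>w\<in>Om. p w * log 2 ((\<lambda>t g. 1 / real (card S)) (T w) (G w)))"
    using ne card_mono[OF S(2,1)] by (intro cond_ent_le[OF P]) auto
  also have "\<dots> = log 2 (real (card S))"
    using ne f(3) by (simp add: log_divide sum_negf sum_distrib_right[symmetric])
  finally show ?thesis .
qed

lemma ent_const: "fprob Om p \<Longrightarrow> ent Om p (\<lambda>_. c) = 0"
  using fprobD[of Om p] by (auto simp: ent_def prb_def image_constant_conv)

lemma ent_le_log_card:
  assumes P: "fprob Om p" and S: "T ` Om \<subseteq> S" "finite S"
  shows "ent Om p T \<le> log 2 (real (card S))"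
proof -
  have "ent Om p (\<lambda>w. (T w, ())) = ent Om p T" by (intro ent_cong fprobD[OF P]) auto
  then show ?thesis using cond_ent_le_log_card[OF assms, of "\<lambda>_. ()"] ent_const[OF P, of "()"] by simp
qed

section \<open>Random binning and privacy amplification\<close>

text \<open>A two-universal family with uniformly drawn index. \<open>M\<close> only bounds the
  collision probability by \<open>1 / M\<close> and is not tied to a range, so one set of functions
  can count as hashing into different numbers of bins, depending on which part of the value is
  read.\<close>

definition univ_hash :: "'f set \<Rightarrow> ('f \<Rightarrow> 'v \<Rightarrow> 'k) \<Rightarrow> 'v set \<Rightarrow> real \<Rightarrow> bool" where
  "univ_hash F h S M \<longleftrightarrow> finite F \<and> F \<noteq> {} \<and> M > 0 \<and>
     (\<forall>v\<in>S. \<forall>v'\<in>S. v \<noteq> v' \<longrightarrow> real (card {f\<in>F. h f v = h f v'}) \<le> real (card F) / M)"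

text \<open>Once all values of a random function except the one at \<open>v\<close> are fixed,
  exactly \<open>K\<close> of the \<open>M * K\<close> candidates for \<open>f v\<close> have the
  same quotient as \<open>f v'\<close>. With 1 in place of \<open>K\<close> the whole value is
  read.\<close>

lemma univ_hash_PiE:
  assumes "finite S" "0 < M" "0 < K"
  shows "univ_hash (S \<rightarrow>\<^sub>E {..<M * K}) (\<lambda>f v. f v div K) S (real M)"
  unfolding univ_hash_def
proof (intro conjI ballI impI)
  let ?T = "{..<M * K}"
  show "finite (S \<rightarrow>\<^sub>E ?T)" using assms by (intro finite_PiE) auto
  show "(S \<rightarrow>\<^sub>E ?T) \<noteq> {}" using assms by (simp add: PiE_eq_empty_iff lessThan_empty_iff)
  show "0 < real M" using assms by simp
  fix v v' assume v: "v \<in> S" "v' \<in> S" "v \<noteq> v'"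
  define S' where "S' = S - {v}"
  have S: "S = insert v S'" "v \<notin> S'" "finite S'" "v' \<in> S'" using v assms by (auto simp: S'_def)
  let ?c = "\<lambda>(y,g). g(v := y)"
  have inj: "inj_on ?c (?T \<times> (S' \<rightarrow>\<^sub>E ?T))" by (rule inj_combinator[OF S(2)])
  have F: "(S \<rightarrow>\<^sub>E ?T) = ?c ` (?T \<times> (S' \<rightarrow>\<^sub>E ?T))"
    unfolding S(1) by (rule PiE_insert_eq)
  have card1: "card {y. y < M * K \<and> y div K = c div K} = K" if "c < M * K" for c
  proof -
    have "{y. y < M * K \<and> y div K = c div K} = {c div K * K ..< c div K * K + K}"
    proof (intro set_eqI iffI)
      fix y assume "y \<in> {y. y < M * K \<and> y div K = c div K}"
      then have "y = c div K * K + y mod K" using div_mult_mod_eq[of y K] by simp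
      moreover have "y mod K < K" using assms(3) by simp
      ultimately show "y \<in> {c div K * K ..< c div K * K + K}" unfolding atLeastLessThan_iff by linarith
    next
      fix y assume y: "y \<in> {c div K * K ..< c div K * K + K}"
      then have e: "y div K = c div K"
        using assms(3) by (intro div_nat_eqI) (auto simp: mult.commute)
      have "c div K < M" using that by (simp add: less_mult_imp_div_less)
      then have "c div K * K + K \<le> M * K"
        by (metis Suc_leI add.commute mult_Suc mult_le_mono1)
      then show "y \<in> {y. y < M * K \<and> y div K = c div K}" using y e by auto
    qed
    then show ?thesis by simp
  qed
  have fin: "finite (S' \<rightarrow>\<^sub>E ?T)" using S by (intro finite_PiE) auto
  define E where "E = (S' \<rightarrow>\<^sub>E ?T)"
  let ?D = "{x \<in> ?T \<times> E. fst x div K = snd x v' div K}"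
  have "{f \<in> ?c ` (?T \<times> E). f v div K = f v' div K} = ?c ` {x \<in> ?T \<times> E. ?c x v div K = ?c x v' div K}"
    by blast
  also have "{x \<in> ?T \<times> E. ?c x v div K = ?c x v' div K} = ?D"
    using v(3) by (intro Collect_cong) (simp add: case_prod_unfold)
  finally have "card {f \<in> S \<rightarrow>\<^sub>E ?T. f v div K = f v' div K} = card (?c ` ?D)"
    unfolding F E_def by (rule arg_cong)
  also have "\<dots> = card ?D"
    using inj unfolding E_def by (intro card_image) (rule inj_on_subset, auto)
  also have "?D = prod.swap ` (SIGMA g:E. {y. y < M * K \<and> y div K = g v' div K})"
    by (auto simp: image_iff)
  also have "card \<dots> = card (SIGMA g:E. {y. y < M * K \<and> y div K = g v' div K})"
    by (intro card_image) simp
  also have "\<dots> = (\<Sum>g\<in>E. K)"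
  proof -
    have "card {y. y < M * K \<and> y div K = g v' div K} = K" if "g \<in> E" for g
      using that S(4) by (intro card1) (auto simp: E_def dest: PiE_mem)
    moreover have "finite E" using fin by (simp add: E_def)
    ultimately show ?thesis by (subst card_SigmaI) auto
  qed
  finally have "card {f \<in> S \<rightarrow>\<^sub>E ?T. f v div K = f v' div K} = card (S' \<rightarrow>\<^sub>E ?T) * K"
    by (simp add: E_def)
  moreover have "card (S \<rightarrow>\<^sub>E ?T) = M * K * card (S' \<rightarrow>\<^sub>E ?T)"
    unfolding F by (subst card_image[OF inj]) (simp add: card_cartesian_product)
  ultimately show "real (card {f \<in> S \<rightarrow>\<^sub>E ?T. f v div K = f v' div K})
      \<le> real (card (S \<rightarrow>\<^sub>E ?T)) / real M"
    using assms by (simp add: field_simps)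
qed

text \<open>The maximum a posteriori decoder of bin \<open>k\<close> can only err on \<open>map_err\<close>.\<close>
definition map_err :: "'w set \<Rightarrow> ('w \<Rightarrow> real) \<Rightarrow> ('w \<Rightarrow> 'v) \<Rightarrow> ('w \<Rightarrow> 'y) \<Rightarrow> ('v \<Rightarrow> 'k) \<Rightarrow> 'w set" where
  "map_err Om p V Y h = {w\<in>Om. \<exists>v'\<in>V ` Om. v' \<noteq> V w \<and> h v' = h (V w) \<and>
      prb Om p (\<lambda>w. (V w, Y w)) (V w, Y w) \<le> prb Om p (\<lambda>w. (V w, Y w)) (v', Y w)}"

text \<open>Strict maximality makes the selected word unique, since \<open>map_err\<close> counts
  ties as errors. When no word of the bin is strictly best, the choice is arbitrary.\<close>

definition map_dec :: "'w set \<Rightarrow> ('w \<Rightarrow> real) \<Rightarrow> ('w \<Rightarrow> 'v) \<Rightarrow> ('w \<Rightarrow> 'y) \<Rightarrow> ('v \<Rightarrow> 'k) \<Rightarrow> 'k \<Rightarrow> 'y \<Rightarrow> 'v" where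
  "map_dec Om p V Y h k y = (SOME v. v \<in> V ` Om \<and> h v = k \<and>
      (\<forall>v'\<in>V ` Om. v' \<noteq> v \<and> h v' = k \<longrightarrow>
         prb Om p (\<lambda>w. (V w, Y w)) (v', y) < prb Om p (\<lambda>w. (V w, Y w)) (v, y)))"

lemma map_dec_correct:
  assumes "w \<in> Om" "w \<notin> map_err Om p V Y h"
  shows "map_dec Om p V Y h (h (V w)) (Y w) = V w"
  unfolding map_dec_def
proof (rule some_equality)
  show "V w \<in> V ` Om \<and> h (V w) = h (V w) \<and> (\<forall>v'\<in>V ` Om. v' \<noteq> V w \<and> h v' = h (V w) \<longrightarrow>
         prb Om p (\<lambda>w. (V w, Y w)) (v', Y w) < prb Om p (\<lambda>w. (V w, Y w)) (V w, Y w))"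
    using assms by (auto simp: map_err_def not_le)
next
  fix v assume "v \<in> V ` Om \<and> h v = h (V w) \<and> (\<forall>v'\<in>V ` Om. v' \<noteq> v \<and> h v' = h (V w) \<longrightarrow>
         prb Om p (\<lambda>w. (V w, Y w)) (v', Y w) < prb Om p (\<lambda>w. (V w, Y w)) (v, Y w))"
  then show "v = V w" using assms by (force simp: map_err_def)
qed

text \<open>For \<open>x \<ge> 1\<close> the exponent \<open>-s\<close> is weaker than
  \<open>-1\<close>; for \<open>x < 1\<close> the power exceeds 1. The truncated union bound thereby
  becomes a power, which factorises over i.i.d. letters.\<close>

lemma min_le_powr:
  fixes x s :: real assumes "x > 0" "0 < s" "s \<le> 1"
  shows "min 1 (1 / x) \<le> x powr (-s)"
proof (cases "x \<ge> 1")
  case True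
  then have "x powr (-1) \<le> x powr (-s)" using assms by (intro powr_mono) auto
  then show ?thesis using assms by (simp add: powr_minus_divide min.coboundedI2)
next
  case False
  then have "x powr s \<le> 1" "x powr s > 0" using assms by (auto intro: powr_le1)
  then show ?thesis by (simp add: powr_minus one_le_inverse min.coboundedI1)
qed

text \<open>Slepian--Wolf coding: at most \<open>1 / P(v|y)\<close> words are at least as likely as \<open>v\<close>,
  each colliding with probability at most \<open>1/M\<close>.\<close>
lemma avg_map_err_le:
  assumes P: "fprob Om p" and U: "univ_hash F h (V ` Om) M" and s: "0 < s" "s \<le> 1"
  shows "(\<Sum>f\<in>F. \<Sum>w\<in>map_err Om p V Y (h f). p w)
     \<le> real (card F) * (\<Sum>w\<in>Om. p w * (M * post Om p V Y w) powr (-s))"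
proof -
  note f = fprobD[OF P]
  have F: "finite F" "F \<noteq> {}" "M > 0" using U by (auto simp: univ_hash_def)
  let ?q = "\<lambda>v y. prb Om p (\<lambda>w. (V w, Y w)) (v, y)"
  have "(\<Sum>f\<in>F. \<Sum>w\<in>map_err Om p V Y (h f). p w)
     = (\<Sum>f\<in>F. \<Sum>w\<in>Om. if w \<in> map_err Om p V Y (h f) then p w else 0)"
  proof (rule sum.cong[OF refl])
    fix g
    have "Om \<inter> map_err Om p V Y (h g) = map_err Om p V Y (h g)" by (auto simp: map_err_def)
    then show "sum p (map_err Om p V Y (h g)) = (\<Sum>w\<in>Om. if w \<in> map_err Om p V Y (h g) then p w else 0)"
      using sum.inter_restrict[OF f(1), of p "map_err Om p V Y (h g)"] by simp
  qed
  also have "\<dots> = (\<Sum>w\<in>Om. p w * real (card {f\<in>F. w \<in> map_err Om p V Y (h f)}))"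
    using F(1) by (subst sum.swap) (simp add: sum.inter_filter[symmetric] mult.commute)
  also have "\<dots> \<le> (\<Sum>w\<in>Om. p w * (real (card F) * (M * post Om p V Y w) powr (-s)))"
  proof (rule sum_mono)
    fix w assume w: "w \<in> Om"
    show "p w * real (card {f\<in>F. w \<in> map_err Om p V Y (h f)})
       \<le> p w * (real (card F) * (M * post Om p V Y w) powr (-s))"
    proof (cases "p w > 0")
      case True
      note pp = post_pos(1)[OF P w True, of Y] post_pos(2,3)[OF P w True, of V Y]
      define D where "D = {v'\<in>V ` Om. v' \<noteq> V w \<and> ?q (V w) (Y w) \<le> ?q v' (Y w)}"
      have fD: "finite D" using f(1) by (simp add: D_def)
      have "{f\<in>F. w \<in> map_err Om p V Y (h f)} = (\<Union>v'\<in>D. {f\<in>F. h f v' = h f (V w)})"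
        using w by (auto simp: map_err_def D_def)
      then have "real (card {f\<in>F. w \<in> map_err Om p V Y (h f)})
         \<le> (\<Sum>v'\<in>D. real (card {f\<in>F. h f v' = h f (V w)}))"
        using card_UN_le[OF fD, of "\<lambda>v'. {f\<in>F. h f v' = h f (V w)}"] by (simp flip: of_nat_sum)
      also have "\<dots> \<le> (\<Sum>v'\<in>D. real (card F) / M)"
        using U w by (intro sum_mono) (auto simp: univ_hash_def D_def)
      also have "\<dots> = real (card D) * (real (card F) / M)" by simp
      also have "\<dots> \<le> (1 / post Om p V Y w) * (real (card F) / M)"
      proof (rule mult_right_mono)
        have "real (card D) * ?q (V w) (Y w) = (\<Sum>v'\<in>D. ?q (V w) (Y w))" by simp
        also have "\<dots> \<le> (\<Sum>v'\<in>D. ?q v' (Y w))" by (intro sum_mono) (auto simp: D_def)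
        also have "\<dots> \<le> (\<Sum>v'\<in>V ` Om. ?q v' (Y w))"
          using f(1) prb_nonneg[OF P] by (intro sum_mono2) (auto simp: D_def)
        also have "\<dots> = prb Om p Y (Y w)" by (rule sum_prb_pair[OF f(1)])
        finally show "real (card D) \<le> 1 / post Om p V Y w"
          using pp by (simp add: post_def field_simps)
      qed (use F in simp)
      finally have 1: "real (card {f\<in>F. w \<in> map_err Om p V Y (h f)})
         \<le> real (card F) * (1 / (M * post Om p V Y w))" by (simp add: mult.commute)
      \<comment> \<open>Capping the union bound at 1 permits a small exponent \<open>s\<close>. With
        exponent 1 the moment would count the possible words instead of measuring their
        entropy.\<close>
      have "real (card {f\<in>F. w \<in> map_err Om p V Y (h f)}) \<le> real (card F) * 1"
        using F(1) by (simp add: card_mono)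
      with 1 have "real (card {f\<in>F. w \<in> map_err Om p V Y (h f)})
         \<le> real (card F) * min 1 (1 / (M * post Om p V Y w))" by (simp add: min_def)
      also have "\<dots> \<le> real (card F) * (M * post Om p V Y w) powr (-s)"
        using min_le_powr[of "M * post Om p V Y w" s] F(3) pp s by (intro mult_left_mono) auto
      finally show ?thesis using True by (intro mult_left_mono) auto
    next
      case False then show ?thesis using f(2)[OF w] by simp
    qed
  qed
  finally show ?thesis by (simp add: sum_distrib_left mult.left_commute)
qed

text \<open>Subadditivity \<open>(1 + t) powr s \<le> 1 + t powr s\<close>. It replaces the first
  moment of the posterior, which belongs to collision entropy, by a moment of small exponent, which
  is governed by Shannon entropy.\<close>

lemma log2_one_plus_le:
  fixes t s :: real assumes "t > 0" "0 < s" "s \<le> 1"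
  shows "log 2 (1 + t) \<le> (1 / s) * log 2 (1 + t powr s)"
proof -
  have "(1 + t) powr s \<le> 1 + t powr s"
  proof -
    have "(1 + t) powr s = (1 + t) * (1 + t) powr (s - 1)"
      using assms by (simp add: powr_diff)
    also have "\<dots> = (1 + t) powr (s - 1) + t * (1 + t) powr (s - 1)" by (simp add: algebra_simps)
    also have "\<dots> \<le> 1 + t * t powr (s - 1)"
      using assms powr_mono2'[of "s - 1" t "1 + t"] powr_mono2'[of "s - 1" 1 "1 + t"]
      by (intro add_mono mult_left_mono) auto
    also have "t * t powr (s - 1) = t powr s" using assms by (simp add: powr_diff)
    finally show ?thesis by simp
  qed
  then have "log 2 ((1 + t) powr s) \<le> log 2 (1 + t powr s)" using assms by (intro log_mono) auto
  then show ?thesis using assms by (simp add: log_powr field_simps)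
qed

text \<open>Privacy amplification. Jensen's inequality over the hash family replaces \<open>P(h(v)|z)\<close>
  by \<open>P(v|z) + 1/M\<close>.\<close>
lemma avg_hash_ent_deficit:
  assumes P: "fprob Om p" and U: "univ_hash F h (V ` Om) M" and s: "0 < s" "s \<le> 1"
  shows "(\<Sum>f\<in>F. log 2 M - (ent Om p (\<lambda>w. (h f (V w), Z w)) - ent Om p Z))
     \<le> real (card F) * ((1 / s) * log 2 (1 + (\<Sum>w\<in>Om. p w * (M * post Om p V Z w) powr s)))"
proof -
  note f = fprobD[OF P]
  have F: "finite F" "F \<noteq> {}" "M > 0" "card F > 0" using U by (auto simp: univ_hash_def card_gt_0_iff)
  \<comment> \<open>\<open>x g w\<close> is the posterior of the hash value; the deficit from
    uniformity is the mean of \<open>log 2 (M * x g w)\<close>.\<close>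
  define x where "x g w = post Om p (\<lambda>w. h g (V w)) Z w" for g w
  let ?r = "post Om p V Z"
  have "log 2 M - (ent Om p (\<lambda>w. (h g (V w), Z w)) - ent Om p Z) = (\<Sum>w\<in>Om. p w * log 2 (M * x g w))" for g
  proof -
    have "(\<Sum>w\<in>Om. p w * log 2 (M * x g w)) = (\<Sum>w\<in>Om. p w * log 2 M + p w * log 2 (x g w))"
    proof (rule sum.cong[OF refl])
      fix w assume w: "w \<in> Om"
      show "p w * log 2 (M * x g w) = p w * log 2 M + p w * log 2 (x g w)"
        using post_pos(3)[OF P w, of "\<lambda>w. h g (V w)" Z] f(2)[OF w] F(3)
        by (cases "p w > 0") (auto simp: x_def log_mult algebra_simps)
    qed
    also have "\<dots> = log 2 M - (ent Om p (\<lambda>w. (h g (V w), Z w)) - ent Om p Z)"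
      unfolding cond_ent_post[OF P] x_def
      by (simp add: sum.distrib sum_distrib_right[symmetric] f(3))
    finally show ?thesis by simp
  qed
  then have "(\<Sum>g\<in>F. log 2 M - (ent Om p (\<lambda>w. (h g (V w), Z w)) - ent Om p Z))
     = (\<Sum>w\<in>Om. p w * (\<Sum>g\<in>F. log 2 (M * x g w)))"
    by (simp add: sum.swap[of _ Om F] sum_distrib_left)
  also have "\<dots> \<le> (\<Sum>w\<in>Om. p w * (real (card F) * log 2 (1 + M * ?r w)))"
  proof (rule sum_mono)
    fix w assume w: "w \<in> Om"
    show "p w * (\<Sum>g\<in>F. log 2 (M * x g w)) \<le> p w * (real (card F) * log 2 (1 + M * ?r w))"
    proof (cases "p w > 0")
      case True
      note pp = post_pos(1)[OF P w True, of Z] post_pos(2,3)[OF P w True, of V Z]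
      have xp: "x g w > 0" for g using post_pos(3)[OF P w True, of "\<lambda>w. h g (V w)" Z] by (simp add: x_def)
      let ?A = "{w'\<in>Om. Z w' = Z w}"
      have num: "prb Om p (\<lambda>w. (h g (V w), Z w)) (h g (V w), Z w)
         = (\<Sum>w'\<in>?A. if h g (V w') = h g (V w) then p w' else 0)" for g
        unfolding prb_def using f(1) by (subst sum.inter_filter[symmetric]) (auto intro!: sum.cong)
      have "(\<Sum>g\<in>F. prb Om p (\<lambda>w. (h g (V w), Z w)) (h g (V w), Z w))
         = (\<Sum>w'\<in>?A. p w' * real (card {g\<in>F. h g (V w') = h g (V w)}))"
        unfolding num using F(1) by (subst sum.swap) (simp add: sum.inter_filter[symmetric] mult.commute)
      \<comment> \<open>A word equal to \<open>V w\<close> collides with it under every hash, any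
        other word under at most a fraction \<open>1 / M\<close> of them.\<close>
      also have "\<dots> \<le> (\<Sum>w'\<in>?A. p w' * ((if V w' = V w then real (card F) else 0) + real (card F) / M))"
      proof (intro sum_mono mult_left_mono)
        fix w' assume "w' \<in> ?A"
        then show "real (card {g\<in>F. h g (V w') = h g (V w)})
           \<le> (if V w' = V w then real (card F) else 0) + real (card F) / M"
          using U w F(3) by (auto simp: univ_hash_def)
      qed (use f in auto)
      also have "\<dots> = real (card F) * (\<Sum>w'\<in>?A. if V w' = V w then p w' else 0) + real (card F) / M * (\<Sum>w'\<in>?A. p w')"
        unfolding distrib_left sum.distrib sum_distrib_left
        by (intro arg_cong2[where f="(+)"] sum.cong) auto
      also have "(\<Sum>w'\<in>?A. if V w' = V w then p w' else 0) = prb Om p (\<lambda>w. (V w, Z w)) (V w, Z w)"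
        unfolding prb_def using f(1) by (subst sum.inter_filter[symmetric]) (auto intro!: sum.cong)
      also have "(\<Sum>w'\<in>?A. p w') = prb Om p Z (Z w)" by (simp add: prb_def)
      finally have le: "(\<Sum>g\<in>F. prb Om p (\<lambda>w. (h g (V w), Z w)) (h g (V w), Z w))
        \<le> real (card F) * prb Om p (\<lambda>w. (V w, Z w)) (V w, Z w) + real (card F) / M * prb Om p Z (Z w)" .
      have "(\<Sum>g\<in>F. (1 / real (card F)) * (M * x g w))
         = (M / (real (card F) * prb Om p Z (Z w))) * (\<Sum>g\<in>F. prb Om p (\<lambda>w. (h g (V w), Z w)) (h g (V w), Z w))"
        by (simp add: x_def post_def sum_distrib_left field_simps)
      also have "\<dots> \<le> (M / (real (card F) * prb Om p Z (Z w))) *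
          (real (card F) * prb Om p (\<lambda>w. (V w, Z w)) (V w, Z w) + real (card F) / M * prb Om p Z (Z w))"
        using le F pp by (intro mult_left_mono) auto
      also have "\<dots> = 1 + M * ?r w" using F pp by (simp add: post_def field_simps)
      finally have "(\<Sum>g\<in>F. (1 / real (card F)) * (M * x g w)) \<le> 1 + M * ?r w" .
      then have "(\<Sum>g\<in>F. (1 / real (card F)) * log 2 (M * x g w)) \<le> log 2 (1 + M * ?r w)"
        using F xp by (intro jensen_log2(1)) auto
      then have "(\<Sum>g\<in>F. log 2 (M * x g w)) \<le> real (card F) * log 2 (1 + M * ?r w)"
        using F by (simp add: sum_divide_distrib[symmetric] field_simps)
      then show ?thesis using True by (intro mult_left_mono) auto
    next
      case False then show ?thesis using f(2)[OF w] by simp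
    qed
  qed
  also have "\<dots> = real (card F) * (\<Sum>w\<in>Om. p w * log 2 (1 + M * ?r w))"
    by (simp add: sum_distrib_left mult.left_commute)
  also have "(\<Sum>w\<in>Om. p w * log 2 (1 + M * ?r w)) \<le> (\<Sum>w\<in>Om. p w * ((1 / s) * log 2 (1 + (M * ?r w) powr s)))"
  proof (rule sum_mono)
    fix w assume w: "w \<in> Om"
    show "p w * log 2 (1 + M * ?r w) \<le> p w * ((1 / s) * log 2 (1 + (M * ?r w) powr s))"
    proof (cases "p w > 0")
      case True
      then show ?thesis using post_pos(3)[OF P w True, of V Z] F(3) s
        by (intro mult_left_mono log2_one_plus_le) auto
    next
      case False then show ?thesis using f(2)[OF w] by simp
    qed
  qed
  also have "\<dots> = (1 / s) * (\<Sum>w\<in>Om. p w * log 2 (1 + (M * ?r w) powr s))"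
    by (simp add: sum_distrib_left mult.left_commute)
  also have "(\<Sum>w\<in>Om. p w * log 2 (1 + (M * ?r w) powr s)) \<le> log 2 (1 + (\<Sum>w\<in>Om. p w * (M * ?r w) powr s))"
  proof (rule jensen_log2(1)[OF f(1,2,3)])
    show "(\<Sum>w\<in>Om. p w * (1 + (M * ?r w) powr s)) \<le> 1 + (\<Sum>w\<in>Om. p w * (M * ?r w) powr s)"
      by (simp add: algebra_simps sum.distrib f(3))
  qed (auto intro: add_pos_nonneg)
  finally show ?thesis using s by (simp add: mult_left_mono divide_right_mono)
qed

section \<open>Product laws on words\<close>

definition seqs :: "'w set \<Rightarrow> nat \<Rightarrow> 'w list set" where
  "seqs Om N = {l. set l \<subseteq> Om \<and> length l = N}"

definition iid :: "('w \<Rightarrow> real) \<Rightarrow> nat \<Rightarrow> 'w list \<Rightarrow> real" where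
  "iid p N l = (\<Prod>i<N. p (l ! i))"

lemma finite_seqs: "finite Om \<Longrightarrow> finite (seqs Om N)"
  unfolding seqs_def by (rule finite_lists_length_eq)

lemma seqs_nth: "l \<in> seqs Om N \<Longrightarrow> i < N \<Longrightarrow> l ! i \<in> Om"
  unfolding seqs_def by (auto dest: nth_mem)

lemma seqs_length: "l \<in> seqs Om N \<Longrightarrow> length l = N"
  unfolding seqs_def by auto

text \<open>The distributive law. The factor may vary with the position, as it does for channel laws
  conditional on a fixed input word.\<close>

lemma sum_seqs_prod:
  fixes F :: "nat \<Rightarrow> 'a \<Rightarrow> real"
  assumes "finite Om"
  shows "(\<Sum>l\<in>seqs Om N. \<Prod>i<N. F i (l ! i)) = (\<Prod>i<N. \<Sum>a\<in>Om. F i a)"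
proof (induction N arbitrary: F)
  case 0
  have "seqs Om 0 = {[]}" by (auto simp: seqs_def)
  then show ?case by simp
next
  case (Suc N)
  have b: "bij_betw (\<lambda>(a,l). a # l) (Om \<times> seqs Om N) (seqs Om (Suc N))"
    by (rule bij_betwI[where g="\<lambda>l. (hd l, tl l)"]) (auto simp: seqs_def length_Suc_conv)
  have "(\<Sum>l\<in>seqs Om (Suc N). \<Prod>i<Suc N. F i (l ! i))
      = (\<Sum>(a,l)\<in>Om \<times> seqs Om N. F 0 a * (\<Prod>i<N. F (Suc i) (l ! i)))"
    by (subst sum.reindex_bij_betw[OF b, symmetric], rule sum.cong[OF refl])
       (auto simp: prod.lessThan_Suc_shift simp del: prod.lessThan_Suc)
  also have "\<dots> = (\<Sum>a\<in>Om. F 0 a) * (\<Sum>l\<in>seqs Om N. \<Prod>i<N. F (Suc i) (l ! i))"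
    by (simp add: sum.cartesian_product[symmetric] sum_product)
  finally show ?case 
    by (simp add: Suc.IH[of "\<lambda>i. F (Suc i)"] prod.lessThan_Suc_shift del: prod.lessThan_Suc)
qed

text \<open>Every factor except the \<open>k\<close>-th sums out to 1, so the test function only
  meets position \<open>k\<close>.\<close>

lemma sum_seqs_prod_nth:
  fixes F :: "nat \<Rightarrow> 'a \<Rightarrow> real"
  assumes "finite Om" "k < N" "\<And>i. i < N \<Longrightarrow> i \<noteq> k \<Longrightarrow> (\<Sum>a\<in>Om. F i a) = 1"
  shows "(\<Sum>l\<in>seqs Om N. (\<Prod>i<N. F i (l ! i)) * \<phi> (l ! k)) = (\<Sum>a\<in>Om. F k a * \<phi> a)"
proof -
  let ?G = "\<lambda>i a. F i a * (if i = k then \<phi> a else 1)"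
  have "(\<Prod>i<N. F i (l ! i)) * \<phi> (l ! k) = (\<Prod>i<N. ?G i (l ! i))" for l
    using assms(2) by (simp add: prod.distrib prod.delta)
  then have "(\<Sum>l\<in>seqs Om N. (\<Prod>i<N. F i (l ! i)) * \<phi> (l ! k)) = (\<Prod>i<N. \<Sum>a\<in>Om. ?G i a)"
    using sum_seqs_prod[OF assms(1), where N=N and F="?G"] by simp
  also have "\<dots> = (\<Prod>i<N. if i = k then (\<Sum>a\<in>Om. F k a * \<phi> a) else 1)"
    using assms(3) by (intro prod.cong) auto
  also have "\<dots> = (\<Sum>a\<in>Om. F k a * \<phi> a)" using assms(2) by (simp add: prod.delta)
  finally show ?thesis .
qed

lemma fprob_iid:
  assumes "fprob Om p" shows "fprob (seqs Om N) (iid p N)"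
  using assms sum_seqs_prod[of Om "\<lambda>_. p" N] finite_seqs[of Om N]
  by (auto simp: fprob_def iid_def seqs_nth intro!: prod_nonneg)

lemma iid_pos:
  assumes "fprob Om p" "l \<in> seqs Om N" "iid p N l > 0" "i < N"
  shows "p (l ! i) > 0"
proof -
  have "p (l ! i) \<noteq> 0"
  proof
    assume "p (l ! i) = 0"
    then have "iid p N l = 0" unfolding iid_def using assms(4) by (intro prod_zero) auto
    then show False using assms(3) by simp
  qed
  moreover have "p (l ! i) \<ge> 0" using assms fprobD(2) seqs_nth by metis
  ultimately show ?thesis by simp
qed

lemma sum_iid_prod:
  assumes "finite Om"
  shows "(\<Sum>l\<in>seqs Om N. iid p N l * (\<Prod>i<N. \<phi> (l ! i))) = (\<Sum>w\<in>Om. p w * \<phi> w) ^ N"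
  using sum_seqs_prod[OF assms, of "\<lambda>i a. p a * \<phi> a" N] by (simp add: iid_def prod.distrib)

lemma sum_iid_sum:
  assumes "fprob Om p"
  shows "(\<Sum>l\<in>seqs Om N. iid p N l * (\<Sum>i<N. \<phi> (l ! i))) = real N * (\<Sum>w\<in>Om. p w * \<phi> w)"
proof -
  have "(\<Sum>l\<in>seqs Om N. iid p N l * (\<Sum>i<N. \<phi> (l ! i)))
      = (\<Sum>i<N. \<Sum>l\<in>seqs Om N. iid p N l * \<phi> (l ! i))"
    by (simp add: sum_distrib_left sum.swap[of _ "seqs Om N"])
  also have "\<dots> = (\<Sum>i<N. \<Sum>w\<in>Om. p w * \<phi> w)"
    unfolding iid_def using fprobD[OF assms]
    by (intro sum.cong refl sum_seqs_prod_nth[where F="\<lambda>_. p"]) auto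
  finally show ?thesis by simp
qed

lemma prb_iid:
  assumes "finite Om" "length b = N"
  shows "prb (seqs Om N) (iid p N) (map f) b = (\<Prod>i<N. prb Om p f (b ! i))"
proof -
  have "(if map f l = b then iid p N l else 0) = (\<Prod>i<N. if f (l ! i) = b ! i then p (l ! i) else 0)"
    if l: "l \<in> seqs Om N" for l
  proof (cases "map f l = b")
    case True
    then have "f (l ! i) = b ! i" if "i < N" for i using that seqs_length[OF l] by auto
    then show ?thesis using True by (simp add: iid_def)
  next
    case False
    then obtain i where "i < N" "f (l ! i) \<noteq> b ! i"
      using seqs_length[OF l] assms(2) by (auto simp: list_eq_iff_nth_eq)
    then show ?thesis using False by (auto intro!: prod_zero[symmetric])
  qed
  then have "prb (seqs Om N) (iid p N) (map f) b
      = (\<Sum>l\<in>seqs Om N. \<Prod>i<N. if f (l ! i) = b ! i then p (l ! i) else 0)"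
    by (simp add: prb_eq_sum_if[OF finite_seqs[OF assms(1)]])
  also have "\<dots> = (\<Prod>i<N. prb Om p f (b ! i))"
    unfolding prb_eq_sum_if[OF assms(1)]
    by (rule sum_seqs_prod[OF assms(1), where F="\<lambda>i a. if f a = b ! i then p a else 0"])
  finally show ?thesis .
qed

lemma ent_iid:
  assumes P: "fprob Om p"
  shows "ent (seqs Om N) (iid p N) (map f) = real N * ent Om p f"
proof -
  note f = fprobD[OF P]
  have key: "iid p N l * log 2 (prb (seqs Om N) (iid p N) (map f) (map f l))
      = iid p N l * (\<Sum>i<N. log 2 (prb Om p f (f (l ! i))))" if l: "l \<in> seqs Om N" for l
  proof (cases "iid p N l > 0")
    case True
    have "prb Om p f (f (l ! i)) \<noteq> 0" if "i < N" for i
      using prb_ge[OF P seqs_nth[OF l that], of f] iid_pos[OF P l True that] by linarith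
    then have "log 2 (\<Prod>i<N. prb Om p f (f (l ! i))) = (\<Sum>i<N. log 2 (prb Om p f (f (l ! i))))"
      unfolding log_def by (subst ln_prod) (auto simp: sum_divide_distrib)
    then show ?thesis using prb_iid[OF f(1), of "map f l" N] seqs_length[OF l] by simp
  next
    case False
    then show ?thesis using fprobD(2)[OF fprob_iid[OF P] l] by simp
  qed
  have "(\<Sum>l\<in>seqs Om N. iid p N l * log 2 (prb (seqs Om N) (iid p N) (map f) (map f l)))
      = real N * (\<Sum>w\<in>Om. p w * log 2 (prb Om p f (f w)))"
    unfolding sum_iid_sum[OF P, symmetric] by (rule sum.cong[OF refl key])
  then show ?thesis
    unfolding ent_eq_sum[OF f(1)] ent_eq_sum[OF finite_seqs[OF f(1)]] by simp
qed

lemma map_pair_eq_iff: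
  "length l = length l' \<Longrightarrow>
    (map (\<lambda>w. (f w, g w)) l = map (\<lambda>w. (f w, g w)) l') = (map f l = map f l' \<and> map g l = map g l')"
  by (auto simp: list_eq_iff_nth_eq)

lemma post_iid:
  assumes "finite Om" "l \<in> seqs Om N"
  shows "post (seqs Om N) (iid p N) (map V) (map Y) l = (\<Prod>i<N. post Om p V Y (l ! i))"
proof -
  have "prb (seqs Om N) (iid p N) (\<lambda>l. (map V l, map Y l)) (map V l, map Y l)
      = prb (seqs Om N) (iid p N) (map (\<lambda>w. (V w, Y w))) (map (\<lambda>w. (V w, Y w)) l)"
    using assms(2) by (intro prb_cong) (simp add: map_pair_eq_iff seqs_length)
  then show ?thesis
    using seqs_length[OF assms(2)] by (simp add: post_def prb_iid[OF assms(1)] prod_dividef)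
qed

section \<open>Exponential moments and hashing of i.i.d. words\<close>

text \<open>Chernoff's argument: the moment generating function of \<open>h - c\<close> is 1 at
  \<open>s = 0\<close> and has a negative derivative there, hence is below 1 for some small
  \<open>s > 0\<close>. The cap \<open>s \<le> 1\<close> is what the two hashing bounds
  require.\<close>

lemma exp_moment_less_1:
  assumes P: "fprob Om p" and m: "(\<Sum>w\<in>Om. p w * h w) < c"
  shows "\<exists>s. 0 < s \<and> s \<le> 1 \<and> (\<Sum>w\<in>Om. p w * exp (s * (h w - c))) < 1"
proof -
  note f = fprobD[OF P]
  let ?g = "\<lambda>s. \<Sum>w\<in>Om. p w * exp (s * (h w - c))"
  have "(?g has_real_derivative (\<Sum>w\<in>Om. p w * (exp (0 * (h w - c)) * (h w - c)))) (at 0)"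
    by (auto intro!: derivative_eq_intros simp: mult.commute)
  moreover have "(\<Sum>w\<in>Om. p w * (exp (0 * (h w - c)) * (h w - c))) < 0"
    using m f(3) by (simp add: right_diff_distrib sum_subtractf sum_distrib_right[symmetric])
  ultimately obtain d where d: "d > 0" "\<And>s. 0 < s \<Longrightarrow> s < d \<Longrightarrow> ?g 0 > ?g (0 + s)"
    using DERIV_neg_dec_right by blast
  have "?g (min 1 (d/2)) < ?g 0" using d(1) d(2)[of "min 1 (d/2)"] by auto
  also have "?g 0 = 1" using f(3) by simp
  finally show ?thesis using d(1) by (intro exI[of _ "min 1 (d/2)"]) auto
qed

text \<open>The Chernoff argument for \<open>h = ln r\<close> and threshold
  \<open>- R * ln 2\<close>, rewritten as a power moment. Its hypothesis compares a rate with an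
  entropy once \<open>r\<close> is a posterior or its reciprocal.\<close>

lemma powr_moment_less_1:
  assumes P: "fprob Om p" and r: "\<And>w. w \<in> Om \<Longrightarrow> p w > 0 \<Longrightarrow> r w > 0"
    and m: "(\<Sum>w\<in>Om. p w * log 2 (r w)) + R < 0"
  shows "\<exists>s. 0 < s \<and> s \<le> 1 \<and> (\<Sum>w\<in>Om. p w * (2 powr R * r w) powr s) < 1"
proof -
  note f = fprobD[OF P]
  have "(\<Sum>w\<in>Om. p w * ln (r w)) / ln 2 + R < 0"
    using m by (simp add: log_def sum_divide_distrib)
  then have "(\<Sum>w\<in>Om. p w * ln (r w)) < - R * ln 2" by (simp add: field_simps)
  then obtain s where s: "0 < s" "s \<le> 1" "(\<Sum>w\<in>Om. p w * exp (s * (ln (r w) - - R * ln 2))) < 1"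
    using exp_moment_less_1[OF P, of "\<lambda>w. ln (r w)" "- R * ln 2"] by blast
  have "p w * exp (s * (ln (r w) - - R * ln 2)) = p w * (2 powr R * r w) powr s" if w: "w \<in> Om" for w
  proof (cases "p w > 0")
    case True
    then show ?thesis using r[OF w True] by (simp add: powr_def ln_mult algebra_simps)
  next
    case False then show ?thesis using f(2)[OF w] by simp
  qed
  then have "(\<Sum>w\<in>Om. p w * exp (s * (ln (r w) - - R * ln 2))) = (\<Sum>w\<in>Om. p w * (2 powr R * r w) powr s)"
    by (rule sum.cong[OF refl])
  then show ?thesis using s by metis
qed

lemma sum_iid_powr:
  assumes P: "fprob Om p" and nn: "\<And>w. w \<in> Om \<Longrightarrow> r w \<ge> 0"
  shows "(\<Sum>l\<in>seqs Om N. iid p N l * (2 powr (real N * R) * (\<Prod>i<N. r (l ! i))) powr s)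
     = (\<Sum>w\<in>Om. p w * (2 powr R * r w) powr s) ^ N"
proof -
  have "(2 powr (real N * R) * (\<Prod>i<N. r (l ! i))) powr s = (\<Prod>i<N. (2 powr R * r (l ! i)) powr s)"
    if "l \<in> seqs Om N" for l
  proof -
    have "2 powr (real N * R) * (\<Prod>i<N. r (l ! i)) = (\<Prod>i<N. 2 powr R * r (l ! i))"
      by (simp add: prod.distrib powr_powr[symmetric] powr_realpow[symmetric] mult.commute)
    then show ?thesis using nn seqs_nth[OF that] by (simp add: prod_powr_distrib)
  qed
  then show ?thesis using sum_iid_prod[OF fprobD(1)[OF P], of p N "\<lambda>w. (2 powr R * r w) powr s"] by simp
qed

text \<open>At a bin rate \<open>R\<close> above H(V|Y) the reciprocal posterior has mean logarithm
  below \<open>R\<close>, so the moment in \<open>avg_map_err_le\<close> is the \<open>N\<close>-th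
  power of a number below 1. That number \<open>\<rho>\<close> depends only on the single-letter
  data and precedes \<open>N\<close>, \<open>M\<close> and the hash family.\<close>

lemma avg_map_err_iid:
  assumes P: "fprob Om p" and R: "ent Om p (\<lambda>w. (V w, Y w)) - ent Om p Y < R"
  shows "\<exists>\<rho>. 0 \<le> \<rho> \<and> \<rho> < 1 \<and> (\<forall>N M F (h :: 'f \<Rightarrow> _ \<Rightarrow> 'k).
     univ_hash F h (map V ` seqs Om N) M \<longrightarrow> 2 powr (real N * R) \<le> M \<longrightarrow>
     (\<Sum>f\<in>F. \<Sum>l\<in>map_err (seqs Om N) (iid p N) (map V) (map Y) (h f). iid p N l) \<le> real (card F) * \<rho> ^ N)"
proof -
  note f = fprobD[OF P]
  let ?r = "\<lambda>w. 1 / post Om p V Y w"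
  have "(\<Sum>w\<in>Om. p w * log 2 (?r w)) = - (\<Sum>w\<in>Om. p w * log 2 (post Om p V Y w))"
    unfolding sum_negf[symmetric]
  proof (rule sum.cong[OF refl])
    fix w assume w: "w \<in> Om"
    show "p w * log 2 (?r w) = - (p w * log 2 (post Om p V Y w))"
      using post_pos(3)[OF P w, of V Y] f(2)[OF w] by (cases "p w > 0") (auto simp: log_divide)
  qed
  then have "(\<Sum>w\<in>Om. p w * log 2 (?r w)) + - R < 0"
    using R cond_ent_post[OF P, of V Y] by simp
  from powr_moment_less_1[OF P _ this] post_pos(3)[OF P]
  obtain s where s: "0 < s" "s \<le> 1" "(\<Sum>w\<in>Om. p w * (2 powr (-R) * ?r w) powr s) < 1" (is "?\<rho> < 1")
    by (metis zero_less_divide_1_iff)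
  show ?thesis
  proof (intro exI[of _ ?\<rho>] conjI allI impI)
    show "0 \<le> ?\<rho>" using f by (intro sum_nonneg) auto
    show "?\<rho> < 1" by (rule s(3))
    fix N M and F :: "'f set" and h :: "'f \<Rightarrow> _ \<Rightarrow> 'k"
    assume U: "univ_hash F h (map V ` seqs Om N) M" and M: "2 powr (real N * R) \<le> M"
    have Mpos: "M > 0" using U by (simp add: univ_hash_def)
    have "(\<Sum>f\<in>F. \<Sum>l\<in>map_err (seqs Om N) (iid p N) (map V) (map Y) (h f). iid p N l)
      \<le> real (card F) * (\<Sum>l\<in>seqs Om N. iid p N l * (M * post (seqs Om N) (iid p N) (map V) (map Y) l) powr (-s))"
      by (rule avg_map_err_le[OF fprob_iid[OF P] U s(1,2)])
    also have "(\<Sum>l\<in>seqs Om N. iid p N l * (M * post (seqs Om N) (iid p N) (map V) (map Y) l) powr (-s))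
      \<le> (\<Sum>l\<in>seqs Om N. iid p N l * (2 powr (real N * -R) * (\<Prod>i<N. ?r (l ! i))) powr s)"
    proof (rule sum_mono)
      fix l assume l: "l \<in> seqs Om N"
      have nn: "(\<Prod>i<N. post Om p V Y (l ! i)) \<ge> 0" by (intro prod_nonneg post_nonneg[OF P])
      have "(M * (\<Prod>i<N. post Om p V Y (l ! i))) powr (-s) = (1 / M * (\<Prod>i<N. ?r (l ! i))) powr s"
        using nn Mpos by (simp add: powr_minus powr_divide powr_mult prod_dividef inverse_eq_divide)
      also have "\<dots> \<le> (2 powr (real N * -R) * (\<Prod>i<N. ?r (l ! i))) powr s"
      proof (rule powr_mono2)
        have "1 / M \<le> 1 / 2 powr (real N * R)" using M Mpos by (intro divide_left_mono) auto
        also have "\<dots> = 2 powr (real N * -R)" by (simp add: powr_minus_divide)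
        finally show "1 / M * (\<Prod>i<N. ?r (l ! i)) \<le> 2 powr (real N * -R) * (\<Prod>i<N. ?r (l ! i))"
          using post_nonneg[OF P] by (intro mult_right_mono prod_nonneg) auto
        show "0 \<le> 1 / M * (\<Prod>i<N. ?r (l ! i))"
          using Mpos post_nonneg[OF P] by (intro mult_nonneg_nonneg prod_nonneg) auto
      qed (use s in simp)
      finally show "iid p N l * (M * post (seqs Om N) (iid p N) (map V) (map Y) l) powr (-s)
        \<le> iid p N l * (2 powr (real N * -R) * (\<Prod>i<N. ?r (l ! i))) powr s"
        using fprobD(2)[OF fprob_iid[OF P] l] by (simp add: post_iid[OF f(1) l] mult_left_mono)
    qed
    also have "\<dots> = ?\<rho> ^ N"
      by (rule sum_iid_powr[OF P]) (simp add: post_nonneg[OF P])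
    finally show "(\<Sum>f\<in>F. \<Sum>l\<in>map_err (seqs Om N) (iid p N) (map V) (map Y) (h f). iid p N l) \<le> real (card F) * ?\<rho> ^ N"
      by (simp add: mult_left_mono)
  qed
qed

text \<open>\<open>D\<close> is the deficit tolerated per letter. With \<open>D = 0\<close> the hash
  rate lies below H(V|Z) and the deficit decays exponentially, which is secrecy. With
  \<open>D > 0\<close> the rate may exceed H(V|Z) by less than \<open>D\<close> and the deficit
  grows at most like \<open>D * N\<close> plus a constant, which is how leakage is counted.\<close>

lemma avg_hash_deficit_iid:
  assumes P: "fprob Om p" and R: "R - (ent Om p (\<lambda>w. (V w, Z w)) - ent Om p Z) < D"
  shows "\<exists>s \<rho>. 0 < s \<and> 0 \<le> \<rho> \<and> \<rho> < 1 \<and> (\<forall>N M F (h :: 'f \<Rightarrow> _ \<Rightarrow> 'k).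
     univ_hash F h (map V ` seqs Om N) M \<longrightarrow> M \<le> 2 powr (real N * R) \<longrightarrow>
     (\<Sum>f\<in>F. log 2 M - (ent (seqs Om N) (iid p N) (\<lambda>l. (h f (map V l), map Z l)) - ent (seqs Om N) (iid p N) (map Z)))
      \<le> real (card F) * ((1 / s) * log 2 (1 + 2 powr (s * D * real N) * \<rho> ^ N)))"
proof -
  note f = fprobD[OF P]
  let ?r = "post Om p V Z"
  have "(\<Sum>w\<in>Om. p w * log 2 (?r w)) + (R - D) < 0" using R cond_ent_post[OF P, of V Z] by simp
  from powr_moment_less_1[OF P _ this] post_pos(3)[OF P]
  obtain s where s: "0 < s" "s \<le> 1" "(\<Sum>w\<in>Om. p w * (2 powr (R - D) * ?r w) powr s) < 1" (is "?\<rho> < 1")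
    by blast
  show ?thesis
  proof (rule exI[of _ s], rule exI[of _ ?\<rho>], intro conjI allI impI)
    show "0 \<le> ?\<rho>" using f by (intro sum_nonneg) auto
    fix N M and F :: "'f set" and h :: "'f \<Rightarrow> _ \<Rightarrow> 'k"
    assume U: "univ_hash F h (map V ` seqs Om N) M" and M: "M \<le> 2 powr (real N * R)"
    have Mpos: "M > 0" using U by (simp add: univ_hash_def)
    let ?m = "(\<Sum>l\<in>seqs Om N. iid p N l * (M * post (seqs Om N) (iid p N) (map V) (map Z) l) powr s)"
    have "?m \<le> (\<Sum>l\<in>seqs Om N. 2 powr (s * D * real N) * (iid p N l * (2 powr (real N * (R - D)) * (\<Prod>i<N. ?r (l ! i))) powr s))"
    proof (rule sum_mono)
      fix l assume l: "l \<in> seqs Om N"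
      have nn: "(\<Prod>i<N. post Om p V Z (l ! i)) \<ge> 0" by (intro prod_nonneg post_nonneg[OF P])
      have "(M * (\<Prod>i<N. ?r (l ! i))) powr s \<le> (2 powr (real N * R) * (\<Prod>i<N. ?r (l ! i))) powr s"
        using M nn s Mpos by (intro powr_mono2 mult_right_mono) auto
      \<comment> \<open>Splitting off the tolerated rate \<open>D\<close> leaves the rate
        \<open>R - D\<close>, which is below H(V|Z) and has the moment \<open>?\<rho>\<close> below
        1.\<close>
      also have "2 powr (real N * R) = 2 powr (D * real N) * 2 powr (real N * (R - D))"
        by (simp add: powr_add[symmetric] algebra_simps)
      also have "(2 powr (D * real N) * 2 powr (real N * (R - D)) * (\<Prod>i<N. ?r (l ! i))) powr s
         = 2 powr (s * D * real N) * (2 powr (real N * (R - D)) * (\<Prod>i<N. ?r (l ! i))) powr s"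
        using nn by (simp add: powr_mult powr_powr algebra_simps)
      finally show "iid p N l * (M * post (seqs Om N) (iid p N) (map V) (map Z) l) powr s
        \<le> 2 powr (s * D * real N) * (iid p N l * (2 powr (real N * (R - D)) * (\<Prod>i<N. ?r (l ! i))) powr s)"
        using fprobD(2)[OF fprob_iid[OF P] l] mult_left_mono
        by (simp add: post_iid[OF f(1) l] mult.left_commute)
    qed
    also have "\<dots> = 2 powr (s * D * real N) * ?\<rho> ^ N"
      unfolding sum_distrib_left[symmetric] by (subst sum_iid_powr[OF P]) (simp_all add: post_nonneg[OF P])
    finally have le: "?m \<le> 2 powr (s * D * real N) * ?\<rho> ^ N" .
    have m0: "?m \<ge> 0" using fprobD(2)[OF fprob_iid[OF P]] by (intro sum_nonneg) auto
    have "(\<Sum>f\<in>F. log 2 M - (ent (seqs Om N) (iid p N) (\<lambda>l. (h f (map V l), map Z l)) - ent (seqs Om N) (iid p N) (map Z)))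
      \<le> real (card F) * ((1 / s) * log 2 (1 + ?m))"
      by (rule avg_hash_ent_deficit[OF fprob_iid[OF P] U s(1,2)])
    also have "\<dots> \<le> real (card F) * ((1 / s) * log 2 (1 + 2 powr (s * D * real N) * ?\<rho> ^ N))"
    proof -
      have "log 2 (1 + ?m) \<le> log 2 (1 + 2 powr (s * D * real N) * ?\<rho> ^ N)"
        using le m0 by (intro log_mono) auto
      then show ?thesis using s by (intro mult_left_mono) auto
    qed
    finally show "(\<Sum>f\<in>F. log 2 M - (ent (seqs Om N) (iid p N) (\<lambda>l. (h f (map V l), map Z l)) - ent (seqs Om N) (iid p N) (map Z)))
      \<le> real (card F) * ((1 / s) * log 2 (1 + 2 powr (s * D * real N) * ?\<rho> ^ N))" .
  qed (use s in auto)
qed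

section \<open>The outer code\<close>

lemma ex_le_average:
  fixes \<phi> :: "'f \<Rightarrow> real"
  assumes "finite F" "F \<noteq> {}" "sum \<phi> F \<le> real (card F) * B"
  shows "\<exists>f\<in>F. \<phi> f \<le> B"
proof (rule ccontr)
  assume "\<not> (\<exists>f\<in>F. \<phi> f \<le> B)"
  then have "(\<Sum>f\<in>F. B) < sum \<phi> F" using assms by (intro sum_strict_mono) auto
  then show False using assms(3) by simp
qed

text \<open>Rounding \<open>2 powr (real N * R)\<close> up to an integer costs at most a factor 2,
  which \<open>1 \<le> real N * \<epsilon>\<close> absorbs into the rate.\<close>

lemma ex_bin_number:
  fixes N :: nat and R \<epsilon> :: real
  assumes "0 \<le> R" "0 < \<epsilon>" "1 \<le> real N * \<epsilon>"
  obtains M :: nat where "M \<ge> 1" "2 powr (real N * R) \<le> real M" "log 2 (real M) \<le> real N * (R + \<epsilon>)"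
    "real M \<le> 2 powr (real N * (R + \<epsilon>))"
proof -
  define M where "M = nat \<lceil>2 powr (real N * R)\<rceil>"
  have 1: "2 powr (real N * R) \<ge> 1" using assms by (intro ge_one_powr_ge_zero) auto
  have M: "2 powr (real N * R) \<le> real M" unfolding M_def by linarith
  then have M1: "real M \<ge> 1" using 1 by linarith
  have "real M \<le> 2 powr (real N * R) + 1" unfolding M_def using 1 by linarith
  also have "\<dots> \<le> 2 powr (real N * R) * 2 powr 1" using 1 by simp
  also have "\<dots> = 2 powr (real N * R + 1)" by (simp only: powr_add)
  also have "\<dots> \<le> 2 powr (real N * (R + \<epsilon>))" using assms by (intro powr_mono) (auto simp: algebra_simps)
  finally have M2: "real M \<le> 2 powr (real N * (R + \<epsilon>))" .
  then have "log 2 (real M) \<le> log 2 (2 powr (real N * (R + \<epsilon>)))" using M1 by (intro log_mono) auto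
  then show ?thesis using that[of M] M M1 M2 by simp
qed

text \<open>The factor \<open>N\<close> is there because the outer code weights its exponentially
  small terms by a multiple of \<open>N\<close>.\<close>

lemma eventually_mult_power_le:
  fixes \<rho> c e :: real
  assumes "0 \<le> \<rho>" "\<rho> < 1" "e > 0"
  shows "\<exists>N0. \<forall>N\<ge>N0. c * (real N * \<rho> ^ N) \<le> e"
proof -
  have "(\<lambda>n. c * (real n * \<rho> ^ n)) \<longlonglongrightarrow> c * 0"
    using powser_times_n_limit_0[of \<rho>] assms by (intro tendsto_mult tendsto_const) simp
  then have "eventually (\<lambda>n. c * (real n * \<rho> ^ n) < e) sequentially"
    using assms by (intro order_tendstoD(2)[of _ "c * 0"]) auto
  then show ?thesis by (meson eventually_sequentially less_imp_le)
qed

text \<open>One hash of the \<open>V\<close>-block serves as bin index and key at once (quotient and remainder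
  modulo \<open>K\<close>). The leakage deficit is of order \<open>N\<close> while the error and secrecy terms are
  exponentially small, so weighting the latter by \<open>c N\<close> lets one averaging step control all.\<close>
lemma outer_code:
  fixes A :: "'w \<Rightarrow> 'a" and U :: "'w \<Rightarrow> 'u" and V :: "'w \<Rightarrow> 'v" and X :: "'w \<Rightarrow> 'x"
    and Y :: "'w \<Rightarrow> 'y" and Z :: "'w \<Rightarrow> 'z"
  assumes P: "fprob Om p" and e: "\<epsilon> > 0" and d: "\<delta> > 0"
  defines "AY \<equiv> \<lambda>w. (A w, Y w)" and "AUY \<equiv> \<lambda>w. (A w, U w, Y w)"
    and "AUZ \<equiv> \<lambda>w. (A w, U w, Z w)" and "AUXZ \<equiv> \<lambda>w. (A w, U w, X w, Z w)"
  defines "HU \<equiv> ent Om p (\<lambda>w. (U w, AY w)) - ent Om p AY"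
    and "HY \<equiv> ent Om p (\<lambda>w. (V w, AUY w)) - ent Om p AUY"
    and "HZ \<equiv> ent Om p (\<lambda>w. (V w, AUZ w)) - ent Om p AUZ"
    and "HXZ \<equiv> ent Om p (\<lambda>w. (V w, AUXZ w)) - ent Om p AUXZ"
  shows "\<exists>N0. \<forall>N\<ge>N0. \<forall>K\<ge>1. K = 1 \<or> log 2 (real K) \<le> real N * (HZ - HY - 2 * \<epsilon>) \<longrightarrow>
    (\<exists>Mu Mv (fu :: 'u list \<Rightarrow> nat) (f :: 'v list \<Rightarrow> nat). Mu \<ge> 1 \<and> Mv \<ge> 1
      \<and> log 2 (real Mu) \<le> real N * (HU + \<epsilon>) \<and> log 2 (real Mv) \<le> real N * (HY + \<epsilon>)
      \<and> (\<forall>l\<in>seqs Om N. fu (map U l) < Mu) \<and> (\<forall>l\<in>seqs Om N. f (map V l) < Mv * K)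
      \<and> sum (iid p N) (map_err (seqs Om N) (iid p N) (map U) (map AY) fu) \<le> \<delta>
      \<and> sum (iid p N) (map_err (seqs Om N) (iid p N) (map V) (map AUY) (\<lambda>v. f v div K)) \<le> \<delta>
      \<and> log 2 (real Mv) - (ent (seqs Om N) (iid p N) (\<lambda>l. (f (map V l) div K, map AUXZ l))
           - ent (seqs Om N) (iid p N) (map AUXZ)) \<le> real N * (max 0 (HY - HXZ) + 3 * \<epsilon>)
      \<and> (K = 1 \<or> log 2 (real (Mv * K)) - (ent (seqs Om N) (iid p N) (\<lambda>l. (f (map V l), map AUZ l))
           - ent (seqs Om N) (iid p N) (map AUZ)) \<le> \<delta>))"
proof -
  note fP = fprobD[OF P]
  \<comment> \<open>The bin rate may reach \<open>HY + \<epsilon>\<close>, and \<open>D\<close> is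
    larger than its excess over \<open>HXZ\<close> = H(V|A,U,X,Z). The maximum with 0 covers the
    regime in which the bin index is almost uniform even given (A,U,X,Z).\<close>
  define D where "D = max 0 (HY - HXZ) + 2 * \<epsilon>"
  have D: "D > 0" "(HY + \<epsilon>) - HXZ < D" "D + \<epsilon> = max 0 (HY - HXZ) + 3 * \<epsilon>"
    using e by (auto simp: D_def)
  have nn: "HU \<ge> 0" "HY \<ge> 0"
    unfolding HU_def HY_def le_diff_eq add_0 by (rule ent_le_ent[OF P]; simp)+
  have hu: "ent Om p (\<lambda>w. (U w, AY w)) - ent Om p AY < HU + \<epsilon> / 2"
    and hv: "ent Om p (\<lambda>w. (V w, AUY w)) - ent Om p AUY < HY + \<epsilon> / 2"
    and hz: "(HZ - \<epsilon>) - (ent Om p (\<lambda>w. (V w, AUZ w)) - ent Om p AUZ) < 0"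
    and hx: "(HY + \<epsilon>) - (ent Om p (\<lambda>w. (V w, AUXZ w)) - ent Om p AUXZ) < D"
    using e D(2) by (simp_all add: HU_def HY_def HZ_def HXZ_def)
  obtain \<rho>1 where
    r1: "0 \<le> \<rho>1" "\<rho>1 < 1" "\<And>N M F (h :: ('u list \<Rightarrow> nat) \<Rightarrow> _ \<Rightarrow> nat). univ_hash F h (map U ` seqs Om N) M \<Longrightarrow>
      2 powr (real N * (HU + \<epsilon> / 2)) \<le> M \<Longrightarrow>
      (\<Sum>f\<in>F. sum (iid p N) (map_err (seqs Om N) (iid p N) (map U) (map AY) (h f))) \<le> real (card F) * \<rho>1 ^ N"
    using avg_map_err_iid[OF P hu, where ?'f="'u list \<Rightarrow> nat" and ?'k=nat] by blast
  obtain \<rho>2 where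
    r2: "0 \<le> \<rho>2" "\<rho>2 < 1" "\<And>N M F (h :: ('v list \<Rightarrow> nat) \<Rightarrow> _ \<Rightarrow> nat). univ_hash F h (map V ` seqs Om N) M \<Longrightarrow>
      2 powr (real N * (HY + \<epsilon> / 2)) \<le> M \<Longrightarrow>
      (\<Sum>f\<in>F. sum (iid p N) (map_err (seqs Om N) (iid p N) (map V) (map AUY) (h f))) \<le> real (card F) * \<rho>2 ^ N"
    using avg_map_err_iid[OF P hv, where ?'f="'v list \<Rightarrow> nat" and ?'k=nat] by blast
  obtain s3 \<rho>3 where
    r3: "0 < s3" "0 \<le> \<rho>3" "\<rho>3 < 1" "\<And>N M F (h :: ('v list \<Rightarrow> nat) \<Rightarrow> _ \<Rightarrow> nat). univ_hash F h (map V ` seqs Om N) M \<Longrightarrow>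
      M \<le> 2 powr (real N * (HZ - \<epsilon>)) \<Longrightarrow>
      (\<Sum>f\<in>F. log 2 M - (ent (seqs Om N) (iid p N) (\<lambda>l. (h f (map V l), map AUZ l)) - ent (seqs Om N) (iid p N) (map AUZ)))
      \<le> real (card F) * ((1 / s3) * log 2 (1 + 2 powr (s3 * 0 * real N) * \<rho>3 ^ N))"
    using avg_hash_deficit_iid[OF P hz, where ?'f="'v list \<Rightarrow> nat" and ?'k=nat] by blast
  obtain s4 \<rho>4 where
    r4: "0 < s4" "0 \<le> \<rho>4" "\<rho>4 < 1" "\<And>N M F (h :: ('v list \<Rightarrow> nat) \<Rightarrow> _ \<Rightarrow> nat). univ_hash F h (map V ` seqs Om N) M \<Longrightarrow>
      M \<le> 2 powr (real N * (HY + \<epsilon>)) \<Longrightarrow>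
      (\<Sum>f\<in>F. log 2 M - (ent (seqs Om N) (iid p N) (\<lambda>l. (h f (map V l), map AUXZ l)) - ent (seqs Om N) (iid p N) (map AUXZ)))
      \<le> real (card F) * ((1 / s4) * log 2 (1 + 2 powr (s4 * D * real N) * \<rho>4 ^ N))"
    using avg_hash_deficit_iid[OF P hx, where ?'f="'v list \<Rightarrow> nat" and ?'k=nat] by blast
  \<comment> \<open>Chosen so that \<open>c * N * \<delta>\<close> equals the bound
    \<open>(D + \<epsilon>) * N\<close> on the weighted sum: any function meeting that bound then
    has error and secrecy deficit at most \<open>\<delta>\<close>.\<close>
  define c where "c = (D + \<epsilon>) / \<delta>"
  have c: "c > 0" using D e d by (simp add: c_def)
  obtain N1 where N1: "\<And>N. N \<ge> N1 \<Longrightarrow> (1 / \<delta>) * (real N * \<rho>1 ^ N) \<le> 1"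
    using eventually_mult_power_le[OF r1(1,2), of 1 "1/\<delta>"] by auto
  obtain N2 where N2: "\<And>N. N \<ge> N2 \<Longrightarrow> c * (real N * \<rho>2 ^ N) \<le> 1/2"
    using eventually_mult_power_le[OF r2(1,2), of "1/2" c] by auto
  obtain N3 where N3: "\<And>N. N \<ge> N3 \<Longrightarrow> (c / (s3 * ln 2)) * (real N * \<rho>3 ^ N) \<le> 1/2"
    using eventually_mult_power_le[OF r3(2,3), of "1/2" "c / (s3 * ln 2)"] by auto
  \<comment> \<open>\<open>N4\<close> absorbs the constant \<open>1 / s4\<close> and the two halves
    left over by \<open>N2\<close> and \<open>N3\<close> into \<open>N * \<epsilon>\<close>;
    \<open>N5\<close> pays for rounding the bin numbers with slack
    \<open>\<epsilon> / 2\<close>.\<close>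
  obtain N4 :: nat where N4: "real N4 \<ge> (1 / s4 + 1) / \<epsilon>" using real_arch_simple by blast
  obtain N5 :: nat where N5: "real N5 \<ge> 2 / \<epsilon>" using real_arch_simple by blast
  define N0 where "N0 = N1 + N2 + N3 + N4 + N5 + 1"
  show ?thesis
  proof (rule exI[of _ N0], intro allI impI)
    fix N K :: nat assume N: "N0 \<le> N" and K1: "1 \<le> K"
      and K: "K = 1 \<or> log 2 (real K) \<le> real N * (HZ - HY - 2 * \<epsilon>)"
    have Np: "real N > 0" using N by (simp add: N0_def)
    have "real N \<ge> real N5" using N by (simp add: N0_def)
    then have "real N \<ge> 2 / \<epsilon>" using N5 by linarith
    then have Ne: "1 \<le> real N * (\<epsilon> / 2)" using e by (simp add: field_simps)
    have "real N \<ge> real N4" using N by (simp add: N0_def)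
    then have "real N \<ge> (1 / s4 + 1) / \<epsilon>" using N4 by linarith
    then have Ns: "1 / s4 + 1 \<le> real N * \<epsilon>" using e by (simp add: pos_divide_le_eq)
    let ?S = "seqs Om N" and ?p = "iid p N"
    have P': "fprob ?S ?p" by (rule fprob_iid[OF P])
    note fS = fprobD[OF P']
    obtain Mu where Mu: "Mu \<ge> 1" "2 powr (real N * (HU + \<epsilon>/2)) \<le> real Mu"
      "log 2 (real Mu) \<le> real N * (HU + \<epsilon>/2 + \<epsilon>/2)"
      using ex_bin_number[of "HU + \<epsilon>/2" "\<epsilon>/2" N] nn e Ne by auto
    obtain Mv where Mv: "Mv \<ge> 1" "2 powr (real N * (HY + \<epsilon>/2)) \<le> real Mv"
      "log 2 (real Mv) \<le> real N * (HY + \<epsilon>/2 + \<epsilon>/2)" "real Mv \<le> 2 powr (real N * (HY + \<epsilon>/2 + \<epsilon>/2))"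
      using ex_bin_number[of "HY + \<epsilon>/2" "\<epsilon>/2" N] nn e Ne by auto
    have fin: "finite (map U ` ?S)" "finite (map V ` ?S)" using fS(1) by auto
    \<comment> \<open>Since \<open>U\<close> is handed to the eavesdropper anyway, its bins have no
      secrecy or leakage to respect and are chosen by decoding error alone.\<close>
    let ?Fu = "map U ` ?S \<rightarrow>\<^sub>E {..<Mu}"
    have Uu: "univ_hash ?Fu (\<lambda>f v. f v) (map U ` ?S) (real Mu)"
      using univ_hash_PiE[OF fin(1), of Mu 1] Mu by simp
    have Fu: "finite ?Fu" "?Fu \<noteq> {}" using Uu unfolding univ_hash_def by blast+
    obtain fu where fu: "fu \<in> ?Fu" "sum ?p (map_err ?S ?p (map U) (map AY) fu) \<le> \<rho>1 ^ N"
      using ex_le_average[OF Fu r1(3)[OF Uu Mu(2)]] by blast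
    have "\<rho>1 ^ N \<le> real N * \<rho>1 ^ N" using r1(1) N by (simp add: N0_def mult_le_cancel_right1)
    also have "\<dots> \<le> \<delta>" using N1[of N] N d by (simp add: N0_def field_simps)
    finally have fu2: "sum ?p (map_err ?S ?p (map U) (map AY) fu) \<le> \<delta>" using fu by linarith
    let ?Fv = "map V ` ?S \<rightarrow>\<^sub>E {..<Mv * K}"
    \<comment> \<open>The same random functions are read twice: through the quotient by
      \<open>K\<close> as bin index, and as a whole for secrecy.\<close>
    have Uv: "univ_hash ?Fv (\<lambda>f v. f v div K) (map V ` ?S) (real Mv)"
      using univ_hash_PiE[OF fin(2), of Mv K] Mv K1 by simp
    have Uk: "univ_hash ?Fv (\<lambda>f v. f v) (map V ` ?S) (real (Mv * K))"
      using univ_hash_PiE[OF fin(2), of "Mv * K" 1] Mv K1 by simp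
    let ?er = "\<lambda>f. sum ?p (map_err ?S ?p (map V) (map AUY) (\<lambda>v. f v div K))"
    let ?lk = "\<lambda>f. log 2 (real Mv) - (ent ?S ?p (\<lambda>l. (f (map V l) div K, map AUXZ l)) - ent ?S ?p (map AUXZ))"
    let ?sc0 = "\<lambda>f. log 2 (real (Mv * K)) - (ent ?S ?p (\<lambda>l. (f (map V l), map AUZ l)) - ent ?S ?p (map AUZ))"
    \<comment> \<open>For \<open>K = 1\<close> no secrecy is claimed and the rate bound may fail, so
      the term is set to 0.\<close>
    let ?sc = "\<lambda>f. if K = 1 then 0 else ?sc0 f"
    have er: "(\<Sum>f\<in>?Fv. ?er f) \<le> real (card ?Fv) * \<rho>2 ^ N" by (rule r2(3)[OF Uv Mv(2)])
    have "(\<Sum>f\<in>?Fv. ?lk f) \<le> real (card ?Fv) * ((1 / s4) * log 2 (1 + 2 powr (s4 * D * real N) * \<rho>4 ^ N))"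
      using Mv(4) by (intro r4(4)[OF Uv]) (simp add: add.commute)
    also have "(1 / s4) * log 2 (1 + 2 powr (s4 * D * real N) * \<rho>4 ^ N) \<le> 1 / s4 + D * real N"
    proof -
      have g1: "2 powr (s4 * D * real N) \<ge> 1" using r4 D by (intro ge_one_powr_ge_zero) auto
      have "1 + 2 powr (s4 * D * real N) * \<rho>4 ^ N \<le> 1 + 2 powr (s4 * D * real N) * 1"
        using r4 by (intro add_left_mono mult_left_mono power_le_one) auto
      also have "\<dots> \<le> 2 powr 1 * 2 powr (s4 * D * real N)" using g1 by simp
      also have "\<dots> = 2 powr (1 + s4 * D * real N)" by (simp only: powr_add)
      finally have "log 2 (1 + 2 powr (s4 * D * real N) * \<rho>4 ^ N) \<le> log 2 (2 powr (1 + s4 * D * real N))"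
        using r4 by (intro log_mono) (auto intro!: add_pos_nonneg)
      then have "(1 / s4) * log 2 (1 + 2 powr (s4 * D * real N) * \<rho>4 ^ N) \<le> (1 / s4) * (1 + s4 * D * real N)"
        using r4(1) by (intro mult_left_mono) auto
      also have "\<dots> = 1 / s4 + D * real N" using r4(1) by (simp add: field_simps)
      finally show ?thesis .
    qed
    finally have lk: "(\<Sum>f\<in>?Fv. ?lk f) \<le> real (card ?Fv) * (1 / s4 + D * real N)"
      by (simp add: mult_left_mono)
    have sc: "(\<Sum>f\<in>?Fv. ?sc f) \<le> real (card ?Fv) * (\<rho>3 ^ N / (s3 * ln 2))"
    proof (cases "K = 1")
      case True then show ?thesis using r3 by simp
    next
      case False
      \<comment> \<open>Bin rate up to \<open>HY + \<epsilon>\<close> plus key rate up to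
        \<open>HZ - HY - 2 * \<epsilon>\<close>: the whole hash stays \<open>\<epsilon>\<close>
        below H(V|A,U,Z).\<close>
      have "log 2 (real (Mv * K)) \<le> real N * (HZ - \<epsilon>)"
        using False K Mv K1 by (simp add: log_mult algebra_simps)
      then have "real (Mv * K) \<le> 2 powr (real N * (HZ - \<epsilon>))"
        using Mv K1 by (simp add: log_le_iff)
      from r3(4)[OF Uk this]
      have "(\<Sum>f\<in>?Fv. ?sc f) \<le> real (card ?Fv) * ((1 / s3) * log 2 (1 + \<rho>3 ^ N))"
        using False by simp
      also have "\<dots> \<le> real (card ?Fv) * ((1 / s3) * (\<rho>3 ^ N / ln 2))"
      proof -
        have "log 2 (1 + \<rho>3 ^ N) \<le> \<rho>3 ^ N / ln 2"
          unfolding log_def using r3 by (intro divide_right_mono ln_add_one_self_le_self) auto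
        then show ?thesis using r3 by (intro mult_left_mono) auto
      qed
      finally show ?thesis by simp
    qed
    have "(\<Sum>f\<in>?Fv. ?lk f + c * real N * (?er f + ?sc f))
       = (\<Sum>f\<in>?Fv. ?lk f) + c * real N * ((\<Sum>f\<in>?Fv. ?er f) + (\<Sum>f\<in>?Fv. ?sc f))"
      by (simp only: sum.distrib sum_distrib_left[symmetric])
    also have "\<dots> \<le> real (card ?Fv) * (1 / s4 + D * real N)
       + c * real N * (real (card ?Fv) * \<rho>2 ^ N + real (card ?Fv) * (\<rho>3 ^ N / (s3 * ln 2)))"
      using lk er sc c by (intro add_mono mult_left_mono) auto
    also have "\<dots> = real (card ?Fv) * ((1 / s4 + D * real N) + (c * (real N * \<rho>2 ^ N) + (c / (s3 * ln 2)) * (real N * \<rho>3 ^ N)))"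
      by (simp add: algebra_simps)
    also have "\<dots> \<le> real (card ?Fv) * ((D + \<epsilon>) * real N)"
    proof (rule mult_left_mono)
      have "c * (real N * \<rho>2 ^ N) \<le> 1/2" "(c / (s3 * ln 2)) * (real N * \<rho>3 ^ N) \<le> 1/2"
        using N2[of N] N3[of N] N by (simp_all only: N0_def)
      moreover have "(D + \<epsilon>) * real N = D * real N + real N * \<epsilon>" by (simp add: algebra_simps)
      ultimately show "(1 / s4 + D * real N) + (c * (real N * \<rho>2 ^ N) + (c / (s3 * ln 2)) * (real N * \<rho>3 ^ N))
          \<le> (D + \<epsilon>) * real N" using Ns by linarith
    qed simp
    finally have avg: "(\<Sum>f\<in>?Fv. ?lk f + c * real N * (?er f + ?sc f)) \<le> real (card ?Fv) * ((D + \<epsilon>) * real N)" .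
    have Fv: "finite ?Fv" "?Fv \<noteq> {}" using Uv unfolding univ_hash_def by blast+
    obtain f where f: "f \<in> ?Fv" "?lk f + c * real N * (?er f + ?sc f) \<le> (D + \<epsilon>) * real N"
      using ex_le_average[OF Fv avg] by blast
    have fr: "f (map V l) < Mv * K" if "l \<in> ?S" for l
      using f(1) that by (auto dest!: PiE_mem[of _ _ _ "map V l"])
    \<comment> \<open>Nonnegativity of all three terms lets the one bound on their weighted sum
      bound each of them. For the two deficits it holds because a conditional entropy is at most the
      logarithm of the range size.\<close>
    have er0: "?er f \<ge> 0" using fS(2) by (intro sum_nonneg) (auto simp: map_err_def)
    have lk0: "?lk f \<ge> 0"
    proof -
      have "(\<lambda>l. f (map V l) div K) ` ?S \<subseteq> {..<Mv}"
        using fr K1 by (auto simp: less_mult_imp_div_less)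
      from cond_ent_le_log_card[OF P' this, of "map AUXZ"] show ?thesis by simp
    qed
    have sc0: "?sc f \<ge> 0"
    proof -
      have "(\<lambda>l. f (map V l)) ` ?S \<subseteq> {..<Mv * K}" using fr by auto
      from cond_ent_le_log_card[OF P' this, of "map AUZ"] show ?thesis by simp
    qed
    have cN: "c * real N > 0" using c Np by simp
    have lk1: "?lk f \<le> (D + \<epsilon>) * real N"
      using f(2) er0 sc0 cN by (smt (verit) mult_nonneg_nonneg)
    have "c * real N * (?er f + ?sc f) \<le> (D + \<epsilon>) * real N" using f(2) lk0 by linarith
    also have "\<dots> = c * real N * \<delta>" using d by (simp add: c_def)
    finally have "?er f + ?sc f \<le> \<delta>" using cN by (simp only: mult_le_cancel_left_pos)
    then have fin1: "?er f \<le> \<delta>" "?sc f \<le> \<delta>" using er0 sc0 by linarith+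
    have fur: "fu (map U l) < Mu" if "l \<in> ?S" for l
      using fu(1) that by (auto dest!: PiE_mem[of _ _ _ "map U l"])
    show "\<exists>Mu Mv (fu :: 'u list \<Rightarrow> nat) (f :: 'v list \<Rightarrow> nat). Mu \<ge> 1 \<and> Mv \<ge> 1
      \<and> log 2 (real Mu) \<le> real N * (HU + \<epsilon>) \<and> log 2 (real Mv) \<le> real N * (HY + \<epsilon>)
      \<and> (\<forall>l\<in>seqs Om N. fu (map U l) < Mu) \<and> (\<forall>l\<in>seqs Om N. f (map V l) < Mv * K)
      \<and> sum (iid p N) (map_err (seqs Om N) (iid p N) (map U) (map AY) fu) \<le> \<delta>
      \<and> sum (iid p N) (map_err (seqs Om N) (iid p N) (map V) (map AUY) (\<lambda>v. f v div K)) \<le> \<delta>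
      \<and> log 2 (real Mv) - (ent (seqs Om N) (iid p N) (\<lambda>l. (f (map V l) div K, map AUXZ l))
           - ent (seqs Om N) (iid p N) (map AUXZ)) \<le> real N * (max 0 (HY - HXZ) + 3 * \<epsilon>)
      \<and> (K = 1 \<or> log 2 (real (Mv * K)) - (ent (seqs Om N) (iid p N) (\<lambda>l. (f (map V l), map AUZ l))
           - ent (seqs Om N) (iid p N) (map AUZ)) \<le> \<delta>)"
    proof (rule exI[of _ Mu], rule exI[of _ Mv], rule exI[of _ fu], rule exI[of _ f], intro conjI)
      show "?lk f \<le> real N * (max 0 (HY - HXZ) + 3 * \<epsilon>)" using lk1 D(3) by (simp add: mult.commute)
    qed (use Mu Mv fr fur fin1 fu2 in \<open>auto simp: add.commute split: if_splits\<close>)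
  qed
qed

text \<open>Handing \<open>U\<close> to the eavesdropper only weakens the claims: \<open>W\<close> and \<open>Z\<close> are functions of
  \<open>(A, U, Z)\<close> and the bin index of \<open>V\<close>.\<close>
lemma binning_secrecy:
  assumes P: "fprob Om p" and K: "K \<ge> 1" and M: "M \<ge> 1"
    and f: "\<And>w. w \<in> Om \<Longrightarrow> f (V w) < M * K"
    and sec: "K = 1 \<or> log 2 (real (M * K)) -
        (ent Om p (\<lambda>w. (f (V w), AUZ w)) - ent Om p AUZ) \<le> \<delta>" and d: "\<delta> \<ge> 0"
    and G: "\<And>w w'. w \<in> Om \<Longrightarrow> w' \<in> Om \<Longrightarrow> f (V w) div K = f (V w') div K \<Longrightarrow> AUZ w = AUZ w' \<Longrightarrow> G w = G w'"
  shows "log 2 (real K) - (ent Om p (\<lambda>w. (f (V w) mod K, G w)) - ent Om p G) \<le> \<delta>"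
proof (cases "K = 1")
  case True
  have "ent Om p G \<le> ent Om p (\<lambda>w. (f (V w) mod K, G w))" by (rule ent_le_ent[OF P]) simp
  then show ?thesis using True d by simp
next
  case False
  let ?B = "\<lambda>w. f (V w) div K" and ?S = "\<lambda>w. f (V w) mod K"
  let ?H = "\<lambda>w. (?B w, AUZ w)"
  have "ent Om p (\<lambda>w. (?S w, ?H w)) - ent Om p ?H \<le> ent Om p (\<lambda>w. (?S w, G w)) - ent Om p G"
    using G by (intro cond_ent_antimono[OF P]) blast
  moreover have "ent Om p (\<lambda>w. (?S w, ?H w)) = ent Om p (\<lambda>w. (f (V w), AUZ w))"
  proof (rule ent_cong[OF fprobD(1)[OF P]])
    fix w w'
    show "((?S w, ?H w) = (?S w', ?H w')) = ((f (V w), AUZ w) = (f (V w'), AUZ w'))"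
      by (metis div_mult_mod_eq prod.inject)
  qed
  \<comment> \<open>The bin index takes at most \<open>log 2 M\<close> of the almost full entropy
    \<open>log 2 (M * K)\<close> of the hash; the rest belongs to the remainder, which is the
    key.\<close>
  moreover have "ent Om p ?H - ent Om p AUZ \<le> log 2 (real (card {..<M}))"
    using f K by (intro cond_ent_le_log_card[OF P]) (auto simp: less_mult_imp_div_less)
  moreover have "log 2 (real (M * K)) = log 2 (real M) + log 2 (real K)"
    using M K by (simp add: log_mult)
  ultimately show ?thesis using sec False by simp
qed

lemma mi_eq_ent:
  assumes P: "fprob Om p"
  shows "mi Om p X G = ent Om p X + ent Om p G - ent Om p (\<lambda>w. (X w, G w))"
proof -
  have "ent Om p (\<lambda>w. (X w, ())) = ent Om p X" "ent Om p (\<lambda>w. (G w, ())) = ent Om p G"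
    "ent Om p (\<lambda>w. (X w, G w, ())) = ent Om p (\<lambda>w. (X w, G w))"
    by (rule ent_cong[OF fprobD(1)[OF P]], simp)+
  then show ?thesis unfolding mi_def cmi_def using ent_const[OF P] by simp
qed

text \<open>With \<open>AUZ\<close> added to the eavesdropper's view and B the bin index, I(X;B,AUZ)
  = I(X;AUZ) + H(B|AUZ) - H(B|X,AUZ). Bounding H(B|AUZ) by \<open>log 2 M\<close> turns the extra
  terms into a uniformity deficit of the kind that hashing controls.\<close>

lemma binning_leakage:
  assumes P: "fprob Om p" and K: "K \<ge> 1" and M: "M \<ge> 1"
    and f: "\<And>w. w \<in> Om \<Longrightarrow> f (V w) < M * K"
    and G: "\<And>w w'. w \<in> Om \<Longrightarrow> w' \<in> Om \<Longrightarrow> f (V w) div K = f (V w') div K \<Longrightarrow> AUZ w = AUZ w' \<Longrightarrow> G w = G w'"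
  shows "mi Om p X G \<le> mi Om p X AUZ + (log 2 (real M) -
     (ent Om p (\<lambda>w. (f (V w) div K, (X w, AUZ w))) - ent Om p (\<lambda>w. (X w, AUZ w))))"
proof -
  note fP = fprobD(1)[OF P]
  let ?B = "\<lambda>w. f (V w) div K"
  let ?H = "\<lambda>w. (?B w, AUZ w)"
  have "ent Om p (\<lambda>w. (X w, ?H w)) - ent Om p ?H \<le> ent Om p (\<lambda>w. (X w, G w)) - ent Om p G"
    using G by (intro cond_ent_antimono[OF P]) blast
  moreover have "ent Om p (\<lambda>w. (X w, ?H w)) = ent Om p (\<lambda>w. (?B w, (X w, AUZ w)))"
    by (rule ent_cong[OF fP]) auto
  moreover have "ent Om p ?H - ent Om p AUZ \<le> log 2 (real (card {..<M}))"
    using f K by (intro cond_ent_le_log_card[OF P]) (auto simp: less_mult_imp_div_less)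
  ultimately show ?thesis unfolding mi_eq_ent[OF P] by simp
qed

section \<open>Greedy covering\<close>

text \<open>Derandomised random coding: the words are picked one at a time, each time at least as
  well as a random word would do on average.\<close>
lemma greedy_cover:
  fixes w :: "'b \<Rightarrow> real" and q :: "'d \<Rightarrow> real"
  assumes B: "finite B" and D: "finite D" "\<And>d. d \<in> D \<Longrightarrow> 0 \<le> q d" "sum q D = 1"
    and w: "\<And>b. b \<in> B \<Longrightarrow> 0 \<le> w b"
  shows "\<exists>c::nat \<Rightarrow> 'd. (\<forall>j. c j \<in> D) \<and> (\<Sum>b\<in>B. if \<exists>j<M. T b (c j) then 0 else w b)
     \<le> (\<Sum>b\<in>B. w b * (1 - (\<Sum>d\<in>D. if T b d then q d else 0)) ^ M)"
  using w
proof (induction M arbitrary: w)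
  case 0
  obtain d where "d \<in> D" using D(3) by fastforce
  then show ?case by (intro exI[of _ "\<lambda>_. d"]) simp
next
  case (Suc M)
  let ?t = "\<lambda>b. \<Sum>d\<in>D. if T b d then q d else 0"
  let ?w = "\<lambda>d b. if T b d then 0 else w b"
  let ?\<phi> = "\<lambda>d. \<Sum>b\<in>B. ?w d b * (1 - ?t b) ^ M"
  let ?R = "\<Sum>b\<in>B. w b * (1 - ?t b) ^ Suc M"
  have t: "(\<Sum>d\<in>D. if T b d then 0 else q d) = 1 - ?t b" for b
  proof -
    have "(\<Sum>d\<in>D. if T b d then 0 else q d) + ?t b = sum q D"
      unfolding sum.distrib[symmetric] by (intro sum.cong) auto
    then show ?thesis using D(3) by simp
  qed
  have "(\<Sum>d\<in>D. q d * ?\<phi> d) = (\<Sum>b\<in>B. \<Sum>d\<in>D. w b * (1 - ?t b) ^ M * (if T b d then 0 else q d))"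
    unfolding sum_distrib_left by (subst sum.swap) (intro sum.cong, auto)
  also have "\<dots> = ?R" unfolding sum_distrib_left[symmetric] t by (simp add: mult_ac)
  finally have avg: "(\<Sum>d\<in>D. q d * ?\<phi> d) = ?R" .
  have "\<exists>d\<in>D. ?\<phi> d \<le> ?R"
  proof (rule ccontr)
    assume "\<not> (\<exists>d\<in>D. ?\<phi> d \<le> ?R)"
    then have less: "?\<phi> d > ?R" if "d \<in> D" for d using that by (meson not_le)
    obtain d0 where d0: "d0 \<in> D" "q d0 > 0"
    proof -
      have "\<exists>d\<in>D. q d \<noteq> 0" using D(3) by (metis sum.neutral zero_neq_one)
      then show ?thesis using that D(2) by (metis less_eq_real_def)
    qed
    have "(\<Sum>d\<in>D. q d * ?R) < (\<Sum>d\<in>D. q d * ?\<phi> d)"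
    proof (rule sum_strict_mono_ex1[OF D(1)])
      show "\<forall>d\<in>D. q d * ?R \<le> q d * ?\<phi> d" using less D(2) by (intro ballI mult_left_mono) (auto intro: less_imp_le)
      show "\<exists>d\<in>D. q d * ?R < q d * ?\<phi> d" using less d0 by (intro bexI[of _ d0] mult_strict_left_mono) auto
    qed
    then show False using avg D(3) by (simp add: sum_distrib_right[symmetric])
  qed
  then obtain d where d: "d \<in> D" "?\<phi> d \<le> ?R" by blast
  obtain c where c: "\<forall>j. c j \<in> D" "(\<Sum>b\<in>B. if \<exists>j<M. T b (c j) then 0 else ?w d b) \<le> ?\<phi> d"
  proof -
    have "0 \<le> ?w d b" if "b \<in> B" for b using Suc.prems[OF that] by simp
    from Suc.IH[of "?w d", OF this] that show ?thesis by blast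
  qed
  \<comment> \<open>The word just picked gets index \<open>M\<close>; the other \<open>M\<close>
    words only had to cover the weight that it leaves uncovered.\<close>
  let ?c = "c(M := d)"
  have "(\<Sum>b\<in>B. if \<exists>j<Suc M. T b (?c j) then 0 else w b) = (\<Sum>b\<in>B. if \<exists>j<M. T b (c j) then 0 else ?w d b)"
    by (intro sum.cong refl) (auto simp: less_Suc_eq)
  then show ?case using c d by (intro exI[of _ ?c]) auto
qed

text \<open>\<open>g b\<close> is the part of the codeword fixed earlier; each of its values gets
  its own codebook of \<open>M\<close> words, whence the factor \<open>M\<close>. Where the density
  of the test channel \<open>k\<close> with respect to \<open>q\<close> is at most
  \<open>2 powr \<tau>\<close>, mass 1/2 under \<open>k\<close> means mass at least
  \<open>2 powr (-\<tau>) / 2\<close> under \<open>q\<close>, and \<open>M\<close> independent draws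
  all miss with probability at most the stated exponential.\<close>

lemma cover_step:
  fixes w :: "'b \<Rightarrow> real" and q :: "'c \<Rightarrow> 'd \<Rightarrow> real" and k :: "'b \<Rightarrow> 'd \<Rightarrow> real"
  assumes B: "finite B" "B0 \<subseteq> B" and D: "finite D"
    and q: "\<And>b d. b \<in> B \<Longrightarrow> d \<in> D \<Longrightarrow> 0 \<le> q (g b) d" "\<And>b. b \<in> B \<Longrightarrow> sum (q (g b)) D = 1"
    and w: "\<And>b. b \<in> B \<Longrightarrow> 0 \<le> w b" "sum w B = 1"
    and M: "M \<ge> 1"
    and dens: "\<And>b d. b \<in> B0 \<Longrightarrow> d \<in> D \<Longrightarrow> T b d \<Longrightarrow> k b d \<le> 2 powr \<tau> * q (g b) d"
    and good: "\<And>b. b \<in> B0 \<Longrightarrow> (\<Sum>d\<in>D. if T b d then k b d else 0) \<ge> 1/2"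
  shows "\<exists>e. (\<forall>b\<in>B. e b \<in> D) \<and> card ((\<lambda>b. (g b, e b)) ` B) \<le> card (g ` B) * M \<and>
     (\<Sum>b\<in>B0. if T b (e b) then 0 else w b) \<le> exp (- (real M * 2 powr (-\<tau>) / 2))"
proof -
  let ?B = "\<lambda>c. {b\<in>B0. g b = c}"
  let ?t = "\<lambda>b. \<Sum>d\<in>D. if T b d then q (g b) d else 0"
  let ?x = "exp (- (real M * 2 powr (-\<tau>) / 2))"
  have fB0: "finite B0" using B finite_subset by blast
  have "\<exists>c'::nat \<Rightarrow> 'd. (\<forall>j. c' j \<in> D) \<and> (\<Sum>b\<in>?B c. if \<exists>j<M. T b (c' j) then 0 else w b)
     \<le> (\<Sum>b\<in>?B c. w b * (1 - ?t b) ^ M)" if c: "c \<in> g ` B" for c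
  proof -
    obtain b0 where b0: "b0 \<in> B" "c = g b0" using c by auto
    have "\<exists>c'::nat \<Rightarrow> 'd. (\<forall>j. c' j \<in> D) \<and> (\<Sum>b\<in>?B c. if \<exists>j<M. T b (c' j) then 0 else w b)
     \<le> (\<Sum>b\<in>?B c. w b * (1 - (\<Sum>d\<in>D. if T b d then q c d else 0)) ^ M)"
      using b0 q fB0 w B by (intro greedy_cover D) auto
    moreover have "(\<Sum>b\<in>?B c. w b * (1 - (\<Sum>d\<in>D. if T b d then q c d else 0)) ^ M) = (\<Sum>b\<in>?B c. w b * (1 - ?t b) ^ M)"
      by (rule sum.cong[OF refl]) auto
    ultimately show ?thesis by simp
  qed
  then have "\<forall>c. \<exists>c'::nat \<Rightarrow> 'd. c \<in> g ` B \<longrightarrow> (\<forall>j. c' j \<in> D) \<and> (\<Sum>b\<in>?B c. if \<exists>j<M. T b (c' j) then 0 else w b)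
     \<le> (\<Sum>b\<in>?B c. w b * (1 - ?t b) ^ M)" by blast
  from choice[OF this] obtain cc :: "'c \<Rightarrow> nat \<Rightarrow> 'd" where cc: "\<And>c j. c \<in> g ` B \<Longrightarrow> cc c j \<in> D"
    "\<And>c. c \<in> g ` B \<Longrightarrow> (\<Sum>b\<in>?B c. if \<exists>j<M. T b (cc c j) then 0 else w b) \<le> (\<Sum>b\<in>?B c. w b * (1 - ?t b) ^ M)"
    by blast
  \<comment> \<open>The default index 0 still names a codeword because \<open>M \<ge> 1\<close>, so
    \<open>e\<close> stays in the codebook even where no word fits.\<close>
  define j where "j b = (if \<exists>j<M. T b (cc (g b) j) then SOME j. j < M \<and> T b (cc (g b) j) else 0)" for b
  have j: "j b < M" "(\<exists>j<M. T b (cc (g b) j)) \<Longrightarrow> T b (cc (g b) (j b))" for b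
    using M someI_ex[of "\<lambda>j. j < M \<and> T b (cc (g b) j)"] by (auto simp: j_def)
  define e where "e b = cc (g b) (j b)" for b
  have eq: "T b (e b) = (\<exists>j<M. T b (cc (g b) j))" for b using j[of b] by (auto simp: e_def)
  have "(\<lambda>b. (g b, e b)) ` B \<subseteq> (\<lambda>(c,j). (c, cc c j)) ` (g ` B \<times> {..<M})"
    using j(1) by (force simp: e_def)
  then have "card ((\<lambda>b. (g b, e b)) ` B) \<le> card ((\<lambda>(c,j). (c, cc c j)) ` (g ` B \<times> {..<M}))"
    using B by (intro card_mono) auto
  also have "\<dots> \<le> card (g ` B \<times> {..<M})" using B by (intro card_image_le) auto
  finally have card: "card ((\<lambda>b. (g b, e b)) ` B) \<le> card (g ` B) * M" by (simp add: card_cartesian_product)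
  have tb: "(1 - ?t b) ^ M \<le> ?x" if b: "b \<in> B0" for b
  proof -
    have bB: "b \<in> B" using b B by auto
    have "?t b \<le> sum (q (g b)) D" using q(1)[OF bB] by (intro sum_mono) auto
    then have t1: "?t b \<le> 1" using q(2)[OF bB] by simp
    have "1/2 \<le> (\<Sum>d\<in>D. if T b d then k b d else 0)" by (rule good[OF b])
    also have "\<dots> \<le> (\<Sum>d\<in>D. 2 powr \<tau> * (if T b d then q (g b) d else 0))"
      using dens[OF b] by (intro sum_mono) auto
    also have "\<dots> = 2 powr \<tau> * ?t b" by (simp add: sum_distrib_left)
    finally have "2 powr (-\<tau>) / 2 \<le> ?t b" by (simp add: powr_minus field_simps)
    then have "1 - ?t b \<le> exp (- (2 powr (-\<tau>) / 2))"
      using exp_ge_add_one_self[of "- (2 powr (-\<tau>) / 2)"] by linarith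
    then have "(1 - ?t b) ^ M \<le> exp (- (2 powr (-\<tau>) / 2)) ^ M" using t1 by (intro power_mono) auto
    also have "\<dots> = ?x" by (simp add: exp_of_nat_mult[symmetric])
    finally show ?thesis .
  qed
  have "(\<Sum>b\<in>B0. if T b (e b) then 0 else w b) = (\<Sum>c\<in>g ` B. \<Sum>b\<in>?B c. if T b (e b) then 0 else w b)"
    using fB0 B by (intro sum.group[symmetric]) auto
  also have "\<dots> \<le> (\<Sum>c\<in>g ` B. \<Sum>b\<in>?B c. w b * (1 - ?t b) ^ M)"
  proof (rule sum_mono)
    fix c assume c: "c \<in> g ` B"
    have "(\<Sum>b\<in>?B c. if T b (e b) then 0 else w b) = (\<Sum>b\<in>?B c. if \<exists>j<M. T b (cc c j) then 0 else w b)"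
      unfolding eq by (intro sum.cong refl) auto
    then show "(\<Sum>b\<in>?B c. if T b (e b) then 0 else w b) \<le> (\<Sum>b\<in>?B c. w b * (1 - ?t b) ^ M)"
      using cc(2)[OF c] by simp
  qed
  also have "\<dots> = (\<Sum>b\<in>B0. w b * (1 - ?t b) ^ M)"
    using fB0 B by (intro sum.group) auto
  also have "\<dots> \<le> (\<Sum>b\<in>B0. w b * ?x)" using w B tb by (intro sum_mono mult_left_mono) auto
  also have "\<dots> = sum w B0 * ?x" by (simp add: sum_distrib_right)
  also have "\<dots> \<le> sum w B * ?x" using B w by (intro mult_right_mono sum_mono2) auto
  finally have "(\<Sum>b\<in>B0. if T b (e b) then 0 else w b) \<le> ?x" using w(2) by simp
  then show ?thesis using card cc(1) by (intro exI[of _ e]) (auto simp: e_def)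
qed

text \<open>Markov's inequality: where the good set has conditional mass below 1/2 the bad set has
  mass above 1/2, so such \<open>b\<close> weigh at most twice the total bad mass.\<close>

lemma markov_half:
  fixes \<mu> :: "'b \<Rightarrow> real"
  assumes "finite B" "finite D" "\<And>b. b \<in> B \<Longrightarrow> 0 \<le> \<mu> b" "\<And>b d. b \<in> B \<Longrightarrow> d \<in> D \<Longrightarrow> 0 \<le> k b d"
    and "\<And>b. b \<in> B \<Longrightarrow> sum (k b) D = 1"
  shows "(\<Sum>b\<in>B. if (\<Sum>d\<in>D. if T b d then k b d else 0) \<ge> 1/2 then 0 else \<mu> b)
    \<le> 2 * (\<Sum>b\<in>B. \<Sum>d\<in>D. if T b d then 0 else \<mu> b * k b d)"
  unfolding sum_distrib_left
proof (rule sum_mono)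
  fix b assume b: "b \<in> B"
  have "(\<Sum>d\<in>D. if T b d then 0 else k b d) + (\<Sum>d\<in>D. if T b d then k b d else 0) = sum (k b) D"
    unfolding sum.distrib[symmetric] by (intro sum.cong) auto
  then have s: "(\<Sum>d\<in>D. if T b d then k b d else 0) = 1 - (\<Sum>d\<in>D. if T b d then 0 else k b d)"
    using assms(5)[OF b] by simp
  have "(\<Sum>d\<in>D. 2 * (if T b d then 0 else \<mu> b * k b d)) = \<mu> b * (2 * (\<Sum>d\<in>D. if T b d then 0 else k b d))"
    unfolding sum_distrib_left by (intro sum.cong) auto
  moreover have "(\<Sum>d\<in>D. if T b d then 0 else k b d) \<ge> 0" using assms(4)[OF b] by (intro sum_nonneg) auto
  moreover have "\<mu> b \<ge> 0" using assms(3)[OF b] .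
  ultimately show "(if (\<Sum>d\<in>D. if T b d then k b d else 0) \<ge> 1/2 then 0 else \<mu> b)
      \<le> (\<Sum>d\<in>D. 2 * (if T b d then 0 else \<mu> b * k b d))"
    unfolding s using mult_left_mono[of 1 "2 * (\<Sum>d\<in>D. if T b d then 0 else k b d)" "\<mu> b"] by auto
qed

text \<open>Each stage only keeps words that leave the next stage a good chance, so no conditional
  typicality statement is needed.\<close>
lemma cover_three:
  fixes pb :: "'b \<Rightarrow> real" and ka :: "'b \<Rightarrow> 'a \<Rightarrow> real" and ku :: "'b \<Rightarrow> 'a \<Rightarrow> 'u \<Rightarrow> real"
    and kv :: "'b \<Rightarrow> 'a \<Rightarrow> 'u \<Rightarrow> 'v \<Rightarrow> real"
  assumes fin: "finite B" "finite DA" "finite DU" "finite DV"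
    and pb: "\<And>b. b \<in> B \<Longrightarrow> 0 \<le> pb b" "sum pb B = 1"
    and ka: "\<And>b a. 0 \<le> ka b a" "\<And>b. b \<in> B \<Longrightarrow> sum (ka b) DA = 1"
    and ku: "\<And>b a u. 0 \<le> ku b a u" "\<And>b a. b \<in> B \<Longrightarrow> a \<in> DA \<Longrightarrow> sum (ku b a) DU = 1"
    and kv: "\<And>b a u v. 0 \<le> kv b a u v" "\<And>b a u. b \<in> B \<Longrightarrow> a \<in> DA \<Longrightarrow> u \<in> DU \<Longrightarrow> sum (kv b a u) DV = 1"
    and qa: "\<And>a. 0 \<le> qa a" "sum qa DA = 1"
    and qu: "\<And>a u. 0 \<le> qu a u" "\<And>a. a \<in> DA \<Longrightarrow> sum (qu a) DU = 1"
    and qv: "\<And>a u v. 0 \<le> qv a u v" "\<And>a u. a \<in> DA \<Longrightarrow> u \<in> DU \<Longrightarrow> sum (qv a u) DV = 1"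
    and M: "M1 \<ge> 1" "M2 \<ge> 1" "M3 \<ge> 1"
    and d1: "(\<Sum>b\<in>B. \<Sum>a\<in>DA. if ka b a \<le> 2 powr \<tau>1 * qa a then 0 else pb b * ka b a) \<le> \<delta>1"
    and d2: "(\<Sum>b\<in>B. \<Sum>a\<in>DA. \<Sum>u\<in>DU. if ku b a u \<le> 2 powr \<tau>2 * qu a u then 0 else pb b * ka b a * ku b a u) \<le> \<delta>2"
    and d3: "(\<Sum>b\<in>B. \<Sum>a\<in>DA. \<Sum>u\<in>DU. \<Sum>v\<in>DV. if typ b a u v \<and> kv b a u v \<le> 2 powr \<tau>3 * qv a u v then 0
        else pb b * ka b a * ku b a u * kv b a u v) \<le> \<delta>3"
  shows "\<exists>ea eu ev. (\<forall>b\<in>B. ea b \<in> DA \<and> eu b \<in> DU \<and> ev b \<in> DV) \<and> card (ea ` B) \<le> M1 \<and>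
     card ((\<lambda>b. (ea b, eu b)) ` B) \<le> M1 * M2 \<and> card ((\<lambda>b. ((ea b, eu b), ev b)) ` B) \<le> M1 * M2 * M3 \<and>
     (\<Sum>b\<in>B. if typ b (ea b) (eu b) (ev b) then 0 else pb b) \<le> 2 * \<delta>1 + 4 * \<delta>2 + 8 * \<delta>3
       + exp (- (real M1 * 2 powr (-\<tau>1) / 2)) + exp (- (real M2 * 2 powr (-\<tau>2) / 2)) + exp (- (real M3 * 2 powr (-\<tau>3) / 2))"
proof -
  \<comment> \<open>The good sets are defined backwards: each asks for a moderate density and for
    the next set to keep conditional mass at least 1/2. Three passes of \<open>markov_half\<close>
    produce the factors 2, 4 and 8.\<close>
  define T3 where "T3 b a u v \<longleftrightarrow> typ b a u v \<and> kv b a u v \<le> 2 powr \<tau>3 * qv a u v" for b a u v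
  define T2 where "T2 b a u \<longleftrightarrow> ku b a u \<le> 2 powr \<tau>2 * qu a u \<and>
     (\<Sum>v\<in>DV. if T3 b a u v then kv b a u v else 0) \<ge> 1/2" for b a u
  define T1 where "T1 b a \<longleftrightarrow> ka b a \<le> 2 powr \<tau>1 * qa a \<and>
     (\<Sum>u\<in>DU. if T2 b a u then ku b a u else 0) \<ge> 1/2" for b a
  define T0 where "T0 b \<longleftrightarrow> (\<Sum>a\<in>DA. if T1 b a then ka b a else 0) \<ge> 1/2" for b
  have "(\<Sum>b\<in>B. \<Sum>a\<in>DA. \<Sum>u\<in>DU. if T2 b a u then 0 else pb b * ka b a * ku b a u)
     \<le> (\<Sum>b\<in>B. \<Sum>a\<in>DA. (\<Sum>u\<in>DU. if ku b a u \<le> 2 powr \<tau>2 * qu a u then 0 else pb b * ka b a * ku b a u)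
        + 2 * (\<Sum>u\<in>DU. \<Sum>v\<in>DV. if T3 b a u v then 0 else pb b * ka b a * ku b a u * kv b a u v))"
  proof (intro sum_mono)
    fix b a assume ba: "b \<in> B" "a \<in> DA"
    have nn: "0 \<le> pb b * ka b a * ku b a u" for u using pb(1)[OF ba(1)] ka(1) ku(1) by simp
    have "(\<Sum>u\<in>DU. if T2 b a u then 0 else pb b * ka b a * ku b a u)
      \<le> (\<Sum>u\<in>DU. (if ku b a u \<le> 2 powr \<tau>2 * qu a u then 0 else pb b * ka b a * ku b a u)
         + (if (\<Sum>v\<in>DV. if T3 b a u v then kv b a u v else 0) \<ge> 1/2 then 0 else pb b * ka b a * ku b a u))"
      using nn by (intro sum_mono) (auto simp: T2_def)
    also have "\<dots> \<le> (\<Sum>u\<in>DU. if ku b a u \<le> 2 powr \<tau>2 * qu a u then 0 else pb b * ka b a * ku b a u)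
         + 2 * (\<Sum>u\<in>DU. \<Sum>v\<in>DV. if T3 b a u v then 0 else pb b * ka b a * ku b a u * kv b a u v)"
      unfolding sum.distrib using nn kv ba fin by (intro add_left_mono markov_half) auto
    finally show "(\<Sum>u\<in>DU. if T2 b a u then 0 else pb b * ka b a * ku b a u) \<le> \<dots>" .
  qed
  also have "\<dots> \<le> \<delta>2 + 2 * \<delta>3"
    using d2 d3 unfolding T3_def[symmetric] by (simp add: sum.distrib sum_distrib_left[symmetric])
  finally have e2: "(\<Sum>b\<in>B. \<Sum>a\<in>DA. \<Sum>u\<in>DU. if T2 b a u then 0 else pb b * ka b a * ku b a u) \<le> \<delta>2 + 2 * \<delta>3" .
  have "(\<Sum>b\<in>B. \<Sum>a\<in>DA. if T1 b a then 0 else pb b * ka b a)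
     \<le> (\<Sum>b\<in>B. (\<Sum>a\<in>DA. if ka b a \<le> 2 powr \<tau>1 * qa a then 0 else pb b * ka b a)
        + 2 * (\<Sum>a\<in>DA. \<Sum>u\<in>DU. if T2 b a u then 0 else pb b * ka b a * ku b a u))"
  proof (intro sum_mono)
    fix b assume b: "b \<in> B"
    have nn: "0 \<le> pb b * ka b a" for a using pb(1)[OF b] ka(1) by simp
    have "(\<Sum>a\<in>DA. if T1 b a then 0 else pb b * ka b a)
      \<le> (\<Sum>a\<in>DA. (if ka b a \<le> 2 powr \<tau>1 * qa a then 0 else pb b * ka b a)
         + (if (\<Sum>u\<in>DU. if T2 b a u then ku b a u else 0) \<ge> 1/2 then 0 else pb b * ka b a))"
      using nn by (intro sum_mono) (auto simp: T1_def)
    also have "\<dots> \<le> (\<Sum>a\<in>DA. if ka b a \<le> 2 powr \<tau>1 * qa a then 0 else pb b * ka b a)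
         + 2 * (\<Sum>a\<in>DA. \<Sum>u\<in>DU. if T2 b a u then 0 else pb b * ka b a * ku b a u)"
      unfolding sum.distrib using nn ku b fin by (intro add_left_mono markov_half) auto
    finally show "(\<Sum>a\<in>DA. if T1 b a then 0 else pb b * ka b a) \<le> \<dots>" .
  qed
  also have "\<dots> \<le> \<delta>1 + 2 * (\<delta>2 + 2 * \<delta>3)"
    using d1 e2 by (simp add: sum.distrib sum_distrib_left[symmetric])
  finally have e1: "(\<Sum>b\<in>B. \<Sum>a\<in>DA. if T1 b a then 0 else pb b * ka b a) \<le> \<delta>1 + 2 * (\<delta>2 + 2 * \<delta>3)" .
  have "(\<Sum>b\<in>B. if T0 b then 0 else pb b) \<le> 2 * (\<Sum>b\<in>B. \<Sum>a\<in>DA. if T1 b a then 0 else pb b * ka b a)"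
    unfolding T0_def using pb ka fin by (intro markov_half) auto
  also have "\<dots> \<le> 2 * (\<delta>1 + 2 * (\<delta>2 + 2 * \<delta>3))" by (rule mult_left_mono[OF e1]) simp
  also have "\<dots> = 2 * \<delta>1 + 4 * \<delta>2 + 8 * \<delta>3" by simp
  finally have e0: "(\<Sum>b\<in>B. if T0 b then 0 else pb b) \<le> 2 * \<delta>1 + 4 * \<delta>2 + 8 * \<delta>3" .
  let ?x1 = "exp (- (real M1 * 2 powr (-\<tau>1) / 2))" and ?x2 = "exp (- (real M2 * 2 powr (-\<tau>2) / 2))"
    and ?x3 = "exp (- (real M3 * 2 powr (-\<tau>3) / 2))"
  \<comment> \<open>The stage for \<open>A\<close> has nothing fixed before it, hence the constant
    prefix \<open>()\<close> and a single codebook.\<close>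
  have "\<exists>e. (\<forall>b\<in>B. e b \<in> DA) \<and> card ((\<lambda>b. ((), e b)) ` B) \<le> card ((\<lambda>_. ()) ` B) * M1 \<and>
     (\<Sum>b\<in>{b\<in>B. T0 b}. if T1 b (e b) then 0 else pb b) \<le> ?x1"
    by (rule cover_step[where q="\<lambda>_. qa" and k=ka]) (use fin qa pb M in \<open>auto simp: T0_def T1_def\<close>)
  then obtain ea where ea: "\<forall>b\<in>B. ea b \<in> DA" "card ((\<lambda>b. ((), ea b)) ` B) \<le> card ((\<lambda>_. ()) ` B) * M1"
     "(\<Sum>b\<in>{b\<in>B. T0 b}. if T1 b (ea b) then 0 else pb b) \<le> ?x1" by blast
  have "card (ea ` B) = card (snd ` (\<lambda>b. ((), ea b)) ` B)" by (simp add: image_image)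
  also have "\<dots> \<le> card ((\<lambda>b. ((), ea b)) ` B)" using fin by (intro card_image_le) auto
  also have "\<dots> \<le> card ((\<lambda>_. ()) ` B) * M1" by (rule ea(2))
  also have "\<dots> \<le> 1 * M1" using card_mono[of "UNIV::unit set" "(\<lambda>_. ()) ` B"] by (intro mult_right_mono) auto
  finally have c1: "card (ea ` B) \<le> M1" by simp
  have "\<exists>e. (\<forall>b\<in>B. e b \<in> DU) \<and> card ((\<lambda>b. (ea b, e b)) ` B) \<le> card (ea ` B) * M2 \<and>
     (\<Sum>b\<in>{b\<in>B. T1 b (ea b)}. if T2 b (ea b) (e b) then 0 else pb b) \<le> ?x2"
    by (rule cover_step[where q=qu and k="\<lambda>b. ku b (ea b)"]) (use fin qu pb M ea(1) in \<open>auto simp: T1_def T2_def\<close>)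
  then obtain eu where eu: "\<forall>b\<in>B. eu b \<in> DU" "card ((\<lambda>b. (ea b, eu b)) ` B) \<le> card (ea ` B) * M2"
     "(\<Sum>b\<in>{b\<in>B. T1 b (ea b)}. if T2 b (ea b) (eu b) then 0 else pb b) \<le> ?x2" by blast
  have c2: "card ((\<lambda>b. (ea b, eu b)) ` B) \<le> M1 * M2" using eu(2) mult_right_mono[OF c1, of M2] by linarith
  have "\<exists>e. (\<forall>b\<in>B. e b \<in> DV) \<and> card ((\<lambda>b. ((ea b, eu b), e b)) ` B) \<le> card ((\<lambda>b. (ea b, eu b)) ` B) * M3 \<and>
     (\<Sum>b\<in>{b\<in>B. T2 b (ea b) (eu b)}. if T3 b (ea b) (eu b) (e b) then 0 else pb b) \<le> ?x3"
    by (rule cover_step[where q="\<lambda>(a,u). qv a u" and k="\<lambda>b. kv b (ea b) (eu b)"])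
       (use fin qv pb M ea(1) eu(1) in \<open>auto simp: T2_def T3_def\<close>)
  then obtain ev where ev: "\<forall>b\<in>B. ev b \<in> DV" "card ((\<lambda>b. ((ea b, eu b), ev b)) ` B) \<le> card ((\<lambda>b. (ea b, eu b)) ` B) * M3"
     "(\<Sum>b\<in>{b\<in>B. T2 b (ea b) (eu b)}. if T3 b (ea b) (eu b) (ev b) then 0 else pb b) \<le> ?x3" by blast
  have c3: "card ((\<lambda>b. ((ea b, eu b), ev b)) ` B) \<le> M1 * M2 * M3" using ev(2) mult_right_mono[OF c2, of M3] by linarith
  \<comment> \<open>A source word without a typical codeword either fails \<open>T0\<close> or
    leaves the good sets at exactly one of the three stages.\<close>
  have "(\<Sum>b\<in>B. if typ b (ea b) (eu b) (ev b) then 0 else pb b)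
    \<le> (\<Sum>b\<in>B. (if T0 b then 0 else pb b) + (if T0 b then if T1 b (ea b) then 0 else pb b else 0)
       + (if T1 b (ea b) then if T2 b (ea b) (eu b) then 0 else pb b else 0)
       + (if T2 b (ea b) (eu b) then if T3 b (ea b) (eu b) (ev b) then 0 else pb b else 0))"
    using pb(1) by (intro sum_mono) (auto simp: T3_def)
  also have "\<dots> = (\<Sum>b\<in>B. if T0 b then 0 else pb b) + (\<Sum>b\<in>{b\<in>B. T0 b}. if T1 b (ea b) then 0 else pb b)
     + (\<Sum>b\<in>{b\<in>B. T1 b (ea b)}. if T2 b (ea b) (eu b) then 0 else pb b)
     + (\<Sum>b\<in>{b\<in>B. T2 b (ea b) (eu b)}. if T3 b (ea b) (eu b) (ev b) then 0 else pb b)"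
    using fin(1) by (simp only: sum.distrib sum.inter_filter)
  also have "\<dots> \<le> 2 * \<delta>1 + 4 * \<delta>2 + 8 * \<delta>3 + ?x1 + ?x2 + ?x3"
    using e0 ea(3) eu(3) ev(3) by linarith
  finally show ?thesis using ea(1) eu(1) ev(1) c1 c2 c3
    by (intro exI[of _ ea] exI[of _ eu] exI[of _ ev] conjI) auto
qed

section \<open>Concentration of types and log-densities\<close>

text \<open>Chernoff bound: on the bad event the exponential of \<open>s\<close> times the excess of
  the sum over \<open>n * c\<close> is at least 1, and its mean is the \<open>n\<close>-th power of
  a number below 1.\<close>

lemma tail_tendsto_0:
  assumes P: "fprob Om p" and c: "(\<Sum>w\<in>Om. p w * h w) < c"
  shows "(\<lambda>n. \<Sum>l\<in>seqs Om n. if (\<Sum>i<n. h (l ! i)) < real n * c then 0 else iid p n l) \<longlonglongrightarrow> 0"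
proof -
  obtain s where s: "0 < s" "(\<Sum>w\<in>Om. p w * exp (s * (h w - c))) < 1" (is "?\<rho> < 1")
    using exp_moment_less_1[OF P c] by blast
  have r0: "?\<rho> \<ge> 0" using fprobD[OF P] by (intro sum_nonneg) auto
  have le: "(\<Sum>l\<in>seqs Om n. if (\<Sum>i<n. h (l ! i)) < real n * c then 0 else iid p n l) \<le> ?\<rho> ^ n" for n
    unfolding sum_iid_prod[OF fprobD(1)[OF P], symmetric]
  proof (rule sum_mono)
    fix l assume l: "l \<in> seqs Om n"
    have nn: "iid p n l \<ge> 0" by (rule fprobD(2)[OF fprob_iid[OF P] l])
    have "(\<Prod>i<n. exp (s * (h (l ! i) - c))) = exp (s * ((\<Sum>i<n. h (l ! i)) - real n * c))"
      by (simp add: exp_sum[symmetric] sum_distrib_left[symmetric] sum_subtractf)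
    moreover have "exp (s * ((\<Sum>i<n. h (l ! i)) - real n * c)) \<ge> 1" if "\<not> (\<Sum>i<n. h (l ! i)) < real n * c"
      using that s(1) by simp
    ultimately show "(if (\<Sum>i<n. h (l ! i)) < real n * c then 0 else iid p n l)
        \<le> iid p n l * (\<Prod>i<n. exp (s * (h (l ! i) - c)))"
      using nn by (auto simp: mult_le_cancel_left1)
  qed
  have nn: "0 \<le> (\<Sum>l\<in>seqs Om n. if (\<Sum>i<n. h (l ! i)) < real n * c then 0 else iid p n l)" for n
    using fprobD(2)[OF fprob_iid[OF P]] by (intro sum_nonneg) auto
  show ?thesis
    by (rule tendsto_sandwich[OF _ _ tendsto_const LIMSEQ_realpow_zero[OF r0 s(2)]])
       (use nn le in \<open>auto intro!: always_eventually\<close>)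
qed

lemma sum_seqs_Times:
  "(\<Sum>l\<in>seqs (A \<times> B) n. \<phi> l) = (\<Sum>x\<in>seqs A n. \<Sum>y\<in>seqs B n. \<phi> (zip x y))"
proof -
  have b: "bij_betw (\<lambda>(x,y). zip x y) (seqs A n \<times> seqs B n) (seqs (A \<times> B) n)"
  proof (rule bij_betwI[where g="\<lambda>l. (map fst l, map snd l)"])
    show "(\<lambda>(x,y). zip x y) \<in> seqs A n \<times> seqs B n \<rightarrow> seqs (A \<times> B) n"
      by (auto simp: seqs_def dest: set_zip_leftD set_zip_rightD)
    show "(\<lambda>l. (map fst l, map snd l)) \<in> seqs (A \<times> B) n \<rightarrow> seqs A n \<times> seqs B n"
      by (force simp: seqs_def)
  qed (auto simp: seqs_def zip_map_fst_snd)
  show ?thesis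
    by (subst sum.reindex_bij_betw[OF b, symmetric]) (simp add: sum.cartesian_product case_prod_unfold)
qed

text \<open>The empirical law (type) of \<open>n\<close> letters. The letters are given as a
  function of the position, so that several words can be read jointly.\<close>

definition freq :: "nat \<Rightarrow> (nat \<Rightarrow> 'a) \<Rightarrow> 'a \<Rightarrow> real" where
  "freq n f t = real (card {i. i < n \<and> f i = t}) / real n"

text \<open>Two one-sided tail bounds for the indicator of each letter, summed over the finite
  alphabet.\<close>

lemma freq_tendsto_0:
  fixes P :: "'a::finite \<Rightarrow> real"
  assumes P: "fprob UNIV P" and e: "e > 0"
  shows "(\<lambda>n. \<Sum>l\<in>seqs UNIV n. if \<forall>t. \<bar>freq n (\<lambda>i. l ! i) t - P t\<bar> \<le> e then 0 else iid P n l) \<longlonglongrightarrow> 0"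
proof -
  let ?h = "\<lambda>t w. if w = t then 1 else 0 :: real"
  let ?u = "\<lambda>t n. \<Sum>l\<in>seqs UNIV n. if (\<Sum>i<n. ?h t (l ! i)) < real n * (P t + e) then 0 else iid P n l"
  let ?v = "\<lambda>t n. \<Sum>l\<in>seqs UNIV n. if (\<Sum>i<n. - ?h t (l ! i)) < real n * (e - P t) then 0 else iid P n l"
  let ?x = "\<lambda>n. \<Sum>l\<in>seqs UNIV n. if \<forall>t. \<bar>freq n (\<lambda>i. l ! i) t - P t\<bar> \<le> e then 0 else iid P n l"
  have nn: "iid P n l \<ge> 0" if "l \<in> seqs UNIV n" for n l by (rule fprobD(2)[OF fprob_iid[OF P] that])
  have m: "(\<Sum>w\<in>UNIV. P w * ?h t w) = P t" for t by (simp add: if_distrib cong: if_cong)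
  have "(\<lambda>n. \<Sum>t\<in>UNIV. ?u t n + ?v t n) \<longlonglongrightarrow> (\<Sum>t\<in>(UNIV::'a set). 0 + 0)"
  proof (intro tendsto_sum tendsto_add tail_tendsto_0[OF P])
    fix t show "(\<Sum>w\<in>UNIV. P w * ?h t w) < P t + e" using m e by simp
    have "(\<Sum>w\<in>UNIV. P w * - ?h t w) = - P t" using m[of t] by (simp add: sum_negf)
    then show "(\<Sum>w\<in>UNIV. P w * - ?h t w) < e - P t" using e by simp
  qed
  then have lim: "(\<lambda>n. \<Sum>t\<in>UNIV. ?u t n + ?v t n) \<longlonglongrightarrow> 0" by simp
  have le: "?x n \<le> (\<Sum>t\<in>UNIV. ?u t n + ?v t n)" if n: "n > 0" for n
  proof -
    have "?x n \<le> (\<Sum>l\<in>seqs UNIV n. \<Sum>t\<in>UNIV. (if (\<Sum>i<n. ?h t (l ! i)) < real n * (P t + e) then 0 else iid P n l)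
        + (if (\<Sum>i<n. - ?h t (l ! i)) < real n * (e - P t) then 0 else iid P n l))" (is "_ \<le> (\<Sum>l\<in>_. \<Sum>t\<in>_. ?z l t)")
    proof (rule sum_mono)
      fix l :: "'a list" assume l: "l \<in> seqs UNIV n"
      have z: "?z l t \<ge> 0" for t using nn[OF l] by simp
      show "(if \<forall>t. \<bar>freq n (\<lambda>i. l ! i) t - P t\<bar> \<le> e then 0 else iid P n l) \<le> (\<Sum>t\<in>UNIV. ?z l t)"
      proof (cases "\<forall>t. \<bar>freq n (\<lambda>i. l ! i) t - P t\<bar> \<le> e")
        case True then show ?thesis using z by (simp add: sum_nonneg)
      next
        case False
        then obtain t where t: "\<bar>freq n (\<lambda>i. l ! i) t - P t\<bar> > e" by (meson not_le)
        have cnt: "(\<Sum>i<n. ?h t (l ! i)) = real n * freq n (\<lambda>i. l ! i) t"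
          using n by (simp add: freq_def sum.inter_filter[symmetric])
        have "iid P n l \<le> ?z l t"
        proof (cases "freq n (\<lambda>i. l ! i) t \<ge> P t + e")
          case True
          then have "real n * (P t + e) \<le> real n * freq n (\<lambda>i. l ! i) t" by (intro mult_left_mono) auto
          then show ?thesis unfolding sum_negf cnt using nn[OF l] by simp
        next
          case False
          then have "e - P t \<le> - freq n (\<lambda>i. l ! i) t" using t by linarith
          then have "real n * (e - P t) \<le> real n * - freq n (\<lambda>i. l ! i) t" by (intro mult_left_mono) auto
          then show ?thesis unfolding sum_negf cnt using nn[OF l] by simp
        qed
        also have "\<dots> \<le> (\<Sum>t\<in>UNIV. ?z l t)" using z by (intro member_le_sum) auto
        finally show ?thesis by (subst if_not_P[OF False])
      qed
    qed
    also have "\<dots> = (\<Sum>t\<in>UNIV. ?u t n + ?v t n)"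
      by (subst sum.swap) (simp only: sum.distrib)
    finally show ?thesis .
  qed
  show ?thesis
  proof (rule tendsto_sandwich[OF _ _ tendsto_const lim])
    show "\<forall>\<^sub>F n in sequentially. 0 \<le> ?x n" using nn by (intro always_eventually allI sum_nonneg) auto
    show "\<forall>\<^sub>F n in sequentially. ?x n \<le> (\<Sum>t\<in>UNIV. ?u t n + ?v t n)"
      using le by (intro eventually_sequentiallyI[of 1]) simp
  qed
qed

text \<open>Conditional pmf of \<open>G\<close> given \<open>F\<close>, uniform on null events so that it is always a kernel.\<close>
definition cpr :: "('w::finite \<Rightarrow> real) \<Rightarrow> ('w \<Rightarrow> 'g::finite) \<Rightarrow> ('w \<Rightarrow> 'f) \<Rightarrow> 'f \<Rightarrow> 'g \<Rightarrow> real" where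
  "cpr P G F x y = (if prb UNIV P F x = 0 then 1 / real CARD('g)
      else prb UNIV P (\<lambda>w. (G w, F w)) (y, x) / prb UNIV P F x)"

lemma sum_prb_UNIV:
  fixes G :: "'w::finite \<Rightarrow> 'g::finite"
  shows "(\<Sum>y\<in>UNIV. prb UNIV P (\<lambda>w. (G w, F w)) (y, x)) = prb UNIV P F x"
proof -
  have "(\<Sum>y\<in>UNIV. prb UNIV P (\<lambda>w. (G w, F w)) (y, x)) = (\<Sum>y\<in>UNIV. \<Sum>w\<in>{w\<in>{w. F w = x}. G w = y}. P w)"
    unfolding prb_def by (intro sum.cong) auto
  also have "\<dots> = (\<Sum>w\<in>{w. F w = x}. P w)" by (intro sum.group) auto
  finally show ?thesis by (simp add: prb_def)
qed

lemma cpr_kernel: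
  fixes G :: "'w::finite \<Rightarrow> 'g::finite"
  assumes "fprob UNIV P"
  shows "0 \<le> cpr P G F x y" "(\<Sum>y\<in>UNIV. cpr P G F x y) = 1"
    "prb UNIV P F x * cpr P G F x y = prb UNIV P (\<lambda>w. (G w, F w)) (y, x)"
proof -
  show "0 \<le> cpr P G F x y"
    unfolding cpr_def by (auto intro!: divide_nonneg_nonneg prb_nonneg[OF assms])
  show "(\<Sum>y\<in>UNIV. cpr P G F x y) = 1"
    by (cases "prb UNIV P F x = 0") (simp_all add: cpr_def sum_divide_distrib[symmetric] sum_prb_UNIV)
  have "prb UNIV P (\<lambda>w. (G w, F w)) (y, x) \<le> prb UNIV P F x" by (rule prb_mono[OF assms]) auto
  then show "prb UNIV P F x * cpr P G F x y = prb UNIV P (\<lambda>w. (G w, F w)) (y, x)"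
    using prb_nonneg[OF assms, of "\<lambda>w. (G w, F w)" "(y, x)"] by (auto simp: cpr_def)
qed

lemma cpr_eq_post:
  assumes "fprob UNIV P" "P w > 0"
  shows "cpr P G F (F w) (G w) = post UNIV P G F w"
  using post_pos(1)[OF assms(1) UNIV_I assms(2), of F] by (simp add: cpr_def post_def)

text \<open>The log-density of the law of \<open>G\<close> given \<open>F\<close> against its law
  given \<open>F'\<close> has mean H(G|F') - H(G|F), which is a conditional mutual information when
  \<open>F'\<close> is a function of \<open>F\<close>. A rate above the mean is exceeded with
  vanishing probability.\<close>

lemma density_tendsto_0:
  fixes P :: "'w::finite \<Rightarrow> real" and G :: "'w \<Rightarrow> 'g::finite"
  assumes P: "fprob UNIV P"
    and I: "(ent UNIV P (\<lambda>w. (G w, F' w)) - ent UNIV P F') - (ent UNIV P (\<lambda>w. (G w, F w)) - ent UNIV P F) < R"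
  shows "(\<lambda>n. \<Sum>l\<in>seqs UNIV n. if (\<Prod>i<n. cpr P G F (F (l ! i)) (G (l ! i)))
      \<le> 2 powr (real n * R) * (\<Prod>i<n. cpr P G F' (F' (l ! i)) (G (l ! i))) then 0 else iid P n l) \<longlonglongrightarrow> 0"
    (is "?x \<longlonglongrightarrow> 0")
proof -
  let ?h = "\<lambda>w. log 2 (post UNIV P G F w) - log 2 (post UNIV P G F' w)"
  let ?y = "\<lambda>n. \<Sum>l\<in>seqs UNIV n. if (\<Sum>i<n. ?h (l ! i)) < real n * R then 0 else iid P n l"
  have "(\<Sum>w\<in>UNIV. P w * ?h w) < R"
    using I cond_ent_post[OF P, of G F] cond_ent_post[OF P, of G F']
    by (simp add: right_diff_distrib sum_subtractf)
  from tail_tendsto_0[OF P this] have lim: "?y \<longlonglongrightarrow> 0" .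
  have nn: "iid P n l \<ge> 0" if "l \<in> seqs UNIV n" for n l by (rule fprobD(2)[OF fprob_iid[OF P] that])
  have le: "?x n \<le> ?y n" for n
  proof (rule sum_mono)
    fix l :: "'w list" assume l: "l \<in> seqs UNIV n"
    show "(if (\<Prod>i<n. cpr P G F (F (l ! i)) (G (l ! i)))
      \<le> 2 powr (real n * R) * (\<Prod>i<n. cpr P G F' (F' (l ! i)) (G (l ! i))) then 0 else iid P n l)
      \<le> (if (\<Sum>i<n. ?h (l ! i)) < real n * R then 0 else iid P n l)"
    \<comment> \<open>Only words of positive probability need an argument; on them
      \<open>cpr\<close> agrees with the posterior and has a logarithm.\<close>
    proof (cases "iid P n l > 0 \<and> (\<Sum>i<n. ?h (l ! i)) < real n * R")
      case True
      have pos: "P (l ! i) > 0" if "i < n" for i using iid_pos[OF P l _ that] True by simp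
      have powr: "(\<Prod>i<n. cpr P G F (F (l ! i)) (G (l ! i))) = 2 powr (\<Sum>i<n. log 2 (post UNIV P G F (l ! i)))"
        for F :: "'w \<Rightarrow> 'h"
      proof -
        have "2 powr (\<Sum>i<n. log 2 (post UNIV P G F (l ! i))) = (\<Prod>i<n. 2 powr log 2 (post UNIV P G F (l ! i)))"
          by (simp add: powr_sum)
        also have "\<dots> = (\<Prod>i<n. cpr P G F (F (l ! i)) (G (l ! i)))"
          using post_pos(3)[OF P UNIV_I pos, of _ G F]
          by (intro prod.cong refl) (simp add: cpr_eq_post[OF P pos])
        finally show ?thesis by simp
      qed
      have powr': "(\<Prod>i<n. cpr P G F' (F' (l ! i)) (G (l ! i))) = 2 powr (\<Sum>i<n. log 2 (post UNIV P G F' (l ! i)))"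
      proof -
        have "2 powr (\<Sum>i<n. log 2 (post UNIV P G F' (l ! i))) = (\<Prod>i<n. 2 powr log 2 (post UNIV P G F' (l ! i)))"
          by (simp add: powr_sum)
        also have "\<dots> = (\<Prod>i<n. cpr P G F' (F' (l ! i)) (G (l ! i)))"
          using post_pos(3)[OF P UNIV_I pos, of _ G F']
          by (intro prod.cong refl) (simp add: cpr_eq_post[OF P pos])
        finally show ?thesis by simp
      qed
      have "(\<Sum>i<n. log 2 (post UNIV P G F (l ! i))) \<le> real n * R + (\<Sum>i<n. log 2 (post UNIV P G F' (l ! i)))"
        using True by (simp add: sum_subtractf)
      then have "(\<Prod>i<n. cpr P G F (F (l ! i)) (G (l ! i)))
        \<le> 2 powr (real n * R) * (\<Prod>i<n. cpr P G F' (F' (l ! i)) (G (l ! i)))"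
        unfolding powr powr' powr_add[symmetric] by simp
      then show ?thesis using nn[OF l] by simp
    next
      case False then show ?thesis using nn[OF l] by auto
    qed
  qed
  show ?thesis
    by (rule tendsto_sandwich[OF _ _ tendsto_const lim])
       (use nn le in \<open>auto intro!: always_eventually sum_nonneg\<close>)
qed

text \<open>The crude bound \<open>exp (-x) \<le> 1 / x\<close> suffices. The sequence bounds the
  mass of good source words missed by a codebook whose rate is \<open>e\<close> above the density
  threshold.\<close>

lemma exp_powr_tendsto_0:
  fixes e :: real assumes "e > 0"
  shows "(\<lambda>n. exp (- (2 powr (real n * e) / 2))) \<longlonglongrightarrow> 0"
proof -
  have b: "0 \<le> 2 powr (-e)" "2 powr (-e) < 1" using assms by (auto simp: powr_less_one)
  have "(\<lambda>n. 2 * (2 powr (-e)) ^ n) \<longlonglongrightarrow> 2 * 0"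
    by (intro tendsto_mult tendsto_const LIMSEQ_realpow_zero b)
  then have lim: "(\<lambda>n. 2 * (2 powr (-e)) ^ n) \<longlonglongrightarrow> 0" by simp
  have le: "exp (- (2 powr (real n * e) / 2)) \<le> 2 * (2 powr (-e)) ^ n" for n
  proof -
    have x: "2 powr (real n * e) / 2 > 0" (is "?x > 0") by simp
    have "exp (- ?x) = 1 / exp ?x" by (simp add: exp_minus inverse_eq_divide)
    also have "\<dots> \<le> 1 / ?x"
    proof (rule divide_left_mono)
      show "?x \<le> exp ?x" using exp_ge_add_one_self[of ?x] by linarith
    qed simp_all
    also have "\<dots> = 2 * (2 powr (-e)) ^ n"
      by (simp add: powr_realpow[symmetric] powr_powr powr_minus field_simps)
    finally show ?thesis .
  qed
  show ?thesis
    by (rule tendsto_sandwich[OF _ _ tendsto_const lim]) (use le in auto)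
qed

text \<open>\<open>I1\<close>, \<open>I2\<close>, \<open>I3\<close> are I(A;B), I(U;B|A) and
  I(V;B|A,U), the mean log-densities of the test channel against the codeword law at the three
  stages. Only the type averaged over source words has to be close to \<open>P\<close>, so words
  left uncovered may keep an arbitrary codeword as long as their total mass is small.\<close>

lemma covering:
  fixes P :: "'b::finite \<times> 'a::finite \<times> 'u::finite \<times> 'v::finite \<Rightarrow> real"
  assumes P: "fprob UNIV P" and \<epsilon>: "\<epsilon> > 0"
  defines "I1 \<equiv> (ent UNIV P (\<lambda>(b,a,u,v). (a, ())) - ent UNIV P (\<lambda>_. ()))
      - (ent UNIV P (\<lambda>(b,a,u,v). (a, b)) - ent UNIV P (\<lambda>(b,a,u,v). b))"
    and "I2 \<equiv> (ent UNIV P (\<lambda>(b,a,u,v). (u, a)) - ent UNIV P (\<lambda>(b,a,u,v). a))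
      - (ent UNIV P (\<lambda>(b,a,u,v). (u, (b, a))) - ent UNIV P (\<lambda>(b,a,u,v). (b, a)))"
    and "I3 \<equiv> (ent UNIV P (\<lambda>(b,a,u,v). (v, (a, u))) - ent UNIV P (\<lambda>(b,a,u,v). (a, u)))
      - (ent UNIV P (\<lambda>(b,a,u,v). (v, (b, a, u))) - ent UNIV P (\<lambda>(b,a,u,v). (b, a, u)))"
    and "pb \<equiv> prb UNIV P (\<lambda>(b,a,u,v). b)"
  shows "\<exists>n\<ge>1. \<exists>(ea :: 'b list \<Rightarrow> 'a list) (eu :: 'b list \<Rightarrow> 'u list) (ev :: 'b list \<Rightarrow> 'v list).
     (\<forall>bs\<in>seqs UNIV n. length (ea bs) = n \<and> length (eu bs) = n \<and> length (ev bs) = n) \<and>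
     log 2 (card (ea ` seqs UNIV n)) \<le> real n * (I1 + \<epsilon>) \<and>
     log 2 (card ((\<lambda>bs. (ea bs, eu bs)) ` seqs UNIV n)) \<le> real n * (I1 + I2 + \<epsilon>) \<and>
     log 2 (card ((\<lambda>bs. ((ea bs, eu bs), ev bs)) ` seqs UNIV n)) \<le> real n * (I1 + I2 + I3 + \<epsilon>) \<and>
     (\<forall>t. \<bar>(\<Sum>bs\<in>seqs UNIV n. iid pb n bs * freq n (\<lambda>i. (bs ! i, ea bs ! i, eu bs ! i, ev bs ! i)) t) - P t\<bar> \<le> \<epsilon>)"
proof -
  define fb :: "'b \<times> 'a \<times> 'u \<times> 'v \<Rightarrow> 'b" where "fb = (\<lambda>(b,a,u,v). b)"
  define fa :: "'b \<times> 'a \<times> 'u \<times> 'v \<Rightarrow> 'a" where "fa = (\<lambda>(b,a,u,v). a)"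
  define fu :: "'b \<times> 'a \<times> 'u \<times> 'v \<Rightarrow> 'u" where "fu = (\<lambda>(b,a,u,v). u)"
  define fv :: "'b \<times> 'a \<times> 'u \<times> 'v \<Rightarrow> 'v" where "fv = (\<lambda>(b,a,u,v). v)"
  note fdefs = fb_def fa_def fu_def fv_def
  define ka where "ka b a = cpr P fa fb b a" for b a
  define ku where "ku b a u = cpr P fu (\<lambda>w. (fb w, fa w)) (b, a) u" for b a u
  define kv where "kv b a u v = cpr P fv (\<lambda>w. (fb w, fa w, fu w)) (b, a, u) v" for b a u v
  define qa where "qa a = cpr P fa (\<lambda>_. ()) () a" for a
  define qu where "qu a u = cpr P fu fa a u" for a u
  define qv where "qv a u v = cpr P fv (\<lambda>w. (fa w, fu w)) (a, u) v" for a u v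
  have pbn: "pb b \<ge> 0" for b unfolding pb_def by (rule prb_nonneg[OF P])
  have pbs: "sum pb UNIV = 1"
  proof -
    have "(\<Sum>b\<in>UNIV. prb UNIV P (\<lambda>w. (fb w, ())) (b, ())) = prb UNIV P (\<lambda>_. ()) ()" by (rule sum_prb_UNIV)
    then show ?thesis using fprobD(3)[OF P] by (simp add: pb_def prb_def fb_def)
  qed
  note kk = cpr_kernel[OF P]
  have fact: "P (b,a,u,v) = pb b * ka b a * ku b a u * kv b a u v" for b a u v
  proof -
    have "pb b * ka b a = prb UNIV P (\<lambda>w. (fb w, fa w)) (b, a)"
      using kk(3)[of fb b fa a] unfolding pb_def ka_def fb_def[symmetric] by (auto intro: prb_cong)
    also have "\<dots> * ku b a u = prb UNIV P (\<lambda>w. (fb w, fa w, fu w)) (b, a, u)"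
      using kk(3)[of "\<lambda>w. (fb w, fa w)" "(b,a)" fu u] unfolding ku_def by (auto intro: prb_cong)
    also have "\<dots> * kv b a u v = prb UNIV P (\<lambda>w. w) (b, a, u, v)"
      using kk(3)[of "\<lambda>w. (fb w, fa w, fu w)" "(b,a,u)" fv v] unfolding kv_def
      by (auto simp: fdefs intro: prb_cong)
    also have "\<dots> = P (b,a,u,v)" by (simp add: prb_def)
    finally show ?thesis by simp
  qed
  have "0 \<le> ent UNIV P (\<lambda>w. (fa w, ())) - ent UNIV P (\<lambda>_. ()) - (ent UNIV P (\<lambda>w. (fa w, fb w)) - ent UNIV P fb)"
    using cond_ent_antimono[OF P, of fb "\<lambda>_. ()" fa] by simp
  then have I1: "I1 \<ge> 0" by (simp add: I1_def fdefs case_prod_unfold)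
  have "0 \<le> ent UNIV P (\<lambda>w. (fu w, fa w)) - ent UNIV P fa - (ent UNIV P (\<lambda>w. (fu w, fb w, fa w)) - ent UNIV P (\<lambda>w. (fb w, fa w)))"
    using cond_ent_antimono[OF P, of "\<lambda>w. (fb w, fa w)" fa fu] by simp
  then have I2: "I2 \<ge> 0" by (simp add: I2_def fdefs case_prod_unfold)
  have "0 \<le> ent UNIV P (\<lambda>w. (fv w, fa w, fu w)) - ent UNIV P (\<lambda>w. (fa w, fu w))
     - (ent UNIV P (\<lambda>w. (fv w, fb w, fa w, fu w)) - ent UNIV P (\<lambda>w. (fb w, fa w, fu w)))"
    using cond_ent_antimono[OF P, of "\<lambda>w. (fb w, fa w, fu w)" "\<lambda>w. (fa w, fu w)" fv] by simp
  then have I3: "I3 \<ge> 0" by (simp add: I3_def fdefs case_prod_unfold)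
  \<comment> \<open>Densities are cut off \<open>\<epsilon> / 12\<close> above their mean rate while
    the codebooks have rate at least \<open>\<epsilon> / 6\<close> above it; the remaining exponent
    \<open>\<epsilon> / 12\<close> drives the miss probability to 0.\<close>
  let ?e = "\<epsilon> / 12"
  let ?d = "\<lambda>k q R n. \<Sum>l\<in>seqs UNIV n. if (\<Prod>i<n. k (l ! i)) \<le> 2 powr (real n * R) * (\<Prod>i<n. q (l ! i)) then 0 else iid P n l"
  have "?d (\<lambda>w. cpr P fa fb (fb w) (fa w)) (\<lambda>w. cpr P fa (\<lambda>_. ()) () (fa w)) (I1 + ?e) \<longlonglongrightarrow> 0"
    using \<epsilon> by (intro density_tendsto_0[OF P]) (simp add: I1_def fdefs case_prod_unfold)
  then have d1: "?d (\<lambda>w. ka (fb w) (fa w)) (\<lambda>w. qa (fa w)) (I1 + ?e) \<longlonglongrightarrow> 0" by (simp add: ka_def qa_def)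
  have "?d (\<lambda>w. cpr P fu (\<lambda>w. (fb w, fa w)) (fb w, fa w) (fu w)) (\<lambda>w. cpr P fu fa (fa w) (fu w)) (I2 + ?e) \<longlonglongrightarrow> 0"
    using \<epsilon> by (intro density_tendsto_0[OF P, of fu fa "\<lambda>w. (fb w, fa w)"]) (simp add: I2_def fdefs case_prod_unfold)
  then have d2: "?d (\<lambda>w. ku (fb w) (fa w) (fu w)) (\<lambda>w. qu (fa w) (fu w)) (I2 + ?e) \<longlonglongrightarrow> 0" by (simp add: ku_def qu_def)
  have "?d (\<lambda>w. cpr P fv (\<lambda>w. (fb w, fa w, fu w)) (fb w, fa w, fu w) (fv w))
      (\<lambda>w. cpr P fv (\<lambda>w. (fa w, fu w)) (fa w, fu w) (fv w)) (I3 + ?e) \<longlonglongrightarrow> 0"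
    using \<epsilon> by (intro density_tendsto_0[OF P, of fv "\<lambda>w. (fa w, fu w)" "\<lambda>w. (fb w, fa w, fu w)"])
       (simp add: I3_def fdefs case_prod_unfold)
  then have d3: "?d (\<lambda>w. kv (fb w) (fa w) (fu w) (fv w)) (\<lambda>w. qv (fa w) (fu w) (fv w)) (I3 + ?e) \<longlonglongrightarrow> 0"
    by (simp add: kv_def qv_def)
  let ?t = "\<lambda>n. \<Sum>l\<in>seqs UNIV n. if \<forall>t. \<bar>freq n (\<lambda>i. l ! i) t - P t\<bar> \<le> \<epsilon>/2 then 0 else iid P n l"
  have dt: "?t \<longlonglongrightarrow> 0" using \<epsilon> by (intro freq_tendsto_0[OF P]) simp
  let ?x = "\<lambda>n. exp (- (2 powr (real n * ?e) / 2))"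
  \<comment> \<open>The right side of \<open>cover_three\<close> with the failure probabilities
    inserted. Typicality and the third density share the weight 8 because both are demanded at the
    last stage.\<close>
  let ?tot = "\<lambda>n. 2 * ?d (\<lambda>w. ka (fb w) (fa w)) (\<lambda>w. qa (fa w)) (I1 + ?e) n
     + 4 * ?d (\<lambda>w. ku (fb w) (fa w) (fu w)) (\<lambda>w. qu (fa w) (fu w)) (I2 + ?e) n
     + 8 * (?t n + ?d (\<lambda>w. kv (fb w) (fa w) (fu w) (fv w)) (\<lambda>w. qv (fa w) (fu w) (fv w)) (I3 + ?e) n) + 3 * ?x n"
  have "?tot \<longlonglongrightarrow> 2 * 0 + 4 * 0 + 8 * (0 + 0) + 3 * 0"
    using \<epsilon> by (intro tendsto_add tendsto_mult tendsto_const d1 d2 d3 dt exp_powr_tendsto_0) simp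
  then have "eventually (\<lambda>n. ?tot n < \<epsilon> / 2) sequentially"
    using \<epsilon> by (intro order_tendstoD(2)[of ?tot "2 * 0 + 4 * 0 + 8 * (0 + 0) + 3 * 0"]) auto
  then obtain n1 where n1: "\<And>n. n \<ge> n1 \<Longrightarrow> ?tot n < \<epsilon> / 2" by (auto simp: eventually_sequentially)
  obtain n2 :: nat where n2: "real n2 \<ge> 6 / \<epsilon>" using real_arch_simple by blast
  define n where "n = n1 + n2 + 1"
  have n: "n \<ge> 1" "?tot n < \<epsilon> / 2" using n1[of n] by (auto simp: n_def)
  have "real n \<ge> 6 / \<epsilon>" using n2 by (simp add: n_def)
  then have ne: "1 \<le> real n * (\<epsilon> / 6)" using \<epsilon> by (simp add: field_simps)
  \<comment> \<open>Each codebook gets slack \<open>\<epsilon> / 6\<close> in rate and another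
    \<open>\<epsilon> / 6\<close> for rounding, so the three together spend
    \<open>\<epsilon>\<close>.\<close>
  obtain M1 where M1: "M1 \<ge> 1" "2 powr (real n * (I1 + \<epsilon>/6)) \<le> real M1" "log 2 (real M1) \<le> real n * (I1 + \<epsilon>/6 + \<epsilon>/6)"
    using ex_bin_number[of "I1 + \<epsilon>/6" "\<epsilon>/6" n] I1 \<epsilon> ne by auto
  obtain M2 where M2: "M2 \<ge> 1" "2 powr (real n * (I2 + \<epsilon>/6)) \<le> real M2" "log 2 (real M2) \<le> real n * (I2 + \<epsilon>/6 + \<epsilon>/6)"
    using ex_bin_number[of "I2 + \<epsilon>/6" "\<epsilon>/6" n] I2 \<epsilon> ne by auto
  obtain M3 where M3: "M3 \<ge> 1" "2 powr (real n * (I3 + \<epsilon>/6)) \<le> real M3" "log 2 (real M3) \<le> real n * (I3 + \<epsilon>/6 + \<epsilon>/6)"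
    using ex_bin_number[of "I3 + \<epsilon>/6" "\<epsilon>/6" n] I3 \<epsilon> ne by auto
  have ex: "exp (- (real M * 2 powr (- (real n * (I + ?e))) / 2)) \<le> ?x n"
    if "2 powr (real n * (I + \<epsilon>/6)) \<le> real M" for M I
  proof -
    have "2 powr (real n * ?e) = 2 powr (real n * (I + \<epsilon>/6)) * 2 powr (- (real n * (I + ?e)))"
      by (simp add: powr_add[symmetric] algebra_simps)
    also have "\<dots> \<le> real M * 2 powr (- (real n * (I + ?e)))" using that by (intro mult_right_mono) auto
    finally show ?thesis by simp
  qed
  let ?B = "seqs UNIV n :: 'b list set" and ?A = "seqs UNIV n :: 'a list set"
    and ?U = "seqs UNIV n :: 'u list set" and ?V = "seqs UNIV n :: 'v list set"
  define pbn' where "pbn' bs = (\<Prod>i<n. pb (bs ! i))" for bs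
  define kan where "kan bs aa = (\<Prod>i<n. ka (bs ! i) (aa ! i))" for bs aa
  define kun where "kun bs aa us = (\<Prod>i<n. ku (bs ! i) (aa ! i) (us ! i))" for bs aa us
  define kvn where "kvn bs aa us vs = (\<Prod>i<n. kv (bs ! i) (aa ! i) (us ! i) (vs ! i))" for bs aa us vs
  define qan where "qan aa = (\<Prod>i<n. qa (aa ! i))" for aa
  define qun where "qun aa us = (\<Prod>i<n. qu (aa ! i) (us ! i))" for aa us
  define qvn where "qvn aa us vs = (\<Prod>i<n. qv (aa ! i) (us ! i) (vs ! i))" for aa us vs
  \<comment> \<open>Typicality uses half the tolerance; the other half is kept for the mass of
    source words without a typical codeword.\<close>
  define tpc where "tpc bs aa us vs \<longleftrightarrow> (\<forall>t. \<bar>freq n (\<lambda>i. (bs ! i, aa ! i, us ! i, vs ! i)) t - P t\<bar> \<le> \<epsilon>/2)" for bs aa us vs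
  have fin: "finite ?B" "finite ?A" "finite ?U" "finite ?V" by (simp_all add: finite_seqs)
  have s_pb: "sum pbn' ?B = 1"
    unfolding pbn'_def using sum_seqs_prod[OF finite_class.finite_UNIV, of "\<lambda>_. pb" n] pbs by simp
  have s_ka: "sum (kan bs) ?A = 1" for bs
    unfolding kan_def using sum_seqs_prod[OF finite_class.finite_UNIV, of "\<lambda>i. ka (bs ! i)" n] by (simp add: ka_def kk(2))
  have s_ku: "sum (kun bs aa) ?U = 1" for bs aa
    unfolding kun_def using sum_seqs_prod[OF finite_class.finite_UNIV, of "\<lambda>i. ku (bs ! i) (aa ! i)" n] by (simp add: ku_def kk(2))
  have s_kv: "sum (kvn bs aa us) ?V = 1" for bs aa us
    unfolding kvn_def using sum_seqs_prod[OF finite_class.finite_UNIV, of "\<lambda>i. kv (bs ! i) (aa ! i) (us ! i)" n] by (simp add: kv_def kk(2))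
  have s_qa: "sum qan ?A = 1"
    unfolding qan_def using sum_seqs_prod[OF finite_class.finite_UNIV, of "\<lambda>i. qa" n] by (simp add: qa_def kk(2))
  have s_qu: "sum (qun aa) ?U = 1" for aa
    unfolding qun_def using sum_seqs_prod[OF finite_class.finite_UNIV, of "\<lambda>i. qu (aa ! i)" n] by (simp add: qu_def kk(2))
  have s_qv: "sum (qvn aa us) ?V = 1" for aa us
    unfolding qvn_def using sum_seqs_prod[OF finite_class.finite_UNIV, of "\<lambda>i. qv (aa ! i) (us ! i)" n] by (simp add: qv_def kk(2))
  \<comment> \<open>A tail sum over joint words becomes four nested sums over the component words,
    with the product law factored into the stage kernels. This is the form in which
    \<open>cover_three\<close> takes its hypotheses.\<close>
  have four: "(\<Sum>l\<in>seqs UNIV n. if C l then 0 else iid P n l)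
     = (\<Sum>bs\<in>?B. \<Sum>aa\<in>?A. \<Sum>us\<in>?U. \<Sum>vs\<in>?V. if C (zip bs (zip aa (zip us vs))) then 0
         else pbn' bs * kan bs aa * kun bs aa us * kvn bs aa us vs)" for C
  proof -
    have U: "(UNIV :: ('b \<times> 'a \<times> 'u \<times> 'v) set) = UNIV \<times> (UNIV \<times> (UNIV \<times> UNIV))" by simp
    have "iid P n (zip bs (zip aa (zip us vs))) = pbn' bs * kan bs aa * kun bs aa us * kvn bs aa us vs"
      if "bs \<in> ?B" "aa \<in> ?A" "us \<in> ?U" "vs \<in> ?V" for bs aa us vs
      unfolding iid_def pbn'_def kan_def kun_def kvn_def prod.distrib[symmetric]
      using that by (intro prod.cong refl) (simp add: seqs_length fact)
    then show ?thesis unfolding U sum_seqs_Times by (intro sum.cong refl) simp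
  qed
  \<comment> \<open>Kernels of stages that the condition does not mention sum out to 1.\<close>
  have red: "(\<Sum>u\<in>D. if c then 0 else x * k u) = (if c then 0 else x)" if "sum k D = 1" for D c and x :: real and k
    using that by (cases c) (simp_all add: sum_distrib_left[symmetric])
  have zipc: "(\<Prod>i<n. f (zip bs (zip aa (zip us vs)) ! i)) = (\<Prod>i<n. f (bs ! i, aa ! i, us ! i, vs ! i))"
    if "bs \<in> ?B" "aa \<in> ?A" "us \<in> ?U" "vs \<in> ?V" for bs aa us vs and f :: "_ \<Rightarrow> real"
    using that by (intro prod.cong refl) (simp add: seqs_length)
  have zka: "(\<Prod>i<n. ka (fb (zip bs (zip aa (zip us vs)) ! i)) (fa (zip bs (zip aa (zip us vs)) ! i))) = kan bs aa"
    and zqa: "(\<Prod>i<n. qa (fa (zip bs (zip aa (zip us vs)) ! i))) = qan aa"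
    and zku: "(\<Prod>i<n. ku (fb (zip bs (zip aa (zip us vs)) ! i)) (fa (zip bs (zip aa (zip us vs)) ! i)) (fu (zip bs (zip aa (zip us vs)) ! i))) = kun bs aa us"
    and zqu: "(\<Prod>i<n. qu (fa (zip bs (zip aa (zip us vs)) ! i)) (fu (zip bs (zip aa (zip us vs)) ! i))) = qun aa us"
    if m: "bs \<in> ?B" "aa \<in> ?A" "us \<in> ?U" "vs \<in> ?V" for bs aa us vs
    using zipc[OF m, of "\<lambda>w. ka (fb w) (fa w)"] zipc[OF m, of "\<lambda>w. qa (fa w)"]
      zipc[OF m, of "\<lambda>w. ku (fb w) (fa w) (fu w)"] zipc[OF m, of "\<lambda>w. qu (fa w) (fu w)"]
    by (simp_all add: kan_def qan_def kun_def qun_def fdefs)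
  have D1: "(\<Sum>bs\<in>?B. \<Sum>aa\<in>?A. if kan bs aa \<le> 2 powr (real n * (I1 + ?e)) * qan aa then 0 else pbn' bs * kan bs aa)
     \<le> ?d (\<lambda>w. ka (fb w) (fa w)) (\<lambda>w. qa (fa w)) (I1 + ?e) n"
  proof (rule eq_refl)
    have "?d (\<lambda>w. ka (fb w) (fa w)) (\<lambda>w. qa (fa w)) (I1 + ?e) n =
      (\<Sum>bs\<in>?B. \<Sum>aa\<in>?A. \<Sum>us\<in>?U. \<Sum>vs\<in>?V. if kan bs aa \<le> 2 powr (real n * (I1 + ?e)) * qan aa then 0
         else pbn' bs * kan bs aa * kun bs aa us * kvn bs aa us vs)"
      unfolding four by (intro sum.cong refl) (simp only: zka zqa)
    then show "(\<Sum>bs\<in>?B. \<Sum>aa\<in>?A. if kan bs aa \<le> 2 powr (real n * (I1 + ?e)) * qan aa then 0 else pbn' bs * kan bs aa) =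
       ?d (\<lambda>w. ka (fb w) (fa w)) (\<lambda>w. qa (fa w)) (I1 + ?e) n"
      by (simp only: red[OF s_kv] red[OF s_ku])
  qed
  have D2: "(\<Sum>bs\<in>?B. \<Sum>aa\<in>?A. \<Sum>us\<in>?U. if kun bs aa us \<le> 2 powr (real n * (I2 + ?e)) * qun aa us then 0
       else pbn' bs * kan bs aa * kun bs aa us)
     \<le> ?d (\<lambda>w. ku (fb w) (fa w) (fu w)) (\<lambda>w. qu (fa w) (fu w)) (I2 + ?e) n"
  proof (rule eq_refl)
    have "?d (\<lambda>w. ku (fb w) (fa w) (fu w)) (\<lambda>w. qu (fa w) (fu w)) (I2 + ?e) n =
      (\<Sum>bs\<in>?B. \<Sum>aa\<in>?A. \<Sum>us\<in>?U. \<Sum>vs\<in>?V. if kun bs aa us \<le> 2 powr (real n * (I2 + ?e)) * qun aa us then 0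
         else pbn' bs * kan bs aa * kun bs aa us * kvn bs aa us vs)"
      unfolding four by (intro sum.cong refl) (simp only: zku zqu)
    then show "(\<Sum>bs\<in>?B. \<Sum>aa\<in>?A. \<Sum>us\<in>?U. if kun bs aa us \<le> 2 powr (real n * (I2 + ?e)) * qun aa us then 0
       else pbn' bs * kan bs aa * kun bs aa us) =
       ?d (\<lambda>w. ku (fb w) (fa w) (fu w)) (\<lambda>w. qu (fa w) (fu w)) (I2 + ?e) n"
      by (simp only: red[OF s_kv])
  qed
  have D3: "(\<Sum>bs\<in>?B. \<Sum>aa\<in>?A. \<Sum>us\<in>?U. \<Sum>vs\<in>?V. if tpc bs aa us vs \<and>
         kvn bs aa us vs \<le> 2 powr (real n * (I3 + ?e)) * qvn aa us vs then 0
       else pbn' bs * kan bs aa * kun bs aa us * kvn bs aa us vs)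
     \<le> ?t n + ?d (\<lambda>w. kv (fb w) (fa w) (fu w) (fv w)) (\<lambda>w. qv (fa w) (fu w) (fv w)) (I3 + ?e) n"
  proof -
    have fr: "freq n (\<lambda>i. zip bs (zip aa (zip us vs)) ! i) = freq n (\<lambda>i. (bs ! i, aa ! i, us ! i, vs ! i))"
      if "bs \<in> ?B" "aa \<in> ?A" "us \<in> ?U" "vs \<in> ?V" for bs aa us vs
    proof
      fix t
      have "{i. i < n \<and> zip bs (zip aa (zip us vs)) ! i = t} = {i. i < n \<and> (bs ! i, aa ! i, us ! i, vs ! i) = t}"
        using that by (auto simp: seqs_length)
      then show "freq n (\<lambda>i. zip bs (zip aa (zip us vs)) ! i) t = freq n (\<lambda>i. (bs ! i, aa ! i, us ! i, vs ! i)) t"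
        by (simp add: freq_def)
    qed
    have nn: "0 \<le> pbn' bs * kan bs aa * kun bs aa us * kvn bs aa us vs" for bs aa us vs
      unfolding pbn'_def kan_def kun_def kvn_def
      by (intro mult_nonneg_nonneg prod_nonneg) (auto simp: pbn ka_def ku_def kv_def kk(1))
    show ?thesis
      unfolding four sum.distrib[symmetric]
    proof (intro sum_mono)
      fix bs aa us vs assume m: "bs \<in> ?B" "aa \<in> ?A" "us \<in> ?U" "vs \<in> ?V"
      show "(if tpc bs aa us vs \<and> kvn bs aa us vs \<le> 2 powr (real n * (I3 + ?e)) * qvn aa us vs then 0
         else pbn' bs * kan bs aa * kun bs aa us * kvn bs aa us vs)
       \<le> (if \<forall>t. \<bar>freq n (\<lambda>i. zip bs (zip aa (zip us vs)) ! i) t - P t\<bar> \<le> \<epsilon>/2 then 0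
           else pbn' bs * kan bs aa * kun bs aa us * kvn bs aa us vs)
        + (if (\<Prod>i<n. kv (fb (zip bs (zip aa (zip us vs)) ! i)) (fa (zip bs (zip aa (zip us vs)) ! i))
             (fu (zip bs (zip aa (zip us vs)) ! i)) (fv (zip bs (zip aa (zip us vs)) ! i)))
           \<le> 2 powr (real n * (I3 + ?e)) * (\<Prod>i<n. qv (fa (zip bs (zip aa (zip us vs)) ! i))
             (fu (zip bs (zip aa (zip us vs)) ! i)) (fv (zip bs (zip aa (zip us vs)) ! i))) then 0
           else pbn' bs * kan bs aa * kun bs aa us * kvn bs aa us vs)"
        using nn[of bs aa us vs] unfolding fr[OF m] tpc_def
          zipc[OF m, of "\<lambda>w. kv (fb w) (fa w) (fu w) (fv w)"] zipc[OF m, of "\<lambda>w. qv (fa w) (fu w) (fv w)"]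
        by (simp add: kvn_def qvn_def fdefs)
    qed
  qed
  have "\<exists>ea eu ev. (\<forall>b\<in>?B. ea b \<in> ?A \<and> eu b \<in> ?U \<and> ev b \<in> ?V) \<and> card (ea ` ?B) \<le> M1 \<and>
     card ((\<lambda>b. (ea b, eu b)) ` ?B) \<le> M1 * M2 \<and> card ((\<lambda>b. ((ea b, eu b), ev b)) ` ?B) \<le> M1 * M2 * M3 \<and>
     (\<Sum>b\<in>?B. if tpc b (ea b) (eu b) (ev b) then 0 else pbn' b) \<le>
       2 * ?d (\<lambda>w. ka (fb w) (fa w)) (\<lambda>w. qa (fa w)) (I1 + ?e) n
       + 4 * ?d (\<lambda>w. ku (fb w) (fa w) (fu w)) (\<lambda>w. qu (fa w) (fu w)) (I2 + ?e) n
       + 8 * (?t n + ?d (\<lambda>w. kv (fb w) (fa w) (fu w) (fv w)) (\<lambda>w. qv (fa w) (fu w) (fv w)) (I3 + ?e) n)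
       + exp (- (real M1 * 2 powr (- (real n * (I1 + ?e))) / 2)) + exp (- (real M2 * 2 powr (- (real n * (I2 + ?e))) / 2))
       + exp (- (real M3 * 2 powr (- (real n * (I3 + ?e))) / 2))"
  proof (rule cover_three[OF fin _ s_pb _ s_ka _ s_ku _ s_kv _ s_qa _ s_qu _ s_qv M1(1) M2(1) M3(1) D1 D2 D3])
  qed (auto simp: pbn'_def kan_def kun_def kvn_def qan_def qun_def qvn_def pbn ka_def ku_def kv_def qa_def qu_def qv_def kk(1)
        intro!: prod_nonneg)
  then obtain ea eu ev where E: "\<And>b. b \<in> ?B \<Longrightarrow> ea b \<in> ?A \<and> eu b \<in> ?U \<and> ev b \<in> ?V" "card (ea ` ?B) \<le> M1"
     "card ((\<lambda>b. (ea b, eu b)) ` ?B) \<le> M1 * M2" "card ((\<lambda>b. ((ea b, eu b), ev b)) ` ?B) \<le> M1 * M2 * M3"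
     "(\<Sum>b\<in>?B. if tpc b (ea b) (eu b) (ev b) then 0 else pbn' b) \<le>
       2 * ?d (\<lambda>w. ka (fb w) (fa w)) (\<lambda>w. qa (fa w)) (I1 + ?e) n
       + 4 * ?d (\<lambda>w. ku (fb w) (fa w) (fu w)) (\<lambda>w. qu (fa w) (fu w)) (I2 + ?e) n
       + 8 * (?t n + ?d (\<lambda>w. kv (fb w) (fa w) (fu w) (fv w)) (\<lambda>w. qv (fa w) (fu w) (fv w)) (I3 + ?e) n)
       + exp (- (real M1 * 2 powr (- (real n * (I1 + ?e))) / 2)) + exp (- (real M2 * 2 powr (- (real n * (I2 + ?e))) / 2))
       + exp (- (real M3 * 2 powr (- (real n * (I3 + ?e))) / 2))" by blast
  have bad: "(\<Sum>b\<in>?B. if tpc b (ea b) (eu b) (ev b) then 0 else pbn' b) \<le> \<epsilon> / 2"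
    using E(5) ex[OF M1(2)] ex[OF M2(2)] ex[OF M3(2)] n(2) by linarith
  have neB: "?B \<noteq> {}" using s_pb by auto
  have lg: "log 2 (real c) \<le> log 2 (real m)" if "c \<le> m" "c > 0" for c m :: nat
    using that by (intro log_mono) auto
  have c1: "log 2 (card (ea ` ?B)) \<le> real n * (I1 + \<epsilon>)"
  proof -
    have "log 2 (card (ea ` ?B)) \<le> log 2 (real M1)" using fin neB E(2) by (intro lg) (auto simp: card_gt_0_iff)
    also have "\<dots> \<le> real n * (I1 + \<epsilon>/6 + \<epsilon>/6)" by (rule M1)
    also have "\<dots> \<le> real n * (I1 + \<epsilon>)" using \<epsilon> by (intro mult_left_mono) auto
    finally show ?thesis .
  qed
  have c2: "log 2 (card ((\<lambda>b. (ea b, eu b)) ` ?B)) \<le> real n * (I1 + I2 + \<epsilon>)"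
  proof -
    have "log 2 (card ((\<lambda>b. (ea b, eu b)) ` ?B)) \<le> log 2 (real (M1 * M2))"
      using fin neB E(3) by (intro lg) (auto simp: card_gt_0_iff)
    also have "\<dots> = log 2 (real M1) + log 2 (real M2)" using M1 M2 by (simp add: log_mult)
    also have "\<dots> \<le> real n * (I1 + \<epsilon>/6 + \<epsilon>/6) + real n * (I2 + \<epsilon>/6 + \<epsilon>/6)" by (intro add_mono M1 M2)
    also have "\<dots> = real n * (I1 + I2 + 2 * \<epsilon> / 3)" by (simp add: algebra_simps)
    also have "\<dots> \<le> real n * (I1 + I2 + \<epsilon>)" using \<epsilon> by (intro mult_left_mono) auto
    finally show ?thesis .
  qed
  have c3: "log 2 (card ((\<lambda>b. ((ea b, eu b), ev b)) ` ?B)) \<le> real n * (I1 + I2 + I3 + \<epsilon>)"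
  proof -
    have "log 2 (card ((\<lambda>b. ((ea b, eu b), ev b)) ` ?B)) \<le> log 2 (real (M1 * M2 * M3))"
      using fin neB E(4) by (intro lg) (auto simp: card_gt_0_iff)
    also have "\<dots> = log 2 (real M1) + log 2 (real M2) + log 2 (real M3)" using M1 M2 M3 by (simp add: log_mult)
    also have "\<dots> \<le> real n * (I1 + \<epsilon>/6 + \<epsilon>/6) + real n * (I2 + \<epsilon>/6 + \<epsilon>/6) + real n * (I3 + \<epsilon>/6 + \<epsilon>/6)"
      by (intro add_mono M1 M2 M3)
    also have "\<dots> = real n * (I1 + I2 + I3 + \<epsilon>)" by (simp add: algebra_simps)
    finally show ?thesis .
  qed
  \<comment> \<open>A typical codeword deviates by at most \<open>\<epsilon> / 2\<close>, an
    untypical one by at most 1, and the latter concerns source words of mass at most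
    \<open>\<epsilon> / 2\<close>.\<close>
  have avg: "\<bar>(\<Sum>bs\<in>?B. iid pb n bs * freq n (\<lambda>i. (bs ! i, ea bs ! i, eu bs ! i, ev bs ! i)) t) - P t\<bar> \<le> \<epsilon>" for t
  proof -
    let ?f = "\<lambda>bs. freq n (\<lambda>i. (bs ! i, ea bs ! i, eu bs ! i, ev bs ! i)) t"
    have f01: "0 \<le> ?f bs" "?f bs \<le> 1" for bs
      using card_mono[of "{..<n}" "{i. i < n \<and> (bs ! i, ea bs ! i, eu bs ! i, ev bs ! i) = t}"]
      by (auto simp: freq_def divide_le_eq_1)
    have P01: "0 \<le> P t" "P t \<le> 1" using fprobD[OF P] member_le_sum[of t UNIV P] by auto
    have p0: "pbn' bs \<ge> 0" for bs unfolding pbn'_def by (intro prod_nonneg) (simp add: pbn)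
    have "(\<Sum>bs\<in>?B. iid pb n bs * ?f bs) - P t = (\<Sum>bs\<in>?B. pbn' bs * (?f bs - P t))"
      using s_pb by (simp add: iid_def pbn'_def right_diff_distrib sum_subtractf sum_distrib_right[symmetric])
    also have "\<bar>\<dots>\<bar> \<le> (\<Sum>bs\<in>?B. \<bar>pbn' bs * (?f bs - P t)\<bar>)" by (rule sum_abs)
    also have "\<dots> \<le> (\<Sum>bs\<in>?B. pbn' bs * (\<epsilon>/2) + (if tpc bs (ea bs) (eu bs) (ev bs) then 0 else pbn' bs))"
    proof (rule sum_mono)
      fix bs
      have "\<bar>pbn' bs * (?f bs - P t)\<bar> = pbn' bs * \<bar>?f bs - P t\<bar>" using p0[of bs] by (simp add: abs_mult)
      also have "\<dots> \<le> pbn' bs * (\<epsilon>/2) + (if tpc bs (ea bs) (eu bs) (ev bs) then 0 else pbn' bs)"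
      proof (cases "tpc bs (ea bs) (eu bs) (ev bs)")
        case True
        then have "\<bar>?f bs - P t\<bar> \<le> \<epsilon>/2" unfolding tpc_def by blast
        from mult_left_mono[OF this p0] show ?thesis using True by simp
      next
        case False
        have "pbn' bs * \<bar>?f bs - P t\<bar> \<le> pbn' bs * 1" using f01[of bs] P01 p0[of bs] by (intro mult_left_mono) auto
        moreover have "0 \<le> pbn' bs * (\<epsilon>/2)" using p0[of bs] \<epsilon> by simp
        ultimately show ?thesis using False by simp
      qed
      finally show "\<bar>pbn' bs * (?f bs - P t)\<bar> \<le> pbn' bs * (\<epsilon>/2) + (if tpc bs (ea bs) (eu bs) (ev bs) then 0 else pbn' bs)" .
    qed
    also have "\<dots> \<le> \<epsilon>/2 + \<epsilon>/2"
      unfolding sum.distrib sum_distrib_right[symmetric] s_pb using bad by simp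
    finally show ?thesis by simp
  qed
  have "\<forall>bs\<in>?B. length (ea bs) = n \<and> length (eu bs) = n \<and> length (ev bs) = n"
  proof
    fix bs :: "'b list" assume "bs \<in> ?B"
    from E(1)[OF this] show "length (ea bs) = n \<and> length (eu bs) = n \<and> length (ev bs) = n"
      by (simp add: seqs_def)
  qed
  then show ?thesis
    using n(1) c1 c2 c3 avg by blast
qed

section \<open>Single-letter bounds for block codes\<close>

lemma sum_freq:
  fixes x :: "nat \<Rightarrow> 'a::finite" and \<psi> :: "'a \<Rightarrow> real"
  assumes "n > 0"
  shows "(\<Sum>i<n. \<psi> (x i)) = real n * (\<Sum>t\<in>UNIV. freq n x t * \<psi> t)"
proof -
  have "(\<Sum>i<n. \<psi> (x i)) = (\<Sum>t\<in>UNIV. \<Sum>i\<in>{i\<in>{..<n}. x i = t}. \<psi> (x i))"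
    by (rule sum.group[symmetric]) auto
  also have "\<dots> = (\<Sum>t\<in>UNIV. real n * (freq n x t * \<psi> t))"
    using assms by (intro sum.cong refl) (simp add: freq_def)
  finally show ?thesis by (simp add: sum_distrib_left)
qed

lemma sum_UNIV_pair:
  fixes f :: "'a::finite \<times> 'b::finite \<Rightarrow> real"
  shows "sum f UNIV = (\<Sum>a\<in>UNIV. \<Sum>b\<in>UNIV. f (a, b))"
  by (simp add: sum.cartesian_product)

lemma sum_UNIV_triple:
  fixes f :: "'a::finite \<times> 'b::finite \<times> 'c::finite \<Rightarrow> real"
  shows "sum f UNIV = (\<Sum>a\<in>UNIV. \<Sum>b\<in>UNIV. \<Sum>c\<in>UNIV. f (a, b, c))"
  by (simp add: sum.cartesian_product)

text \<open>Given \<open>b\<close> and \<open>\<pi> g\<close> the output law is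
  \<open>\<kappa> b g\<close> itself, so the conditional entropy is a mean negative log-probability
  of a fixed channel. The right side is linear in \<open>Q\<close>, free of its marginals and the
  same for all admissible \<open>\<pi>\<close>; the limit argument and the Markov identities both
  live on this.\<close>

lemma markov_cond_ent:
  fixes Q :: "'b::finite \<times> 'g::finite \<times> 'o::finite \<Rightarrow> real"
  assumes Q: "fprob UNIV Q" "\<And>b g o'. Q (b, g, o') = q b g * \<kappa> b g o'"
    and \<kappa>: "\<And>b g. (\<Sum>o'\<in>UNIV. \<kappa> b g o') = 1" "\<And>b g g'. \<pi> g = \<pi> g' \<Longrightarrow> \<kappa> b g = \<kappa> b g'"
  shows "ent UNIV Q (\<lambda>(b,g,o'). (\<tau> o', (b, \<pi> g))) - ent UNIV Q (\<lambda>(b,g,o'). (b, \<pi> g))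
     = - (\<Sum>(b,g,o')\<in>UNIV. Q (b,g,o') * log 2 (\<Sum>o''\<in>UNIV. if \<tau> o'' = \<tau> o' then \<kappa> b g o'' else 0))"
proof -
  \<comment> \<open>Any preimage of \<open>h\<close> under \<open>\<pi>\<close> gives the same
    kernel, because \<open>\<kappa>\<close> factors through \<open>\<pi>\<close>.\<close>
  define r where "r t = (\<lambda>(b,h). \<Sum>o''\<in>UNIV. if \<tau> o'' = t then \<kappa> b (SOME g. \<pi> g = h) o'' else 0)" for t
  have r: "r t (b, \<pi> g) = (\<Sum>o''\<in>UNIV. if \<tau> o'' = t then \<kappa> b g o'' else 0)" for t b g
  proof -
    have "\<pi> (SOME g'. \<pi> g' = \<pi> g) = \<pi> g" by (rule someI) simp
    then have "\<kappa> b (SOME g'. \<pi> g' = \<pi> g) = \<kappa> b g" by (rule \<kappa>(2))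
    then show ?thesis by (simp only: r_def prod.case)
  qed
  let ?T = "\<lambda>w::'b \<times> 'g \<times> 'o. \<tau> (snd (snd w))" and ?G = "\<lambda>w::'b \<times> 'g \<times> 'o. (fst w, \<pi> (fst (snd w)))"
  have key: "prb UNIV Q (\<lambda>w. (?T w, ?G w)) (t, (b0, \<pi> g0)) = prb UNIV Q ?G (b0, \<pi> g0) * r t (b0, \<pi> g0)" for t b0 g0
  proof -
    have "prb UNIV Q (\<lambda>w. (?T w, ?G w)) (t, (b0, \<pi> g0))
        = (\<Sum>b\<in>UNIV. \<Sum>g\<in>UNIV. \<Sum>o'\<in>UNIV. if \<tau> o' = t \<and> b = b0 \<and> \<pi> g = \<pi> g0 then q b g * \<kappa> b g o' else 0)"
      unfolding prb_eq_sum_if[OF finite_class.finite_UNIV] sum_UNIV_triple by (intro sum.cong refl) (simp add: Q(2))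
    also have "\<dots> = (\<Sum>b\<in>UNIV. \<Sum>g\<in>UNIV. (\<Sum>o'\<in>UNIV. if b = b0 \<and> \<pi> g = \<pi> g0 then q b g * \<kappa> b g o' else 0) * r t (b0, \<pi> g0))"
    proof (intro sum.cong refl)
      fix b g
      show "(\<Sum>o'\<in>UNIV. if \<tau> o' = t \<and> b = b0 \<and> \<pi> g = \<pi> g0 then q b g * \<kappa> b g o' else 0)
        = (\<Sum>o'\<in>UNIV. if b = b0 \<and> \<pi> g = \<pi> g0 then q b g * \<kappa> b g o' else 0) * r t (b0, \<pi> g0)"
      proof (cases "b = b0 \<and> \<pi> g = \<pi> g0")
        case True
        have "(\<Sum>o'\<in>UNIV. if \<tau> o' = t then q b g * \<kappa> b g o' else 0) = q b g * r t (b0, \<pi> g)"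
          using True unfolding r sum_distrib_left by (intro sum.cong) auto
        moreover have "(\<Sum>o'\<in>UNIV. q b g * \<kappa> b g o') = q b g"
          by (simp add: sum_distrib_left[symmetric] \<kappa>(1))
        ultimately show ?thesis using True by simp
      next
        case False then show ?thesis by auto
      qed
    qed
    also have "\<dots> = (\<Sum>b\<in>UNIV. \<Sum>g\<in>UNIV. \<Sum>o'\<in>UNIV. if b = b0 \<and> \<pi> g = \<pi> g0 then q b g * \<kappa> b g o' else 0) * r t (b0, \<pi> g0)"
      by (simp only: sum_distrib_right)
    also have "(\<Sum>b\<in>UNIV. \<Sum>g\<in>UNIV. \<Sum>o'\<in>UNIV. if b = b0 \<and> \<pi> g = \<pi> g0 then q b g * \<kappa> b g o' else 0)
        = prb UNIV Q ?G (b0, \<pi> g0)"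
      unfolding prb_eq_sum_if[OF finite_class.finite_UNIV] sum_UNIV_triple by (intro sum.cong refl) (simp add: Q(2))
    finally show ?thesis .
  qed
  have "ent UNIV Q (\<lambda>w. (?T w, ?G w)) - ent UNIV Q ?G = - (\<Sum>w\<in>UNIV. Q w * log 2 (r (?T w) (?G w)))"
    by (rule cond_ent_eq[OF Q(1)]) (rule key)
  then show ?thesis by (simp add: case_prod_unfold r)
qed

text \<open>In the application \<open>'b\<close> is the encoder's observation, \<open>'g\<close> the
  code letter (a,u,v) and \<open>'o\<close> the triple (x,y,z). The source letter is among the
  outputs because it is regenerated from the observation by the backward channel.\<close>

locale block_code =
  fixes pb :: "'b::finite \<Rightarrow> real" and \<kappa> :: "'b \<Rightarrow> 'g::finite \<Rightarrow> 'o::finite \<Rightarrow> real"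
    and e :: "'b list \<Rightarrow> 'g list" and n :: nat
  assumes pb: "is_pmf pb" and \<kappa>: "\<And>b g. is_pmf (\<kappa> b g)"
    and e: "\<And>bs. bs \<in> seqs UNIV n \<Longrightarrow> length (e bs) = n" and n: "n \<ge> 1"
begin

definition blk :: "('b list \<times> 'o list) set" where
  "blk = seqs UNIV n \<times> seqs UNIV n"

definition bp :: "'b list \<times> 'o list \<Rightarrow> real" where
  "bp = (\<lambda>(bs,os). iid pb n bs * (\<Prod>i<n. \<kappa> (bs ! i) (e bs ! i) (os ! i)))"

definition letters :: "'b list \<times> 'o list \<Rightarrow> ('b \<times> 'g \<times> 'o) list" where
  "letters = (\<lambda>(bs,os). zip bs (zip (e bs) os))"

definition q :: "'b \<Rightarrow> 'g \<Rightarrow> real" where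
  "q b g = (\<Sum>bs\<in>seqs UNIV n. iid pb n bs * freq n (\<lambda>i. (bs ! i, e bs ! i)) (b, g))"

text \<open>The law of the letters at a uniformly random position of the block.\<close>
definition Q :: "'b \<times> 'g \<times> 'o \<Rightarrow> real" where
  "Q = (\<lambda>(b,g,o'). q b g * \<kappa> b g o')"

lemma fprob_pb: "fprob UNIV pb"
  using pb by (simp add: is_pmf_def fprob_def)

lemma sum_\<kappa>: "(\<Sum>o'\<in>UNIV. \<kappa> b g o') = 1" and \<kappa>_nonneg: "0 \<le> \<kappa> b g o'"
  using \<kappa>[of b g] by (auto simp: is_pmf_def)

lemma sum_blk: "(\<Sum>w\<in>blk. f w) = (\<Sum>bs\<in>seqs UNIV n. \<Sum>os\<in>seqs UNIV n. f (bs, os))"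
  unfolding blk_def by (simp add: sum.cartesian_product)

lemma sum_os: "(\<Sum>os\<in>seqs UNIV n. \<Prod>i<n. \<kappa> (bs ! i) (e bs ! i) (os ! i)) = 1"
  using sum_seqs_prod[OF finite_class.finite_UNIV, of "\<lambda>i. \<kappa> (bs ! i) (e bs ! i)" n] by (simp add: sum_\<kappa>)

lemma fprob_blk: "fprob blk bp"
  unfolding fprob_def
proof (intro conjI ballI)
  show "finite blk" by (simp add: blk_def finite_seqs)
  show "0 \<le> bp w" if "w \<in> blk" for w
    using that fprobD(2)[OF fprob_iid[OF fprob_pb]]
    by (auto simp: bp_def blk_def intro!: mult_nonneg_nonneg prod_nonneg \<kappa>_nonneg)
  show "sum bp blk = 1"
    using fprobD(3)[OF fprob_iid[OF fprob_pb, of n]]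
    by (simp add: sum_blk bp_def sum_distrib_left[symmetric] sum_os)
qed

lemma letters_nth:
  assumes "w \<in> blk" "i < n"
  shows "letters w ! i = (fst w ! i, e (fst w) ! i, snd w ! i)"
  using assms by (auto simp: letters_def blk_def seqs_length e)

lemma length_letters: "w \<in> blk \<Longrightarrow> length (letters w) = n"
  by (auto simp: letters_def blk_def seqs_length e)

text \<open>Additive functionals of a block only depend on the averaged letter law: at each position
  the outputs of the other positions sum out, and \<open>freq\<close> counts the positions with a
  given input letter.\<close>

lemma sum_letters:
  "(\<Sum>w\<in>blk. bp w * (\<Sum>i<n. \<phi> (letters w ! i))) = real n * (\<Sum>t\<in>UNIV. Q t * \<phi> t)"
proof -
  define \<psi> where "\<psi> = (\<lambda>(b,g). \<Sum>o'\<in>UNIV. \<kappa> b g o' * \<phi> (b,g,o'))"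
  have "(\<Sum>os\<in>seqs UNIV n. bp (bs,os) * (\<Sum>i<n. \<phi> (letters (bs,os) ! i)))
      = iid pb n bs * (real n * (\<Sum>t\<in>UNIV. freq n (\<lambda>i. (bs ! i, e bs ! i)) t * \<psi> t))"
    if bs: "bs \<in> seqs UNIV n" for bs
  proof -
    have "(\<Sum>os\<in>seqs UNIV n. bp (bs,os) * (\<Sum>i<n. \<phi> (letters (bs,os) ! i)))
      = iid pb n bs * (\<Sum>i<n. \<Sum>os\<in>seqs UNIV n. (\<Prod>i<n. \<kappa> (bs ! i) (e bs ! i) (os ! i)) * \<phi> (bs ! i, e bs ! i, os ! i))"
      unfolding sum_distrib_left using bs
      by (subst sum.swap) (intro sum.cong refl, simp add: letters_nth blk_def bp_def)
    also have "\<dots> = iid pb n bs * (\<Sum>i<n. \<psi> (bs ! i, e bs ! i))"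
    proof -
      have "(\<Sum>os\<in>seqs UNIV n. (\<Prod>i<n. \<kappa> (bs ! i) (e bs ! i) (os ! i)) * \<phi> (bs ! k, e bs ! k, os ! k))
        = \<psi> (bs ! k, e bs ! k)" if "k < n" for k
        using sum_seqs_prod_nth[OF finite_class.finite_UNIV that, of "\<lambda>i. \<kappa> (bs ! i) (e bs ! i)" "\<lambda>o'. \<phi> (bs ! k, e bs ! k, o')"]
        by (simp add: sum_\<kappa> \<psi>_def)
      then show ?thesis by simp
    qed
    finally show ?thesis using sum_freq[of n \<psi> "\<lambda>i. (bs ! i, e bs ! i)"] n by simp
  qed
  then have "(\<Sum>w\<in>blk. bp w * (\<Sum>i<n. \<phi> (letters w ! i)))
     = (\<Sum>bs\<in>seqs UNIV n. \<Sum>t\<in>UNIV. real n * (iid pb n bs * freq n (\<lambda>i. (bs ! i, e bs ! i)) t * \<psi> t))"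
    unfolding sum_blk by (intro sum.cong refl) (simp add: sum_distrib_left mult_ac)
  also have "\<dots> = (\<Sum>t\<in>UNIV. real n * ((\<lambda>(b,g). q b g) t * \<psi> t))"
    by (subst sum.swap) (intro sum.cong refl, simp add: sum_distrib_left sum_distrib_right q_def case_prod_unfold)
  also have "\<dots> = real n * (\<Sum>b\<in>UNIV. \<Sum>g\<in>UNIV. \<Sum>o'\<in>UNIV. Q (b,g,o') * \<phi> (b,g,o'))"
    unfolding sum_UNIV_pair by (simp add: Q_def \<psi>_def sum_distrib_left mult.assoc)
  also have "(\<Sum>b\<in>UNIV. \<Sum>g\<in>UNIV. \<Sum>o'\<in>UNIV. Q (b,g,o') * \<phi> (b,g,o')) = (\<Sum>t\<in>UNIV. Q t * \<phi> t)"
    by (simp add: sum.cartesian_product)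
  finally show ?thesis .
qed

lemma fprob_Q: "fprob UNIV Q"
  unfolding fprob_def
proof (intro conjI ballI)
  have "q b g \<ge> 0" for b g
    unfolding q_def using fprobD(2)[OF fprob_iid[OF fprob_pb]]
    by (intro sum_nonneg mult_nonneg_nonneg) (auto simp: freq_def)
  then show "0 \<le> Q t" for t by (simp add: Q_def case_prod_unfold \<kappa>_nonneg)
  have "real n * (\<Sum>t\<in>UNIV. Q t * 1) = (\<Sum>w\<in>blk. bp w * (\<Sum>i<n. 1))"
    by (rule sum_letters[of "\<lambda>_. 1", symmetric])
  also have "\<dots> = real n" using fprobD(3)[OF fprob_blk] by (simp add: sum_distrib_right[symmetric])
  finally show "sum Q UNIV = 1" using n by simp
qed simp

text \<open>\<open>sum_letters\<close> for the indicator of the letter: one occurrence in a block of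
  positive weight already forces positive weight in \<open>Q\<close>. Single-letter posteriors are
  therefore positive along possible blocks.\<close>

lemma Q_pos:
  assumes w: "w \<in> blk" "bp w > 0" and i: "i < n"
  shows "Q (letters w ! i) > 0"
proof -
  let ?t = "letters w ! i"
  let ?h = "\<lambda>t. if t = ?t then 1 else 0 :: real"
  have "1 \<le> (\<Sum>j<n. ?h (letters w ! j))"
    using member_le_sum[of i "{..<n}" "\<lambda>j. ?h (letters w ! j)"] i by simp
  then have "bp w * 1 \<le> bp w * (\<Sum>j<n. ?h (letters w ! j))" using w by (intro mult_left_mono) auto
  also have "\<dots> \<le> (\<Sum>w\<in>blk. bp w * (\<Sum>j<n. ?h (letters w ! j)))"
    using w fprobD[OF fprob_blk] by (intro member_le_sum[of w blk "\<lambda>w. bp w * (\<Sum>j<n. ?h (letters w ! j))"])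
      (auto intro!: mult_nonneg_nonneg sum_nonneg split: if_splits)
  also have "\<dots> = real n * Q ?t" unfolding sum_letters[of ?h] by (simp add: if_distrib cong: if_cong)
  finally have "0 < real n * Q ?t" using w by linarith
  then show ?thesis using n by (simp add: zero_less_mult_iff)
qed

lemma log2_prod_letters:
  assumes pos: "\<And>t. Q t > 0 \<Longrightarrow> f t > 0"
  shows "- (\<Sum>w\<in>blk. bp w * log 2 (\<Prod>i<n. f (letters w ! i))) = - (real n * (\<Sum>t\<in>UNIV. Q t * log 2 (f t)))"
proof -
  have "bp w * log 2 (\<Prod>i<n. f (letters w ! i)) = bp w * (\<Sum>i<n. log 2 (f (letters w ! i)))" if w: "w \<in> blk" for w
  proof (cases "bp w > 0")
    case True
    then have "f (letters w ! i) \<noteq> 0" if "i < n" for i using pos[OF Q_pos[OF w True that]] by simp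
    then show ?thesis unfolding log_def by (subst ln_prod) (auto simp: sum_divide_distrib)
  next
    case False then show ?thesis using fprobD(2)[OF fprob_blk w] by simp
  qed
  then have "(\<Sum>w\<in>blk. bp w * log 2 (\<Prod>i<n. f (letters w ! i))) = (\<Sum>w\<in>blk. bp w * (\<Sum>i<n. log 2 (f (letters w ! i))))"
    by (rule sum.cong[OF refl])
  then show ?thesis by (simp add: sum_letters[of "\<lambda>t. log 2 (f t)"])
qed

text \<open>Gibbs' inequality with the product of the conditional laws of \<open>\<tau>\<close>
  given \<open>\<pi>\<close> under \<open>Q\<close> as kernel. The block need not be memoryless,
  because the mean logarithm of a product over positions depends on \<open>Q\<close> alone.\<close>

lemma single_letter_upper:
  "ent blk bp (\<lambda>w. (map \<tau> (letters w), map \<pi> (letters w))) - ent blk bp (\<lambda>w. map \<pi> (letters w))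
    \<le> real n * (ent UNIV Q (\<lambda>t. (\<tau> t, \<pi> t)) - ent UNIV Q \<pi>)"
proof -
  let ?f = "\<lambda>t h. prb UNIV Q (\<lambda>t. (\<tau> t, \<pi> t)) (t, h) / prb UNIV Q \<pi> h"
  define r where "r ts hs = (\<Prod>i<n. ?f (ts ! i) (hs ! i))" for ts hs
  have rl: "r (map \<tau> (letters w)) (map \<pi> (letters w)) = (\<Prod>i<n. post UNIV Q \<tau> \<pi> (letters w ! i))" if "w \<in> blk" for w
    using length_letters[OF that] by (simp add: r_def post_def)
  have pos: "post UNIV Q \<tau> \<pi> t > 0" if "Q t > 0" for t by (rule post_pos(3)[OF fprob_Q _ that]) simp
  have fnn: "0 \<le> ?f t h" for t h by (intro divide_nonneg_nonneg prb_nonneg[OF fprob_Q])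
  have "ent blk bp (\<lambda>w. (map \<tau> (letters w), map \<pi> (letters w))) - ent blk bp (\<lambda>w. map \<pi> (letters w))
     \<le> - (\<Sum>w\<in>blk. bp w * log 2 (r (map \<tau> (letters w)) (map \<pi> (letters w))))"
  proof (rule cond_ent_le[OF fprob_blk])
    show "r (map \<tau> (letters w)) (map \<pi> (letters w)) > 0" if "w \<in> blk" "bp w > 0" for w
      unfolding rl[OF that(1)] using pos Q_pos[OF that] by (intro prod_pos) auto
    show "r ts hs \<ge> 0" for ts hs unfolding r_def using fnn by (intro prod_nonneg) auto
    fix hs
    have "(\<Sum>ts\<in>(\<lambda>w. map \<tau> (letters w)) ` blk. r ts hs) \<le> (\<Sum>ts\<in>seqs (range \<tau>) n. r ts hs)"
    proof (rule sum_mono2)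
      show "finite (seqs (range \<tau>) n)" by (simp add: finite_seqs)
      show "(\<lambda>w. map \<tau> (letters w)) ` blk \<subseteq> seqs (range \<tau>) n" by (auto simp: seqs_def length_letters)
      show "0 \<le> r ts hs" for ts unfolding r_def using fnn by (intro prod_nonneg) auto
    qed
    also have "\<dots> = (\<Prod>i<n. \<Sum>t\<in>range \<tau>. ?f t (hs ! i))"
      unfolding r_def by (rule sum_seqs_prod) simp
    also have "\<dots> \<le> 1"
    proof (rule prod_le_1)
      fix i
      show "0 \<le> (\<Sum>t\<in>range \<tau>. ?f t (hs ! i)) \<and> (\<Sum>t\<in>range \<tau>. ?f t (hs ! i)) \<le> 1"
        using sum_prb_pair[of UNIV Q \<tau> \<pi> "hs ! i"] fnn
        by (auto simp: sum_divide_distrib[symmetric] divide_le_eq_1 prb_nonneg[OF fprob_Q] intro!: divide_nonneg_nonneg)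
    qed
    finally show "(\<Sum>ts\<in>(\<lambda>w. map \<tau> (letters w)) ` blk. r ts hs) \<le> 1" .
  qed
  also have "\<dots> = - (\<Sum>w\<in>blk. bp w * log 2 (\<Prod>i<n. post UNIV Q \<tau> \<pi> (letters w ! i)))"
    by (intro arg_cong[where f=uminus] sum.cong refl) (simp add: rl)
  also have "\<dots> = - (real n * (\<Sum>t\<in>UNIV. Q t * log 2 (post UNIV Q \<tau> \<pi> t)))"
    by (rule log2_prod_letters[OF pos])
  also have "\<dots> = real n * (ent UNIV Q (\<lambda>t. (\<tau> t, \<pi> t)) - ent UNIV Q \<pi>)"
    using cond_ent_post[OF fprob_Q, of \<tau> \<pi>] by simp
  finally show ?thesis .
qed

lemma ent_source: "ent blk bp fst = real n * ent UNIV pb (\<lambda>b. b)"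
proof -
  have pr: "prb blk bp fst bs = iid pb n bs" if "bs \<in> seqs UNIV n" for bs
  proof -
    have "prb blk bp fst bs = (\<Sum>bs'\<in>seqs UNIV n. if bs' = bs then \<Sum>os\<in>seqs UNIV n. bp (bs', os) else 0)"
      unfolding prb_eq_sum_if[OF fprobD(1)[OF fprob_blk]] sum_blk by (intro sum.cong) auto
    also have "\<dots> = (\<Sum>os\<in>seqs UNIV n. bp (bs, os))" using that by (simp add: finite_seqs)
    finally show ?thesis by (simp add: bp_def sum_distrib_left[symmetric] sum_os)
  qed
  have pr': "prb (seqs UNIV n) (iid pb n) (\<lambda>b. b) bs = iid pb n bs" if "bs \<in> seqs UNIV n" for bs
    using that by (simp add: prb_eq_sum_if finite_seqs)
  have "ent blk bp fst = - (\<Sum>bs\<in>seqs UNIV n. iid pb n bs * log 2 (iid pb n bs))"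
    unfolding ent_eq_sum[OF fprobD(1)[OF fprob_blk]] sum_blk
  proof (intro arg_cong[where f=uminus] sum.cong refl)
    fix bs :: "'b list" assume bs: "bs \<in> seqs UNIV n"
    have "(\<Sum>os\<in>seqs UNIV n. bp (bs, os)) = iid pb n bs" by (simp add: bp_def sum_distrib_left[symmetric] sum_os)
    then show "(\<Sum>os\<in>seqs UNIV n. bp (bs, os) * log 2 (prb blk bp fst (fst (bs, os)))) = iid pb n bs * log 2 (iid pb n bs)"
      by (simp add: pr[OF bs] sum_distrib_right[symmetric])
  qed
  also have "\<dots> = ent (seqs UNIV n) (iid pb n) (\<lambda>b. b)"
    by (simp add: ent_eq_sum finite_seqs pr')
  also have "\<dots> = ent (seqs UNIV n) (iid pb n) (map (\<lambda>b. b))"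
    by (intro ent_cong) (simp_all add: finite_seqs)
  also have "\<dots> = real n * ent UNIV pb (\<lambda>b. b)" by (rule ent_iid[OF fprob_pb])
  finally show ?thesis .
qed

text \<open>A source block determines its codeword, and given both the outputs are independent. The
  conditional entropy is therefore exactly a sum of channel log-probabilities over positions, hence
  linear in \<open>Q\<close>.\<close>

lemma cond_ent_given_source:
  "ent blk bp (\<lambda>w. (map \<tau> (snd w), fst w)) - ent blk bp fst
    = - (real n * (\<Sum>(b,g,o')\<in>UNIV. Q (b,g,o') * log 2 (\<Sum>o''\<in>UNIV. if \<tau> o'' = \<tau> o' then \<kappa> b g o'' else 0)))"
proof -
  let ?k = "\<lambda>b g t. \<Sum>o''\<in>UNIV. if \<tau> o'' = t then \<kappa> b g o'' else 0"
  let ?f = "\<lambda>(b,g,o'). ?k b g (\<tau> o')"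
  define r where "r ts bs = (\<Prod>i<n. ?k (bs ! i) (e bs ! i) (ts ! i))" for ts bs
  have rl: "r (map \<tau> (snd w)) (fst w) = (\<Prod>i<n. ?f (letters w ! i))" if "w \<in> blk" for w
    using that by (auto simp: r_def letters_nth[OF that] blk_def seqs_length intro!: prod.cong)
  have "ent blk bp (\<lambda>w. (map \<tau> (snd w), fst w)) - ent blk bp fst = - (\<Sum>w\<in>blk. bp w * log 2 (r (map \<tau> (snd w)) (fst w)))"
  proof (rule cond_ent_eq[OF fprob_blk])
    fix w assume "w \<in> blk"
    then obtain bs os where w: "w = (bs, os)" "bs \<in> seqs UNIV n" "os \<in> seqs UNIV n" by (auto simp: blk_def)
    let ?ts = "map \<tau> os"
    have "prb blk bp (\<lambda>w. (map \<tau> (snd w), fst w)) (?ts, bs)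
        = (\<Sum>bs'\<in>seqs UNIV n. if bs' = bs then \<Sum>os'\<in>seqs UNIV n. if map \<tau> os' = ?ts then bp (bs', os') else 0 else 0)"
      unfolding prb_eq_sum_if[OF fprobD(1)[OF fprob_blk]] sum_blk by (intro sum.cong) auto
    also have "\<dots> = (\<Sum>os'\<in>seqs UNIV n. if map \<tau> os' = ?ts then bp (bs, os') else 0)"
      using w by (simp add: finite_seqs)
    also have "\<dots> = (\<Sum>os'\<in>seqs UNIV n. iid pb n bs * (\<Prod>i<n. if \<tau> (os' ! i) = ?ts ! i then \<kappa> (bs ! i) (e bs ! i) (os' ! i) else 0))"
    proof (rule sum.cong[OF refl])
      fix os' :: "'o list" assume os': "os' \<in> seqs UNIV n"
      show "(if map \<tau> os' = ?ts then bp (bs, os') else 0)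
        = iid pb n bs * (\<Prod>i<n. if \<tau> (os' ! i) = ?ts ! i then \<kappa> (bs ! i) (e bs ! i) (os' ! i) else 0)"
      proof (cases "map \<tau> os' = ?ts")
        case True
        then have "\<tau> (os' ! i) = ?ts ! i" if "i < n" for i
          using that os' by (metis nth_map seqs_length)
        then show ?thesis using True by (simp add: bp_def)
      next
        case False
        then obtain i where "i < n" "\<tau> (os' ! i) \<noteq> ?ts ! i"
          using os' w(3) by (auto simp: list_eq_iff_nth_eq seqs_length)
        then have "(\<Prod>i<n. if \<tau> (os' ! i) = ?ts ! i then \<kappa> (bs ! i) (e bs ! i) (os' ! i) else 0) = 0"
          by (intro prod_zero) auto
        then show ?thesis using False by simp
      qed
    qed
    also have "\<dots> = iid pb n bs * r ?ts bs"
      unfolding sum_distrib_left[symmetric] r_def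
      using sum_seqs_prod[OF finite_class.finite_UNIV, of "\<lambda>i o'. if \<tau> o' = ?ts ! i then \<kappa> (bs ! i) (e bs ! i) o' else 0" n]
      by simp
    also have "iid pb n bs = prb blk bp fst bs"
    proof -
      have "prb blk bp fst bs = (\<Sum>bs'\<in>seqs UNIV n. if bs' = bs then \<Sum>os\<in>seqs UNIV n. bp (bs', os) else 0)"
        unfolding prb_eq_sum_if[OF fprobD(1)[OF fprob_blk]] sum_blk by (intro sum.cong) auto
      also have "\<dots> = (\<Sum>os\<in>seqs UNIV n. bp (bs, os))" using w by (simp add: finite_seqs)
      finally show ?thesis by (simp add: bp_def sum_distrib_left[symmetric] sum_os)
    qed
    finally show "prb blk bp (\<lambda>w. (map \<tau> (snd w), fst w)) (map \<tau> (snd w), fst w)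
        = prb blk bp fst (fst w) * r (map \<tau> (snd w)) (fst w)" by (simp add: w)
  qed
  also have "\<dots> = - (\<Sum>w\<in>blk. bp w * log 2 (\<Prod>i<n. ?f (letters w ! i)))"
    by (intro arg_cong[where f=uminus] sum.cong refl) (simp add: rl)
  also have "\<dots> = - (real n * (\<Sum>t\<in>UNIV. Q t * log 2 (?f t)))"
  proof (rule log2_prod_letters)
    fix t assume "Q t > 0"
    obtain b g o' where t: "t = (b,g,o')" by (cases t)
    have "\<kappa> b g o' > 0" using \<open>Q t > 0\<close> \<kappa>_nonneg[of b g o'] by (auto simp: t Q_def zero_less_mult_iff)
    also have "\<kappa> b g o' \<le> ?k b g (\<tau> o')"
      using member_le_sum[of o' UNIV "\<lambda>o''. if \<tau> o'' = \<tau> o' then \<kappa> b g o'' else 0"] \<kappa>_nonneg by simp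
    finally show "?f t > 0" by (simp add: t)
  qed
  finally show ?thesis by (simp add: case_prod_unfold)
qed

text \<open>For source block B, codeword part G and output T, the chain rule gives H(T,G) = H(B) +
  H(T|B) - H(B|T,G), since G is a function of B. The first two terms are known exactly and the third
  is bounded by \<open>single_letter_upper\<close>.\<close>

lemma single_letter_lower:
  "real n * (ent UNIV pb (\<lambda>b. b)
      - (\<Sum>(b,g,o')\<in>UNIV. Q (b,g,o') * log 2 (\<Sum>o''\<in>UNIV. if \<tau> o'' = \<tau> o' then \<kappa> b g o'' else 0))
      - (ent UNIV Q (\<lambda>(b,g,o'). (b, (\<tau> o', \<pi> g))) - ent UNIV Q (\<lambda>(b,g,o'). (\<tau> o', \<pi> g))))
   \<le> ent blk bp (\<lambda>w. (map \<tau> (snd w), map \<pi> (e (fst w))))"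
proof -
  note fin = fprobD(1)[OF fprob_blk]
  let ?t = "\<lambda>w::'b \<times> 'g \<times> 'o. fst w" and ?p = "\<lambda>w::'b \<times> 'g \<times> 'o. (\<tau> (snd (snd w)), \<pi> (fst (snd w)))"
  have 1: "ent blk bp (\<lambda>w. (map ?t (letters w), map ?p (letters w))) = ent blk bp (\<lambda>w. (map \<tau> (snd w), fst w))"
  proof (rule ent_cong[OF fin])
    fix w w' assume w: "w \<in> blk" "w' \<in> blk"
    have [simp]: "map ?t (letters w) = fst w" if "w \<in> blk" for w
      using that by (auto simp: letters_def blk_def seqs_length e)
    show "((map ?t (letters w), map ?p (letters w)) = (map ?t (letters w'), map ?p (letters w')))
       = ((map \<tau> (snd w), fst w) = (map \<tau> (snd w'), fst w'))"
    proof -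
      have len: "length (snd w) = n" "length (snd w') = n" using w by (auto simp: blk_def seqs_length)
      have "(map ?p (letters w) = map ?p (letters w')) = (map \<tau> (snd w) = map \<tau> (snd w'))" if "fst w = fst w'"
        unfolding list_eq_iff_nth_eq using that w by (simp add: length_letters letters_nth len)
      then show ?thesis using w by auto
    qed
  qed
  have 2: "ent blk bp (\<lambda>w. map ?p (letters w)) = ent blk bp (\<lambda>w. (map \<tau> (snd w), map \<pi> (e (fst w))))"
  proof (rule ent_cong[OF fin])
    fix w w' assume w: "w \<in> blk" "w' \<in> blk"
    have len: "length (e (fst w)) = n" "length (snd w) = n" if "w \<in> blk" for w
      using that by (auto simp: blk_def seqs_length e)
    show "(map ?p (letters w) = map ?p (letters w'))
       = ((map \<tau> (snd w), map \<pi> (e (fst w))) = (map \<tau> (snd w'), map \<pi> (e (fst w'))))"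
      using w by (auto simp: list_eq_iff_nth_eq length_letters letters_nth len)
  qed
  have "ent blk bp (\<lambda>w. (map ?t (letters w), map ?p (letters w))) - ent blk bp (\<lambda>w. map ?p (letters w))
     \<le> real n * (ent UNIV Q (\<lambda>t. (?t t, ?p t)) - ent UNIV Q ?p)"
    by (rule single_letter_upper)
  then show ?thesis
    using cond_ent_given_source[of \<tau>] ent_source unfolding 1 2
    by (simp add: case_prod_unfold algebra_simps)
qed

text \<open>The same entropy split as H(G) + H(T|G): the number of codewords bounds the first term,
  the letter law the second.\<close>

lemma single_letter_upper':
  "ent blk bp (\<lambda>w. (map \<tau> (snd w), map \<pi> (e (fst w)))) \<le>
     log 2 (card ((\<lambda>bs. map \<pi> (e bs)) ` seqs UNIV n))
     + real n * (ent UNIV Q (\<lambda>(b,g,o'). (\<tau> o', \<pi> g)) - ent UNIV Q (\<lambda>(b,g,o'). \<pi> g))"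
proof -
  note fin = fprobD(1)[OF fprob_blk]
  let ?t = "\<lambda>w::'b \<times> 'g \<times> 'o. \<tau> (snd (snd w))" and ?p = "\<lambda>w::'b \<times> 'g \<times> 'o. \<pi> (fst (snd w))"
  have l: "map ?t (letters w) = map \<tau> (snd w)" "map ?p (letters w) = map \<pi> (e (fst w))" if "w \<in> blk" for w
  proof -
    have len: "length (e (fst w)) = n" "length (snd w) = n"
      using that by (auto simp: blk_def seqs_length e)
    show "map ?t (letters w) = map \<tau> (snd w)" "map ?p (letters w) = map \<pi> (e (fst w))"
      using that by (auto simp: list_eq_iff_nth_eq length_letters letters_nth len)
  qed
  have "ent blk bp (\<lambda>w. (map ?t (letters w), map ?p (letters w))) = ent blk bp (\<lambda>w. (map \<tau> (snd w), map \<pi> (e (fst w))))"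
    by (rule ent_cong[OF fin]) (simp add: l)
  moreover have "ent blk bp (\<lambda>w. map ?p (letters w)) \<le> log 2 (card ((\<lambda>bs. map \<pi> (e bs)) ` seqs UNIV n))"
  proof (rule ent_le_log_card[OF fprob_blk])
    show "(\<lambda>w. map ?p (letters w)) ` blk \<subseteq> (\<lambda>bs. map \<pi> (e bs)) ` seqs UNIV n"
      using l by (auto simp: blk_def)
  qed (simp add: finite_seqs)
  moreover note single_letter_upper[of ?t ?p]
  ultimately show ?thesis by (simp add: case_prod_unfold)
qed

end

section \<open>Continuity of entropy and the limit of block entropies\<close>

text \<open>Away from 0 this is continuity of the logarithm; at 0 the bound
  \<open>\<bar>y * ln y\<bar> \<le> 2 * sqrt y + y * y\<close> squeezes the sequence.\<close>

lemma xlog2x_tendsto: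
  fixes x :: "nat \<Rightarrow> real"
  assumes "x \<longlonglongrightarrow> l" "\<And>k. 0 \<le> x k" "0 \<le> l"
  shows "(\<lambda>k. x k * log 2 (x k)) \<longlonglongrightarrow> l * log 2 l"
proof (cases "l = 0")
  case False
  then show ?thesis using assms by (intro tendsto_mult tendsto_log tendsto_const) auto
next
  case True
  have b: "\<bar>y * ln y\<bar> \<le> 2 * sqrt y + y * y" if y: "0 \<le> y" for y :: real
  proof (cases "y = 0")
    case False
    then have y0: "y > 0" using y by simp
    have "ln (1 / sqrt y) \<le> 1 / sqrt y - 1" using y0 by (intro ln_le_minus_one) simp
    then have "- ln y \<le> 2 / sqrt y" using y0 by (simp add: ln_div ln_sqrt)
    then have "y * - ln y \<le> y * (2 / sqrt y)" using y0 by (intro mult_left_mono) auto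
    also have "\<dots> = 2 * sqrt y" using y0 by (simp add: field_simps)
    finally have 1: "- (y * ln y) \<le> 2 * sqrt y" by simp
    have "ln y \<le> y" using ln_le_minus_one[OF y0] by simp
    then have "y * ln y \<le> y * y" using y0 by (intro mult_left_mono) auto
    then show ?thesis using 1 y0 by (simp add: abs_le_iff add_increasing add_increasing2)
  qed simp
  have "(\<lambda>k. (2 * sqrt (x k) + x k * x k) / ln 2) \<longlonglongrightarrow> (2 * sqrt 0 + 0 * 0) / ln 2"
    using assms(1) True by (intro tendsto_intros) auto
  then have lim: "(\<lambda>k. (2 * sqrt (x k) + x k * x k) / ln 2) \<longlonglongrightarrow> 0" by simp
  have "(\<lambda>k. x k * log 2 (x k)) \<longlonglongrightarrow> 0"
    by (rule Lim_null_comparison[OF _ lim])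
       (use b[OF assms(2)] in \<open>auto simp: log_def intro!: always_eventually divide_right_mono\<close>)
  then show ?thesis using True by simp
qed

lemma ent_tendsto:
  fixes P :: "'w::finite \<Rightarrow> real"
  assumes "\<And>t. (\<lambda>k. Q k t) \<longlonglongrightarrow> P t" "\<And>k. fprob UNIV (Q k)" "fprob UNIV P"
  shows "(\<lambda>k. ent UNIV (Q k) f) \<longlonglongrightarrow> ent UNIV P f"
proof -
  have e: "ent UNIV p f = - (\<Sum>b\<in>range f. prb UNIV p f b * log 2 (prb UNIV p f b))" for p :: "'w \<Rightarrow> real"
    unfolding ent_def by (intro arg_cong[where f=uminus] sum.cong) auto
  have "(\<lambda>k. prb UNIV (Q k) f b) \<longlonglongrightarrow> prb UNIV P f b" for b
    unfolding prb_def by (intro tendsto_sum assms(1))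
  then show ?thesis unfolding e
    by (intro tendsto_minus tendsto_sum xlog2x_tendsto) (auto intro!: prb_nonneg assms)
qed

lemma ent_weight_cong:
  assumes "\<And>w. w \<in> Om \<Longrightarrow> p w = p' w"
  shows "ent Om p f = ent Om p' f"
proof -
  have "prb Om p f b = prb Om p' f b" for b unfolding prb_def using assms by (intro sum.cong) auto
  then show ?thesis by (simp only: ent_def)
qed

text \<open>The chain-rule lower bound and the codebook upper bound meet at H(T,G) - H(G|B) per
  letter, where T and G stand for the images under \<open>\<tau>\<close> and \<open>\<pi>\<close>.
  They meet because the \<open>k\<close>-th codebook has exponent at most I(G;B) +
  \<open>1 / (k + 1)\<close> and because \<open>\<kappa>\<close> depends on the code letter only
  through \<open>\<pi>\<close>.\<close>

lemma inner_limit: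
  fixes pb :: "'b::finite \<Rightarrow> real" and \<kappa> :: "'b \<Rightarrow> 'g::finite \<Rightarrow> 'o::finite \<Rightarrow> real"
    and P :: "'b \<times> 'g \<times> 'o \<Rightarrow> real" and \<tau> :: "'o \<Rightarrow> 't" and \<pi> :: "'g \<Rightarrow> 'h"
  assumes bc: "\<And>k. block_code pb \<kappa> (e k) (n k)"
    and Q: "\<And>t. (\<lambda>k. block_code.Q pb \<kappa> (e k) (n k) t) \<longlonglongrightarrow> P t"
    and P: "fprob UNIV P" "\<And>b g o'. P (b,g,o') = p0 b g * \<kappa> b g o'"
    and pb: "ent UNIV pb (\<lambda>b. b) = ent UNIV P (\<lambda>(b,g,o'). b)"
    and \<pi>: "\<And>b g g'. \<pi> g = \<pi> g' \<Longrightarrow> \<kappa> b g = \<kappa> b g'"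
    and card: "\<And>k. log 2 (card ((\<lambda>bs. map \<pi> (e k bs)) ` seqs UNIV (n k))) \<le>
       real (n k) * (ent UNIV P (\<lambda>(b,g,o'). \<pi> g) + ent UNIV P (\<lambda>(b,g,o'). b) - ent UNIV P (\<lambda>(b,g,o'). (b, \<pi> g)) + 1 / (real k + 1))"
  shows "(\<lambda>k. ent (block_code.blk (n k)) (block_code.bp pb \<kappa> (e k) (n k)) (\<lambda>w. (map \<tau> (snd w), map \<pi> (e k (fst w)))) / real (n k))
     \<longlonglongrightarrow> ent UNIV P (\<lambda>(b,g,o'). (\<tau> o', \<pi> g)) + ent UNIV P (\<lambda>(b,g,o'). b) - ent UNIV P (\<lambda>(b,g,o'). (b, \<pi> g))"
proof -
  let ?Q = "\<lambda>k. block_code.Q pb \<kappa> (e k) (n k)"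
  let ?x = "\<lambda>k. ent (block_code.blk (n k)) (block_code.bp pb \<kappa> (e k) (n k)) (\<lambda>w. (map \<tau> (snd w), map \<pi> (e k (fst w))))"
  let ?s = "\<lambda>q. \<Sum>(b,g,o')\<in>UNIV. q (b,g,o') * log 2 (\<Sum>o''\<in>UNIV. if \<tau> o'' = \<tau> o' then \<kappa> b g o'' else 0)"
  have n: "real (n k) > 0" for k using block_code.n[OF bc[of k]] by simp
  have tend1: "(\<lambda>k. ent UNIV (?Q k) (\<lambda>(b,g,o'). (b, (\<tau> o', \<pi> g)))) \<longlonglongrightarrow> ent UNIV P (\<lambda>(b,g,o'). (b, (\<tau> o', \<pi> g)))"
    by (rule ent_tendsto[OF Q block_code.fprob_Q[OF bc] P(1)])
  have tend2: "(\<lambda>k. ent UNIV (?Q k) (\<lambda>(b,g,o'). (\<tau> o', \<pi> g))) \<longlonglongrightarrow> ent UNIV P (\<lambda>(b,g,o'). (\<tau> o', \<pi> g))"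
    by (rule ent_tendsto[OF Q block_code.fprob_Q[OF bc] P(1)])
  have tend3: "(\<lambda>k. ent UNIV (?Q k) (\<lambda>(b,g,o'). \<pi> g)) \<longlonglongrightarrow> ent UNIV P (\<lambda>(b,g,o'). \<pi> g)"
    by (rule ent_tendsto[OF Q block_code.fprob_Q[OF bc] P(1)])
  have tends: "(\<lambda>k. ?s (?Q k)) \<longlonglongrightarrow> ?s P"
    unfolding case_prod_unfold by (intro tendsto_sum tendsto_mult tendsto_const) (simp add: Q)
  have \<kappa>1: "(\<Sum>o'\<in>UNIV. \<kappa> b g o') = 1" for b g using block_code.sum_\<kappa>[OF bc] .
  \<comment> \<open>Here the hypothesis on \<open>\<pi>\<close> enters: at the limit law the linear
    functional \<open>?s\<close> is minus a genuine conditional entropy, which lets the lower bound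
    match the upper one.\<close>
  have m: "ent UNIV P (\<lambda>(b,g,o'). (\<tau> o', (b, \<pi> g))) - ent UNIV P (\<lambda>(b,g,o'). (b, \<pi> g)) = - ?s P"
    by (rule markov_cond_ent[OF P \<kappa>1 \<pi>])
  have sw: "ent UNIV P (\<lambda>(b,g,o'). (b, (\<tau> o', \<pi> g))) = ent UNIV P (\<lambda>(b,g,o'). (\<tau> o', (b, \<pi> g)))"
    by (rule ent_cong) auto
  let ?L = "ent UNIV P (\<lambda>(b,g,o'). (\<tau> o', \<pi> g)) + ent UNIV P (\<lambda>(b,g,o'). b) - ent UNIV P (\<lambda>(b,g,o'). (b, \<pi> g))"
  have lo: "(\<lambda>k. ent UNIV pb (\<lambda>b. b) - ?s (?Q k) - (ent UNIV (?Q k) (\<lambda>(b,g,o'). (b, (\<tau> o', \<pi> g)))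
       - ent UNIV (?Q k) (\<lambda>(b,g,o'). (\<tau> o', \<pi> g)))) \<longlonglongrightarrow> ?L"
  proof -
    have "?L = ent UNIV pb (\<lambda>b. b) - ?s P - (ent UNIV P (\<lambda>(b,g,o'). (b, (\<tau> o', \<pi> g))) - ent UNIV P (\<lambda>(b,g,o'). (\<tau> o', \<pi> g)))"
      using m pb sw by linarith
    then show ?thesis by (simp only:) (intro tendsto_diff tendsto_const tends tend1 tend2)
  qed
  have up: "(\<lambda>k. (ent UNIV P (\<lambda>(b,g,o'). \<pi> g) + ent UNIV P (\<lambda>(b,g,o'). b) - ent UNIV P (\<lambda>(b,g,o'). (b, \<pi> g)) + 1 / (real k + 1))
       + (ent UNIV (?Q k) (\<lambda>(b,g,o'). (\<tau> o', \<pi> g)) - ent UNIV (?Q k) (\<lambda>(b,g,o'). \<pi> g))) \<longlonglongrightarrow> ?L"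
  proof -
    have z: "(\<lambda>k. 1 / (real k + 1)) \<longlonglongrightarrow> 0"
      using LIMSEQ_inverse_real_of_nat by (simp add: inverse_eq_divide add.commute)
    have "?L = (ent UNIV P (\<lambda>(b,g,o'). \<pi> g) + ent UNIV P (\<lambda>(b,g,o'). b) - ent UNIV P (\<lambda>(b,g,o'). (b, \<pi> g)) + 0)
       + (ent UNIV P (\<lambda>(b,g,o'). (\<tau> o', \<pi> g)) - ent UNIV P (\<lambda>(b,g,o'). \<pi> g))" by simp
    then show ?thesis by (simp only:) (intro tendsto_diff tendsto_add tendsto_const z tend2 tend3)
  qed
  show ?thesis
  proof (rule tendsto_sandwich[OF _ _ lo up]; intro always_eventually allI)
    fix k
    show "ent UNIV pb (\<lambda>b. b) - ?s (?Q k) - (ent UNIV (?Q k) (\<lambda>(b,g,o'). (b, (\<tau> o', \<pi> g)))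
       - ent UNIV (?Q k) (\<lambda>(b,g,o'). (\<tau> o', \<pi> g))) \<le> ?x k / real (n k)"
      using block_code.single_letter_lower[OF bc[of k], of \<tau> \<pi>] n[of k]
      by (simp only: pos_le_divide_eq mult.commute)
    have "?x k \<le> real (n k) * ((ent UNIV P (\<lambda>(b,g,o'). \<pi> g) + ent UNIV P (\<lambda>(b,g,o'). b) - ent UNIV P (\<lambda>(b,g,o'). (b, \<pi> g)) + 1 / (real k + 1))
       + (ent UNIV (?Q k) (\<lambda>(b,g,o'). (\<tau> o', \<pi> g)) - ent UNIV (?Q k) (\<lambda>(b,g,o'). \<pi> g)))"
      unfolding distrib_left[of "real (n k)" "_ + 1 / (real k + 1)"]
      using block_code.single_letter_upper'[OF bc[of k], of \<tau> \<pi>] card[of k] by linarith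
    then show "?x k / real (n k) \<le> (ent UNIV P (\<lambda>(b,g,o'). \<pi> g) + ent UNIV P (\<lambda>(b,g,o'). b) - ent UNIV P (\<lambda>(b,g,o'). (b, \<pi> g)) + 1 / (real k + 1))
       + (ent UNIV (?Q k) (\<lambda>(b,g,o'). (\<tau> o', \<pi> g)) - ent UNIV (?Q k) (\<lambda>(b,g,o'). \<pi> g))"
      using n[of k] by (simp only: pos_divide_le_eq mult.commute)
  qed
qed

text \<open>Outputs see the code letter (a,u,v) through \<open>a\<close> alone. The nesting of the
  tuple is that of the letter law \<open>Q\<close> of \<open>block_code\<close>.\<close>

definition chan :: "('b \<times> 'a \<times> 'u \<times> 'v \<Rightarrow> real) \<Rightarrow> ('b \<Rightarrow> 'a \<Rightarrow> 'o \<Rightarrow> real)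
    \<Rightarrow> 'b \<times> ('a \<times> 'u \<times> 'v) \<times> 'o \<Rightarrow> real" where
  "chan P \<kappa> = (\<lambda>(b,g,o'). P (b,g) * \<kappa> b (fst g) o')"

lemma fprob_chan:
  fixes P :: "'b::finite \<times> 'a::finite \<times> 'u::finite \<times> 'v::finite \<Rightarrow> real" and \<kappa> :: "'b \<Rightarrow> 'a \<Rightarrow> 'o::finite \<Rightarrow> real"
  assumes "fprob UNIV P" "\<And>b a. is_pmf (\<kappa> b a)"
  shows "fprob UNIV (chan P \<kappa>)"
proof -
  have "sum (chan P \<kappa>) UNIV = (\<Sum>b\<in>UNIV. \<Sum>g\<in>UNIV. P (b,g))"
    unfolding sum_UNIV_triple using assms(2) by (simp add: chan_def sum_distrib_left[symmetric] is_pmf_def)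
  also have "\<dots> = 1" using fprobD(3)[OF assms(1)] by (simp add: sum_UNIV_pair[symmetric])
  finally show ?thesis
    using fprobD(2)[OF assms(1)] assms(2) by (auto simp: fprob_def chan_def is_pmf_def)
qed

lemma ent_chan:
  fixes P :: "'b::finite \<times> 'a::finite \<times> 'u::finite \<times> 'v::finite \<Rightarrow> real" and \<kappa> :: "'b \<Rightarrow> 'a \<Rightarrow> 'o::finite \<Rightarrow> real"
  assumes "\<And>b a. is_pmf (\<kappa> b a)"
  shows "ent UNIV (chan P \<kappa>) (\<lambda>(b,g,o'). f (b,g)) = ent UNIV P f"
proof -
  have "prb UNIV (chan P \<kappa>) (\<lambda>(b,g,o'). f (b,g)) c = prb UNIV P f c" for c
  proof -
    have "(\<Sum>o'\<in>UNIV. if f (b,g) = c then P (b,g) * \<kappa> b (fst g) o' else 0) = (if f (b,g) = c then P (b,g) else 0)" for b g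
      using assms[of b "fst g"] by (simp add: is_pmf_def sum_distrib_left[symmetric])
    moreover have "prb UNIV (chan P \<kappa>) (\<lambda>(b,g,o'). f (b,g)) c
        = (\<Sum>b\<in>UNIV. \<Sum>g\<in>UNIV. \<Sum>o'\<in>UNIV. if f (b,g) = c then P (b,g) * \<kappa> b (fst g) o' else 0)"
      unfolding prb_eq_sum_if[OF finite_class.finite_UNIV]
      by (subst sum_UNIV_triple) (simp only: chan_def prod.case)
    moreover have "prb UNIV P f c = (\<Sum>b\<in>UNIV. \<Sum>g\<in>UNIV. if f (b,g) = c then P (b,g) else 0)"
      unfolding prb_eq_sum_if[OF finite_class.finite_UNIV] by (rule sum_UNIV_pair)
    ultimately show ?thesis by simp
  qed
  moreover have "range (\<lambda>(b,g,o'::'o). f (b,g)) = range f" by (auto simp: image_iff, blast)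
  ultimately show ?thesis by (simp only: ent_def)
qed

abbreviation "lent P \<kappa> \<equiv> ent UNIV (chan P \<kappa>)"

definition sblk :: "nat \<Rightarrow> ('b list \<times> 'o list) set" where
  "sblk n = seqs UNIV n \<times> seqs UNIV n"

text \<open>The block law of \<open>block_code\<close> with only the action word as channel input,
  so that it can be stated before the words for \<open>U\<close> and \<open>V\<close> are merged
  in.\<close>

definition sprob :: "('b \<Rightarrow> real) \<Rightarrow> ('b \<Rightarrow> 'a \<Rightarrow> 'o \<Rightarrow> real) \<Rightarrow> ('b list \<Rightarrow> 'a list) \<Rightarrow> nat \<Rightarrow> 'b list \<times> 'o list \<Rightarrow> real" where
  "sprob pb \<kappa> ea n = (\<lambda>(bs,os). iid pb n bs * (\<Prod>i<n. \<kappa> (bs ! i) (ea bs ! i) (os ! i)))"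

lemma log2_card_image_mono:
  assumes "finite S" "S \<noteq> {}" "\<And>x y. x \<in> S \<Longrightarrow> y \<in> S \<Longrightarrow> f' x = f' y \<Longrightarrow> f x = f y"
  shows "log 2 (card (f ` S)) \<le> log 2 (card (f' ` S))"
proof -
  define h where "h c = f (SOME x. x \<in> S \<and> f' x = c)" for c
  have "f x = h (f' x)" if "x \<in> S" for x
  proof -
    have "(SOME y. y \<in> S \<and> f' y = f' x) \<in> S \<and> f' (SOME y. y \<in> S \<and> f' y = f' x) = f' x"
      by (rule someI[of _ x]) (simp add: that)
    from assms(3)[OF conjunct1[OF this] that conjunct2[OF this]] show ?thesis unfolding h_def by simp
  qed
  then have "f ` S = (\<lambda>x. h (f' x)) ` S" by (rule image_cong[OF refl])
  then have "f ` S = h ` f' ` S" by (simp only: image_image)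
  then have "card (f ` S) \<le> card (f' ` S)" using assms(1) by (simp add: card_image_le)
  then show ?thesis using assms(1,2) by (intro log_mono) (auto simp: card_gt_0_iff)
qed

section \<open>The inner code\<close>

text \<open>A good block quantiser: all entropies of block variables are close to \<open>n\<close> times
  their single-letter values, up to terms \<open>H(A, U, V | B)\<close> that cancel below.\<close>
lemma inner_code:
  fixes P :: "'b::finite \<times> 'a::finite \<times> 'u::finite \<times> 'v::finite \<Rightarrow> real"
    and \<kappa> :: "'b \<Rightarrow> 'a \<Rightarrow> 'x::finite \<times> 'y::finite \<times> 'z::finite \<Rightarrow> real" and \<Gamma> :: "'a \<Rightarrow> real"
  assumes P: "fprob UNIV P" and \<kappa>: "\<And>b a. is_pmf (\<kappa> b a)" and \<epsilon>: "\<epsilon> > 0"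
  defines "pb \<equiv> prb UNIV P (\<lambda>(b,a,u,v). b)"
  defines "RW \<equiv> lent P \<kappa> (\<lambda>(b,(a,u,v),(x,y,z)). a) + lent P \<kappa> (\<lambda>(b,(a,u,v),(x,y,z)). b) - lent P \<kappa> (\<lambda>(b,(a,u,v),(x,y,z)). (b, (a, u, v)))
      + lent P \<kappa> (\<lambda>(b,(a,u,v),(x,y,z)). (y, (a, u, v))) - lent P \<kappa> (\<lambda>(b,(a,u,v),(x,y,z)). (y, a))"
    and "RK \<equiv> lent P \<kappa> (\<lambda>(b,(a,u,v),(x,y,z)). (z, (a, u, v))) - lent P \<kappa> (\<lambda>(b,(a,u,v),(x,y,z)). (z, (a, u)))
      - lent P \<kappa> (\<lambda>(b,(a,u,v),(x,y,z)). (y, (a, u, v))) + lent P \<kappa> (\<lambda>(b,(a,u,v),(x,y,z)). (y, (a, u)))"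
    and "L3 \<equiv> lent P \<kappa> (\<lambda>(b,(a,u,v),(x,y,z)). x) + lent P \<kappa> (\<lambda>(b,(a,u,v),(x,y,z)). (z, (a, u)))
      - lent P \<kappa> (\<lambda>(b,(a,u,v),(x,y,z)). ((x, z), (a, u)))"
    and "L2 \<equiv> lent P \<kappa> (\<lambda>(b,(a,u,v),(x,y,z)). x) + lent P \<kappa> (\<lambda>(b,(a,u,v),(x,y,z)). (z, (a, u)))
      + lent P \<kappa> (\<lambda>(b,(a,u,v),(x,y,z)). (y, (a, u, v))) - lent P \<kappa> (\<lambda>(b,(a,u,v),(x,y,z)). (y, (a, u)))
      - lent P \<kappa> (\<lambda>(b,(a,u,v),(x,y,z)). ((x, z), (a, u, v)))"
  shows "\<exists>n\<ge>1. \<exists>(ea :: 'b list \<Rightarrow> 'a list) (eu :: 'b list \<Rightarrow> 'u list) (ev :: 'b list \<Rightarrow> 'v list).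
     (\<forall>bs\<in>seqs UNIV n. length (ea bs) = n) \<and>
     (let H = (\<lambda>f. ent (sblk n) (sprob pb \<kappa> ea n) f) :: ('b list \<times> ('x \<times> 'y \<times> 'z) list \<Rightarrow> 'x list \<times> 'y list \<times> 'z list \<times> 'a list \<times> 'u list \<times> 'v list) \<Rightarrow> real;
          A = (\<lambda>w. ea (fst w)); U = (\<lambda>w. eu (fst w)); V = (\<lambda>w. ev (fst w));
          X = (\<lambda>w. map fst (snd w)); Y = (\<lambda>w. map (\<lambda>t. fst (snd t)) (snd w)); Z = (\<lambda>w. map (\<lambda>t. snd (snd t)) (snd w));
          H_AY = H (\<lambda>w. ([], Y w, [], A w, [], [])); H_AUY = H (\<lambda>w. ([], Y w, [], A w, U w, []));
          H_AUVY = H (\<lambda>w. ([], Y w, [], A w, U w, V w)); H_AUZ = H (\<lambda>w. ([], [], Z w, A w, U w, []));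
          H_AUVZ = H (\<lambda>w. ([], [], Z w, A w, U w, V w)); H_AUXZ = H (\<lambda>w. (X w, [], Z w, A w, U w, []));
          H_AUVXZ = H (\<lambda>w. (X w, [], Z w, A w, U w, V w)); H_X = H (\<lambda>w. (X w, [], [], [], [], []))
      in log 2 (card (ea ` seqs UNIV n)) + H_AUVY - H_AY \<le> real n * (RW + \<epsilon>)
       \<and> (H_AUVZ - H_AUZ) - (H_AUVY - H_AUY) \<ge> real n * (RK - \<epsilon>)
       \<and> H_X + H_AUZ - H_AUXZ \<le> real n * (L3 + \<epsilon>)
       \<and> H_X + H_AUZ - H_AUXZ + (H_AUVY - H_AUY) - (H_AUVXZ - H_AUXZ) \<le> real n * (L2 + \<epsilon>))
     \<and> (\<Sum>bs\<in>seqs UNIV n. iid pb n bs * (\<Sum>i<n. \<Gamma> (ea bs ! i))) \<le> real n * ((\<Sum>(b,a,u,v)\<in>UNIV. P (b,a,u,v) * \<Gamma> a) + \<epsilon>)"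
proof -
  define \<kappa>' where "\<kappa>' b g = \<kappa> b (fst g)" for b and g :: "'a \<times> 'u \<times> 'v"
  define I1 where "I1 = (ent UNIV P (\<lambda>(b,a,u,v). (a, ())) - ent UNIV P (\<lambda>_. ()))
      - (ent UNIV P (\<lambda>(b,a,u,v). (a, b)) - ent UNIV P (\<lambda>(b,a,u,v). b))"
  define I2 where "I2 = (ent UNIV P (\<lambda>(b,a,u,v). (u, a)) - ent UNIV P (\<lambda>(b,a,u,v). a))
      - (ent UNIV P (\<lambda>(b,a,u,v). (u, (b, a))) - ent UNIV P (\<lambda>(b,a,u,v). (b, a)))"
  define I3 where "I3 = (ent UNIV P (\<lambda>(b,a,u,v). (v, (a, u))) - ent UNIV P (\<lambda>(b,a,u,v). (a, u)))
      - (ent UNIV P (\<lambda>(b,a,u,v). (v, (b, a, u))) - ent UNIV P (\<lambda>(b,a,u,v). (b, a, u)))"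
  \<comment> \<open>Covering at tolerance \<open>1 / (k + 1)\<close>. A whole sequence of codes is
    needed because block entropies are identified only as the letter law converges.\<close>
  define good where "good k n ea eu ev \<longleftrightarrow> n \<ge> 1 \<and>
     (\<forall>bs\<in>seqs UNIV n. length (ea bs) = n \<and> length (eu bs) = n \<and> length (ev bs) = n) \<and>
     log 2 (card (ea ` seqs UNIV n)) \<le> real n * (I1 + 1 / (real k + 1)) \<and>
     log 2 (card ((\<lambda>bs. (ea bs, eu bs)) ` seqs UNIV n)) \<le> real n * (I1 + I2 + 1 / (real k + 1)) \<and>
     log 2 (card ((\<lambda>bs. ((ea bs, eu bs), ev bs)) ` seqs UNIV n)) \<le> real n * (I1 + I2 + I3 + 1 / (real k + 1)) \<and>
     (\<forall>t. \<bar>(\<Sum>bs\<in>seqs UNIV n. iid pb n bs * freq n (\<lambda>i. (bs ! i, ea bs ! i, eu bs ! i, ev bs ! i)) t) - P t\<bar> \<le> 1 / (real k + 1))"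
    for k n :: nat and ea :: "'b list \<Rightarrow> 'a list" and eu :: "'b list \<Rightarrow> 'u list" and ev :: "'b list \<Rightarrow> 'v list"
  have "\<exists>n ea eu ev. good k n ea eu ev" for k
    using covering[OF P, of "1 / (real k + 1)"] unfolding good_def pb_def I1_def I2_def I3_def by simp
  then have "\<exists>c. good k (fst c) (fst (snd c)) (fst (snd (snd c))) (snd (snd (snd c)))" for k by simp
  then obtain c where c: "\<And>k. good k (fst (c k)) (fst (snd (c k))) (fst (snd (snd (c k)))) (snd (snd (snd (c k))))"
    by metis
  define n where "n k = fst (c k)" for k
  define ea where "ea k = fst (snd (c k))" for k
  define eu where "eu k = fst (snd (snd (c k)))" for k
  define ev where "ev k = snd (snd (snd (c k)))" for k
  have g: "good k (n k) (ea k) (eu k) (ev k)" for k unfolding n_def ea_def eu_def ev_def by (rule c)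
  have n: "n k \<ge> 1"
    and len: "\<forall>bs\<in>seqs UNIV (n k). length (ea k bs) = n k \<and> length (eu k bs) = n k \<and> length (ev k bs) = n k"
    and c1: "log 2 (card (ea k ` seqs UNIV (n k))) \<le> real (n k) * (I1 + 1 / (real k + 1))"
    and c2: "log 2 (card ((\<lambda>bs. (ea k bs, eu k bs)) ` seqs UNIV (n k))) \<le> real (n k) * (I1 + I2 + 1 / (real k + 1))"
    and c3: "log 2 (card ((\<lambda>bs. ((ea k bs, eu k bs), ev k bs)) ` seqs UNIV (n k))) \<le> real (n k) * (I1 + I2 + I3 + 1 / (real k + 1))"
    and avg: "\<And>t. \<bar>(\<Sum>bs\<in>seqs UNIV (n k). iid pb (n k) bs * freq (n k) (\<lambda>i. (bs ! i, ea k bs ! i, eu k bs ! i, ev k bs ! i)) t) - P t\<bar> \<le> 1 / (real k + 1)"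
    for k using g[of k] unfolding good_def by blast+
  \<comment> \<open>The three words are merged into one word over code letters (a,u,v); projections
    then recover A, (A,U) or all three.\<close>
  define e where "e k bs = zip (ea k bs) (zip (eu k bs) (ev k bs))" for k bs
  have fst4: "(\<lambda>(b,a,u,v). b) = (fst :: 'b \<times> 'a \<times> 'u \<times> 'v \<Rightarrow> 'b)" by (simp add: fun_eq_iff)
  have pbp: "is_pmf pb"
  proof -
    have eq: "prb UNIV P (\<lambda>w. (fst w, ())) (b, ()) = pb b" for b
      unfolding pb_def fst4 by (rule prb_cong) simp
    have "(\<Sum>b\<in>UNIV. prb UNIV P (\<lambda>w. (fst w, ())) (b, ())) = prb UNIV P (\<lambda>_. ()) ()" by (rule sum_prb_UNIV)
    also have "\<dots> = 1" using fprobD(3)[OF P] by (simp add: prb_def)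
    finally have "sum pb UNIV = 1" unfolding eq .
    then show ?thesis unfolding is_pmf_def by (simp add: pb_def prb_nonneg[OF P])
  qed
  have e_len: "length (e k bs) = n k" if "bs \<in> seqs UNIV (n k)" for k bs
    using len[of k] that by (simp add: e_def)
  have e_nth: "e k bs ! i = (ea k bs ! i, eu k bs ! i, ev k bs ! i)" if "bs \<in> seqs UNIV (n k)" "i < n k" for k bs i
    using len[of k] that by (simp add: e_def)
  have bc: "block_code pb \<kappa>' (e k) (n k)" for k
    by unfold_locales (use pbp \<kappa> e_len n in \<open>auto simp: \<kappa>'_def\<close>)
  have chan: "chan P \<kappa> = (\<lambda>(b,g,o'). P (b,g) * \<kappa>' b g o')" by (simp add: chan_def \<kappa>'_def)
  have z: "(\<lambda>k. 1 / (real k + 1)) \<longlonglongrightarrow> 0"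
    using LIMSEQ_inverse_real_of_nat by (simp add: inverse_eq_divide add.commute)
  have q: "(\<lambda>k. block_code.q pb (e k) (n k) b g) \<longlonglongrightarrow> P (b,g)" for b g
  proof (rule Lim_transform2[OF tendsto_const], rule Lim_null_comparison[OF _ z])
    have "block_code.q pb (e k) (n k) b g
        = (\<Sum>bs\<in>seqs UNIV (n k). iid pb (n k) bs * freq (n k) (\<lambda>i. (bs ! i, ea k bs ! i, eu k bs ! i, ev k bs ! i)) (b,g))" for k
      unfolding block_code.q_def[OF bc]
    proof (intro sum.cong refl arg_cong2[where f="(*)"])
      fix bs :: "'b list" assume bs: "bs \<in> seqs UNIV (n k)"
      have "{i. i < n k \<and> (bs ! i, e k bs ! i) = (b,g)} = {i. i < n k \<and> (bs ! i, ea k bs ! i, eu k bs ! i, ev k bs ! i) = (b,g)}"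
        using e_nth[OF bs] by auto
      then show "freq (n k) (\<lambda>i. (bs ! i, e k bs ! i)) (b,g) = freq (n k) (\<lambda>i. (bs ! i, ea k bs ! i, eu k bs ! i, ev k bs ! i)) (b,g)"
        by (simp add: freq_def)
    qed
    then show "\<forall>\<^sub>F k in sequentially. norm (P (b,g) - block_code.q pb (e k) (n k) b g) \<le> 1 / (real k + 1)"
      using avg by (intro always_eventually allI) (simp add: abs_minus_commute)
  qed
  have Q: "(\<lambda>k. block_code.Q pb \<kappa>' (e k) (n k) t) \<longlonglongrightarrow> chan P \<kappa> t" for t
    unfolding block_code.Q_def[OF bc] chan by (cases t) (auto intro!: tendsto_mult tendsto_const q)
  have C: "fprob UNIV (chan P \<kappa>)" by (rule fprob_chan[where \<kappa>=\<kappa>, OF P \<kappa>])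
  have Cf: "chan P \<kappa> (b,g,o') = (\<lambda>b g. P (b,g)) b g * \<kappa>' b g o'" for b g o' by (simp add: chan)
  define A where "A k w = ea k (fst w)" for k and w :: "'b list \<times> ('x \<times> 'y \<times> 'z) list"
  define U where "U k w = eu k (fst w)" for k and w :: "'b list \<times> ('x \<times> 'y \<times> 'z) list"
  define V where "V k w = ev k (fst w)" for k and w :: "'b list \<times> ('x \<times> 'y \<times> 'z) list"
  define X where "X w = map fst (snd w)" for w :: "'b list \<times> ('x \<times> 'y \<times> 'z) list"
  define Y where "Y w = map (\<lambda>t. fst (snd t)) (snd w)" for w :: "'b list \<times> ('x \<times> 'y \<times> 'z) list"
  define Z where "Z w = map (\<lambda>t. snd (snd t)) (snd w)" for w :: "'b list \<times> ('x \<times> 'y \<times> 'z) list"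
  \<comment> \<open>All block variables share one sextuple type, with \<open>[]\<close> in the slots
    that do not occur, so that a single monomorphic \<open>H\<close> names every entropy.\<close>
  define H where "H k f = ent (sblk (n k)) (sprob pb \<kappa> (ea k) (n k)) f"
    for k and f :: "'b list \<times> ('x \<times> 'y \<times> 'z) list \<Rightarrow> 'x list \<times> 'y list \<times> 'z list \<times> 'a list \<times> 'u list \<times> 'v list"
  have Heq: "H k f = ent (block_code.blk (n k)) (block_code.bp pb \<kappa>' (e k) (n k)) f" for k f
  proof -
    have 1: "sblk (n k) = (block_code.blk (n k) :: ('b list \<times> ('x \<times> 'y \<times> 'z) list) set)" unfolding sblk_def block_code.blk_def[OF bc] ..
    have 2: "sprob pb \<kappa> (ea k) (n k) w = block_code.bp pb \<kappa>' (e k) (n k) w" if "w \<in> block_code.blk (n k)"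
      for w :: "'b list \<times> ('x \<times> 'y \<times> 'z) list"
      using that unfolding sprob_def block_code.bp_def[OF bc] block_code.blk_def[OF bc]
      by (auto simp: \<kappa>'_def e_nth intro!: prod.cong)
    show ?thesis unfolding H_def 1 by (rule ent_weight_cong[OF 2])
  qed
  \<comment> \<open>Block entropies converge to their single-letter values plus
    \<open>hB - hA\<close>, \<open>hB - hU\<close> or \<open>hB - hV\<close>, that is, minus H(A|B),
    H(A,U|B) or H(A,U,V|B), depending on the code letters they contain.\<close>
  define hB where "hB = lent P \<kappa> (\<lambda>(b,(a,u,v),(x,y,z)). b)"
  define hA where "hA = lent P \<kappa> (\<lambda>(b,(a,u,v),(x,y,z)). (b, a))"
  define hU where "hU = lent P \<kappa> (\<lambda>(b,(a,u,v),(x,y,z)). (b, (a, u)))"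
  define hV where "hV = lent P \<kappa> (\<lambda>(b,(a,u,v),(x,y,z)). (b, (a, u, v)))"
  have pbE: "ent UNIV pb (\<lambda>b. b) = lent P \<kappa> (\<lambda>(b,g,o'). b)"
  proof -
    have "lent P \<kappa> (\<lambda>(b,g,o'). b) = ent UNIV P (\<lambda>(b,a,u,v). b)"
      using ent_chan[where \<kappa>=\<kappa> and P=P and f="\<lambda>(b,a,u,v). b", OF \<kappa>] by (simp add: case_prod_unfold)
    moreover have "ent UNIV P fst = ent UNIV pb (\<lambda>b. b)"
    proof -
      have "prb UNIV pb (\<lambda>b. b) b = prb UNIV P fst b" for b
        by (simp add: prb_eq_sum_if pb_def fst4)
      moreover have "range (fst :: 'b \<times> 'a \<times> 'u \<times> 'v \<Rightarrow> 'b) = range (\<lambda>b. b)" by simp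
      ultimately show ?thesis by (simp only: ent_def)
    qed
    ultimately show ?thesis by (simp only: fst4)
  qed
  have eqA: "(map fst (e k bs) = map fst (e k bs')) = (ea k bs = ea k bs')"
    and eqU: "(map (\<lambda>g. (fst g, fst (snd g))) (e k bs) = map (\<lambda>g. (fst g, fst (snd g))) (e k bs')) = (ea k bs = ea k bs' \<and> eu k bs = eu k bs')"
    and eqV: "(map (\<lambda>g. g) (e k bs) = map (\<lambda>g. g) (e k bs')) = (ea k bs = ea k bs' \<and> eu k bs = eu k bs' \<and> ev k bs = ev k bs')"
    if m: "bs \<in> seqs UNIV (n k)" "bs' \<in> seqs UNIV (n k)" for k bs bs'
  proof -
    have l: "length (ea k bs) = n k" "length (eu k bs) = n k" "length (ev k bs) = n k"
      "length (ea k bs') = n k" "length (eu k bs') = n k" "length (ev k bs') = n k"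
      using len[of k] m by auto
    have nt: "e k bs ! i = (ea k bs ! i, eu k bs ! i, ev k bs ! i)" "e k bs' ! i = (ea k bs' ! i, eu k bs' ! i, ev k bs' ! i)"
      if "i < n k" for i using e_nth m that by auto
    show "(map fst (e k bs) = map fst (e k bs')) = (ea k bs = ea k bs')"
      "(map (\<lambda>g. (fst g, fst (snd g))) (e k bs) = map (\<lambda>g. (fst g, fst (snd g))) (e k bs')) = (ea k bs = ea k bs' \<and> eu k bs = eu k bs')"
      "(map (\<lambda>g. g) (e k bs) = map (\<lambda>g. g) (e k bs')) = (ea k bs = ea k bs' \<and> eu k bs = eu k bs' \<and> ev k bs = ev k bs')"
      unfolding list_eq_iff_nth_eq using nt l e_len m by auto
  qed
  have S: "seqs UNIV (n k) \<noteq> ({} :: 'b list set)" for k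
  proof -
    have "replicate (n k) undefined \<in> (seqs UNIV (n k) :: 'b list set)" by (simp add: seqs_def)
    then show ?thesis by blast
  qed
  note lg = log2_card_image_mono[OF finite_seqs[OF finite_class.finite_UNIV] S]
  \<comment> \<open>The chain rule for mutual information: the codebook exponents telescope to
    I(A;B), I(A,U;B) and I(A,U,V;B), the exponents that \<open>inner_limit\<close> expects.\<close>
  have I1: "I1 = lent P \<kappa> (\<lambda>(b,g,o'). fst g) + lent P \<kappa> (\<lambda>(b,g,o'). b) - lent P \<kappa> (\<lambda>(b,g,o'). (b, fst g))"
    and I2: "I1 + I2 = lent P \<kappa> (\<lambda>(b,g,o'). (fst g, fst (snd g))) + lent P \<kappa> (\<lambda>(b,g,o'). b) - lent P \<kappa> (\<lambda>(b,g,o'). (b, (fst g, fst (snd g))))"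
    and I3: "I1 + I2 + I3 = lent P \<kappa> (\<lambda>(b,g,o'). g) + lent P \<kappa> (\<lambda>(b,g,o'). b) - lent P \<kappa> (\<lambda>(b,g,o'). (b, g))"
  proof -
    have c: "ent UNIV P (\<lambda>_. ()) = 0" by (rule ent_const[OF P])
    have e1: "ent UNIV P (\<lambda>(b,a,u,v). (a, ())) = lent P \<kappa> (\<lambda>(b,g,o'). fst g)"
      "ent UNIV P (\<lambda>(b,a,u,v). a) = lent P \<kappa> (\<lambda>(b,g,o'). fst g)"
      using ent_chan[where \<kappa>=\<kappa> and P=P and f="\<lambda>(b,a,u,v). a", OF \<kappa>] ent_cong[of UNIV "\<lambda>(b,a,u,v). (a, ())" "\<lambda>(b,a,u,v). a" P]
      by (simp_all add: case_prod_unfold)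
    have e2: "ent UNIV P (\<lambda>(b,a,u,v). b) = lent P \<kappa> (\<lambda>(b,g,o'). b)"
      using ent_chan[where \<kappa>=\<kappa> and P=P and f="\<lambda>(b,a,u,v). b", OF \<kappa>] by (simp add: case_prod_unfold)
    have e3: "ent UNIV P (\<lambda>(b,a,u,v). (a, b)) = lent P \<kappa> (\<lambda>(b,g,o'). (b, fst g))"
      "ent UNIV P (\<lambda>(b,a,u,v). (b, a)) = lent P \<kappa> (\<lambda>(b,g,o'). (b, fst g))"
      using ent_chan[where \<kappa>=\<kappa> and P=P and f="\<lambda>(b,a,u,v). (b, a)", OF \<kappa>] ent_cong[of UNIV "\<lambda>(b,a,u,v). (a, b)" "\<lambda>(b,a,u,v). (b, a)" P]
      by (auto simp add: case_prod_unfold)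
    have e4: "ent UNIV P (\<lambda>(b,a,u,v). (u, a)) = lent P \<kappa> (\<lambda>(b,g,o'). (fst g, fst (snd g)))"
      "ent UNIV P (\<lambda>(b,a,u,v). (a, u)) = lent P \<kappa> (\<lambda>(b,g,o'). (fst g, fst (snd g)))"
      using ent_chan[where \<kappa>=\<kappa> and P=P and f="\<lambda>(b,a,u,v). (a, u)", OF \<kappa>] ent_cong[of UNIV "\<lambda>(b,a,u,v). (u, a)" "\<lambda>(b,a,u,v). (a, u)" P]
      by (auto simp add: case_prod_unfold)
    have e5: "ent UNIV P (\<lambda>(b,a,u,v). (u, (b, a))) = lent P \<kappa> (\<lambda>(b,g,o'). (b, (fst g, fst (snd g))))"
      "ent UNIV P (\<lambda>(b,a,u,v). (b, a, u)) = lent P \<kappa> (\<lambda>(b,g,o'). (b, (fst g, fst (snd g))))"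
      using ent_chan[where \<kappa>=\<kappa> and P=P and f="\<lambda>(b,a,u,v). (b, a, u)", OF \<kappa>] ent_cong[of UNIV "\<lambda>(b,a,u,v). (u, (b, a))" "\<lambda>(b,a,u,v). (b, a, u)" P]
      by (auto simp add: case_prod_unfold)
    have "ent UNIV P (\<lambda>(b,a,u,v). (v, (a, u))) = ent UNIV P (\<lambda>(b,a,u,v). (a, u, v))"
      by (rule ent_cong) auto
    then have e6: "ent UNIV P (\<lambda>(b,a,u,v). (v, (a, u))) = lent P \<kappa> (\<lambda>(b,g,o'). g)"
      using ent_chan[where \<kappa>=\<kappa> and P=P and f="\<lambda>(b,a,u,v). (a, u, v)", OF \<kappa>] by (simp add: case_prod_unfold)
    have "ent UNIV P (\<lambda>(b,a,u,v). (v, (b, a, u))) = ent UNIV P (\<lambda>(b,a,u,v). (b, a, u, v))"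
      by (rule ent_cong) auto
    then have e7: "ent UNIV P (\<lambda>(b,a,u,v). (v, (b, a, u))) = lent P \<kappa> (\<lambda>(b,g,o'). (b, g))"
      using ent_chan[where \<kappa>=\<kappa> and P=P and f="\<lambda>(b,a,u,v). (b, a, u, v)", OF \<kappa>] by (simp add: case_prod_unfold)
    show "I1 = lent P \<kappa> (\<lambda>(b,g,o'). fst g) + lent P \<kappa> (\<lambda>(b,g,o'). b) - lent P \<kappa> (\<lambda>(b,g,o'). (b, fst g))"
      "I1 + I2 = lent P \<kappa> (\<lambda>(b,g,o'). (fst g, fst (snd g))) + lent P \<kappa> (\<lambda>(b,g,o'). b) - lent P \<kappa> (\<lambda>(b,g,o'). (b, (fst g, fst (snd g))))"
      "I1 + I2 + I3 = lent P \<kappa> (\<lambda>(b,g,o'). g) + lent P \<kappa> (\<lambda>(b,g,o'). b) - lent P \<kappa> (\<lambda>(b,g,o'). (b, g))"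
      unfolding I1_def I2_def I3_def c e1 e2 e3 e4 e5 e6 e7 by simp_all
  qed
  have cA: "log 2 (card ((\<lambda>bs. map fst (e k bs)) ` seqs UNIV (n k))) \<le> real (n k) *
     (lent P \<kappa> (\<lambda>(b,g,o'). fst g) + lent P \<kappa> (\<lambda>(b,g,o'). b) - lent P \<kappa> (\<lambda>(b,g,o'). (b, fst g)) + 1 / (real k + 1))" for k
    unfolding I1[symmetric] by (rule order_trans[OF lg c1]) (simp only: eqA)
  have cU: "log 2 (card ((\<lambda>bs. map (\<lambda>g. (fst g, fst (snd g))) (e k bs)) ` seqs UNIV (n k))) \<le> real (n k) *
     (lent P \<kappa> (\<lambda>(b,g,o'). (fst g, fst (snd g))) + lent P \<kappa> (\<lambda>(b,g,o'). b) - lent P \<kappa> (\<lambda>(b,g,o'). (b, (fst g, fst (snd g)))) + 1 / (real k + 1))" for k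
    unfolding I2[symmetric] by (rule order_trans[OF lg c2]) (simp only: eqU prod.inject)
  have cV: "log 2 (card ((\<lambda>bs. map (\<lambda>g. g) (e k bs)) ` seqs UNIV (n k))) \<le> real (n k) *
     (lent P \<kappa> (\<lambda>(b,g,o'). g) + lent P \<kappa> (\<lambda>(b,g,o'). b) - lent P \<kappa> (\<lambda>(b,g,o'). (b, g)) + 1 / (real k + 1))" for k
    unfolding I3[symmetric] by (rule order_trans[OF lg c3]) (simp only: eqV prod.inject)
  \<comment> \<open>Outputs depend on the code letter through the action, so
    \<open>\<kappa>'\<close> factors through every projection that retains \<open>a\<close>.\<close>
  have kA: "fst g = fst g' \<Longrightarrow> \<kappa>' b g = \<kappa>' b g'"
    and kU: "(fst g, fst (snd g)) = (fst g', fst (snd g')) \<Longrightarrow> \<kappa>' b g = \<kappa>' b g'"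
    and kV: "g = g' \<Longrightarrow> \<kappa>' b g = \<kappa>' b g'" for b g g'
    by (simp_all add: \<kappa>'_def)
  have lAY: "(\<lambda>k. H k (\<lambda>w. ([], Y w, [], A k w, [], [])) / real (n k)) \<longlonglongrightarrow> lent P \<kappa> (\<lambda>(b,(a,u,v),(x,y,z)). (y, a)) + hB - hA"
  proof -
    have "H k (\<lambda>w. ([], Y w, [], A k w, [], [])) = ent (block_code.blk (n k)) (block_code.bp pb \<kappa>' (e k) (n k))
        (\<lambda>w. (map (\<lambda>t. fst (snd t)) (snd w), map (fst) (e k (fst w))))" for k
      unfolding Heq
    proof (rule ent_cong)
      fix w w' :: "'b list \<times> ('x \<times> 'y \<times> 'z) list"
      assume "w \<in> block_code.blk (n k)" "w' \<in> block_code.blk (n k)"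
      then have m: "fst w \<in> seqs UNIV (n k)" "fst w' \<in> seqs UNIV (n k)" "length (snd w) = length (snd w')"
        unfolding block_code.blk_def[OF bc] by (auto simp: seqs_length)
      show "(([], Y w, [], A k w, [], []) = ([], Y w', [], A k w', [], []))
        = ((map (\<lambda>t. fst (snd t)) (snd w), map (fst) (e k (fst w))) = (map (\<lambda>t. fst (snd t)) (snd w'), map (fst) (e k (fst w'))))"
        using eqA[OF m(1,2)] map_pair_eq_iff[OF m(3), of fst "\<lambda>t. snd (snd t)"] by (auto simp: A_def U_def V_def X_def Y_def Z_def)
    qed (rule fprobD(1)[OF block_code.fprob_blk[OF bc]])
    moreover have "(\<lambda>k. ent (block_code.blk (n k)) (block_code.bp pb \<kappa>' (e k) (n k))
        (\<lambda>w. (map (\<lambda>t. fst (snd t)) (snd w), map (fst) (e k (fst w)))) / real (n k)) \<longlonglongrightarrow> lent P \<kappa> (\<lambda>(b,(a,u,v),(x,y,z)). (y, a)) + hB - hA"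
      using inner_limit[OF bc Q C Cf pbE kA cA, of "\<lambda>t. fst (snd t)"] by (simp add: case_prod_unfold hB_def hA_def hU_def hV_def)
    ultimately show ?thesis by simp
  qed
  have lAUY: "(\<lambda>k. H k (\<lambda>w. ([], Y w, [], A k w, U k w, [])) / real (n k)) \<longlonglongrightarrow> lent P \<kappa> (\<lambda>(b,(a,u,v),(x,y,z)). (y, (a, u))) + hB - hU"
  proof -
    have "H k (\<lambda>w. ([], Y w, [], A k w, U k w, [])) = ent (block_code.blk (n k)) (block_code.bp pb \<kappa>' (e k) (n k))
        (\<lambda>w. (map (\<lambda>t. fst (snd t)) (snd w), map (\<lambda>g. (fst g, fst (snd g))) (e k (fst w))))" for k
      unfolding Heq
    proof (rule ent_cong)
      fix w w' :: "'b list \<times> ('x \<times> 'y \<times> 'z) list"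
      assume "w \<in> block_code.blk (n k)" "w' \<in> block_code.blk (n k)"
      then have m: "fst w \<in> seqs UNIV (n k)" "fst w' \<in> seqs UNIV (n k)" "length (snd w) = length (snd w')"
        unfolding block_code.blk_def[OF bc] by (auto simp: seqs_length)
      show "(([], Y w, [], A k w, U k w, []) = ([], Y w', [], A k w', U k w', []))
        = ((map (\<lambda>t. fst (snd t)) (snd w), map (\<lambda>g. (fst g, fst (snd g))) (e k (fst w))) = (map (\<lambda>t. fst (snd t)) (snd w'), map (\<lambda>g. (fst g, fst (snd g))) (e k (fst w'))))"
        using eqU[OF m(1,2)] map_pair_eq_iff[OF m(3), of fst "\<lambda>t. snd (snd t)"] by (auto simp: A_def U_def V_def X_def Y_def Z_def)
    qed (rule fprobD(1)[OF block_code.fprob_blk[OF bc]])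
    moreover have "(\<lambda>k. ent (block_code.blk (n k)) (block_code.bp pb \<kappa>' (e k) (n k))
        (\<lambda>w. (map (\<lambda>t. fst (snd t)) (snd w), map (\<lambda>g. (fst g, fst (snd g))) (e k (fst w)))) / real (n k)) \<longlonglongrightarrow> lent P \<kappa> (\<lambda>(b,(a,u,v),(x,y,z)). (y, (a, u))) + hB - hU"
      using inner_limit[OF bc Q C Cf pbE kU cU, of "\<lambda>t. fst (snd t)"] by (simp add: case_prod_unfold hB_def hA_def hU_def hV_def)
    ultimately show ?thesis by simp
  qed
  have lAUVY: "(\<lambda>k. H k (\<lambda>w. ([], Y w, [], A k w, U k w, V k w)) / real (n k)) \<longlonglongrightarrow> lent P \<kappa> (\<lambda>(b,(a,u,v),(x,y,z)). (y, (a, u, v))) + hB - hV"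
  proof -
    have "H k (\<lambda>w. ([], Y w, [], A k w, U k w, V k w)) = ent (block_code.blk (n k)) (block_code.bp pb \<kappa>' (e k) (n k))
        (\<lambda>w. (map (\<lambda>t. fst (snd t)) (snd w), map (\<lambda>g. g) (e k (fst w))))" for k
      unfolding Heq
    proof (rule ent_cong)
      fix w w' :: "'b list \<times> ('x \<times> 'y \<times> 'z) list"
      assume "w \<in> block_code.blk (n k)" "w' \<in> block_code.blk (n k)"
      then have m: "fst w \<in> seqs UNIV (n k)" "fst w' \<in> seqs UNIV (n k)" "length (snd w) = length (snd w')"
        unfolding block_code.blk_def[OF bc] by (auto simp: seqs_length)
      show "(([], Y w, [], A k w, U k w, V k w) = ([], Y w', [], A k w', U k w', V k w'))
        = ((map (\<lambda>t. fst (snd t)) (snd w), map (\<lambda>g. g) (e k (fst w))) = (map (\<lambda>t. fst (snd t)) (snd w'), map (\<lambda>g. g) (e k (fst w'))))"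
        using eqV[OF m(1,2)] map_pair_eq_iff[OF m(3), of fst "\<lambda>t. snd (snd t)"] by (auto simp: A_def U_def V_def X_def Y_def Z_def)
    qed (rule fprobD(1)[OF block_code.fprob_blk[OF bc]])
    moreover have "(\<lambda>k. ent (block_code.blk (n k)) (block_code.bp pb \<kappa>' (e k) (n k))
        (\<lambda>w. (map (\<lambda>t. fst (snd t)) (snd w), map (\<lambda>g. g) (e k (fst w)))) / real (n k)) \<longlonglongrightarrow> lent P \<kappa> (\<lambda>(b,(a,u,v),(x,y,z)). (y, (a, u, v))) + hB - hV"
      using inner_limit[OF bc Q C Cf pbE kV cV, of "\<lambda>t. fst (snd t)"] by (simp add: case_prod_unfold hB_def hA_def hU_def hV_def)
    ultimately show ?thesis by simp
  qed
  have lAUZ: "(\<lambda>k. H k (\<lambda>w. ([], [], Z w, A k w, U k w, [])) / real (n k)) \<longlonglongrightarrow> lent P \<kappa> (\<lambda>(b,(a,u,v),(x,y,z)). (z, (a, u))) + hB - hU"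
  proof -
    have "H k (\<lambda>w. ([], [], Z w, A k w, U k w, [])) = ent (block_code.blk (n k)) (block_code.bp pb \<kappa>' (e k) (n k))
        (\<lambda>w. (map (\<lambda>t. snd (snd t)) (snd w), map (\<lambda>g. (fst g, fst (snd g))) (e k (fst w))))" for k
      unfolding Heq
    proof (rule ent_cong)
      fix w w' :: "'b list \<times> ('x \<times> 'y \<times> 'z) list"
      assume "w \<in> block_code.blk (n k)" "w' \<in> block_code.blk (n k)"
      then have m: "fst w \<in> seqs UNIV (n k)" "fst w' \<in> seqs UNIV (n k)" "length (snd w) = length (snd w')"
        unfolding block_code.blk_def[OF bc] by (auto simp: seqs_length)
      show "(([], [], Z w, A k w, U k w, []) = ([], [], Z w', A k w', U k w', []))
        = ((map (\<lambda>t. snd (snd t)) (snd w), map (\<lambda>g. (fst g, fst (snd g))) (e k (fst w))) = (map (\<lambda>t. snd (snd t)) (snd w'), map (\<lambda>g. (fst g, fst (snd g))) (e k (fst w'))))"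
        using eqU[OF m(1,2)] map_pair_eq_iff[OF m(3), of fst "\<lambda>t. snd (snd t)"] by (auto simp: A_def U_def V_def X_def Y_def Z_def)
    qed (rule fprobD(1)[OF block_code.fprob_blk[OF bc]])
    moreover have "(\<lambda>k. ent (block_code.blk (n k)) (block_code.bp pb \<kappa>' (e k) (n k))
        (\<lambda>w. (map (\<lambda>t. snd (snd t)) (snd w), map (\<lambda>g. (fst g, fst (snd g))) (e k (fst w)))) / real (n k)) \<longlonglongrightarrow> lent P \<kappa> (\<lambda>(b,(a,u,v),(x,y,z)). (z, (a, u))) + hB - hU"
      using inner_limit[OF bc Q C Cf pbE kU cU, of "\<lambda>t. snd (snd t)"] by (simp add: case_prod_unfold hB_def hA_def hU_def hV_def)
    ultimately show ?thesis by simp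
  qed
  have lAUVZ: "(\<lambda>k. H k (\<lambda>w. ([], [], Z w, A k w, U k w, V k w)) / real (n k)) \<longlonglongrightarrow> lent P \<kappa> (\<lambda>(b,(a,u,v),(x,y,z)). (z, (a, u, v))) + hB - hV"
  proof -
    have "H k (\<lambda>w. ([], [], Z w, A k w, U k w, V k w)) = ent (block_code.blk (n k)) (block_code.bp pb \<kappa>' (e k) (n k))
        (\<lambda>w. (map (\<lambda>t. snd (snd t)) (snd w), map (\<lambda>g. g) (e k (fst w))))" for k
      unfolding Heq
    proof (rule ent_cong)
      fix w w' :: "'b list \<times> ('x \<times> 'y \<times> 'z) list"
      assume "w \<in> block_code.blk (n k)" "w' \<in> block_code.blk (n k)"
      then have m: "fst w \<in> seqs UNIV (n k)" "fst w' \<in> seqs UNIV (n k)" "length (snd w) = length (snd w')"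
        unfolding block_code.blk_def[OF bc] by (auto simp: seqs_length)
      show "(([], [], Z w, A k w, U k w, V k w) = ([], [], Z w', A k w', U k w', V k w'))
        = ((map (\<lambda>t. snd (snd t)) (snd w), map (\<lambda>g. g) (e k (fst w))) = (map (\<lambda>t. snd (snd t)) (snd w'), map (\<lambda>g. g) (e k (fst w'))))"
        using eqV[OF m(1,2)] map_pair_eq_iff[OF m(3), of fst "\<lambda>t. snd (snd t)"] by (auto simp: A_def U_def V_def X_def Y_def Z_def)
    qed (rule fprobD(1)[OF block_code.fprob_blk[OF bc]])
    moreover have "(\<lambda>k. ent (block_code.blk (n k)) (block_code.bp pb \<kappa>' (e k) (n k))
        (\<lambda>w. (map (\<lambda>t. snd (snd t)) (snd w), map (\<lambda>g. g) (e k (fst w)))) / real (n k)) \<longlonglongrightarrow> lent P \<kappa> (\<lambda>(b,(a,u,v),(x,y,z)). (z, (a, u, v))) + hB - hV"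
      using inner_limit[OF bc Q C Cf pbE kV cV, of "\<lambda>t. snd (snd t)"] by (simp add: case_prod_unfold hB_def hA_def hU_def hV_def)
    ultimately show ?thesis by simp
  qed
  have lAUXZ: "(\<lambda>k. H k (\<lambda>w. (X w, [], Z w, A k w, U k w, [])) / real (n k)) \<longlonglongrightarrow> lent P \<kappa> (\<lambda>(b,(a,u,v),(x,y,z)). ((x, z), (a, u))) + hB - hU"
  proof -
    have "H k (\<lambda>w. (X w, [], Z w, A k w, U k w, [])) = ent (block_code.blk (n k)) (block_code.bp pb \<kappa>' (e k) (n k))
        (\<lambda>w. (map (\<lambda>t. (fst t, snd (snd t))) (snd w), map (\<lambda>g. (fst g, fst (snd g))) (e k (fst w))))" for k
      unfolding Heq
    proof (rule ent_cong)
      fix w w' :: "'b list \<times> ('x \<times> 'y \<times> 'z) list"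
      assume "w \<in> block_code.blk (n k)" "w' \<in> block_code.blk (n k)"
      then have m: "fst w \<in> seqs UNIV (n k)" "fst w' \<in> seqs UNIV (n k)" "length (snd w) = length (snd w')"
        unfolding block_code.blk_def[OF bc] by (auto simp: seqs_length)
      show "((X w, [], Z w, A k w, U k w, []) = (X w', [], Z w', A k w', U k w', []))
        = ((map (\<lambda>t. (fst t, snd (snd t))) (snd w), map (\<lambda>g. (fst g, fst (snd g))) (e k (fst w))) = (map (\<lambda>t. (fst t, snd (snd t))) (snd w'), map (\<lambda>g. (fst g, fst (snd g))) (e k (fst w'))))"
        using eqU[OF m(1,2)] map_pair_eq_iff[OF m(3), of fst "\<lambda>t. snd (snd t)"] by (auto simp: A_def U_def V_def X_def Y_def Z_def)
    qed (rule fprobD(1)[OF block_code.fprob_blk[OF bc]])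
    moreover have "(\<lambda>k. ent (block_code.blk (n k)) (block_code.bp pb \<kappa>' (e k) (n k))
        (\<lambda>w. (map (\<lambda>t. (fst t, snd (snd t))) (snd w), map (\<lambda>g. (fst g, fst (snd g))) (e k (fst w)))) / real (n k)) \<longlonglongrightarrow> lent P \<kappa> (\<lambda>(b,(a,u,v),(x,y,z)). ((x, z), (a, u))) + hB - hU"
      using inner_limit[OF bc Q C Cf pbE kU cU, of "\<lambda>t. (fst t, snd (snd t))"] by (simp add: case_prod_unfold hB_def hA_def hU_def hV_def)
    ultimately show ?thesis by simp
  qed
  have lAUVXZ: "(\<lambda>k. H k (\<lambda>w. (X w, [], Z w, A k w, U k w, V k w)) / real (n k)) \<longlonglongrightarrow> lent P \<kappa> (\<lambda>(b,(a,u,v),(x,y,z)). ((x, z), (a, u, v))) + hB - hV"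
  proof -
    have "H k (\<lambda>w. (X w, [], Z w, A k w, U k w, V k w)) = ent (block_code.blk (n k)) (block_code.bp pb \<kappa>' (e k) (n k))
        (\<lambda>w. (map (\<lambda>t. (fst t, snd (snd t))) (snd w), map (\<lambda>g. g) (e k (fst w))))" for k
      unfolding Heq
    proof (rule ent_cong)
      fix w w' :: "'b list \<times> ('x \<times> 'y \<times> 'z) list"
      assume "w \<in> block_code.blk (n k)" "w' \<in> block_code.blk (n k)"
      then have m: "fst w \<in> seqs UNIV (n k)" "fst w' \<in> seqs UNIV (n k)" "length (snd w) = length (snd w')"
        unfolding block_code.blk_def[OF bc] by (auto simp: seqs_length)
      show "((X w, [], Z w, A k w, U k w, V k w) = (X w', [], Z w', A k w', U k w', V k w'))
        = ((map (\<lambda>t. (fst t, snd (snd t))) (snd w), map (\<lambda>g. g) (e k (fst w))) = (map (\<lambda>t. (fst t, snd (snd t))) (snd w'), map (\<lambda>g. g) (e k (fst w'))))"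
        using eqV[OF m(1,2)] map_pair_eq_iff[OF m(3), of fst "\<lambda>t. snd (snd t)"] by (auto simp: A_def U_def V_def X_def Y_def Z_def)
    qed (rule fprobD(1)[OF block_code.fprob_blk[OF bc]])
    moreover have "(\<lambda>k. ent (block_code.blk (n k)) (block_code.bp pb \<kappa>' (e k) (n k))
        (\<lambda>w. (map (\<lambda>t. (fst t, snd (snd t))) (snd w), map (\<lambda>g. g) (e k (fst w)))) / real (n k)) \<longlonglongrightarrow> lent P \<kappa> (\<lambda>(b,(a,u,v),(x,y,z)). ((x, z), (a, u, v))) + hB - hV"
      using inner_limit[OF bc Q C Cf pbE kV cV, of "\<lambda>t. (fst t, snd (snd t))"] by (simp add: case_prod_unfold hB_def hA_def hU_def hV_def)
    ultimately show ?thesis by simp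
  qed
  define hAY where "hAY k = H k (\<lambda>w. ([], Y w, [], A k w, [], []))" for k
  define hAUY where "hAUY k = H k (\<lambda>w. ([], Y w, [], A k w, U k w, []))" for k
  define hAUVY where "hAUVY k = H k (\<lambda>w. ([], Y w, [], A k w, U k w, V k w))" for k
  define hAUZ where "hAUZ k = H k (\<lambda>w. ([], [], Z w, A k w, U k w, []))" for k
  define hAUVZ where "hAUVZ k = H k (\<lambda>w. ([], [], Z w, A k w, U k w, V k w))" for k
  define hAUXZ where "hAUXZ k = H k (\<lambda>w. (X w, [], Z w, A k w, U k w, []))" for k
  define hAUVXZ where "hAUVXZ k = H k (\<lambda>w. (X w, [], Z w, A k w, U k w, V k w))" for k
  note ls = lAY[folded hAY_def] lAUY[folded hAUY_def] lAUVY[folded hAUVY_def] lAUZ[folded hAUZ_def]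
    lAUVZ[folded hAUVZ_def] lAUXZ[folded hAUXZ_def] lAUVXZ[folded hAUVXZ_def]
  let ?q = "\<lambda>k. block_code.Q pb \<kappa>' (e k) (n k)"
  define xq where "xq k = ent UNIV (?q k) (\<lambda>(b,g,o'). (fst o', ())) - ent UNIV (?q k) (\<lambda>(b,g,o'). ())" for k
  have n0: "real (n k) > 0" for k using n[of k] by simp
  have xl: "xq \<longlonglongrightarrow> lent P \<kappa> (\<lambda>(b,(a,u,v),(x,y,z)). x)"
  proof -
    have "lent P \<kappa> (\<lambda>(b,g,o'). (fst o', ())) = lent P \<kappa> (\<lambda>(b,(a,u,v),(x,y,z)). x)" by (rule ent_cong) auto
    moreover have "lent P \<kappa> (\<lambda>(b,g,o'). ()) = 0" using ent_const[OF C, of "()"] by (simp add: case_prod_unfold)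
    moreover have "xq \<longlonglongrightarrow> lent P \<kappa> (\<lambda>(b,g,o'). (fst o', ())) - lent P \<kappa> (\<lambda>(b,g,o'). ())"
      unfolding xq_def by (intro tendsto_diff ent_tendsto[OF Q block_code.fprob_Q[OF bc] C])
    ultimately show ?thesis by simp
  qed
  \<comment> \<open>For \<open>X\<close> alone the projection of the code letter is trivial,
    \<open>\<kappa>'\<close> need not factor through it, and \<open>inner_limit\<close> does not
    apply. An upper bound is enough, as this entropy enters the leakage with a plus sign; the
    trivial projection has one codeword.\<close>
  have hX: "H k (\<lambda>w. (X w, [], [], [], [], [])) \<le> real (n k) * xq k" for k
  proof -
    have "H k (\<lambda>w. (X w, [], [], [], [], [])) = ent (block_code.blk (n k)) (block_code.bp pb \<kappa>' (e k) (n k))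
       (\<lambda>w. (map fst (snd w), map (\<lambda>_. ()) (e k (fst w))))"
      unfolding Heq
    proof (rule ent_cong)
      fix w w' :: "'b list \<times> ('x \<times> 'y \<times> 'z) list"
      assume "w \<in> block_code.blk (n k)" "w' \<in> block_code.blk (n k)"
      then have "length (e k (fst w)) = length (e k (fst w'))"
        unfolding block_code.blk_def[OF bc] by (auto simp: e_len)
      then show "((X w, [], [], [], [], []) = (X w', [], [], [], [], []))
        = ((map fst (snd w), map (\<lambda>_. ()) (e k (fst w))) = (map fst (snd w'), map (\<lambda>_. ()) (e k (fst w'))))"
        by (simp add: X_def map_replicate_const)
    qed (rule fprobD(1)[OF block_code.fprob_blk[OF bc]])
    also have "\<dots> \<le> log 2 (card ((\<lambda>bs. map (\<lambda>_. ()) (e k bs)) ` seqs UNIV (n k))) + real (n k) * xq k"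
      using block_code.single_letter_upper'[OF bc[of k], of fst "\<lambda>_. ()"] by (simp add: xq_def)
    also have "log 2 (card ((\<lambda>bs. map (\<lambda>_. ()) (e k bs)) ` seqs UNIV (n k))) \<le> 0"
    proof -
      have "(\<lambda>bs. map (\<lambda>_. ()) (e k bs)) ` seqs UNIV (n k) \<subseteq> {replicate (n k) ()}"
        by (auto simp: map_replicate_const e_len)
      from card_mono[OF _ this] have "card ((\<lambda>bs. map (\<lambda>_. ()) (e k bs)) ` seqs UNIV (n k)) \<le> 1" by simp
      then have "card ((\<lambda>bs. map (\<lambda>_. ()) (e k bs)) ` seqs UNIV (n k)) = 0 \<or> card ((\<lambda>bs. map (\<lambda>_. ()) (e k bs)) ` seqs UNIV (n k)) = 1"
        by linarith
      then show ?thesis by (auto simp: log_def)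
    qed
    finally show ?thesis by simp
  qed
  define cq where "cq k = (\<Sum>t\<in>UNIV. ?q k t * \<Gamma> (fst (fst (snd t))))" for k
  have cost: "(\<Sum>bs\<in>seqs UNIV (n k). iid pb (n k) bs * (\<Sum>i<n k. \<Gamma> (ea k bs ! i))) = real (n k) * cq k" for k
  proof -
    have "real (n k) * cq k = (\<Sum>w\<in>block_code.blk (n k). block_code.bp pb \<kappa>' (e k) (n k) w *
       (\<Sum>i<n k. \<Gamma> (fst (fst (snd (block_code.letters (e k) w ! i))))))"
      unfolding cq_def by (rule block_code.sum_letters[OF bc, symmetric])
    also have "\<dots> = (\<Sum>bs\<in>seqs UNIV (n k). \<Sum>os\<in>seqs UNIV (n k). iid pb (n k) bs * (\<Prod>i<n k. \<kappa>' (bs ! i) (e k bs ! i) (os ! i)) *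
       (\<Sum>i<n k. \<Gamma> (ea k bs ! i)))"
      unfolding block_code.sum_blk[OF bc]
    proof (intro sum.cong refl)
      fix bs :: "'b list" and os :: "('x \<times> 'y \<times> 'z) list" assume m: "bs \<in> seqs UNIV (n k)" "os \<in> seqs UNIV (n k)"
      then have "(bs, os) \<in> block_code.blk (n k)" unfolding block_code.blk_def[OF bc] by simp
      from block_code.letters_nth[OF bc this]
      have "(\<Sum>i<n k. \<Gamma> (fst (fst (snd (block_code.letters (e k) (bs, os) ! i))))) = (\<Sum>i<n k. \<Gamma> (ea k bs ! i))"
        using e_nth[OF m(1)] by simp
      then show "block_code.bp pb \<kappa>' (e k) (n k) (bs, os) * (\<Sum>i<n k. \<Gamma> (fst (fst (snd (block_code.letters (e k) (bs, os) ! i)))))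
        = iid pb (n k) bs * (\<Prod>i<n k. \<kappa>' (bs ! i) (e k bs ! i) (os ! i)) * (\<Sum>i<n k. \<Gamma> (ea k bs ! i))"
        by (simp add: block_code.bp_def[OF bc])
    qed
    also have "\<dots> = (\<Sum>bs\<in>seqs UNIV (n k). iid pb (n k) bs * (\<Sum>i<n k. \<Gamma> (ea k bs ! i)))"
      using block_code.sum_os[OF bc]
      by (simp add: sum_distrib_right[symmetric] sum_distrib_left[symmetric])
    finally show ?thesis by simp
  qed
  have cl: "cq \<longlonglongrightarrow> (\<Sum>(b,a,u,v)\<in>UNIV. P (b,a,u,v) * \<Gamma> a)"
  proof -
    have "(\<Sum>t\<in>UNIV. chan P \<kappa> t * \<Gamma> (fst (fst (snd t)))) = (\<Sum>b\<in>UNIV. \<Sum>g\<in>UNIV. P (b,g) * \<Gamma> (fst g))"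
    proof -
      have "(\<Sum>o'\<in>UNIV. P (b,g) * \<kappa> b (fst g) o' * \<Gamma> (fst g)) = P (b,g) * \<Gamma> (fst g)" for b g
        using \<kappa>[of b "fst g"] by (simp add: is_pmf_def sum_distrib_right[symmetric] sum_distrib_left[symmetric])
      then show ?thesis by (subst sum_UNIV_triple) (simp add: chan_def)
    qed
    also have "\<dots> = (\<Sum>t\<in>UNIV. P t * \<Gamma> (fst (snd t)))"
      by (subst sum_UNIV_pair) simp
    also have "\<dots> = (\<Sum>(b,a,u,v)\<in>UNIV. P (b,a,u,v) * \<Gamma> a)" by (intro sum.cong) auto
    finally have eq: "(\<Sum>t\<in>UNIV. chan P \<kappa> t * \<Gamma> (fst (fst (snd t)))) = (\<Sum>(b,a,u,v)\<in>UNIV. P (b,a,u,v) * \<Gamma> a)" .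
    show ?thesis unfolding eq[symmetric] cq_def by (intro tendsto_sum tendsto_mult tendsto_const Q)
  qed
  have I1': "I1 = lent P \<kappa> (\<lambda>(b,(a,u,v),(x,y,z)). a) + hB - hA"
    unfolding I1 by (simp add: hB_def hA_def case_prod_unfold)
  \<comment> \<open>The corrections add up as \<open>hB - hA\<close> from the \<open>A\<close>
    codebook, \<open>hB - hV\<close> from H(A,U,V,Y) and minus \<open>hB - hA\<close> from H(A,Y).
    The remaining \<open>hB - hV\<close> is part of \<open>RW\<close>; in the other combinations
    nothing remains.\<close>
  let ?s1 = "\<lambda>k. I1 + 1 / (real k + 1) + (hAUVY k / real (n k) - hAY k / real (n k))"
  have "?s1 \<longlonglongrightarrow> RW"
  proof -
    have "RW = I1 + 0 + ((lent P \<kappa> (\<lambda>(b,(a,u,v),(x,y,z)). (y, (a, u, v))) + hB - hV) - (lent P \<kappa> (\<lambda>(b,(a,u,v),(x,y,z)). (y, a)) + hB - hA))"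
      unfolding RW_def I1' by (simp add: hB_def hV_def)
    then show ?thesis by (simp only:) (intro tendsto_add tendsto_diff tendsto_const z ls)
  qed
  then have v1: "eventually (\<lambda>k. ?s1 k < RW + \<epsilon>) sequentially" using \<epsilon> by (intro order_tendstoD(2)) auto
  let ?s2 = "\<lambda>k. (hAUVZ k / real (n k) - hAUZ k / real (n k)) - (hAUVY k / real (n k) - hAUY k / real (n k))"
  have "?s2 \<longlonglongrightarrow> RK"
  proof -
    have "RK = ((lent P \<kappa> (\<lambda>(b,(a,u,v),(x,y,z)). (z, (a, u, v))) + hB - hV) - (lent P \<kappa> (\<lambda>(b,(a,u,v),(x,y,z)). (z, (a, u))) + hB - hU))
      - ((lent P \<kappa> (\<lambda>(b,(a,u,v),(x,y,z)). (y, (a, u, v))) + hB - hV) - (lent P \<kappa> (\<lambda>(b,(a,u,v),(x,y,z)). (y, (a, u))) + hB - hU))"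
      unfolding RK_def by simp
    then show ?thesis by (simp only:) (intro tendsto_add tendsto_diff tendsto_const ls)
  qed
  then have v2: "eventually (\<lambda>k. ?s2 k > RK - \<epsilon>) sequentially" using \<epsilon> by (intro order_tendstoD(1)) auto
  let ?s3 = "\<lambda>k. xq k + hAUZ k / real (n k) - hAUXZ k / real (n k)"
  have l3: "?s3 \<longlonglongrightarrow> L3"
  proof -
    have "L3 = lent P \<kappa> (\<lambda>(b,(a,u,v),(x,y,z)). x) + (lent P \<kappa> (\<lambda>(b,(a,u,v),(x,y,z)). (z, (a, u))) + hB - hU)
      - (lent P \<kappa> (\<lambda>(b,(a,u,v),(x,y,z)). ((x, z), (a, u))) + hB - hU)"
      unfolding L3_def by simp
    then show ?thesis by (simp only:) (intro tendsto_add tendsto_diff tendsto_const ls xl)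
  qed
  then have v3: "eventually (\<lambda>k. ?s3 k < L3 + \<epsilon>) sequentially" using \<epsilon> by (intro order_tendstoD(2)) auto
  let ?s4 = "\<lambda>k. ?s3 k + (hAUVY k / real (n k) - hAUY k / real (n k)) - (hAUVXZ k / real (n k) - hAUXZ k / real (n k))"
  have "?s4 \<longlonglongrightarrow> L2"
  proof -
    have "L2 = L3 + ((lent P \<kappa> (\<lambda>(b,(a,u,v),(x,y,z)). (y, (a, u, v))) + hB - hV) - (lent P \<kappa> (\<lambda>(b,(a,u,v),(x,y,z)). (y, (a, u))) + hB - hU))
      - ((lent P \<kappa> (\<lambda>(b,(a,u,v),(x,y,z)). ((x, z), (a, u, v))) + hB - hV) - (lent P \<kappa> (\<lambda>(b,(a,u,v),(x,y,z)). ((x, z), (a, u))) + hB - hU))"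
      unfolding L2_def L3_def by simp
    then show ?thesis by (simp only:) (intro tendsto_add tendsto_diff tendsto_const ls l3)
  qed
  then have v4: "eventually (\<lambda>k. ?s4 k < L2 + \<epsilon>) sequentially" using \<epsilon> by (intro order_tendstoD(2)) auto
  have v5: "eventually (\<lambda>k. cq k < (\<Sum>(b,a,u,v)\<in>UNIV. P (b,a,u,v) * \<Gamma> a) + \<epsilon>) sequentially"
    using \<epsilon> by (intro order_tendstoD(2)[OF cl]) auto
  \<comment> \<open>Each limit is met strictly within \<open>\<epsilon>\<close>, so one index
    \<open>k\<close> serves all five requirements.\<close>
  from eventually_happens'[OF sequentially_bot eventually_conj[OF v1 eventually_conj[OF v2 eventually_conj[OF v3 eventually_conj[OF v4 v5]]]]]
  obtain k where k: "?s1 k < RW + \<epsilon>" "?s2 k > RK - \<epsilon>" "?s3 k < L3 + \<epsilon>" "?s4 k < L2 + \<epsilon>"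
    "cq k < (\<Sum>(b,a,u,v)\<in>UNIV. P (b,a,u,v) * \<Gamma> a) + \<epsilon>" by blast
  let ?n = "real (n k)"
  have nk: "?n * (x / ?n) = x" for x using n0[of k] by simp
  have f1: "log 2 (card (ea k ` seqs UNIV (n k))) + hAUVY k - hAY k \<le> ?n * (RW + \<epsilon>)"
    using c1[of k] mult_left_mono[OF less_imp_le[OF k(1)] less_imp_le[OF n0[of k]]]
    by (simp only: distrib_left right_diff_distrib nk; linarith)
  have f2: "(hAUVZ k - hAUZ k) - (hAUVY k - hAUY k) \<ge> ?n * (RK - \<epsilon>)"
    using mult_left_mono[OF less_imp_le[OF k(2)] less_imp_le[OF n0[of k]]]
    by (simp only: distrib_left right_diff_distrib nk)
  have f3: "H k (\<lambda>w. (X w, [], [], [], [], [])) + hAUZ k - hAUXZ k \<le> ?n * (L3 + \<epsilon>)"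
    using hX[of k] mult_left_mono[OF less_imp_le[OF k(3)] less_imp_le[OF n0[of k]]]
    by (simp only: distrib_left right_diff_distrib nk; linarith)
  have f4: "H k (\<lambda>w. (X w, [], [], [], [], [])) + hAUZ k - hAUXZ k + (hAUVY k - hAUY k) - (hAUVXZ k - hAUXZ k) \<le> ?n * (L2 + \<epsilon>)"
    using hX[of k] mult_left_mono[OF less_imp_le[OF k(4)] less_imp_le[OF n0[of k]]]
    by (simp only: distrib_left right_diff_distrib nk; linarith)
  have f5: "(\<Sum>bs\<in>seqs UNIV (n k). iid pb (n k) bs * (\<Sum>i<n k. \<Gamma> (ea k bs ! i))) \<le> ?n * ((\<Sum>(b,a,u,v)\<in>UNIV. P (b,a,u,v) * \<Gamma> a) + \<epsilon>)"
    unfolding cost using k(5) n0[of k] by (intro mult_left_mono) auto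
  have f0: "\<forall>bs\<in>seqs UNIV (n k). length (ea k bs) = n k" using len[of k] by simp
  note ff = f1 f2 f3 f4
  note ff' = ff[unfolded hAY_def hAUY_def hAUVY_def hAUZ_def hAUVZ_def hAUXZ_def hAUVXZ_def H_def A_def U_def V_def X_def Y_def Z_def]
  show ?thesis
    unfolding Let_def
    by (rule exI[of _ "n k"], rule conjI[OF n], rule exI[of _ "ea k"], rule exI[of _ "eu k"], rule exI[of _ "ev k"],
        intro conjI f0 f5 ff')
qed

section \<open>Superblocks\<close>

text \<open>The recursion runs on the number of blocks, so the result has \<open>N\<close> entries
  for every input word; on words of length \<open>n * N\<close> it inverts
  \<open>concat\<close>.\<close>

primrec chunks :: "nat \<Rightarrow> nat \<Rightarrow> 'a list \<Rightarrow> 'a list list" where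
  "chunks n 0 xs = []"
| "chunks n (Suc N) xs = take n xs # chunks n N (drop n xs)"

lemma length_chunks [simp]: "length (chunks n N xs) = N"
  by (induction N arbitrary: xs) auto

lemma concat_chunks: "length xs = n * N \<Longrightarrow> concat (chunks n N xs) = xs"
  by (induction N arbitrary: xs) auto

lemma length_in_chunks: "length xs = n * N \<Longrightarrow> c \<in> set (chunks n N xs) \<Longrightarrow> length c = n"
proof (induction N arbitrary: xs)
  case (Suc N)
  then show ?case using Suc.IH[of "drop n xs"] by auto
qed simp

lemma chunks_concat: "(\<And>c. c \<in> set l \<Longrightarrow> length c = n) \<Longrightarrow> length l = N \<Longrightarrow> chunks n N (concat l) = l"
proof (induction l arbitrary: N)
  case (Cons x l)
  then obtain M where "N = Suc M" "length l = M" by (cases N) auto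
  then show ?case using Cons.IH[of M] Cons.prems(1) by auto
qed simp

lemma length_concat_blocks: "(\<And>c. c \<in> set l \<Longrightarrow> length c = n) \<Longrightarrow> length l = N \<Longrightarrow> length (concat l) = n * N"
proof (induction l arbitrary: N)
  case (Cons x l)
  then obtain M where "N = Suc M" "length l = M" by (cases N) auto
  then show ?case using Cons.IH[of M] Cons.prems(1) by auto
qed simp

lemma nth_concat_blocks:
  "(\<And>c. c \<in> set l \<Longrightarrow> length c = n) \<Longrightarrow> j < length l \<Longrightarrow> t < n \<Longrightarrow> concat l ! (n * j + t) = l ! j ! t"
proof (induction l arbitrary: j)
  case (Cons x l)
  have x: "length x = n" using Cons.prems(1) by simp
  show ?case
  proof (cases j)
    case 0 then show ?thesis using x Cons.prems(3) by (simp add: nth_append)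
  next
    case (Suc i)
    have "concat l ! (n * i + t) = l ! i ! t" using Cons.IH[of i] Cons.prems Suc by auto
    then show ?thesis using x Suc by (simp add: nth_append add.assoc)
  qed
qed simp

lemma nth_concat_map:
  "(\<And>w. w \<in> set l \<Longrightarrow> length (f w) = n) \<Longrightarrow> j < length l \<Longrightarrow> t < n \<Longrightarrow> concat (map f l) ! (n * j + t) = f (l ! j) ! t"
  using nth_concat_blocks[of "map f l" n j t] by fastforce

lemma prod_blocks:
  fixes F :: "nat \<Rightarrow> real"
  shows "(\<Prod>i<n * N. F i) = (\<Prod>j<N. \<Prod>t<n. F (n * j + t))"
proof -
  have split: "(\<Prod>i<a + b. F i) = (\<Prod>i<a. F i) * (\<Prod>i<b. F (a + i))" for a b
    by (induction b) (simp_all add: mult.assoc)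
  show ?thesis
  proof (induction N)
    case (Suc N)
    have "n * Suc N = n * N + n" by simp
    then show ?case using split[of "n * N" n] Suc.IH by (simp add: add.commute)
  qed simp
qed

lemma sum_blocks:
  fixes F :: "nat \<Rightarrow> real"
  shows "(\<Sum>i<n * N. F i) = (\<Sum>j<N. \<Sum>t<n. F (n * j + t))"
proof -
  have split: "(\<Sum>i<a + b. F i) = (\<Sum>i<a. F i) + (\<Sum>i<b. F (a + i))" for a b
    by (induction b) (simp_all add: add.assoc)
  show ?thesis
  proof (induction N)
    case (Suc N)
    have "n * Suc N = n * N + n" by simp
    then show ?case using split[of "n * N" n] Suc.IH by (simp add: add.commute)
  qed simp
qed

text \<open>Identifies \<open>N\<close> superletters with one outcome of the model at block length
  \<open>n * N\<close>; the components are permuted because a superletter lists the observation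
  before the source.\<close>

definition unblk :: "('b list \<times> ('x \<times> 'y \<times> 'z) list) list \<Rightarrow> 'x list \<times> 'b list \<times> 'y list \<times> 'z list" where
  "unblk l = (concat (map (\<lambda>w. map fst (snd w)) l), concat (map fst l),
     concat (map (\<lambda>w. map (\<lambda>t. fst (snd t)) (snd w)) l), concat (map (\<lambda>w. map (\<lambda>t. snd (snd t)) (snd w)) l))"

lemma sblk_lengths:
  assumes "l \<in> seqs (sblk n) N"
  shows "length l = N" "\<And>w. w \<in> set l \<Longrightarrow> length (fst w) = n" "\<And>w. w \<in> set l \<Longrightarrow> length (snd w) = n"
  using assms by (force simp: seqs_def sblk_def)+

lemma chunks_unblk:
  assumes l: "l \<in> seqs (sblk n) N"
  shows "chunks n N (fst (unblk l)) = map (\<lambda>w. map fst (snd w)) l"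
    "chunks n N (fst (snd (unblk l))) = map fst l"
    "chunks n N (fst (snd (snd (unblk l)))) = map (\<lambda>w. map (\<lambda>t. fst (snd t)) (snd w)) l"
    "chunks n N (snd (snd (snd (unblk l)))) = map (\<lambda>w. map (\<lambda>t. snd (snd t)) (snd w)) l"
  unfolding unblk_def fst_conv snd_conv
  by (rule chunks_concat; use sblk_lengths[OF l] in auto)+

lemma bij_unblk:
  "bij_betw (unblk :: ('b list \<times> ('x \<times> 'y \<times> 'z) list) list \<Rightarrow> _) (seqs (sblk n) N) (gs_space (n * N))"
proof -
  \<comment> \<open>The inverse map: all four words are cut into blocks, and the output words are
    zipped back letter by letter.\<close>
  define g :: "'x list \<times> 'b list \<times> 'y list \<times> 'z list \<Rightarrow> ('b list \<times> ('x \<times> 'y \<times> 'z) list) list" where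
    "g = (\<lambda>(xs, bs, ys, zs). zip (chunks n N bs) (map (\<lambda>(x, y, z). zip x (zip y z))
       (zip (chunks n N xs) (zip (chunks n N ys) (chunks n N zs)))))"
  show ?thesis
  proof (rule bij_betwI[where g=g])
    show "unblk \<in> seqs (sblk n) N \<rightarrow> (gs_space (n * N) :: ('x list \<times> 'b list \<times> 'y list \<times> 'z list) set)"
    proof
      fix l :: "('b list \<times> ('x \<times> 'y \<times> 'z) list) list" assume l: "l \<in> seqs (sblk n) N"
      have "length (concat (map (\<lambda>w. map fst (snd w)) l)) = n * N" "length (concat (map fst l)) = n * N"
        "length (concat (map (\<lambda>w. map (\<lambda>t. fst (snd t)) (snd w)) l)) = n * N"
        "length (concat (map (\<lambda>w. map (\<lambda>t. snd (snd t)) (snd w)) l)) = n * N"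
        using sblk_lengths[OF l] by (intro length_concat_blocks; force)+
      then show "unblk l \<in> gs_space (n * N)" by (simp add: unblk_def gs_space_def)
    qed
    show "g \<in> gs_space (n * N) \<rightarrow> seqs (sblk n) N"
    proof
      fix w :: "'x list \<times> 'b list \<times> 'y list \<times> 'z list" assume w: "w \<in> gs_space (n * N)"
      obtain xs bs ys zs where ww: "w = (xs, bs, ys, zs)" by (cases w)
      have len: "length xs = n * N" "length bs = n * N" "length ys = n * N" "length zs = n * N"
        using w by (auto simp: ww gs_space_def)
      have nt: "length (chunks n N xs ! j) = n" "length (chunks n N bs ! j) = n" "length (chunks n N ys ! j) = n"
        "length (chunks n N zs ! j) = n" if "j < N" for j
        by (rule length_in_chunks, rule len, rule nth_mem, simp add: that)+
      have "g w ! j \<in> sblk n" if "j < N" for j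
        using that nt[OF that] by (simp add: ww g_def sblk_def seqs_def)
      then show "g w \<in> seqs (sblk n) N"
        by (auto simp: seqs_def in_set_conv_nth ww g_def)
    qed
    show "g (unblk l) = l" if l: "l \<in> seqs (sblk n) N" for l
    proof -
      have "g (unblk l) = zip (map fst l) (map (\<lambda>(x, y, z). zip x (zip y z)) (zip (map (\<lambda>w. map fst (snd w)) l)
          (zip (map (\<lambda>w. map (\<lambda>t. fst (snd t)) (snd w)) l) (map (\<lambda>w. map (\<lambda>t. snd (snd t)) (snd w)) l))))"
        using chunks_unblk[OF l] by (simp add: g_def case_prod_unfold)
      also have "\<dots> = l"
        by (rule nth_equalityI) (auto simp: list_eq_iff_nth_eq prod_eq_iff)
      finally show ?thesis .
    qed
    show "unblk (g w) = w" if w: "w \<in> gs_space (n * N)" for w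
    proof -
      obtain xs bs ys zs where ww: "w = (xs, bs, ys, zs)" by (cases w)
      have len: "length xs = n * N" "length bs = n * N" "length ys = n * N" "length zs = n * N"
        using w by (auto simp: ww gs_space_def)
      have nt: "length (chunks n N xs ! j) = n" "length (chunks n N bs ! j) = n" "length (chunks n N ys ! j) = n"
        "length (chunks n N zs ! j) = n" if "j < N" for j
        by (rule length_in_chunks, rule len, rule nth_mem, simp add: that)+
      have "map (\<lambda>w. map fst (snd w)) (g w) = chunks n N xs" "map fst (g w) = chunks n N bs"
        "map (\<lambda>w. map (\<lambda>t. fst (snd t)) (snd w)) (g w) = chunks n N ys"
        "map (\<lambda>w. map (\<lambda>t. snd (snd t)) (snd w)) (g w) = chunks n N zs"
        by (rule nth_equalityI; simp add: ww g_def; rule nth_equalityI; simp add: nt)+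
      then show ?thesis using len by (simp add: unblk_def concat_chunks ww)
    qed
  qed
qed

section \<open>Bayes inversion of the source and the model law on superblocks\<close>

text \<open>The law of the encoder's observation, which takes the place of the source in the
  covering.\<close>

definition mu :: "('x::finite \<Rightarrow> real) \<Rightarrow> ('x \<Rightarrow> 'b \<Rightarrow> real) \<Rightarrow> 'b \<Rightarrow> real" where
  "mu PX PXt b = (\<Sum>x\<in>UNIV. PX x * PXt x b)"

text \<open>The backward channel from the encoder observation to source and outputs.\<close>
definition kap :: "('x::finite \<Rightarrow> real) \<Rightarrow> ('x \<Rightarrow> 'b \<Rightarrow> real) \<Rightarrow> ('x \<times> 'b \<times> 'a \<Rightarrow> 'y \<times> 'z \<Rightarrow> real)
    \<Rightarrow> 'b \<Rightarrow> 'a \<Rightarrow> 'x \<times> 'y \<times> 'z \<Rightarrow> real" where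
  "kap PX PXt PYZ b a = (\<lambda>(x, yz). (if mu PX PXt b = 0 then PX x else PX x * PXt x b / mu PX PXt b) * PYZ (x, b, a) yz)"

text \<open>Bayes' rule. Where the observation has probability 0 all products
  \<open>PX x * PXt x b\<close> vanish, so the default \<open>PX\<close> in \<open>kap\<close>,
  which keeps it a pmf, does no harm.\<close>

lemma mu_kap:
  assumes "is_pmf PX" "stoch PXt"
  shows "mu PX PXt b * kap PX PXt PYZ b a (x, yz) = PX x * PXt x b * PYZ (x, b, a) yz"
proof (cases "mu PX PXt b = 0")
  case True
  have "\<forall>x\<in>UNIV. PX x * PXt x b = 0"
    using True assms unfolding mu_def by (subst (asm) sum_nonneg_eq_0_iff) (auto simp: is_pmf_def stoch_def)
  then show ?thesis using True by simp
qed (simp add: kap_def)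

lemma is_pmf_mu:
  assumes "is_pmf PX" "stoch PXt" shows "is_pmf (mu PX PXt)"
proof -
  have "(\<Sum>b\<in>UNIV. mu PX PXt b) = (\<Sum>x\<in>UNIV. PX x * (\<Sum>b\<in>UNIV. PXt x b))"
    unfolding mu_def sum_distrib_left by (rule sum.swap)
  also have "\<dots> = 1" using assms by (simp add: is_pmf_def stoch_def)
  finally show ?thesis using assms by (auto simp: is_pmf_def stoch_def mu_def intro!: sum_nonneg)
qed

lemma is_pmf_kap:
  fixes PYZ :: "'x::finite \<times> 'b::finite \<times> 'a \<Rightarrow> 'y::finite \<times> 'z::finite \<Rightarrow> real"
  assumes "is_pmf PX" "stoch PXt" "stoch PYZ" shows "is_pmf (kap PX PXt PYZ b a)"
proof -
  let ?c = "\<lambda>x. if mu PX PXt b = 0 then PX x else PX x * PXt x b / mu PX PXt b"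
  have "(\<Sum>t\<in>UNIV. kap PX PXt PYZ b a t) = (\<Sum>x\<in>UNIV. ?c x * (\<Sum>yz\<in>UNIV. PYZ (x, b, a) yz))"
    by (subst sum_UNIV_pair) (simp only: kap_def prod.case sum_distrib_left)
  also have "\<dots> = (\<Sum>x\<in>UNIV. ?c x)" using assms(3) by (simp add: stoch_def is_pmf_def)
  also have "\<dots> = 1"
    using assms(1) by (cases "mu PX PXt b = 0") (simp_all add: is_pmf_def sum_divide_distrib[symmetric], simp add: mu_def)
  finally have "(\<Sum>t\<in>UNIV. kap PX PXt PYZ b a t) = 1" .
  moreover have "mu PX PXt b \<ge> 0" using is_pmf_mu[OF assms(1,2)] by (simp add: is_pmf_def)
  ultimately show ?thesis
    using assms by (auto simp: is_pmf_def stoch_def kap_def)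
qed

text \<open>Once the helper data reproduce the action words of all blocks, the product over
  \<open>n * N\<close> positions regroups into \<open>N\<close> block laws, and Bayes' rule
  exchanges source and observation inside each factor.\<close>

lemma gs_prob_unblk:
  assumes PX: "is_pmf PX" and PXt: "stoch PXt" and l: "l \<in> seqs (sblk n) N"
    and fa: "fa (fst (f1 (fst (snd (unblk l))))) = concat (map (\<lambda>w. ea (fst w)) l)"
    and ea: "\<And>bs. bs \<in> seqs UNIV n \<Longrightarrow> length (ea bs) = n"
  shows "iid (sprob (mu PX PXt) (kap PX PXt PYZ) ea n) N l = gs_prob PX PXt PYZ (n * N) f1 fa (unblk l)"
proof -
  have m: "l ! j \<in> sblk n" if "j < N" for j using seqs_nth[OF l that] .
  have len: "length l = N" by (rule sblk_lengths(1)[OF l])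
  have ntx: "concat (map (\<lambda>w. map fst (snd w)) l) ! (n * j + t) = fst (snd (l ! j) ! t)"
    "concat (map fst l) ! (n * j + t) = fst (l ! j) ! t"
    "concat (map (\<lambda>w. map (\<lambda>t. fst (snd t)) (snd w)) l) ! (n * j + t) = fst (snd (snd (l ! j) ! t))"
    "concat (map (\<lambda>w. map (\<lambda>t. snd (snd t)) (snd w)) l) ! (n * j + t) = snd (snd (snd (l ! j) ! t))"
    "concat (map (\<lambda>w. ea (fst w)) l) ! (n * j + t) = ea (fst (l ! j)) ! t" if "j < N" "t < n" for j t
  proof -
    have j: "j < length l" using that len by simp
    have ls: "length (snd (l ! j)) = n" using sblk_lengths(3)[OF l nth_mem[OF j]] .
    have le: "length (ea (fst w)) = n" if "w \<in> set l" for w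
      using sblk_lengths(2)[OF l that] by (intro ea) (simp add: seqs_def)
    note nc = nth_concat_map[OF _ j that(2)]
    show "concat (map (\<lambda>w. map fst (snd w)) l) ! (n * j + t) = fst (snd (l ! j) ! t)"
      "concat (map fst l) ! (n * j + t) = fst (l ! j) ! t"
      "concat (map (\<lambda>w. map (\<lambda>t. fst (snd t)) (snd w)) l) ! (n * j + t) = fst (snd (snd (l ! j) ! t))"
      "concat (map (\<lambda>w. map (\<lambda>t. snd (snd t)) (snd w)) l) ! (n * j + t) = snd (snd (snd (l ! j) ! t))"
      "concat (map (\<lambda>w. ea (fst w)) l) ! (n * j + t) = ea (fst (l ! j)) ! t"
      using that(2) ls le by (subst nc; simp add: sblk_lengths(2,3)[OF l])+
  qed
  have "gs_prob PX PXt PYZ (n * N) f1 fa (unblk l) = (\<Prod>j<N. \<Prod>t<n.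
     PX (fst (snd (l ! j) ! t)) * PXt (fst (snd (l ! j) ! t)) (fst (l ! j) ! t)
      * PYZ (fst (snd (l ! j) ! t), fst (l ! j) ! t, ea (fst (l ! j)) ! t) (snd (snd (l ! j) ! t)))"
    using fa unfolding unblk_def gs_prob_def prod.case fst_conv snd_conv prod_blocks
    by (intro prod.cong refl) (simp add: ntx)
  also have "\<dots> = (\<Prod>j<N. \<Prod>t<n. mu PX PXt (fst (l ! j) ! t) * kap PX PXt PYZ (fst (l ! j) ! t) (ea (fst (l ! j)) ! t) (snd (l ! j) ! t))"
    by (intro prod.cong refl) (simp add: mu_kap[OF PX PXt, symmetric])
  also have "\<dots> = iid (sprob (mu PX PXt) (kap PX PXt PYZ) ea n) N l"
    by (simp add: iid_def sprob_def case_prod_unfold prod.distrib)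
  finally show ?thesis by simp
qed

text \<open>The demands on a single code, in the form that the binning delivers and both models can
  consume: near-uniformity and secrecy of the key are joined in one deficit, \<open>log 2 K\<close>
  minus H(S|W,Z), and the leakage is not divided by \<open>n\<close>.\<close>

definition gs_good ::
  "('x::finite \<Rightarrow> real) \<Rightarrow> ('x \<Rightarrow> 'xt::finite \<Rightarrow> real) \<Rightarrow> ('x \<times> 'xt \<times> 'a::finite \<Rightarrow> 'y::finite \<times> 'z::finite \<Rightarrow> real)
   \<Rightarrow> ('a \<Rightarrow> real) \<Rightarrow> nat \<Rightarrow> nat \<Rightarrow> nat \<Rightarrow> ('xt list \<Rightarrow> nat \<times> nat) \<Rightarrow> (nat \<Rightarrow> 'a list) \<Rightarrow> (nat \<Rightarrow> 'y list \<Rightarrow> nat)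
   \<Rightarrow> real \<Rightarrow> real \<Rightarrow> real \<Rightarrow> bool" where
  "gs_good PX PXt PYZ \<Gamma> n K L f1 fa g \<delta> lk C \<longleftrightarrow>
     (\<forall>xts. length xts = n \<longrightarrow> fst (f1 xts) < L \<and> snd (f1 xts) < K) \<and>
     (\<forall>w<L. length (fa w) = n) \<and>
     (let Om = (gs_space n :: ('x list \<times> 'xt list \<times> 'y list \<times> 'z list) set);
          p = gs_prob PX PXt PYZ n f1 fa;
          Xn = (\<lambda>(xs, xts, ys, zs). xs);
          Zn = (\<lambda>(xs, xts, ys, zs). zs);
          W = (\<lambda>(xs, xts, ys, zs). fst (f1 xts));
          S = (\<lambda>(xs, xts, ys, zs). snd (f1 xts));
          Shat = (\<lambda>(xs, xts, ys, zs). g (fst (f1 xts)) ys);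
          cost = (\<lambda>(xs, xts, ys, zs). (\<Sum>i<n. \<Gamma> (fa (fst (f1 xts)) ! i)) / real n)
      in fprob Om p
       \<and> prb Om p (\<lambda>w. Shat w \<noteq> S w) True \<le> \<delta>
       \<and> log 2 (real K) - (ent Om p (\<lambda>w. (S w, pair2 W Zn w)) - ent Om p (pair2 W Zn)) \<le> \<delta>
       \<and> mi Om p Xn (pair2 W Zn) \<le> lk
       \<and> expect Om p cost \<le> C)"

lemma block_code_kap:
  assumes "is_pmf PX" "stoch PXt" "stoch (PYZ :: 'x::finite \<times> 'b::finite \<times> 'a::finite \<Rightarrow> 'y::finite \<times> 'z::finite \<Rightarrow> real)" "n \<ge> 1"
    "\<And>bs. bs \<in> seqs UNIV n \<Longrightarrow> length (ea bs) = n"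
  shows "block_code (mu PX PXt) (kap PX PXt PYZ) ea n"
  by unfold_locales (use assms is_pmf_mu[OF assms(1,2)] is_pmf_kap[OF assms(1-3)] in auto)

lemma fprob_sprob:
  assumes "is_pmf PX" "stoch PXt" "stoch (PYZ :: 'x::finite \<times> 'b::finite \<times> 'a::finite \<Rightarrow> 'y::finite \<times> 'z::finite \<Rightarrow> real)" "n \<ge> 1"
    "\<And>bs. bs \<in> seqs UNIV n \<Longrightarrow> length (ea bs) = n"
  shows "fprob (sblk n) (sprob (mu PX PXt) (kap PX PXt PYZ) ea n)"
proof -
  have bc: "block_code (mu PX PXt) (kap PX PXt PYZ) ea n" by (rule block_code_kap[OF assms(1-4)]) (rule assms(5))
  show ?thesis
    using block_code.fprob_blk[OF bc]
    unfolding block_code.blk_def[OF bc] block_code.bp_def[OF bc] sblk_def sprob_def .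
qed

text \<open>The helper data consist of the exact action words, the bin of the \<open>U\<close> words
  and the bin of the \<open>V\<close> words; the key is the remainder of the \<open>V\<close> hash.
  Properties proved for i.i.d. superletters are carried to the model along the bijection
  \<open>unblk\<close>. The two decoding stages have \<open>\<delta> / 2\<close> each.\<close>

lemma block_gs_code:
  fixes PX :: "'x::finite \<Rightarrow> real" and PYZ :: "'x \<times> 'b::finite \<times> 'a::finite \<Rightarrow> 'y::finite \<times> 'z::finite \<Rightarrow> real"
    and ea :: "'b list \<Rightarrow> 'a list" and eu :: "'b list \<Rightarrow> 'u list" and ev :: "'b list \<Rightarrow> 'v list"
    and fu :: "'u list list \<Rightarrow> nat" and f :: "'v list list \<Rightarrow> nat"
  assumes pmf: "is_pmf PX" "stoch PXt" "stoch PYZ" and n: "n \<ge> 1" and N: "N \<ge> 1"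
    and ea: "\<And>bs. bs \<in> seqs UNIV n \<Longrightarrow> length (ea bs) = n" and K: "K \<ge> 1" and Mv: "Mv \<ge> 1" and d: "\<delta> \<ge> 0"
  defines "p \<equiv> sprob (mu PX PXt) (kap PX PXt PYZ) ea n"
    and "A \<equiv> \<lambda>w :: 'b list \<times> ('x \<times> 'y \<times> 'z) list. ea (fst w)" and "U \<equiv> \<lambda>w :: 'b list \<times> ('x \<times> 'y \<times> 'z) list. eu (fst w)"
    and "V \<equiv> \<lambda>w :: 'b list \<times> ('x \<times> 'y \<times> 'z) list. ev (fst w)" and "X \<equiv> \<lambda>w :: 'b list \<times> ('x \<times> 'y \<times> 'z) list. map fst (snd w)"
    and "Y \<equiv> \<lambda>w :: 'b list \<times> ('x \<times> 'y \<times> 'z) list. map (\<lambda>t. fst (snd t)) (snd w)"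
    and "Z \<equiv> \<lambda>w :: 'b list \<times> ('x \<times> 'y \<times> 'z) list. map (\<lambda>t. snd (snd t)) (snd w)"
  assumes fu: "\<And>l. l \<in> seqs (sblk n) N \<Longrightarrow> fu (map U l) < Mu" and f: "\<And>l. l \<in> seqs (sblk n) N \<Longrightarrow> f (map V l) < Mv * K"
    and er1: "sum (iid p N) (map_err (seqs (sblk n) N) (iid p N) (map U) (map (\<lambda>w. (A w, Y w))) fu) \<le> \<delta> / 2"
    and er2: "sum (iid p N) (map_err (seqs (sblk n) N) (iid p N) (map V) (map (\<lambda>w. (A w, U w, Y w))) (\<lambda>v. f v div K)) \<le> \<delta> / 2"
    and sec: "K = 1 \<or> log 2 (real (Mv * K)) - (ent (seqs (sblk n) N) (iid p N) (\<lambda>l. (f (map V l), map (\<lambda>w. (A w, U w, Z w)) l))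
           - ent (seqs (sblk n) N) (iid p N) (map (\<lambda>w. (A w, U w, Z w)))) \<le> \<delta>"
    and leak: "log 2 (real Mv) - (ent (seqs (sblk n) N) (iid p N) (\<lambda>l. (f (map V l) div K, map (\<lambda>w. (A w, U w, X w, Z w)) l))
           - ent (seqs (sblk n) N) (iid p N) (map (\<lambda>w. (A w, U w, X w, Z w)))) \<le> lk"
  shows "\<exists>f1 fa g. gs_good PX PXt PYZ \<Gamma> (n * N) K (card (ea ` seqs UNIV n) ^ N * Mu * Mv) f1 fa g \<delta>
     (real N * (ent (sblk n) p X + ent (sblk n) p (\<lambda>w. (A w, U w, Z w)) - ent (sblk n) p (\<lambda>w. (A w, U w, X w, Z w))) + lk)
     ((\<Sum>bs\<in>seqs UNIV n. iid (mu PX PXt) n bs * (\<Sum>i<n. \<Gamma> (ea bs ! i))) / real n)"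
proof -
  let ?S = "seqs (sblk n) N :: ('b list \<times> ('x \<times> 'y \<times> 'z) list) list set" and ?P = "iid p N"
  let ?AUZ = "map (\<lambda>w. (A w, U w, Z w))" and ?AUXZ = "map (\<lambda>w. (A w, U w, X w, Z w))"
  have P0: "fprob (sblk n) p" unfolding p_def by (rule fprob_sprob[OF pmf n]) (rule ea)
  have P': "fprob ?S ?P" by (rule fprob_iid[OF P0])
  note fS = fprobD[OF P']
  define WS where "WS = seqs (ea ` seqs UNIV n) N \<times> {..<Mu} \<times> {..<Mv}"
  have finW: "finite WS" unfolding WS_def by (simp add: finite_seqs)
  have cardW: "card WS = card (ea ` seqs UNIV n) ^ N * Mu * Mv"
  proof -
    have "card (seqs (ea ` seqs UNIV n) N) = card (ea ` seqs UNIV n) ^ N"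
      unfolding seqs_def[of "ea ` seqs UNIV n"] by (rule card_lists_length_eq) (simp add: finite_seqs)
    then show ?thesis by (simp add: WS_def card_cartesian_product)
  qed
  \<comment> \<open>Helper data of the model are natural numbers, so the triples are enumerated
    below \<open>card WS\<close>.\<close>
  obtain enc where enc: "bij_betw enc WS {0..<card WS}" using ex_bij_betw_finite_nat[OF finW] by blast
  define dec where "dec = inv_into WS enc"
  have dec: "dec (enc w) = w" if "w \<in> WS" for w
    unfolding dec_def using that enc by (simp add: bij_betw_def inv_into_f_f)
  have decW: "dec i \<in> WS" if "i < card WS" for i
    unfolding dec_def using that enc by (intro inv_into_into) (auto simp: bij_betw_def)
  have encW: "enc w < card WS" if "w \<in> WS" for w using that enc by (auto simp: bij_betw_def)
  define Wc where "Wc c = (map ea c, fu (map eu c), f (map ev c) div K)" for c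
  define f1 where "f1 bs = (enc (Wc (chunks n N bs)), f (map ev (chunks n N bs)) mod K)" for bs
  define fa where "fa w = concat (fst (dec w))" for w
  \<comment> \<open>Successive decoding: \<open>U\<close> from (A,Y), then \<open>V\<close> from
    (A,U,Y), after which the key can be read off the hash of \<open>V\<close>.\<close>
  define g where "g w ys = (let (aa, wu, wv) = dec w; yy = chunks n N ys;
      uu = map_dec ?S ?P (map U) (map (\<lambda>w. (A w, Y w))) fu wu (zip aa yy);
      vv = map_dec ?S ?P (map V) (map (\<lambda>w. (A w, U w, Y w))) (\<lambda>v. f v div K) wv (zip aa (zip uu yy))
      in f vv mod K)" for w and ys :: "'y list"
  define Wl where "Wl l = (map A l, fu (map U l), f (map V l) div K)" for l
  have WlW: "Wl l \<in> WS" if l: "l \<in> ?S" for l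
    unfolding Wl_def WS_def using fu[OF l] f[OF l] seqs_nth[OF l] seqs_length[OF l] l
    by (auto simp: seqs_def sblk_def A_def less_mult_imp_div_less)
  \<comment> \<open>Every list of observed blocks extends to an outcome in \<open>?S\<close>. The
    range conditions concern all words of length \<open>n * N\<close>, while the hypotheses on
    \<open>fu\<close> and \<open>f\<close> speak of outcomes only.\<close>
  have ex: "\<exists>l\<in>?S. map fst l = c" if "\<And>b. b \<in> set c \<Longrightarrow> length b = n" "length c = N" for c :: "'b list list"
    by (rule bexI[of _ "map (\<lambda>b. (b, replicate n undefined)) c"]) (use that in \<open>auto simp: seqs_def sblk_def comp_def\<close>)
  have mapc: "map ea (map fst l) = map A l" "map eu (map fst l) = map U l" "map ev (map fst l) = map V l" for l
    by (simp_all add: A_def U_def V_def)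
  have Wcl: "Wc (map fst l) = Wl l" for l by (simp only: Wc_def Wl_def mapc)
  have f1l: "f1 (fst (snd (unblk l))) = (enc (Wl l), f (map V l) mod K)" if "l \<in> ?S" for l
    unfolding f1_def chunks_unblk(2)[OF that] Wcl mapc ..
  have fal: "fa (enc (Wl l)) = concat (map A l)" if "l \<in> ?S" for l
    unfolding fa_def dec[OF WlW[OF that]] by (simp add: Wl_def)
  have range: "fst (f1 bs) < card WS \<and> snd (f1 bs) < K" if bs: "length bs = n * N" for bs
  proof -
    obtain l where l: "l \<in> ?S" "map fst l = chunks n N bs"
      using ex[of "chunks n N bs"] length_in_chunks[OF bs] by auto
    have "Wc (chunks n N bs) \<in> WS" using WlW[OF l(1)] Wcl[of l] l(2) by simp
    then show ?thesis using encW K by (simp add: f1_def)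
  qed
  have lenfa: "length (fa w) = n * N" if "w < card WS" for w
  proof -
    have "fst (dec w) \<in> seqs (ea ` seqs UNIV n) N" using decW[OF that] by (auto simp: WS_def)
    then show ?thesis unfolding fa_def using ea by (intro length_concat_blocks) (auto simp: seqs_def)
  qed
  let ?G = "gs_space (n * N) :: ('x list \<times> 'b list \<times> 'y list \<times> 'z list) set" and ?gp = "gs_prob PX PXt PYZ (n * N) f1 fa"
  have bij: "bij_betw unblk ?S ?G" by (rule bij_unblk)
  have pr: "?P l = ?gp (unblk l)" if l: "l \<in> ?S" for l
  proof -
    have "fa (fst (f1 (fst (snd (unblk l))))) = concat (map (\<lambda>w. ea (fst w)) l)"
      using f1l[OF l] fal[OF l] by (simp add: A_def)
    from gs_prob_unblk[where ea=ea and fa=fa and ?f1.0=f1, OF pmf(1,2) l this ea] show ?thesis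
      unfolding p_def by simp
  qed
  have fG: "fprob ?G ?gp"
  proof -
    have "sum ?gp ?G = sum ?P ?S"
      using sum.reindex_bij_betw[OF bij, of ?gp] pr by simp
    moreover have "0 \<le> ?gp w" if "w \<in> ?G" for w
    proof -
      have "w \<in> unblk ` ?S" using that bij_betw_imp_surj_on[OF bij] by simp
      then obtain l where l: "l \<in> ?S" "w = unblk l" by blast
      then show ?thesis using pr[OF l(1)] fS(2)[OF l(1)] by simp
    qed
    moreover have "finite ?G" using bij_betw_finite[OF bij] fS(1) by simp
    ultimately show ?thesis using fS(3) by (simp add: fprob_def)
  qed
  define Xn where "Xn = (\<lambda>(xs :: 'x list, xts :: 'b list, ys :: 'y list, zs :: 'z list). xs)"
  define Zn where "Zn = (\<lambda>(xs :: 'x list, xts :: 'b list, ys :: 'y list, zs :: 'z list). zs)"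
  define W where "W = (\<lambda>(xs :: 'x list, xts :: 'b list, ys :: 'y list, zs :: 'z list). fst (f1 xts))"
  define Sk where "Sk = (\<lambda>(xs :: 'x list, xts :: 'b list, ys :: 'y list, zs :: 'z list). snd (f1 xts))"
  define Shat where "Shat = (\<lambda>(xs :: 'x list, xts :: 'b list, ys :: 'y list, zs :: 'z list). g (fst (f1 xts)) ys)"
  define cost where "cost = (\<lambda>(xs :: 'x list, xts :: 'b list, ys :: 'y list, zs :: 'z list). (\<Sum>i<n * N. \<Gamma> (fa (fst (f1 xts)) ! i)) / real (n * N))"
  have Wl: "W (unblk l) = enc (Wl l)" and Sl: "Sk (unblk l) = f (map V l) mod K" if "l \<in> ?S" for l
    using f1l[OF that] by (simp_all add: W_def Sk_def case_prod_unfold)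
  have Zl: "Zn (unblk l) = concat (map Z l)" and Xl: "Xn (unblk l) = concat (map X l)" for l
    by (simp_all add: Zn_def Xn_def unblk_def Z_def X_def)
  have comp: "map A l = map A l' \<and> map U l = map U l' \<and> map Z l = map Z l'" if "?AUZ l = ?AUZ l'" for l l'
    using that by (auto simp: list_eq_iff_nth_eq)
  have Xinj: "(concat (map X l) = concat (map X l')) = (map X l = map X l')" if "l \<in> ?S" "l' \<in> ?S" for l l'
  proof
    have c: "chunks n N (concat (map X l)) = map X l" if "l \<in> ?S" for l
      using chunks_unblk(1)[OF that] by (simp add: unblk_def X_def)
    assume "concat (map X l) = concat (map X l')"
    then have "chunks n N (concat (map X l)) = chunks n N (concat (map X l'))" by (rule arg_cong)
    then show "map X l = map X l'" unfolding c[OF that(1)] c[OF that(2)] .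
  qed (rule arg_cong)
  have XAUZ: "(concat (map X l) = concat (map X l') \<and> ?AUZ l = ?AUZ l') = (?AUXZ l = ?AUXZ l')"
    if m: "l \<in> ?S" "l' \<in> ?S" for l l'
  proof -
    have len: "length l = length l'" using sblk_lengths(1)[OF m(1)] sblk_lengths(1)[OF m(2)] by simp
    show ?thesis unfolding Xinj[OF m] by (auto simp: map_pair_eq_iff[OF len])
  qed
  \<comment> \<open>The eavesdropper's view on the superletter space. By \<open>Gf\<close> it is a
    function of the bin index of \<open>V\<close> and of (A,U,Z), as both binning lemmas
    demand.\<close>
  define Gl where "Gl l = (enc (Wl l), concat (map Z l))" for l
  have Gf: "Gl l = Gl l'" if "l \<in> ?S" "l' \<in> ?S" "f (map V l) div K = f (map V l') div K" "?AUZ l = ?AUZ l'" for l l'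
    using comp[OF that(4)] that(3) by (simp add: Gl_def Wl_def)
  have e1: "ent ?G ?gp (pair2 W Zn) = ent ?S ?P Gl"
  proof -
    have "ent ?G ?gp (pair2 W Zn) = ent ?S ?P (\<lambda>l. (pair2 W Zn) (unblk l))"
      by (rule ent_bij[where h=unblk and p'="?P" and p="?gp" and f="pair2 W Zn", OF bij pr, symmetric])
    also have "\<dots> = ent ?S ?P Gl"
      by (rule ent_cong[OF fS(1)]) (simp add: pair2_def Wl Zl Gl_def)
    finally show ?thesis .
  qed
  have e2: "ent ?G ?gp (\<lambda>w. (Sk w, pair2 W Zn w)) = ent ?S ?P (\<lambda>l. (f (map V l) mod K, Gl l))"
  proof -
    have "ent ?G ?gp (\<lambda>w. (Sk w, pair2 W Zn w)) = ent ?S ?P (\<lambda>l. (\<lambda>w. (Sk w, pair2 W Zn w)) (unblk l))"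
      by (rule ent_bij[where h=unblk and p'="?P" and p="?gp" and f="\<lambda>w. (Sk w, pair2 W Zn w)", OF bij pr, symmetric])
    also have "\<dots> = ent ?S ?P (\<lambda>l. (f (map V l) mod K, Gl l))"
      by (rule ent_cong[OF fS(1)]) (simp add: pair2_def Wl Zl Sl Gl_def)
    finally show ?thesis .
  qed
  have e3: "ent ?G ?gp Xn = ent ?S ?P (\<lambda>l. concat (map X l))"
  proof -
    have "ent ?G ?gp (Xn) = ent ?S ?P (\<lambda>l. (Xn) (unblk l))"
      by (rule ent_bij[where h=unblk and p'="?P" and p="?gp" and f="Xn", OF bij pr, symmetric])
    also have "\<dots> = ent ?S ?P (\<lambda>l. concat (map X l))"
      by (rule ent_cong[OF fS(1)]) (simp add: Xl)
    finally show ?thesis .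
  qed
  have e4: "ent ?G ?gp (\<lambda>w. (Xn w, pair2 W Zn w)) = ent ?S ?P (\<lambda>l. (concat (map X l), Gl l))"
  proof -
    have "ent ?G ?gp (\<lambda>w. (Xn w, pair2 W Zn w)) = ent ?S ?P (\<lambda>l. (\<lambda>w. (Xn w, pair2 W Zn w)) (unblk l))"
      by (rule ent_bij[where h=unblk and p'="?P" and p="?gp" and f="\<lambda>w. (Xn w, pair2 W Zn w)", OF bij pr, symmetric])
    also have "\<dots> = ent ?S ?P (\<lambda>l. (concat (map X l), Gl l))"
      by (rule ent_cong[OF fS(1)]) (simp add: pair2_def Wl Zl Xl Gl_def)
    finally show ?thesis .
  qed
  have secrecy: "log 2 (real K) - (ent ?G ?gp (\<lambda>w. (Sk w, pair2 W Zn w)) - ent ?G ?gp (pair2 W Zn)) \<le> \<delta>"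
    unfolding e1 e2 by (rule binning_secrecy[where f=f and V="map V" and AUZ="?AUZ" and G=Gl, OF P' K Mv f sec d Gf])
  have leakage: "mi ?G ?gp Xn (pair2 W Zn) \<le> real N * (ent (sblk n) p X + ent (sblk n) p (\<lambda>w. (A w, U w, Z w))
      - ent (sblk n) p (\<lambda>w. (A w, U w, X w, Z w))) + lk"
  proof -
    have "mi ?G ?gp Xn (pair2 W Zn) = mi ?S ?P (\<lambda>l. concat (map X l)) Gl"
      unfolding mi_eq_ent[OF fG] mi_eq_ent[OF P'] e1 e3 e4 ..
    also have "\<dots> \<le> mi ?S ?P (\<lambda>l. concat (map X l)) ?AUZ + (log 2 (real Mv) -
      (ent ?S ?P (\<lambda>l. (f (map V l) div K, (concat (map X l), ?AUZ l))) - ent ?S ?P (\<lambda>l. (concat (map X l), ?AUZ l))))"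
      by (rule binning_leakage[where f=f and V="map V" and AUZ="?AUZ" and G=Gl, OF P' K Mv f Gf])
    also have "ent ?S ?P (\<lambda>l. (f (map V l) div K, (concat (map X l), ?AUZ l))) = ent ?S ?P (\<lambda>l. (f (map V l) div K, ?AUXZ l))"
      by (rule ent_cong[OF fS(1)]) (use XAUZ in simp)
    also have XA: "ent ?S ?P (\<lambda>l. (concat (map X l), ?AUZ l)) = ent ?S ?P ?AUXZ"
      by (rule ent_cong[OF fS(1)]) (use XAUZ in simp)
    also have "mi ?S ?P (\<lambda>l. concat (map X l)) ?AUZ = ent ?S ?P (map X) + ent ?S ?P ?AUZ - ent ?S ?P ?AUXZ"
    proof -
      have "ent ?S ?P (\<lambda>l. concat (map X l)) = ent ?S ?P (map X)"
        by (rule ent_cong[OF fS(1)]) (simp add: Xinj)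
      then show ?thesis unfolding mi_eq_ent[OF P'] XA by simp
    qed
    also have "\<dots> = real N * (ent (sblk n) p X + ent (sblk n) p (\<lambda>w. (A w, U w, Z w)) - ent (sblk n) p (\<lambda>w. (A w, U w, X w, Z w)))"
      unfolding ent_iid[OF P0] by (simp add: algebra_simps)
    finally show ?thesis using leak by linarith
  qed
  let ?E1 = "map_err ?S ?P (map U) (map (\<lambda>w. (A w, Y w))) fu"
  let ?E2 = "map_err ?S ?P (map V) (map (\<lambda>w. (A w, U w, Y w))) (\<lambda>v. f v div K)"
  have correct: "Shat (unblk l) = Sk (unblk l)" if l: "l \<in> ?S" "l \<notin> ?E1" "l \<notin> ?E2" for l
  proof -
    have yy: "chunks n N (fst (snd (snd (unblk l)))) = map Y l" unfolding chunks_unblk(3)[OF l(1)] Y_def ..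
    have z1: "zip (map A l) (map Y l) = map (\<lambda>w. (A w, Y w)) l" by (simp add: list_eq_iff_nth_eq)
    have z2: "zip (map A l) (zip (map U l) (map Y l)) = map (\<lambda>w. (A w, U w, Y w)) l" by (simp add: list_eq_iff_nth_eq)
    have d: "dec (W (unblk l)) = (map A l, fu (map U l), f (map V l) div K)"
      unfolding Wl[OF l(1)] dec[OF WlW[OF l(1)]] by (rule Wl_def)
    have "Shat (unblk l) = g (W (unblk l)) (fst (snd (snd (unblk l))))"
      by (simp add: Shat_def W_def case_prod_unfold)
    also have "\<dots> = f (map V l) mod K"
      unfolding g_def d yy Let_def prod.case z1 map_dec_correct[OF l(1,2)] z2 map_dec_correct[OF l(1,3)] ..
    finally show ?thesis unfolding Sl[OF l(1)] .
  qed
  have err: "prb ?G ?gp (\<lambda>w. Shat w \<noteq> Sk w) True \<le> \<delta>"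
  proof -
    have "prb ?G ?gp (\<lambda>w. Shat w \<noteq> Sk w) True = prb ?S ?P (\<lambda>l. Shat (unblk l) \<noteq> Sk (unblk l)) True"
      by (rule prb_bij[where h=unblk and p'="?P" and p="?gp", OF bij pr, symmetric])
    also have "\<dots> \<le> sum ?P (?E1 \<union> ?E2)"
      unfolding prb_def
    proof (rule sum_mono2)
      show "finite (?E1 \<union> ?E2)" using fS(1) by (auto simp: map_err_def)
      show "{w \<in> ?S. (Shat (unblk w) \<noteq> Sk (unblk w)) = True} \<subseteq> ?E1 \<union> ?E2" using correct by blast
      show "0 \<le> ?P l" if "l \<in> ?E1 \<union> ?E2 - {w \<in> ?S. (Shat (unblk w) \<noteq> Sk (unblk w)) = True}" for l
        using that fS(2) by (auto simp: map_err_def)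
    qed
    also have "\<dots> \<le> sum ?P ?E1 + sum ?P ?E2"
    proof -
      have "finite ?E1" "finite ?E2" using fS(1) by (auto simp: map_err_def)
      moreover have "0 \<le> sum ?P (?E1 \<inter> ?E2)" using fS(2) by (intro sum_nonneg) (auto simp: map_err_def)
      ultimately show ?thesis by (simp add: sum_Un)
    qed
    finally show ?thesis using er1 er2 by linarith
  qed
  have cost': "expect ?G ?gp cost \<le> (\<Sum>bs\<in>seqs UNIV n. iid (mu PX PXt) n bs * (\<Sum>i<n. \<Gamma> (ea bs ! i))) / real n"
  proof (rule eq_refl)
    let ?\<phi> = "\<lambda>w. \<Sum>t<n. \<Gamma> (A w ! t)"
    have "cost (unblk l) = (\<Sum>j<N. ?\<phi> (l ! j)) / real (n * N)" if l: "l \<in> ?S" for l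
    proof -
      have "concat (map A l) ! (n * j + t) = A (l ! j) ! t" if "j < N" "t < n" for j t
      proof (rule nth_concat_map)
        show "length (A w) = n" if "w \<in> set l" for w
          unfolding A_def using sblk_lengths(2)[OF l that] by (intro ea) (simp add: seqs_def)
      qed (use that sblk_lengths(1)[OF l] in auto)
      then show ?thesis
        using f1l[OF l] fal[OF l] by (simp add: cost_def case_prod_unfold sum_blocks)
    qed
    then have "expect ?G ?gp cost = (\<Sum>l\<in>?S. ?P l * ((\<Sum>j<N. ?\<phi> (l ! j)) / real (n * N)))"
      unfolding expect_def using sum.reindex_bij_betw[OF bij, of "\<lambda>w. ?gp w * cost w"] pr by simp
    also have "\<dots> = (\<Sum>l\<in>?S. ?P l * (\<Sum>j<N. ?\<phi> (l ! j))) / real (n * N)"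
      unfolding times_divide_eq_right by (rule sum_divide_distrib[symmetric])
    also have "\<dots> = (\<Sum>w\<in>sblk n. p w * ?\<phi> w) / real n"
      using sum_iid_sum[OF P0, where \<phi>="?\<phi>" and N=N] N by simp
    also have "(\<Sum>w\<in>sblk n. p w * ?\<phi> w) = (\<Sum>bs\<in>seqs UNIV n. iid (mu PX PXt) n bs * (\<Sum>i<n. \<Gamma> (ea bs ! i)))"
    proof -
      have bc: "block_code (mu PX PXt) (kap PX PXt PYZ) ea n" by (rule block_code_kap[OF pmf n]) (rule ea)
      have "(\<Sum>w\<in>sblk n. p w * ?\<phi> w) = (\<Sum>bs\<in>seqs UNIV n. \<Sum>os\<in>seqs UNIV n. iid (mu PX PXt) n bs
         * (\<Prod>i<n. kap PX PXt PYZ (bs ! i) (ea bs ! i) (os ! i)) * (\<Sum>i<n. \<Gamma> (ea bs ! i)))"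
        by (simp add: sblk_def p_def sprob_def A_def sum.cartesian_product case_prod_unfold)
      also have "\<dots> = (\<Sum>bs\<in>seqs UNIV n. iid (mu PX PXt) n bs * (\<Sum>i<n. \<Gamma> (ea bs ! i)))"
        using block_code.sum_os[OF bc] by (simp add: sum_distrib_right[symmetric] sum_distrib_left[symmetric])
      finally show ?thesis .
    qed
    finally show "expect ?G ?gp cost = (\<Sum>bs\<in>seqs UNIV n. iid (mu PX PXt) n bs * (\<Sum>i<n. \<Gamma> (ea bs ! i))) / real n" .
  qed
  show ?thesis
    unfolding gs_good_def Let_def cardW[symmetric]
    by (rule exI[of _ f1], rule exI[of _ fa], rule exI[of _ g])
       (use range lenfa fG err secrecy leakage cost' in \<open>simp add: Xn_def Zn_def W_def Sk_def Shat_def cost_def\<close>)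
qed

section \<open>From generated to chosen secrets\<close>

text \<open>The deficit bound yields both key conditions: H(S) is at most \<open>log 2 K\<close>, so
  I(S;W,Z) is at most the deficit; and H(S|W,Z) is at most H(S), so H(S) is at least
  \<open>log 2 K - \<delta>\<close>.\<close>

lemma achievable_gsI:
  fixes PX :: "'x::finite \<Rightarrow> real" and PXt :: "'x \<Rightarrow> 'xt::finite \<Rightarrow> real"
    and PYZ :: "'x \<times> 'xt \<times> 'a::finite \<Rightarrow> 'y::finite \<times> 'z::finite \<Rightarrow> real"
  assumes codes: "\<And>\<delta>. \<delta> > 0 \<Longrightarrow> \<exists>n\<ge>1. \<exists>K L f1 fa g. K \<ge> 1 \<and> Rs = log 2 (real K) / real n \<and>
      gs_good PX PXt PYZ \<Gamma> n K L f1 fa g \<delta> (real n * (Rl + \<delta>)) (C + \<delta>) \<and> log 2 (real L) \<le> real n * (Rw + \<delta>)"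
  shows "achievable_gs PX PXt PYZ \<Gamma> (Rs, Rl, Rw, C)"
  unfolding achievable_gs_def prod.case
proof (intro allI impI)
  fix \<delta> :: real assume d: "\<delta> > 0"
  obtain n K L f1 fa g where n: "n \<ge> 1" and K: "K \<ge> 1" and Rs: "Rs = log 2 (real K) / real n"
    and good: "gs_good PX PXt PYZ \<Gamma> n K L f1 fa g \<delta> (real n * (Rl + \<delta>)) (C + \<delta>)"
    and L: "log 2 (real L) \<le> real n * (Rw + \<delta>)"
    using codes[OF d] by blast
  let ?G = "gs_space n :: ('x list \<times> 'xt list \<times> 'y list \<times> 'z list) set" and ?p = "gs_prob PX PXt PYZ n f1 fa"
  define Xn where "Xn = (\<lambda>(xs :: 'x list, xts :: 'xt list, ys :: 'y list, zs :: 'z list). xs)"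
  define Zn where "Zn = (\<lambda>(xs :: 'x list, xts :: 'xt list, ys :: 'y list, zs :: 'z list). zs)"
  define W where "W = (\<lambda>(xs :: 'x list, xts :: 'xt list, ys :: 'y list, zs :: 'z list). fst (f1 xts))"
  define S where "S = (\<lambda>(xs :: 'x list, xts :: 'xt list, ys :: 'y list, zs :: 'z list). snd (f1 xts))"
  define Shat where "Shat = (\<lambda>(xs :: 'x list, xts :: 'xt list, ys :: 'y list, zs :: 'z list). g (fst (f1 xts)) ys)"
  define cost where "cost = (\<lambda>(xs :: 'x list, xts :: 'xt list, ys :: 'y list, zs :: 'z list). (\<Sum>i<n. \<Gamma> (fa (fst (f1 xts)) ! i)) / real n)"
  have P: "fprob ?G ?p"
    and err: "prb ?G ?p (\<lambda>w. Shat w \<noteq> S w) True \<le> \<delta>"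
    and sec: "log 2 (real K) - (ent ?G ?p (\<lambda>w. (S w, pair2 W Zn w)) - ent ?G ?p (pair2 W Zn)) \<le> \<delta>"
    and lk: "mi ?G ?p Xn (pair2 W Zn) \<le> real n * (Rl + \<delta>)"
    and rng: "\<forall>xts. length xts = n \<longrightarrow> fst (f1 xts) < L \<and> snd (f1 xts) < K"
    and lenfa: "\<forall>w<L. length (fa w) = n"
    and cst: "expect ?G ?p cost \<le> C + \<delta>"
    using good unfolding gs_good_def Let_def Xn_def Zn_def W_def S_def Shat_def cost_def by blast+
  have "ent ?G ?p S \<le> log 2 (real (card {..<K}))"
    using rng by (intro ent_le_log_card[OF P]) (auto simp: S_def gs_space_def)
  then have S_le: "ent ?G ?p S \<le> log 2 (real K)" by simp
  have "ent ?G ?p (\<lambda>w. (S w, pair2 W Zn w)) - ent ?G ?p (pair2 W Zn) \<le> ent ?G ?p (\<lambda>w. (S w, ())) - ent ?G ?p (\<lambda>_. ())"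
    by (rule cond_ent_antimono[OF P]) simp
  also have "\<dots> = ent ?G ?p S"
    using ent_const[OF P, of "()"] ent_cong[OF fprobD(1)[OF P], of "\<lambda>w. (S w, ())" S ?p] by simp
  finally have S_ge: "log 2 (real K) - \<delta> \<le> ent ?G ?p S" using sec by linarith
  have c1: "mi ?G ?p S (pair2 W Zn) \<le> \<delta>" unfolding mi_eq_ent[OF P] using S_le sec by linarith
  have n0: "real n \<ge> 1" using n by simp
  have c2: "ent ?G ?p S / real n \<ge> Rs - \<delta>"
  proof -
    have "(log 2 (real K) - \<delta>) / real n \<le> ent ?G ?p S / real n" using S_ge n0 by (intro divide_right_mono) auto
    moreover have "\<delta> / real n \<le> \<delta>" using d n0 by (simp add: field_simps mult_le_cancel_left1)
    ultimately show ?thesis unfolding Rs diff_divide_distrib by linarith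
  qed
  have c3: "mi ?G ?p Xn (pair2 W Zn) / real n \<le> Rl + \<delta>" "log 2 (real L) / real n \<le> Rw + \<delta>"
    using lk L n0 by (auto simp: pos_divide_le_eq mult.commute)
  note F = Rs err c1 c2 c3 cst
  note F' = F[unfolded Xn_def Zn_def W_def S_def Shat_def cost_def]
  show "\<exists>n\<ge>1. \<exists>(K::nat) (L::nat) (f1 :: 'xt list \<Rightarrow> nat \<times> nat) (fa :: nat \<Rightarrow> 'a list)
        (g :: nat \<Rightarrow> 'y list \<Rightarrow> nat).
       (\<forall>xts. length xts = n \<longrightarrow> fst (f1 xts) < L \<and> snd (f1 xts) < K) \<and>
       (\<forall>w<L. length (fa w) = n) \<and>
       (let Om = (gs_space n :: ('x list \<times> 'xt list \<times> 'y list \<times> 'z list) set);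
            p = gs_prob PX PXt PYZ n f1 fa;
            Xn = (\<lambda>(xs, xts, ys, zs). xs);
            Zn = (\<lambda>(xs, xts, ys, zs). zs);
            W = (\<lambda>(xs, xts, ys, zs). fst (f1 xts));
            S = (\<lambda>(xs, xts, ys, zs). snd (f1 xts));
            Shat = (\<lambda>(xs, xts, ys, zs). g (fst (f1 xts)) ys);
            cost = (\<lambda>(xs, xts, ys, zs). (\<Sum>i<n. \<Gamma> (fa (fst (f1 xts)) ! i)) / real n)
        in Rs = log 2 (real K) / real n
         \<and> prb Om p (\<lambda>w. Shat w \<noteq> S w) True \<le> \<delta>
         \<and> mi Om p S (pair2 W Zn) \<le> \<delta>
         \<and> ent Om p S / real n \<ge> Rs - \<delta>
         \<and> mi Om p Xn (pair2 W Zn) / real n \<le> Rl + \<delta>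
         \<and> log 2 (real L) / real n \<le> Rw + \<delta>
         \<and> expect Om p cost \<le> C + \<delta>)"
    by (rule exI[of _ n], rule conjI[OF n], rule exI[of _ K], rule exI[of _ L], rule exI[of _ f1],
        rule exI[of _ fa], rule exI[of _ g], unfold Let_def) (intro conjI rng lenfa F')
qed

section \<open>Adjoining an independent uniform key\<close>

definition unif :: "nat \<Rightarrow> ('w \<Rightarrow> real) \<Rightarrow> nat \<times> 'w \<Rightarrow> real" where
  "unif K p = (\<lambda>(s, w). p w / real K)"

lemma sum_lessThan_Times: "(\<Sum>x\<in>{..<K::nat} \<times> Om. \<phi> x) = (\<Sum>s<K. \<Sum>w\<in>Om. \<phi> (s, w))"
  by (subst sum.cartesian_product) (simp add: case_prod_unfold)

lemma fprob_unif:
  assumes "fprob Om p" "K \<ge> 1" shows "fprob ({..<K} \<times> Om) (unif K p)"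
proof -
  have "(\<Sum>x\<in>{..<K} \<times> Om. unif K p x) = (\<Sum>s<K. \<Sum>w\<in>Om. p w / real K)"
    unfolding unif_def by (rule sum.cartesian_product[symmetric])
  also have "\<dots> = 1" using assms fprobD(3)[OF assms(1)] by (simp add: sum_divide_distrib[symmetric])
  finally show ?thesis using assms fprobD[OF assms(1)] by (auto simp: fprob_def unif_def)
qed

lemma prb_unif:
  assumes "finite Om" "K \<ge> 1"
  shows "prb ({..<K} \<times> Om) (unif K p) (\<lambda>x. F (snd x)) c = prb Om p F c"
    and "s < K \<Longrightarrow> prb ({..<K} \<times> Om) (unif K p) (\<lambda>x. (fst x, F (snd x))) (s, c) = prb Om p F c / real K"
proof -
  have "prb ({..<K} \<times> Om) (unif K p) (\<lambda>x. F (snd x)) c = (\<Sum>s<K. \<Sum>w\<in>Om. if F w = c then p w / real K else 0)"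
    using assms by (simp add: prb_eq_sum_if unif_def sum_lessThan_Times cong: if_cong)
  also have "\<dots> = real K * (\<Sum>w\<in>Om. if F w = c then p w / real K else 0)" by simp
  also have "\<dots> = prb Om p F c"
    using assms unfolding prb_eq_sum_if[OF assms(1)] sum_distrib_left by (intro sum.cong) auto
  finally show "prb ({..<K} \<times> Om) (unif K p) (\<lambda>x. F (snd x)) c = prb Om p F c" .
  assume s: "s < K"
  have "prb ({..<K} \<times> Om) (unif K p) (\<lambda>x. (fst x, F (snd x))) (s, c)
      = (\<Sum>s'<K. \<Sum>w\<in>Om. if s' = s \<and> F w = c then p w / real K else 0)"
    using assms by (simp add: prb_eq_sum_if unif_def sum_lessThan_Times cong: if_cong)
  also have "\<dots> = (\<Sum>s'<K. if s' = s then \<Sum>w\<in>Om. if F w = c then p w / real K else 0 else 0)"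
    by (intro sum.cong refl) auto
  also have "\<dots> = (\<Sum>w\<in>Om. if F w = c then p w / real K else 0)" using s by simp
  also have "\<dots> = prb Om p F c / real K"
    unfolding prb_eq_sum_if[OF assms(1)] sum_divide_distrib by (intro sum.cong) auto
  finally show "prb ({..<K} \<times> Om) (unif K p) (\<lambda>x. (fst x, F (snd x))) (s, c) = prb Om p F c / real K" .
qed

lemma sum_unif:
  assumes "K \<ge> 1"
  shows "(\<Sum>x\<in>{..<K} \<times> Om. unif K p x * \<phi> (snd x)) = (\<Sum>w\<in>Om. p w * \<phi> w)"
proof -
  have "(\<Sum>x\<in>{..<K} \<times> Om. unif K p x * \<phi> (snd x)) = (\<Sum>s<K. \<Sum>w\<in>Om. p w * \<phi> w / real K)"
    by (simp add: unif_def sum_lessThan_Times)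
  then show ?thesis using assms by (simp add: sum_divide_distrib[symmetric])
qed

text \<open>Joint probabilities are those of \<open>F\<close> divided by \<open>K\<close>, so their
  logarithms shift by the constant \<open>log 2 K\<close>.\<close>

lemma ent_unif:
  assumes P: "fprob Om p" and K: "K \<ge> 1"
  shows "ent ({..<K} \<times> Om) (unif K p) (\<lambda>x. F (snd x)) = ent Om p F"
    and "ent ({..<K} \<times> Om) (unif K p) (\<lambda>x. (fst x, F (snd x))) = log 2 (real K) + ent Om p F"
proof -
  note f = fprobD[OF P]
  note fu = fprobD[OF fprob_unif[OF P K]]
  show "ent ({..<K} \<times> Om) (unif K p) (\<lambda>x. F (snd x)) = ent Om p F"
    unfolding ent_eq_sum[OF fu(1)] ent_eq_sum[OF f(1)]
    using sum_unif[OF K, where p=p and \<phi>="\<lambda>w. log 2 (prb Om p F (F w))" and Om=Om] by (simp add: prb_unif(1)[OF f(1) K])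
  have "(\<Sum>x\<in>{..<K} \<times> Om. unif K p x * log 2 (prb ({..<K} \<times> Om) (unif K p) (\<lambda>x. (fst x, F (snd x))) (fst x, F (snd x))))
      = (\<Sum>x\<in>{..<K} \<times> Om. unif K p x * (log 2 (prb Om p F (F (snd x))) - log 2 (real K)))"
  proof (rule sum.cong[OF refl])
    fix x assume x: "x \<in> {..<K} \<times> Om"
    show "unif K p x * log 2 (prb ({..<K} \<times> Om) (unif K p) (\<lambda>x. (fst x, F (snd x))) (fst x, F (snd x)))
      = unif K p x * (log 2 (prb Om p F (F (snd x))) - log 2 (real K))"
    proof (cases "p (snd x) > 0")
      case True
      then have "prb Om p F (F (snd x)) > 0" using prb_ge[OF P, of "snd x" F] x by auto
      moreover have "fst x < K" using x by auto
      ultimately show ?thesis using K by (simp add: prb_unif(2)[OF f(1) K] log_divide)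
    next
      case False
      then have "p (snd x) = 0" using f(2)[of "snd x"] x by auto
      then show ?thesis by (simp add: unif_def case_prod_unfold)
    qed
  qed
  also have "\<dots> = (\<Sum>w\<in>Om. p w * (log 2 (prb Om p F (F w)) - log 2 (real K)))"
    by (rule sum_unif[OF K])
  also have "\<dots> = (\<Sum>w\<in>Om. p w * log 2 (prb Om p F (F w))) - log 2 (real K)"
    using f(3) by (simp add: right_diff_distrib sum_subtractf sum_distrib_right[symmetric])
  finally show "ent ({..<K} \<times> Om) (unif K p) (\<lambda>x. (fst x, F (snd x))) = log 2 (real K) + ent Om p F"
    unfolding ent_eq_sum[OF fu(1)] ent_eq_sum[OF f(1)] by simp
qed

lemma mod_add_right_cancel_less:
  fixes s s' t K :: nat
  assumes "s < K" "s' < K" "(s + t) mod K = (s' + t) mod K"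
  shows "s = s'"
proof -
  have *: "b - a = 0" if "a \<le> b" "b < K" "(a + t) mod K = (b + t) mod K" for a b :: nat
  proof -
    have "(b + t) mod K = (a + t) mod K" using that(3) by (rule sym)
    then have "K dvd (b + t) - (a + t)" using that(1) by (simp add: mod_eq_dvd_iff_nat)
    then have "K dvd b - a" by simp
    moreover have "b - a < K" using that(2) by linarith
    ultimately show ?thesis using dvd_imp_le[of K "b - a"] by linarith
  qed
  show ?thesis
  proof (cases "s \<le> s'")
    case True
    from *[OF this assms(2,3)] True show ?thesis by linarith
  next
    case False
    then have "s' \<le> s" by linarith
    from *[OF this assms(1) assms(3)[symmetric]] this show ?thesis by linarith
  qed
qed

text \<open>The one-time pad: adding \<open>t w\<close> modulo \<open>K\<close> permutes the keys
  over each fixed \<open>w\<close>, so it maps the product of the uniform law with \<open>p\<close>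
  to itself.\<close>

lemma ent_unif_shift:
  assumes P: "fprob Om p" and K: "K \<ge> 1"
  shows "ent ({..<K} \<times> Om) (unif K p) (\<lambda>x. ((fst x + t (snd x)) mod K, F (snd x))) = log 2 (real K) + ent Om p F"
proof -
  let ?h = "\<lambda>x. ((fst x + t (snd x)) mod K, snd x)"
  have "bij_betw ?h ({..<K} \<times> Om) ({..<K} \<times> Om)"
    unfolding bij_betw_def
  proof
    show inj: "inj_on ?h ({..<K} \<times> Om)"
      by (auto simp: inj_on_def intro: mod_add_right_cancel_less)
    show "?h ` ({..<K} \<times> Om) = {..<K} \<times> Om"
      using K by (intro endo_inj_surj fprobD(1)[OF fprob_unif[OF P K]] inj) auto
  qed
  from ent_bij[where h="?h" and p'="unif K p" and p="unif K p" and f="\<lambda>x. (fst x, F (snd x))", OF this]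
  show ?thesis using ent_unif(2)[OF P K, of F] by (simp add: unif_def case_prod_unfold)
qed

text \<open>The chosen key plus the generated key modulo \<open>K\<close> is appended to the
  generated helper data. It is uniform and independent of (X,W,Z), so the leakage is unchanged,
  while the storage rate grows by \<open>Rs\<close>; this is why the hypothesis asks for
  \<open>Rw - Rs\<close>.\<close>

lemma achievable_csI:
  fixes PX :: "'x::finite \<Rightarrow> real" and PXt :: "'x \<Rightarrow> 'xt::finite \<Rightarrow> real"
    and PYZ :: "'x \<times> 'xt \<times> 'a::finite \<Rightarrow> 'y::finite \<times> 'z::finite \<Rightarrow> real"
  assumes codes: "\<And>\<delta>. \<delta> > 0 \<Longrightarrow> \<exists>n\<ge>1. \<exists>K L f1 fa g. K \<ge> 1 \<and> Rs = log 2 (real K) / real n \<and>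
      gs_good PX PXt PYZ \<Gamma> n K L f1 fa g \<delta> (real n * (Rl + \<delta>)) (C + \<delta>) \<and> log 2 (real L) \<le> real n * (Rw - Rs + \<delta>)"
  shows "achievable_cs PX PXt PYZ \<Gamma> (Rs, Rl, Rw, C)"
  unfolding achievable_cs_def prod.case
proof (intro allI impI)
  fix \<delta> :: real assume d: "\<delta> > 0"
  obtain n K L f1 fa g where n: "n \<ge> 1" and K: "K \<ge> 1" and Rs: "Rs = log 2 (real K) / real n"
    and good: "gs_good PX PXt PYZ \<Gamma> n K L f1 fa g \<delta> (real n * (Rl + \<delta>)) (C + \<delta>)"
    and L: "log 2 (real L) \<le> real n * (Rw - Rs + \<delta>)"
    using codes[OF d] by blast
  let ?G = "gs_space n :: ('x list \<times> 'xt list \<times> 'y list \<times> 'z list) set" and ?p = "gs_prob PX PXt PYZ n f1 fa"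
  define Xn where "Xn = (\<lambda>(xs :: 'x list, xts :: 'xt list, ys :: 'y list, zs :: 'z list). xs)"
  define Zn where "Zn = (\<lambda>(xs :: 'x list, xts :: 'xt list, ys :: 'y list, zs :: 'z list). zs)"
  define W where "W = (\<lambda>(xs :: 'x list, xts :: 'xt list, ys :: 'y list, zs :: 'z list). fst (f1 xts))"
  define S where "S = (\<lambda>(xs :: 'x list, xts :: 'xt list, ys :: 'y list, zs :: 'z list). snd (f1 xts))"
  define Shat where "Shat = (\<lambda>(xs :: 'x list, xts :: 'xt list, ys :: 'y list, zs :: 'z list). g (fst (f1 xts)) ys)"
  define cost where "cost = (\<lambda>(xs :: 'x list, xts :: 'xt list, ys :: 'y list, zs :: 'z list). (\<Sum>i<n. \<Gamma> (fa (fst (f1 xts)) ! i)) / real n)"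
  have P: "fprob ?G ?p"
    and err: "prb ?G ?p (\<lambda>w. Shat w \<noteq> S w) True \<le> \<delta>"
    and sec: "log 2 (real K) - (ent ?G ?p (\<lambda>w. (S w, pair2 W Zn w)) - ent ?G ?p (pair2 W Zn)) \<le> \<delta>"
    and lk: "mi ?G ?p Xn (pair2 W Zn) \<le> real n * (Rl + \<delta>)"
    and rng: "\<forall>xts. length xts = n \<longrightarrow> fst (f1 xts) < L \<and> snd (f1 xts) < K"
    and lenfa: "\<forall>w<L. length (fa w) = n"
    and cst: "expect ?G ?p cost \<le> C + \<delta>"
    using good unfolding gs_good_def Let_def Xn_def Zn_def W_def S_def Shat_def cost_def by blast+
  define f2 where "f2 xts s = fst (f1 xts) * K + (s + snd (f1 xts)) mod K" for xts and s :: nat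
  define fa' where "fa' w = fa (w div K)" for w
  \<comment> \<open>Subtraction modulo \<open>K\<close>, written as addition of the complement; the
    inner \<open>mod K\<close> keeps the natural subtraction from truncating.\<close>
  define g' where "g' w ys = (w mod K + (K - g (w div K) ys mod K)) mod K" for w and ys :: "'y list"
  have K0: "K > 0" using K by simp
  have f2d: "f2 xts s div K = fst (f1 xts)" "f2 xts s mod K = (s + snd (f1 xts)) mod K" for xts s
    using K0 by (simp_all add: f2_def)
  have f2L: "f2 xts s < L * K" if "length xts = n" for xts s
  proof -
    have "f2 xts s < fst (f1 xts) * K + K" using K0 by (simp add: f2_def)
    also have "\<dots> = (fst (f1 xts) + 1) * K" by simp
    also have "\<dots> \<le> L * K" using rng that by (intro mult_right_mono) auto
    finally show ?thesis .
  qed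
  have space: "cs_space n K = {..<K} \<times> ?G"
    by (auto simp: cs_space_def gs_space_def)
  have prob: "cs_prob PX PXt PYZ n K f2 fa' = unif K ?p"
    by (simp add: cs_prob_def unif_def gs_prob_def fun_eq_iff fa'_def f2d)
  let ?C = "{..<K} \<times> ?G" and ?q = "unif K ?p"
  have Q: "fprob ?C ?q" by (rule fprob_unif[OF P K])
  note fC = fprobD(1)[OF Q]
  define W' where "W' = (\<lambda>(s :: nat, xs :: 'x list, xts :: 'xt list, ys :: 'y list, zs :: 'z list). f2 xts s)"
  have W'_eq: "W' x = W (snd x) * K + (fst x + S (snd x)) mod K" for x
    by (simp add: W'_def f2_def W_def S_def case_prod_unfold)
  have W'_iff: "(W' x = W' x') = ((fst x + S (snd x)) mod K = (fst x' + S (snd x')) mod K \<and> W (snd x) = W (snd x'))" for x x'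
  proof
    assume e: "W' x = W' x'"
    have "W' x div K = W (snd x) \<and> W' x mod K = (fst x + S (snd x)) mod K" for x using K0 by (simp add: W'_eq)
    then show "(fst x + S (snd x)) mod K = (fst x' + S (snd x')) mod K \<and> W (snd x) = W (snd x')" using e by metis
  qed (simp add: W'_eq)
  have SK: "S w < K" if "w \<in> ?G" for w using that rng by (auto simp: S_def gs_space_def)
  have e1: "ent ?C ?q (pair2 W' (\<lambda>x. Zn (snd x))) = log 2 (real K) + ent ?G ?p (pair2 W Zn)"
    unfolding ent_unif_shift[OF P K, where t=S, symmetric] by (rule ent_cong[OF fC]) (auto simp: pair2_def W'_iff)
  have e2: "ent ?C ?q (\<lambda>x. (Xn (snd x), pair2 W' (\<lambda>x. Zn (snd x)) x)) = log 2 (real K) + ent ?G ?p (\<lambda>w. (Xn w, pair2 W Zn w))"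
    unfolding ent_unif_shift[OF P K, where t=S, symmetric] by (rule ent_cong[OF fC]) (auto simp: pair2_def W'_iff)
  have e3: "ent ?C ?q (\<lambda>x. (fst x, pair2 W' (\<lambda>x. Zn (snd x)) x)) = log 2 (real K) + ent ?G ?p (\<lambda>w. (S w, pair2 W Zn w))"
    unfolding ent_unif(2)[OF P K, symmetric]
  proof (rule ent_cong[OF fC])
    fix x x' assume x: "x \<in> ?C" "x' \<in> ?C"
    \<comment> \<open>For a known chosen key the padded value reveals the generated key, so the
      chosen key with the new view carries the same information as the chosen key with
      (S,W,Z).\<close>
    have "S (snd x) = S (snd x')" if "(fst x + S (snd x)) mod K = (fst x + S (snd x')) mod K"
      using mod_add_right_cancel_less[of "S (snd x)" K "S (snd x')" "fst x"] that SK x by (auto simp: add.commute)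
    then show "((fst x, pair2 W' (\<lambda>x. Zn (snd x)) x) = (fst x', pair2 W' (\<lambda>x. Zn (snd x)) x'))
        = ((fst x, (S (snd x), pair2 W Zn (snd x))) = (fst x', (S (snd x'), pair2 W Zn (snd x'))))"
      by (auto simp: pair2_def W'_iff)
  qed
  have e4: "ent ?C ?q fst = log 2 (real K)"
  proof -
    have "ent ?C ?q fst = ent ?C ?q (\<lambda>x. (fst x, (\<lambda>_. ()) (snd x)))" by (rule ent_cong[OF fC]) simp
    then show ?thesis using ent_unif(2)[OF P K, of "\<lambda>_. ()"] ent_const[OF P, of "()"] by simp
  qed
  \<comment> \<open>After cancellation the mutual information equals \<open>log 2 K\<close> minus
    H(S|W,Z), the secrecy deficit of the generated key.\<close>
  have c1: "mi ?C ?q fst (pair2 W' (\<lambda>x. Zn (snd x))) \<le> \<delta>"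
    unfolding mi_eq_ent[OF Q] e1 e3 e4 using sec by linarith
  have n0: "real n \<ge> 1" using n by simp
  have c2: "ent ?C ?q fst / real n \<ge> Rs - \<delta>" unfolding e4 Rs using d by simp
  have "mi ?C ?q (\<lambda>x. Xn (snd x)) (pair2 W' (\<lambda>x. Zn (snd x))) = mi ?G ?p Xn (pair2 W Zn)"
    unfolding mi_eq_ent[OF Q] mi_eq_ent[OF P] e1 e2 ent_unif(1)[OF P K] by simp
  then have c3: "mi ?C ?q (\<lambda>x. Xn (snd x)) (pair2 W' (\<lambda>x. Zn (snd x))) / real n \<le> Rl + \<delta>"
    using lk n0 by (auto simp: pos_divide_le_eq mult.commute)
  have c4: "log 2 (real (L * K)) / real n \<le> Rw + \<delta>"
  proof (cases "L = 0")
    case True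
    have False using rng[rule_format, of "replicate n undefined"] True by simp
    then show ?thesis ..
  next
    case False
    then have "log 2 (real (L * K)) = log 2 (real L) + log 2 (real K)" using K0 by (simp add: log_mult)
    also have "\<dots> \<le> real n * (Rw - Rs + \<delta>) + real n * Rs" using L n0 by (simp add: Rs)
    also have "\<dots> = (Rw + \<delta>) * real n" by (simp add: algebra_simps)
    finally show ?thesis using n0 by (simp add: pos_divide_le_eq)
  qed
  have corr: "g' (W' x) (fst (snd (snd (snd x)))) = fst x" if x: "x \<in> ?C" "Shat (snd x) = S (snd x)" for x
  proof -
    obtain s xs xts ys zs where xx: "x = (s, xs, xts, ys, zs)" by (cases x)
    have s: "s < K" and t: "snd (f1 xts) < K" using x(1) SK[of "snd x"] by (auto simp: xx S_def)
    have "g (fst (f1 xts)) ys = snd (f1 xts)" using x(2) by (simp add: xx Shat_def S_def)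
    then have "g' (W' x) ys = ((s + snd (f1 xts)) mod K + (K - snd (f1 xts))) mod K"
      using t by (simp add: g'_def W'_def xx f2d)
    also have "\<dots> = (s + snd (f1 xts) + (K - snd (f1 xts))) mod K" by (simp add: mod_add_left_eq)
    also have "\<dots> = s" using s t by simp
    finally show ?thesis by (simp add: xx)
  qed
  have c5: "prb ?C ?q (\<lambda>x. g' (W' x) (fst (snd (snd (snd x)))) \<noteq> fst x) True \<le> \<delta>"
  proof -
    have "prb ?C ?q (\<lambda>x. g' (W' x) (fst (snd (snd (snd x)))) \<noteq> fst x) True \<le> prb ?C ?q (\<lambda>x. Shat (snd x) \<noteq> S (snd x)) True"
      using corr by (intro prb_mono[OF Q]) auto
    also have "\<dots> = prb ?G ?p (\<lambda>w. Shat w \<noteq> S w) True"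
      by (rule prb_unif(1)[OF fprobD(1)[OF P] K, where F="\<lambda>w. Shat w \<noteq> S w"])
    finally show ?thesis using err by linarith
  qed
  have c6: "expect ?C ?q (\<lambda>x. cost (snd x)) \<le> C + \<delta>"
    using cst unfolding expect_def sum_unif[OF K] .
  have lenfa': "\<forall>w<L * K. length (fa' w) = n"
    using lenfa by (auto simp: fa'_def less_mult_imp_div_less)
  have eqs: "(\<lambda>(s :: nat, xs :: 'x list, xts :: 'xt list, ys :: 'y list, zs :: 'z list). xs) = (\<lambda>x. Xn (snd x))"
    "(\<lambda>(s :: nat, xs :: 'x list, xts :: 'xt list, ys :: 'y list, zs :: 'z list). zs) = (\<lambda>x. Zn (snd x))"
    "(\<lambda>(s :: nat, xs :: 'x list, xts :: 'xt list, ys :: 'y list, zs :: 'z list). f2 xts s) = W'"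
    "(\<lambda>(s :: nat, xs :: 'x list, xts :: 'xt list, ys :: 'y list, zs :: 'z list). s) = fst"
    "(\<lambda>(s :: nat, xs :: 'x list, xts :: 'xt list, ys :: 'y list, zs :: 'z list). g' (f2 xts s) ys) = (\<lambda>x. g' (W' x) (fst (snd (snd (snd x)))))"
    "(\<lambda>(s :: nat, xs :: 'x list, xts :: 'xt list, ys :: 'y list, zs :: 'z list). (\<Sum>i<n. \<Gamma> (fa' (f2 xts s) ! i)) / real n) = (\<lambda>x. cost (snd x))"
    by (auto simp: Xn_def Zn_def W'_def cost_def fa'_def f2d)
  show "\<exists>n\<ge>1. \<exists>(K::nat) (L::nat) (f2 :: 'xt list \<Rightarrow> nat \<Rightarrow> nat) (fa :: nat \<Rightarrow> 'a list)
        (g :: nat \<Rightarrow> 'y list \<Rightarrow> nat).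
       K \<ge> 1 \<and>
       (\<forall>xts s. length xts = n \<longrightarrow> s < K \<longrightarrow> f2 xts s < L) \<and>
       (\<forall>w<L. length (fa w) = n) \<and>
       (let Om = (cs_space n K :: (nat \<times> 'x list \<times> 'xt list \<times> 'y list \<times> 'z list) set);
            p = cs_prob PX PXt PYZ n K f2 fa;
            Xn = (\<lambda>(s, xs, xts, ys, zs). xs);
            Zn = (\<lambda>(s, xs, xts, ys, zs). zs);
            W = (\<lambda>(s, xs, xts, ys, zs). f2 xts s);
            S = (\<lambda>(s, xs, xts, ys, zs). s);
            Shat = (\<lambda>(s, xs, xts, ys, zs). g (f2 xts s) ys);
            cost = (\<lambda>(s, xs, xts, ys, zs). (\<Sum>i<n. \<Gamma> (fa (f2 xts s) ! i)) / real n)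
        in Rs = log 2 (real K) / real n
         \<and> prb Om p (\<lambda>w. Shat w \<noteq> S w) True \<le> \<delta>
         \<and> mi Om p S (pair2 W Zn) \<le> \<delta>
         \<and> ent Om p S / real n \<ge> Rs - \<delta>
         \<and> mi Om p Xn (pair2 W Zn) / real n \<le> Rl + \<delta>
         \<and> log 2 (real L) / real n \<le> Rw + \<delta>
         \<and> expect Om p cost \<le> C + \<delta>)"
    by (rule exI[of _ n], rule conjI[OF n], rule exI[of _ K], rule exI[of _ "L * K"], rule exI[of _ f2],
        rule exI[of _ fa'], rule exI[of _ g'], unfold Let_def space prob eqs)
       (intro conjI K allI impI f2L lenfa' Rs c1 c2 c3 c4 c5 c6)
qed

section \<open>Single-letter rates\<close>

text \<open>The marginal of \<open>joint1\<close> on observation, action, \<open>U\<close> and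
  \<open>V\<close>. In the tuple \<open>u\<close> precedes \<open>v\<close>, although it is drawn
  from \<open>v\<close>, because the covering picks the \<open>U\<close> word before the
  \<open>V\<close> word.\<close>

definition letter_law :: "('x::finite \<Rightarrow> real) \<Rightarrow> ('x \<Rightarrow> 'b \<Rightarrow> real) \<Rightarrow> ('b \<Rightarrow> 'a \<Rightarrow> real) \<Rightarrow> ('b \<times> 'a \<Rightarrow> 'v \<Rightarrow> real)
    \<Rightarrow> ('v \<Rightarrow> 'u \<Rightarrow> real) \<Rightarrow> 'b \<times> 'a \<times> 'u \<times> 'v \<Rightarrow> real" where
  "letter_law PX PXt PA PV PU = (\<lambda>(b,a,u,v). mu PX PXt b * PA b a * PV (b,a) v * PU v u)"

lemma sum_letter_law:
  fixes PA :: "'b::finite \<Rightarrow> 'a::finite \<Rightarrow> real" and PV :: "'b \<times> 'a \<Rightarrow> 'v::finite \<Rightarrow> real" and PU :: "'v \<Rightarrow> 'u::finite \<Rightarrow> real"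
  assumes "stoch PV" "stoch PU"
  shows "(\<Sum>u\<in>UNIV. \<Sum>v\<in>UNIV. letter_law PX PXt PA PV PU (b,a,u,v)) = mu PX PXt b * PA b a"
proof -
  have "(\<Sum>v\<in>UNIV. \<Sum>u\<in>UNIV. letter_law PX PXt PA PV PU (b,a,u,v)) = mu PX PXt b * PA b a"
    using assms by (simp add: letter_law_def sum_distrib_left[symmetric] stoch_def is_pmf_def)
  then show ?thesis by (subst sum.swap)
qed

lemma prb_letter_law:
  fixes PA :: "'b::finite \<Rightarrow> 'a::finite \<Rightarrow> real" and PV :: "'b \<times> 'a \<Rightarrow> 'v::finite \<Rightarrow> real" and PU :: "'v \<Rightarrow> 'u::finite \<Rightarrow> real"
  assumes "stoch PA" "stoch PV" "stoch PU"
  shows "prb UNIV (letter_law PX PXt PA PV PU) (\<lambda>(b,a,u,v). b) = mu PX PXt"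
proof
  fix c
  let ?P = "letter_law PX PXt PA PV PU"
  have k: "(\<Sum>a\<in>UNIV. \<Sum>u\<in>UNIV. \<Sum>v\<in>UNIV. if b = c then ?P (b,a,u,v) else 0) = (if b = c then mu PX PXt b else 0)" for b
  proof (cases "b = c")
    case True
    then show ?thesis using assms(1)
      by (simp add: sum_letter_law[OF assms(2,3)] sum_distrib_left[symmetric] stoch_def is_pmf_def)
  qed simp
  have "prb UNIV ?P (\<lambda>(b,a,u,v). b) c = (\<Sum>b\<in>UNIV. \<Sum>t\<in>UNIV. if b = c then ?P (b,t) else 0)"
    unfolding prb_eq_sum_if[OF finite_class.finite_UNIV] by (subst sum_UNIV_pair) (simp add: case_prod_unfold)
  also have "\<dots> = (\<Sum>b\<in>UNIV. if b = c then mu PX PXt b else 0)"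
    by (simp only: sum_UNIV_triple k)
  finally show "prb UNIV ?P (\<lambda>(b,a,u,v). b) c = mu PX PXt c" by simp
qed

lemma fprob_letter_law:
  fixes PXt :: "'x::finite \<Rightarrow> 'b::finite \<Rightarrow> real" and PA :: "'b \<Rightarrow> 'a::finite \<Rightarrow> real"
    and PV :: "'b \<times> 'a \<Rightarrow> 'v::finite \<Rightarrow> real" and PU :: "'v \<Rightarrow> 'u::finite \<Rightarrow> real"
  assumes "is_pmf PX" "stoch PXt" "stoch PA" "stoch PV" "stoch PU"
  shows "fprob UNIV (letter_law PX PXt PA PV PU)"
proof -
  have mu: "is_pmf (mu PX PXt)" by (rule is_pmf_mu[OF assms(1,2)])
  have "sum (letter_law PX PXt PA PV PU) UNIV = (\<Sum>b\<in>UNIV. \<Sum>a\<in>UNIV. mu PX PXt b * PA b a)"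
    by (subst sum_UNIV_pair) (simp only: sum_UNIV_triple sum_letter_law[OF assms(4,5)])
  also have "\<dots> = 1" using assms(3) mu by (simp add: sum_distrib_left[symmetric] stoch_def is_pmf_def)
  finally show ?thesis using assms mu by (auto simp: fprob_def letter_law_def stoch_def is_pmf_def)
qed

text \<open>Attaching (x,y,z) through the backward channel recovers the joint law of the theorem, up
  to the order of components.\<close>

lemma chan_letter_law:
  assumes "is_pmf PX" "stoch PXt"
  shows "chan (letter_law PX PXt PA PV PU) (kap PX PXt PYZ) (b,(a,u,v),(x,y,z)) = joint1 PX PXt PA PYZ PV PU (x,b,a,y,z,v,u)"
proof -
  have "chan (letter_law PX PXt PA PV PU) (kap PX PXt PYZ) (b,(a,u,v),(x,y,z))
      = (mu PX PXt b * kap PX PXt PYZ b a (x,y,z)) * (PA b a * PV (b,a) v * PU v u)"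
    by (simp add: chan_def letter_law_def)
  also have "\<dots> = joint1 PX PXt PA PYZ PV PU (x,b,a,y,z,v,u)"
    unfolding mu_kap[OF assms] by (simp add: joint1_def)
  finally show ?thesis .
qed

lemmas s_defs = sX_def sXt_def sA_def sY_def sZ_def sV_def sU_def

lemma ent_letter_law:
  fixes PXt :: "'x::finite \<Rightarrow> 'b::finite \<Rightarrow> real"
    and f :: "'b \<times> ('a::finite \<times> 'u::finite \<times> 'v::finite) \<times> 'x \<times> 'y::finite \<times> 'z::finite \<Rightarrow> 'r"
  assumes "is_pmf PX" "stoch PXt"
  shows "lent (letter_law PX PXt PA PV PU) (kap PX PXt PYZ) f
    = ent UNIV (joint1 PX PXt PA PYZ PV PU) (\<lambda>w. f (sXt w, (sA w, sU w, sV w), (sX w, sY w, sZ w)))"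
proof -
  let ?h = "\<lambda>w :: 'x \<times> 'b \<times> 'a \<times> 'y \<times> 'z \<times> 'v \<times> 'u. (sXt w, (sA w, sU w, sV w), (sX w, sY w, sZ w))"
  have h: "bij_betw ?h UNIV UNIV"
    by (rule bij_betw_byWitness[where f'="\<lambda>(b,(a,u,v),(x,y,z)). (x,b,a,y,z,v,u)"]) (auto simp: s_defs)
  have J: "joint1 PX PXt PA PYZ PV PU w = chan (letter_law PX PXt PA PV PU) (kap PX PXt PYZ) (?h w)" for w
    by (cases w) (simp add: s_defs chan_letter_law[OF assms])
  show ?thesis
    by (rule ent_bij[where h="?h" and p="chan (letter_law PX PXt PA PV PU) (kap PX PXt PYZ)" and f=f, OF h J, symmetric])
qed

lemma expect_letter_law:
  fixes PXt :: "'x::finite \<Rightarrow> 'b::finite \<Rightarrow> real" and PA :: "'b \<Rightarrow> 'a::finite \<Rightarrow> real"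
    and PV :: "'b \<times> 'a \<Rightarrow> 'v::finite \<Rightarrow> real" and PU :: "'v \<Rightarrow> 'u::finite \<Rightarrow> real"
    and PYZ :: "'x \<times> 'b \<times> 'a \<Rightarrow> 'y::finite \<times> 'z::finite \<Rightarrow> real"
  assumes "is_pmf PX" "stoch PXt" "stoch PYZ"
  shows "expect UNIV (joint1 PX PXt PA PYZ PV PU) (\<lambda>w. \<Gamma> (sA w))
    = (\<Sum>(b,a,u,v)\<in>UNIV. letter_law PX PXt PA PV PU (b,a,u,v) * \<Gamma> a)"
proof -
  let ?P = "letter_law PX PXt PA PV PU" and ?k = "kap PX PXt PYZ"
  let ?h = "\<lambda>w :: 'x \<times> 'b \<times> 'a \<times> 'y \<times> 'z \<times> 'v \<times> 'u. (sXt w, (sA w, sU w, sV w), (sX w, sY w, sZ w))"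
  have h: "bij_betw ?h UNIV UNIV"
    by (rule bij_betw_byWitness[where f'="\<lambda>(b,(a,u,v),(x,y,z)). (x,b,a,y,z,v,u)"]) (auto simp: s_defs)
  have J: "joint1 PX PXt PA PYZ PV PU w * \<Gamma> (sA w) = chan ?P ?k (?h w) * \<Gamma> (fst (fst (snd (?h w))))" for w
    by (cases w) (simp add: s_defs chan_letter_law[OF assms(1,2)])
  have "expect UNIV (joint1 PX PXt PA PYZ PV PU) (\<lambda>w. \<Gamma> (sA w)) = (\<Sum>w\<in>UNIV. chan ?P ?k (?h w) * \<Gamma> (fst (fst (snd (?h w)))))"
    unfolding expect_def by (rule sum.cong[OF refl J])
  also have "\<dots> = (\<Sum>t\<in>UNIV. chan ?P ?k t * \<Gamma> (fst (fst (snd t))))"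
    by (rule sum.reindex_bij_betw[OF h])
  also have "\<dots> = (\<Sum>b\<in>UNIV. \<Sum>g\<in>UNIV. \<Sum>o'\<in>UNIV. ?P (b,g) * \<Gamma> (fst g) * ?k b (fst g) o')"
    by (subst sum_UNIV_triple) (simp add: chan_def mult_ac)
  also have "\<dots> = (\<Sum>b\<in>UNIV. \<Sum>g\<in>UNIV. ?P (b,g) * \<Gamma> (fst g))"
    using is_pmf_kap[OF assms] by (simp add: sum_distrib_left[symmetric] is_pmf_def)
  also have "\<dots> = (\<Sum>t\<in>UNIV. ?P t * \<Gamma> (fst (snd t)))"
    unfolding sum_UNIV_pair[where f="\<lambda>t. ?P t * \<Gamma> (fst (snd t))"] fst_conv snd_conv ..
  finally show ?thesis by (simp add: case_prod_unfold)
qed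

section \<open>Markov chains of the joint law\<close>

text \<open>U depends on everything else only through V, so H(U|V,F) is the same for every
  \<open>F\<close>: both sides reduce to the same linear functional by
  \<open>markov_cond_ent\<close>.\<close>

lemma ent_joint1_UV:
  fixes PX :: "'x::finite \<Rightarrow> real" and PXt :: "'x \<Rightarrow> 'b::finite \<Rightarrow> real" and PA :: "'b \<Rightarrow> 'a::finite \<Rightarrow> real"
    and PV :: "'b \<times> 'a \<Rightarrow> 'v::finite \<Rightarrow> real" and PU :: "'v \<Rightarrow> 'u::finite \<Rightarrow> real"
    and PYZ :: "'x \<times> 'b \<times> 'a \<Rightarrow> 'y::finite \<times> 'z::finite \<Rightarrow> real"
    and F :: "'x \<times> 'b \<times> 'a \<times> 'y \<times> 'z \<Rightarrow> 'f" and F' :: "'x \<times> 'b \<times> 'a \<times> 'y \<times> 'z \<Rightarrow> 'g"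
  defines "J \<equiv> joint1 PX PXt PA PYZ PV PU"
  assumes J: "fprob UNIV J" and PU: "stoch PU"
  shows "ent UNIV J (\<lambda>w. (sU w, sV w, F (sX w, sXt w, sA w, sY w, sZ w))) - ent UNIV J (\<lambda>w. (sV w, F (sX w, sXt w, sA w, sY w, sZ w)))
    = ent UNIV J (\<lambda>w. (sU w, sV w, F' (sX w, sXt w, sA w, sY w, sZ w))) - ent UNIV J (\<lambda>w. (sV w, F' (sX w, sXt w, sA w, sY w, sZ w)))"
proof -
  let ?h = "\<lambda>w :: 'x \<times> 'b \<times> 'a \<times> 'y \<times> 'z \<times> 'v \<times> 'u. (sV w, (sX w, sXt w, sA w, sY w, sZ w), sU w)"
  define Q where "Q = (\<lambda>(v,(x,b,a,y,z),u). J (x,b,a,y,z,v,u))"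
  have h: "bij_betw ?h UNIV UNIV"
    by (rule bij_betw_byWitness[where f'="\<lambda>(v,(x,b,a,y,z),u). (x,b,a,y,z,v,u)"]) (auto simp: s_defs)
  have JQ: "J w = Q (?h w)" for w by (cases w) (simp add: Q_def s_defs)
  have Q: "fprob UNIV Q"
  proof -
    have "sum J UNIV = (\<Sum>w\<in>UNIV. Q (?h w))" by (rule sum.cong[OF refl JQ])
    also have "\<dots> = sum Q UNIV" by (rule sum.reindex_bij_betw[OF h])
    finally have "sum Q UNIV = sum J UNIV" ..
    then show ?thesis using fprobD[OF J] by (auto simp: fprob_def Q_def)
  qed
  have fac: "Q (v, g, u) = (case g of (x,b,a,y,z) \<Rightarrow> PX x * PXt x b * PA b a * PYZ (x,b,a) (y,z) * PV (b,a) v) * PU v u" for v g u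
    by (cases g) (simp add: Q_def J_def joint1_def)
  have PU1: "(\<Sum>u\<in>UNIV. PU v u) = 1" for v using PU by (simp add: stoch_def is_pmf_def)
  have t1: "ent UNIV Q (\<lambda>(v,g,u). (u, v, G g)) = ent UNIV J (\<lambda>w. (sU w, sV w, G (sX w, sXt w, sA w, sY w, sZ w)))"
    and t2: "ent UNIV Q (\<lambda>(v,g,u). (v, G g)) = ent UNIV J (\<lambda>w. (sV w, G (sX w, sXt w, sA w, sY w, sZ w)))"
    for G :: "_ \<Rightarrow> 'f"
    using ent_bij[where h="?h" and p'=J and p=Q and f="\<lambda>(v,g,u). (u, v, G g)", OF h JQ]
      ent_bij[where h="?h" and p'=J and p=Q and f="\<lambda>(v,g,u). (v, G g)", OF h JQ] by simp_all
  have t3: "ent UNIV Q (\<lambda>(v,g,u). (u, v, G g)) = ent UNIV J (\<lambda>w. (sU w, sV w, G (sX w, sXt w, sA w, sY w, sZ w)))"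
    and t4: "ent UNIV Q (\<lambda>(v,g,u). (v, G g)) = ent UNIV J (\<lambda>w. (sV w, G (sX w, sXt w, sA w, sY w, sZ w)))"
    for G :: "_ \<Rightarrow> 'g"
    using ent_bij[where h="?h" and p'=J and p=Q and f="\<lambda>(v,g,u). (u, v, G g)", OF h JQ]
      ent_bij[where h="?h" and p'=J and p=Q and f="\<lambda>(v,g,u). (v, G g)", OF h JQ] by simp_all
  have m1: "ent UNIV Q (\<lambda>(v,g,u). (u, v, F g)) - ent UNIV Q (\<lambda>(v,g,u). (v, F g))
     = - (\<Sum>(v,g,u)\<in>UNIV. Q (v,g,u) * log 2 (\<Sum>u'\<in>UNIV. if u' = u then PU v u' else 0))"
    by (rule markov_cond_ent[where \<tau>="\<lambda>u. u" and \<kappa>="\<lambda>v g. PU v", OF Q fac PU1 refl])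
  have m2: "ent UNIV Q (\<lambda>(v,g,u). (u, v, F' g)) - ent UNIV Q (\<lambda>(v,g,u). (v, F' g))
     = - (\<Sum>(v,g,u)\<in>UNIV. Q (v,g,u) * log 2 (\<Sum>u'\<in>UNIV. if u' = u then PU v u' else 0))"
    by (rule markov_cond_ent[where \<tau>="\<lambda>u. u" and \<kappa>="\<lambda>v g. PU v", OF Q fac PU1 refl])
  show ?thesis using m1 m2 unfolding t1 t2 t3 t4 by simp
qed

text \<open>Given the observation and the action, V is drawn independently of Y; both sides are
  H(V|Xt,A), and the unit component only gives them the shape that \<open>markov_cond_ent\<close>
  produces.\<close>

lemma ent_joint1_VY:
  fixes PX :: "'x::finite \<Rightarrow> real" and PXt :: "'x \<Rightarrow> 'b::finite \<Rightarrow> real" and PA :: "'b \<Rightarrow> 'a::finite \<Rightarrow> real"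
    and PV :: "'b \<times> 'a \<Rightarrow> 'v::finite \<Rightarrow> real" and PU :: "'v \<Rightarrow> 'u::finite \<Rightarrow> real"
    and PYZ :: "'x \<times> 'b \<times> 'a \<Rightarrow> 'y::finite \<times> 'z::finite \<Rightarrow> real"
  defines "J \<equiv> joint1 PX PXt PA PYZ PV PU"
  assumes J: "fprob UNIV J" and PU: "stoch PU" and PV: "stoch PV"
  shows "ent UNIV J (\<lambda>w. (sV w, (sXt w, sA w), sY w)) - ent UNIV J (\<lambda>w. ((sXt w, sA w), sY w))
    = ent UNIV J (\<lambda>w. (sV w, (sXt w, sA w), ())) - ent UNIV J (\<lambda>w. ((sXt w, sA w), ()))"
proof -
  let ?h = "\<lambda>w :: 'x \<times> 'b \<times> 'a \<times> 'y \<times> 'z \<times> 'v \<times> 'u. ((sXt w, sA w), (sX w, sY w, sZ w), (sV w, sU w))"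
  define Q where "Q = (\<lambda>((b,a),(x,y,z),(v,u)). J (x,b,a,y,z,v,u))"
  have h: "bij_betw ?h UNIV UNIV"
    by (rule bij_betw_byWitness[where f'="\<lambda>((b,a),(x,y,z),(v,u)). (x,b,a,y,z,v,u)"]) (auto simp: s_defs)
  have JQ: "J w = Q (?h w)" for w by (cases w) (simp add: Q_def s_defs)
  have Q: "fprob UNIV Q"
  proof -
    have "sum J UNIV = (\<Sum>w\<in>UNIV. Q (?h w))" by (rule sum.cong[OF refl JQ])
    also have "\<dots> = sum Q UNIV" by (rule sum.reindex_bij_betw[OF h])
    finally have "sum Q UNIV = sum J UNIV" ..
    then show ?thesis using fprobD[OF J] by (auto simp: fprob_def Q_def)
  qed
  \<comment> \<open>The kernel draws \<open>v\<close> and \<open>u\<close> together so that it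
    exhausts the remaining randomness of \<open>joint1\<close>; projecting with \<open>fst\<close>
    leaves \<open>v\<close>.\<close>
  define k where "k c t = PV c (fst t) * PU (fst t) (snd t)" for c t
  have fac: "Q (c, g, t) = (case c of (b,a) \<Rightarrow> case g of (x,y,z) \<Rightarrow> PX x * PXt x b * PA b a * PYZ (x,b,a) (y,z)) * k c t" for c g t
    by (cases c; cases g; cases t) (simp add: Q_def J_def joint1_def k_def)
  have k1: "(\<Sum>t\<in>UNIV. k c t) = 1" for c
    using PU PV by (cases c) (simp add: sum_UNIV_pair k_def sum_distrib_left[symmetric] stoch_def is_pmf_def)
  have m1: "ent UNIV Q (\<lambda>(c,g,t). (fst t, c, fst (snd g))) - ent UNIV Q (\<lambda>(c,g,t). (c, fst (snd g)))
     = - (\<Sum>(c,g,t)\<in>UNIV. Q (c,g,t) * log 2 (\<Sum>t'\<in>UNIV. if fst t' = fst t then k c t' else 0))"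
    by (rule markov_cond_ent[where \<tau>=fst and \<pi>="\<lambda>g. fst (snd g)" and \<kappa>="\<lambda>c g. k c", OF Q fac k1 refl])
  have m2: "ent UNIV Q (\<lambda>(c,g,t). (fst t, c, ())) - ent UNIV Q (\<lambda>(c,g,t). (c, ()))
     = - (\<Sum>(c,g,t)\<in>UNIV. Q (c,g,t) * log 2 (\<Sum>t'\<in>UNIV. if fst t' = fst t then k c t' else 0))"
    by (rule markov_cond_ent[where \<tau>=fst and \<pi>="\<lambda>g. ()" and \<kappa>="\<lambda>c g. k c", OF Q fac k1 refl])
  show ?thesis using m1 m2
    ent_bij[where h="?h" and p'=J and p=Q and f="\<lambda>(c,g,t). (fst t, c, fst (snd g))", OF h JQ]
    ent_bij[where h="?h" and p'=J and p=Q and f="\<lambda>(c,g,t). (c, fst (snd g))", OF h JQ]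
    ent_bij[where h="?h" and p'=J and p=Q and f="\<lambda>(c,g,t). (fst t, c, ())", OF h JQ]
    ent_bij[where h="?h" and p'=J and p=Q and f="\<lambda>(c,g,t). (c, ())", OF h JQ] by simp
qed

section \<open>Assembling the codes at rational key rates\<close>

lemma gs_good_mono:
  assumes "gs_good PX PXt PYZ \<Gamma> n K L f1 fa g \<delta> lk C" "lk \<le> lk'" "C \<le> C'"
  shows "gs_good PX PXt PYZ \<Gamma> n K L f1 fa g \<delta> lk' C'"
  using assms unfolding gs_good_def Let_def by (intro conjI) (elim conjE, (assumption | linarith))+

text \<open>For \<open>r > 0\<close> the largest numerator strictly below \<open>r * m\<close>
  misses by at most \<open>1 / m\<close>. Strictness leaves room for the slack of the codes;
  \<open>j = 0\<close> is allowed separately, since \<open>R\<close> may itself be 0.\<close>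

lemma rational_below:
  fixes r :: real
  assumes "0 \<le> r" "r \<le> R" "\<eta> > 0"
  shows "\<exists>j m :: nat. m \<ge> 1 \<and> (j = 0 \<or> real j / real m < R) \<and> real j / real m \<le> r \<and> r - \<eta> < real j / real m"
proof (cases "r = 0")
  case True
  then show ?thesis using assms by (intro exI[of _ 0] exI[of _ 1]) auto
next
  case False
  obtain m' :: nat where m': "inverse (real (Suc m')) < \<eta>" using reals_Archimedean[OF assms(3)] by blast
  define m where "m = Suc m'"
  have m: "m \<ge> 1" "real m > 0" "1 / real m < \<eta>" using m' by (auto simp: m_def inverse_eq_divide)
  define j where "j = nat (\<lceil>r * real m\<rceil> - 1)"
  have "r * real m > 0" using assms(1) False m by simp
  then have j: "real j = real_of_int (\<lceil>r * real m\<rceil> - 1)" unfolding j_def by (simp add: less_ceiling_iff)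
  have lt: "real j < r * real m" "r * real m \<le> real j + 1" unfolding j by linarith+
  then have a: "real j / real m < r" "r \<le> (real j + 1) / real m"
    using m(2) by (simp_all add: pos_divide_less_eq pos_le_divide_eq)
  then have "r - \<eta> < real j / real m" using m(3) by (simp add: add_divide_distrib)
  then show ?thesis using a(1) assms(2) m(1) by (intro exI[of _ j] exI[of _ m]) auto
qed

text \<open>Only the key rate is approximated; leakage, storage and cost already carry a tolerance
  in the definition of achievability.\<close>

lemma closure_first_coordinate:
  fixes Rs :: real and T :: "real \<times> real \<times> real"
  assumes "\<And>\<eta>. \<eta> > 0 \<Longrightarrow> \<exists>Rs'. Rs' \<le> Rs \<and> Rs - \<eta> < Rs' \<and> Q (Rs', T)"
  shows "(Rs, T) \<in> closure {R. Q R}"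
  unfolding closure_approachable
proof (intro allI impI)
  fix \<eta> :: real assume "\<eta> > 0"
  from assms[OF this] obtain Rs' where "Rs' \<le> Rs" "Rs - \<eta> < Rs'" "Q (Rs', T)" by blast
  then show "\<exists>y\<in>{R. Q R}. dist y (Rs, T) < \<eta>"
    by (intro bexI[of _ "(Rs', T)"]) (auto simp: dist_Pair_Pair dist_real_def)
qed

text \<open>The block length \<open>n\<close> is fixed by the inner code, the number
  \<open>N\<close> of blocks by the outer code. \<open>max L2 L3\<close> reflects that the bin index
  of \<open>V\<close> either adds to the leakage or is negligible beside I(X;A,U,Z).\<close>

lemma gs_codes:
  fixes PX :: "'x::finite \<Rightarrow> real" and PXt :: "'x \<Rightarrow> 'b::finite \<Rightarrow> real"
    and PYZ :: "'x \<times> 'b \<times> 'a::finite \<Rightarrow> 'y::finite \<times> 'z::finite \<Rightarrow> real" and \<Gamma> :: "'a \<Rightarrow> real"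
    and P :: "'b \<times> 'a \<times> 'u::finite \<times> 'v::finite \<Rightarrow> real" and j m :: nat
  assumes pmf: "is_pmf PX" "stoch PXt" "stoch PYZ" and P: "fprob UNIV P"
    and Pb: "prb UNIV P (\<lambda>(b,a,u,v). b) = mu PX PXt" and d: "\<delta> > 0" and m: "m \<ge> 1"
  defines "\<kappa> \<equiv> kap PX PXt PYZ"
  defines "RW \<equiv> lent P \<kappa> (\<lambda>(b,(a,u,v),(x,y,z)). a) + lent P \<kappa> (\<lambda>(b,(a,u,v),(x,y,z)). b) - lent P \<kappa> (\<lambda>(b,(a,u,v),(x,y,z)). (b, (a, u, v)))
      + lent P \<kappa> (\<lambda>(b,(a,u,v),(x,y,z)). (y, (a, u, v))) - lent P \<kappa> (\<lambda>(b,(a,u,v),(x,y,z)). (y, a))"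
    and "RK \<equiv> lent P \<kappa> (\<lambda>(b,(a,u,v),(x,y,z)). (z, (a, u, v))) - lent P \<kappa> (\<lambda>(b,(a,u,v),(x,y,z)). (z, (a, u)))
      - lent P \<kappa> (\<lambda>(b,(a,u,v),(x,y,z)). (y, (a, u, v))) + lent P \<kappa> (\<lambda>(b,(a,u,v),(x,y,z)). (y, (a, u)))"
    and "L3 \<equiv> lent P \<kappa> (\<lambda>(b,(a,u,v),(x,y,z)). x) + lent P \<kappa> (\<lambda>(b,(a,u,v),(x,y,z)). (z, (a, u)))
      - lent P \<kappa> (\<lambda>(b,(a,u,v),(x,y,z)). ((x, z), (a, u)))"
    and "L2 \<equiv> lent P \<kappa> (\<lambda>(b,(a,u,v),(x,y,z)). x) + lent P \<kappa> (\<lambda>(b,(a,u,v),(x,y,z)). (z, (a, u)))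
      + lent P \<kappa> (\<lambda>(b,(a,u,v),(x,y,z)). (y, (a, u, v))) - lent P \<kappa> (\<lambda>(b,(a,u,v),(x,y,z)). (y, (a, u)))
      - lent P \<kappa> (\<lambda>(b,(a,u,v),(x,y,z)). ((x, z), (a, u, v)))"
  assumes Rs: "j = 0 \<or> real j / real m < RK"
  shows "\<exists>n\<ge>1. \<exists>K L f1 fa g. K \<ge> 1 \<and> real j / real m = log 2 (real K) / real n \<and>
      gs_good PX PXt PYZ \<Gamma> n K L f1 fa g \<delta> (real n * (max L2 L3 + \<delta>)) ((\<Sum>(b,a,u,v)\<in>UNIV. P (b,a,u,v) * \<Gamma> a) + \<delta>)
      \<and> log 2 (real L) \<le> real n * (RW + \<delta>)"
proof -
  \<comment> \<open>A third of the gap below \<open>RK\<close> is taken because the inner code loses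
    one \<open>\<epsilon>\<close> of key rate and the outer code two. \<open>\<delta> / 8\<close>
    covers the \<open>3 * \<epsilon>\<close> spent on storage and the \<open>4 * \<epsilon>\<close>
    spent on leakage.\<close>
  define \<epsilon> where "\<epsilon> = (if j = 0 then \<delta> / 8 else min (\<delta> / 8) ((RK - real j / real m) / 3))"
  have \<epsilon>: "\<epsilon> > 0" "\<epsilon> \<le> \<delta> / 8" "j = 0 \<or> real j / real m \<le> RK - 3 * \<epsilon>"
    using d Rs by (auto simp: \<epsilon>_def min_def field_simps split: if_splits)
  have \<kappa>: "is_pmf (\<kappa> b a)" for b a unfolding \<kappa>_def by (rule is_pmf_kap[OF pmf])
  obtain n ea eu ev where n: "n \<ge> 1" and ea: "\<forall>bs\<in>seqs UNIV n. length (ea bs :: 'a list) = n"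
    and inner: "let H = (\<lambda>f. ent (sblk n) (sprob (mu PX PXt) \<kappa> ea n) f) :: ('b list \<times> ('x \<times> 'y \<times> 'z) list \<Rightarrow> 'x list \<times> 'y list \<times> 'z list \<times> 'a list \<times> 'u list \<times> 'v list) \<Rightarrow> real;
          A = (\<lambda>w. ea (fst w)); U = (\<lambda>w. eu (fst w)); V = (\<lambda>w. ev (fst w));
          X = (\<lambda>w. map fst (snd w)); Y = (\<lambda>w. map (\<lambda>t. fst (snd t)) (snd w)); Z = (\<lambda>w. map (\<lambda>t. snd (snd t)) (snd w));
          H_AY = H (\<lambda>w. ([], Y w, [], A w, [], [])); H_AUY = H (\<lambda>w. ([], Y w, [], A w, U w, []));
          H_AUVY = H (\<lambda>w. ([], Y w, [], A w, U w, V w)); H_AUZ = H (\<lambda>w. ([], [], Z w, A w, U w, []));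
          H_AUVZ = H (\<lambda>w. ([], [], Z w, A w, U w, V w)); H_AUXZ = H (\<lambda>w. (X w, [], Z w, A w, U w, []));
          H_AUVXZ = H (\<lambda>w. (X w, [], Z w, A w, U w, V w)); H_X = H (\<lambda>w. (X w, [], [], [], [], []))
      in log 2 (card (ea ` seqs UNIV n)) + H_AUVY - H_AY \<le> real n * (RW + \<epsilon>)
       \<and> (H_AUVZ - H_AUZ) - (H_AUVY - H_AUY) \<ge> real n * (RK - \<epsilon>)
       \<and> H_X + H_AUZ - H_AUXZ \<le> real n * (L3 + \<epsilon>)
       \<and> H_X + H_AUZ - H_AUXZ + (H_AUVY - H_AUY) - (H_AUVXZ - H_AUXZ) \<le> real n * (L2 + \<epsilon>)"
    and cost: "(\<Sum>bs\<in>seqs UNIV n. iid (mu PX PXt) n bs * (\<Sum>i<n. \<Gamma> (ea bs ! i))) \<le> real n * ((\<Sum>(b,a,u,v)\<in>UNIV. P (b,a,u,v) * \<Gamma> a) + \<epsilon>)"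
    using inner_code[where P=P and \<kappa>=\<kappa> and \<epsilon>=\<epsilon> and \<Gamma>=\<Gamma>, OF P \<kappa> \<epsilon>(1), unfolded Pb,
      folded RW_def RK_def L3_def L2_def]
    by (elim exE conjE) (rule that)
  define A where "A = (\<lambda>w :: 'b list \<times> ('x \<times> 'y \<times> 'z) list. ea (fst w))"
  define U where "U = (\<lambda>w :: 'b list \<times> ('x \<times> 'y \<times> 'z) list. eu (fst w))"
  define V where "V = (\<lambda>w :: 'b list \<times> ('x \<times> 'y \<times> 'z) list. ev (fst w))"
  define X where "X = (\<lambda>w :: 'b list \<times> ('x \<times> 'y \<times> 'z) list. map fst (snd w))"
  define Y where "Y = (\<lambda>w :: 'b list \<times> ('x \<times> 'y \<times> 'z) list. map (\<lambda>t. fst (snd t)) (snd w))"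
  define Z where "Z = (\<lambda>w :: 'b list \<times> ('x \<times> 'y \<times> 'z) list. map (\<lambda>t. snd (snd t)) (snd w))"
  define p where "p = sprob (mu PX PXt) \<kappa> ea n"
  have P0: "fprob (sblk n) p" unfolding p_def \<kappa>_def by (rule fprob_sprob[OF pmf n]) (use ea in blast)
  note fin = fprobD(1)[OF P0]
  define HAY where "HAY = ent (sblk n) p (\<lambda>w. (A w, Y w))"
  define HUAY where "HUAY = ent (sblk n) p (\<lambda>w. (U w, (A w, Y w)))"
  define HAUY where "HAUY = ent (sblk n) p (\<lambda>w. (A w, U w, Y w))"
  define HVAUY where "HVAUY = ent (sblk n) p (\<lambda>w. (V w, (A w, U w, Y w)))"
  define HAUZ where "HAUZ = ent (sblk n) p (\<lambda>w. (A w, U w, Z w))"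
  define HVAUZ where "HVAUZ = ent (sblk n) p (\<lambda>w. (V w, (A w, U w, Z w)))"
  define HAUXZ where "HAUXZ = ent (sblk n) p (\<lambda>w. (A w, U w, X w, Z w))"
  define HVAUXZ where "HVAUXZ = ent (sblk n) p (\<lambda>w. (V w, (A w, U w, X w, Z w)))"
  define HX where "HX = ent (sblk n) p X"
  note Hdefs = HAY_def HUAY_def HAUY_def HVAUY_def HAUZ_def HVAUZ_def HAUXZ_def HVAUXZ_def HX_def
  have conv: "HAY = ent (sblk n) p (\<lambda>w. ([] :: 'x list, Y w, [] :: 'z list, A w, [] :: 'u list, [] :: 'v list))"
    "HAUY = ent (sblk n) p (\<lambda>w. ([] :: 'x list, Y w, [] :: 'z list, A w, U w, [] :: 'v list))"
    "HVAUY = ent (sblk n) p (\<lambda>w. ([] :: 'x list, Y w, [] :: 'z list, A w, U w, V w))"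
    "HAUZ = ent (sblk n) p (\<lambda>w. ([] :: 'x list, [] :: 'y list, Z w, A w, U w, [] :: 'v list))"
    "HVAUZ = ent (sblk n) p (\<lambda>w. ([] :: 'x list, [] :: 'y list, Z w, A w, U w, V w))"
    "HAUXZ = ent (sblk n) p (\<lambda>w. (X w, [] :: 'y list, Z w, A w, U w, [] :: 'v list))"
    "HVAUXZ = ent (sblk n) p (\<lambda>w. (X w, [] :: 'y list, Z w, A w, U w, V w))"
    "HX = ent (sblk n) p (\<lambda>w. (X w, [] :: 'y list, [] :: 'z list, [] :: 'a list, [] :: 'u list, [] :: 'v list))"
    unfolding Hdefs by (rule ent_cong[OF fin]; simp only: prod.inject simp_thms; blast)+
  have HUAY: "HUAY = HAUY" unfolding Hdefs by (rule ent_cong[OF fin]) auto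
  have "log 2 (card (ea ` seqs UNIV n)) + HVAUY - HAY \<le> real n * (RW + \<epsilon>)
    \<and> (HVAUZ - HAUZ) - (HVAUY - HAUY) \<ge> real n * (RK - \<epsilon>)
    \<and> HX + HAUZ - HAUXZ \<le> real n * (L3 + \<epsilon>)
    \<and> HX + HAUZ - HAUXZ + (HVAUY - HAUY) - (HVAUXZ - HAUXZ) \<le> real n * (L2 + \<epsilon>)"
    using inner unfolding conv unfolding Let_def A_def U_def V_def X_def Y_def Z_def p_def .
  note IN = this
  have in1: "log 2 (card (ea ` seqs UNIV n)) + HVAUY - HAY \<le> real n * (RW + \<epsilon>)"
    and in2: "(HVAUZ - HAUZ) - (HVAUY - HAUY) \<ge> real n * (RK - \<epsilon>)"
    and in3: "HX + HAUZ - HAUXZ \<le> real n * (L3 + \<epsilon>)"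
    and in4: "HX + HAUZ - HAUXZ + (HVAUY - HAUY) - (HVAUXZ - HAUXZ) \<le> real n * (L2 + \<epsilon>)"
    by (rule IN[THEN conjunct1] IN[THEN conjunct2, THEN conjunct1] IN[THEN conjunct2, THEN conjunct2, THEN conjunct1]
      IN[THEN conjunct2, THEN conjunct2, THEN conjunct2])+
  have np: "real n > 0" using n by simp
  \<comment> \<open>The outer code counts per superletter, so its slack is \<open>\<epsilon>\<close>
    times the inner block length.\<close>
  have e2: "real n * \<epsilon> > 0" and d2: "\<delta> / 2 > 0" using np \<epsilon>(1) d by simp_all
  obtain N0 where N0: "\<forall>N\<ge>N0. \<forall>K\<ge>1.
      K = 1 \<or> log 2 (real K) \<le> real N * ((HVAUZ - HAUZ) - (HVAUY - HAUY) - 2 * (real n * \<epsilon>)) \<longrightarrow>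
    (\<exists>Mu Mv fu f. Mu \<ge> 1 \<and> Mv \<ge> 1
      \<and> log 2 (real Mu) \<le> real N * ((HUAY - HAY) + real n * \<epsilon>) \<and> log 2 (real Mv) \<le> real N * ((HVAUY - HAUY) + real n * \<epsilon>)
      \<and> (\<forall>l\<in>seqs (sblk n) N. fu (map U l) < Mu) \<and> (\<forall>l\<in>seqs (sblk n) N. f (map V l) < Mv * K)
      \<and> sum (iid p N) (map_err (seqs (sblk n) N) (iid p N) (map U) (map (\<lambda>w. (A w, Y w))) fu) \<le> \<delta> / 2
      \<and> sum (iid p N) (map_err (seqs (sblk n) N) (iid p N) (map V) (map (\<lambda>w. (A w, U w, Y w))) (\<lambda>v. f v div K)) \<le> \<delta> / 2
      \<and> log 2 (real Mv) - (ent (seqs (sblk n) N) (iid p N) (\<lambda>l. (f (map V l) div K, map (\<lambda>w. (A w, U w, X w, Z w)) l))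
           - ent (seqs (sblk n) N) (iid p N) (map (\<lambda>w. (A w, U w, X w, Z w))))
          \<le> real N * (max 0 ((HVAUY - HAUY) - (HVAUXZ - HAUXZ)) + 3 * (real n * \<epsilon>))
      \<and> (K = 1 \<or> log 2 (real (Mv * K)) - (ent (seqs (sblk n) N) (iid p N) (\<lambda>l. (f (map V l), map (\<lambda>w. (A w, U w, Z w)) l))
           - ent (seqs (sblk n) N) (iid p N) (map (\<lambda>w. (A w, U w, Z w)))) \<le> \<delta> / 2))"
    using outer_code[where A=A and U=U and V=V and X=X and Y=Y and Z=Z and \<epsilon>="real n * \<epsilon>" and \<delta>="\<delta> / 2", OF P0 e2 d2, folded Hdefs]
    by (elim exE) (rule that)
  define N where "N = m * (N0 + 1)"
  \<comment> \<open>Since \<open>N\<close> is a multiple of \<open>m\<close>, the exponent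
    \<open>n * N * j / m\<close> is the integer \<open>n * (N0 + 1) * j\<close>, and the key rate is
    exactly \<open>j / m\<close>.\<close>
  define K :: nat where "K = 2 ^ (n * (N0 + 1) * j)"
  have "1 * (N0 + 1) \<le> m * (N0 + 1)" using m by (intro mult_right_mono) auto
  then have N: "N \<ge> N0" "N \<ge> 1" by (simp_all add: N_def)
  have K: "K \<ge> 1" by (simp add: K_def)
  have lK: "log 2 (real K) = real (n * (N0 + 1) * j)" by (simp add: K_def log_nat_power)
  have lK': "log 2 (real K) = real N * (real n * (real j / real m))"
    using m unfolding lK N_def by (simp add: field_simps)
  have Kc: "K = 1 \<or> log 2 (real K) \<le> real N * ((HVAUZ - HAUZ) - (HVAUY - HAUY) - 2 * (real n * \<epsilon>))"
  proof (cases "j = 0")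
    case True then show ?thesis by (simp add: K_def)
  next
    case False
    then have "real n * (real j / real m) \<le> real n * (RK - 3 * \<epsilon>)"
      using \<epsilon>(3) by (intro mult_left_mono) auto
    also have "\<dots> = real n * (RK - \<epsilon>) - 2 * (real n * \<epsilon>)" by (simp add: algebra_simps)
    also have "\<dots> \<le> (HVAUZ - HAUZ) - (HVAUY - HAUY) - 2 * (real n * \<epsilon>)" using in2 by linarith
    finally show ?thesis unfolding lK' by (intro disjI2 mult_left_mono) auto
  qed
  obtain Mu Mv fu f where M: "Mu \<ge> 1" "Mv \<ge> 1"
    and lMu: "log 2 (real Mu) \<le> real N * ((HUAY - HAY) + real n * \<epsilon>)"
    and lMv: "log 2 (real Mv) \<le> real N * ((HVAUY - HAUY) + real n * \<epsilon>)"
    and fu: "\<forall>l\<in>seqs (sblk n) N. fu (map U l) < Mu" and f: "\<forall>l\<in>seqs (sblk n) N. f (map V l) < Mv * K"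
    and er1: "sum (iid p N) (map_err (seqs (sblk n) N) (iid p N) (map U) (map (\<lambda>w. (A w, Y w))) fu) \<le> \<delta> / 2"
    and er2: "sum (iid p N) (map_err (seqs (sblk n) N) (iid p N) (map V) (map (\<lambda>w. (A w, U w, Y w))) (\<lambda>v. f v div K)) \<le> \<delta> / 2"
    and leak: "log 2 (real Mv) - (ent (seqs (sblk n) N) (iid p N) (\<lambda>l. (f (map V l) div K, map (\<lambda>w. (A w, U w, X w, Z w)) l))
           - ent (seqs (sblk n) N) (iid p N) (map (\<lambda>w. (A w, U w, X w, Z w))))
          \<le> real N * (max 0 ((HVAUY - HAUY) - (HVAUXZ - HAUXZ)) + 3 * (real n * \<epsilon>))"
    and sec: "K = 1 \<or> log 2 (real (Mv * K)) - (ent (seqs (sblk n) N) (iid p N) (\<lambda>l. (f (map V l), map (\<lambda>w. (A w, U w, Z w)) l))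
           - ent (seqs (sblk n) N) (iid p N) (map (\<lambda>w. (A w, U w, Z w)))) \<le> \<delta> / 2"
    using N0[THEN spec, THEN mp, OF N(1), THEN spec, THEN mp, OF K, THEN mp, OF Kc]
    by (elim exE conjE) (rule that)
  have sec': "K = 1 \<or> log 2 (real (Mv * K)) - (ent (seqs (sblk n) N) (iid p N) (\<lambda>l. (f (map V l), map (\<lambda>w. (A w, U w, Z w)) l))
           - ent (seqs (sblk n) N) (iid p N) (map (\<lambda>w. (A w, U w, Z w)))) \<le> \<delta>"
    using sec d by linarith
  have d0: "\<delta> \<ge> 0" using d by simp
  define L where "L = card (ea ` seqs UNIV n) ^ N * Mu * Mv"
  note unf = A_def U_def V_def X_def Y_def Z_def p_def \<kappa>_def
  have "\<exists>f1 fa g. gs_good PX PXt PYZ \<Gamma> (n * N) K L f1 fa g \<delta>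
     (real N * (HX + HAUZ - HAUXZ) + real N * (max 0 ((HVAUY - HAUY) - (HVAUXZ - HAUXZ)) + 3 * (real n * \<epsilon>)))
     ((\<Sum>bs\<in>seqs UNIV n. iid (mu PX PXt) n bs * (\<Sum>i<n. \<Gamma> (ea bs ! i))) / real n)"
    unfolding L_def Hdefs unf
    by (rule block_gs_code[where ea=ea and eu=eu and ev=ev and fu=fu and f=f])
      (fact pmf n N(2) K M(2) d0 er1[unfolded unf] er2[unfolded unf] sec'[unfolded unf] leak[unfolded Hdefs unf]
      | rule bspec[OF ea] bspec[OF fu[unfolded unf]] bspec[OF f[unfolded unf]], assumption)+
  then obtain f1 fa g where good: "gs_good PX PXt PYZ \<Gamma> (n * N) K L f1 fa g \<delta>
     (real N * (HX + HAUZ - HAUXZ) + real N * (max 0 ((HVAUY - HAUY) - (HVAUXZ - HAUXZ)) + 3 * (real n * \<epsilon>)))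
     ((\<Sum>bs\<in>seqs UNIV n. iid (mu PX PXt) n bs * (\<Sum>i<n. \<Gamma> (ea bs ! i))) / real n)"
    by (elim exE) (rule that)
  have nN: "real (n * N) = real N * real n" by simp
  have c1: "real N * (HX + HAUZ - HAUXZ) + real N * (max 0 ((HVAUY - HAUY) - (HVAUXZ - HAUXZ)) + 3 * (real n * \<epsilon>))
     \<le> real (n * N) * (max L2 L3 + \<delta>)"
  proof -
    \<comment> \<open>The bin index of \<open>V\<close> adds max(0, H(V|A,U,Y) - H(V|A,U,X,Z)) to
      I(X;A,U,Z): the value 0 leads to \<open>L3\<close>, the difference to
      \<open>L2\<close>.\<close>
    have "real n * (L3 + \<epsilon>) \<le> real n * (max L2 L3 + \<epsilon>)" "real n * (L2 + \<epsilon>) \<le> real n * (max L2 L3 + \<epsilon>)"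
      by (intro mult_left_mono; simp)+
    then have "HX + HAUZ - HAUXZ + max 0 ((HVAUY - HAUY) - (HVAUXZ - HAUXZ)) \<le> real n * (max L2 L3 + \<epsilon>)"
      using in3 in4 unfolding max_def[of 0] by (simp split: if_split)
    then have "HX + HAUZ - HAUXZ + (max 0 ((HVAUY - HAUY) - (HVAUXZ - HAUXZ)) + 3 * (real n * \<epsilon>))
        \<le> real n * (max L2 L3 + \<epsilon>) + 3 * (real n * \<epsilon>)" by linarith
    also have "\<dots> = real n * (max L2 L3 + 4 * \<epsilon>)" by (simp add: algebra_simps)
    also have "\<dots> \<le> real n * (max L2 L3 + \<delta>)" using \<epsilon>(2) d by (intro mult_left_mono) auto
    finally show ?thesis unfolding nN distrib_left[symmetric, of "real N"] mult.assoc
      by (intro mult_left_mono) auto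
  qed
  have c2: "(\<Sum>bs\<in>seqs UNIV n. iid (mu PX PXt) n bs * (\<Sum>i<n. \<Gamma> (ea bs ! i))) / real n \<le> (\<Sum>(b,a,u,v)\<in>UNIV. P (b,a,u,v) * \<Gamma> a) + \<delta>"
  proof -
    have "(\<Sum>bs\<in>seqs UNIV n. iid (mu PX PXt) n bs * (\<Sum>i<n. \<Gamma> (ea bs ! i))) / real n \<le> (\<Sum>(b,a,u,v)\<in>UNIV. P (b,a,u,v) * \<Gamma> a) + \<epsilon>"
      using cost np by (simp only: pos_divide_le_eq mult.commute)
    then show ?thesis using \<epsilon>(2) d by linarith
  qed
  have cardpos: "card (ea ` seqs UNIV n) > 0"
  proof -
    have "replicate n undefined \<in> seqs UNIV n" by (simp add: seqs_def)
    then show ?thesis by (auto simp: card_gt_0_iff finite_seqs)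
  qed
  have c3: "log 2 (real L) \<le> real (n * N) * (RW + \<delta>)"
  proof -
    have "log 2 (real L) = real N * log 2 (card (ea ` seqs UNIV n)) + log 2 (real Mu) + log 2 (real Mv)"
      unfolding L_def using M cardpos by (simp add: log_mult log_nat_power)
    also have "\<dots> \<le> real N * log 2 (card (ea ` seqs UNIV n)) + real N * ((HUAY - HAY) + real n * \<epsilon>) + real N * ((HVAUY - HAUY) + real n * \<epsilon>)"
      using lMu lMv by linarith
    \<comment> \<open>H(U|A,Y) + H(V|A,U,Y) collapses to H(A,U,V,Y) - H(A,Y), the combination
      estimated by the inner code.\<close>
    also have "\<dots> = real N * (log 2 (card (ea ` seqs UNIV n)) + HVAUY - HAY + 2 * (real n * \<epsilon>))"
      unfolding HUAY by (simp add: algebra_simps)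
    also have "\<dots> \<le> real N * (real n * (RW + \<delta>))"
    proof (rule mult_left_mono)
      have "real n * (RW + \<epsilon>) + 2 * (real n * \<epsilon>) = real n * (RW + 3 * \<epsilon>)" by (simp add: algebra_simps)
      also have "\<dots> \<le> real n * (RW + \<delta>)" using \<epsilon>(2) d by (intro mult_left_mono) auto
      finally show "log 2 (card (ea ` seqs UNIV n)) + HVAUY - HAY + 2 * (real n * \<epsilon>) \<le> real n * (RW + \<delta>)"
        using in1 by linarith
    qed simp
    finally show ?thesis by (simp add: mult_ac)
  qed
  have "real j / real m = log 2 (real K) / real (n * N)" unfolding lK' nN using np N(2) by simp
  moreover have "n * N \<ge> 1" using n N(2) by (simp add: Suc_le_eq)
  ultimately show ?thesis using K gs_good_mono[OF good c1 c2] c3 by blast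
qed

lemma fprob_joint1:
  fixes PX :: "'x::finite \<Rightarrow> real" and PXt :: "'x \<Rightarrow> 'b::finite \<Rightarrow> real" and PA :: "'b \<Rightarrow> 'a::finite \<Rightarrow> real"
    and PV :: "'b \<times> 'a \<Rightarrow> 'v::finite \<Rightarrow> real" and PU :: "'v \<Rightarrow> 'u::finite \<Rightarrow> real"
    and PYZ :: "'x \<times> 'b \<times> 'a \<Rightarrow> 'y::finite \<times> 'z::finite \<Rightarrow> real"
  assumes pmf: "is_pmf PX" "stoch PXt" "stoch PYZ" and st: "stoch PA" "stoch PV" "stoch PU"
  shows "fprob UNIV (joint1 PX PXt PA PYZ PV PU)"
proof -
  let ?Q = "chan (letter_law PX PXt PA PV PU) (kap PX PXt PYZ)"
  let ?h = "\<lambda>w :: 'x \<times> 'b \<times> 'a \<times> 'y \<times> 'z \<times> 'v \<times> 'u. (sXt w, (sA w, sU w, sV w), (sX w, sY w, sZ w))"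
  have h: "bij_betw ?h UNIV UNIV"
    by (rule bij_betw_byWitness[where f'="\<lambda>(b,(a,u,v),(x,y,z)). (x,b,a,y,z,v,u)"]) (auto simp: s_defs)
  have J: "joint1 PX PXt PA PYZ PV PU w = ?Q (?h w)" for w
    by (cases w) (simp add: s_defs chan_letter_law[OF pmf(1,2)])
  have Q: "fprob UNIV ?Q" by (rule fprob_chan[OF fprob_letter_law[OF pmf(1,2) st] is_pmf_kap[OF pmf]])
  have "sum (joint1 PX PXt PA PYZ PV PU) UNIV = (\<Sum>w\<in>UNIV. ?Q (?h w))" by (rule sum.cong[OF refl J])
  also have "\<dots> = sum ?Q UNIV" by (rule sum.reindex_bij_betw[OF h])
  finally show ?thesis using fprobD[OF Q] J by (simp add: fprob_def)
qed

text \<open>All five are linear identities between entropies of \<open>joint1\<close>; those that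
  are not formal use that U hangs on V alone and that V is independent of Y given (Xt,A). The last
  one states that storage in the chosen-secret model is generated-secret storage plus the full key
  rate.\<close>

lemma joint1_rates:
  fixes PX :: "'x::finite \<Rightarrow> real" and PXt :: "'x \<Rightarrow> 'b::finite \<Rightarrow> real" and PA :: "'b \<Rightarrow> 'a::finite \<Rightarrow> real"
    and PV :: "'b \<times> 'a \<Rightarrow> 'v::finite \<Rightarrow> real" and PU :: "'v \<Rightarrow> 'u::finite \<Rightarrow> real"
    and PYZ :: "'x \<times> 'b \<times> 'a \<Rightarrow> 'y::finite \<times> 'z::finite \<Rightarrow> real"
  assumes pmf: "is_pmf PX" "stoch PXt" "stoch PYZ" and st: "stoch PA" "stoch PV" "stoch PU"
  defines "p \<equiv> joint1 PX PXt PA PYZ PV PU"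
  defines "RK \<equiv> cmi UNIV p sV sY (pair2 sA sU) - cmi UNIV p sV sZ (pair2 sA sU)"
    and "RW \<equiv> mi UNIV p sXt sA + cmi UNIV p sV sXt (pair2 sA sY)"
  shows "lent (letter_law PX PXt PA PV PU) (kap PX PXt PYZ) (\<lambda>(b,(a,u,v),(x,y,z)). (z, (a, u, v)))
      - lent (letter_law PX PXt PA PV PU) (kap PX PXt PYZ) (\<lambda>(b,(a,u,v),(x,y,z)). (z, (a, u)))
      - lent (letter_law PX PXt PA PV PU) (kap PX PXt PYZ) (\<lambda>(b,(a,u,v),(x,y,z)). (y, (a, u, v)))
      + lent (letter_law PX PXt PA PV PU) (kap PX PXt PYZ) (\<lambda>(b,(a,u,v),(x,y,z)). (y, (a, u))) = RK" (is ?g1)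
    and "lent (letter_law PX PXt PA PV PU) (kap PX PXt PYZ) (\<lambda>(b,(a,u,v),(x,y,z)). x)
      + lent (letter_law PX PXt PA PV PU) (kap PX PXt PYZ) (\<lambda>(b,(a,u,v),(x,y,z)). (z, (a, u)))
      - lent (letter_law PX PXt PA PV PU) (kap PX PXt PYZ) (\<lambda>(b,(a,u,v),(x,y,z)). ((x, z), (a, u)))
      = mi UNIV p sX (pair3 sA sU sZ)" (is ?g2)
    and "lent (letter_law PX PXt PA PV PU) (kap PX PXt PYZ) (\<lambda>(b,(a,u,v),(x,y,z)). x)
      + lent (letter_law PX PXt PA PV PU) (kap PX PXt PYZ) (\<lambda>(b,(a,u,v),(x,y,z)). (z, (a, u)))
      + lent (letter_law PX PXt PA PV PU) (kap PX PXt PYZ) (\<lambda>(b,(a,u,v),(x,y,z)). (y, (a, u, v)))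
      - lent (letter_law PX PXt PA PV PU) (kap PX PXt PYZ) (\<lambda>(b,(a,u,v),(x,y,z)). (y, (a, u)))
      - lent (letter_law PX PXt PA PV PU) (kap PX PXt PYZ) (\<lambda>(b,(a,u,v),(x,y,z)). ((x, z), (a, u, v)))
      = cmi UNIV p (pair2 sV sX) sZ (pair2 sA sU) + mi UNIV p sX (pair3 sA sV sY) - cmi UNIV p (pair2 sV sX) sY (pair2 sA sU)" (is ?g3)
    and "lent (letter_law PX PXt PA PV PU) (kap PX PXt PYZ) (\<lambda>(b,(a,u,v),(x,y,z)). a)
      + lent (letter_law PX PXt PA PV PU) (kap PX PXt PYZ) (\<lambda>(b,(a,u,v),(x,y,z)). b)
      - lent (letter_law PX PXt PA PV PU) (kap PX PXt PYZ) (\<lambda>(b,(a,u,v),(x,y,z)). (b, (a, u, v)))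
      + lent (letter_law PX PXt PA PV PU) (kap PX PXt PYZ) (\<lambda>(b,(a,u,v),(x,y,z)). (y, (a, u, v)))
      - lent (letter_law PX PXt PA PV PU) (kap PX PXt PYZ) (\<lambda>(b,(a,u,v),(x,y,z)). (y, a)) = RW" (is ?g4)
    and "RW + RK = mi UNIV p sXt (pair2 sA sV) - cmi UNIV p sU sY sA - cmi UNIV p sV sZ (pair2 sA sU)" (is ?g5)
proof -
  have J: "fprob UNIV p" unfolding p_def by (rule fprob_joint1[OF pmf st])
  note J' = J[unfolded p_def]
  note uv = ent_joint1_UV[OF J' st(3), folded p_def]
  have m1: "ent UNIV p (\<lambda>w. (sU w, sV w, (sA w, sY w))) - ent UNIV p (\<lambda>w. (sV w, (sA w, sY w)))
      = ent UNIV p (\<lambda>w. (sU w, sV w, (sX w, sA w, sY w))) - ent UNIV p (\<lambda>w. (sV w, (sX w, sA w, sY w)))"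
    using uv[of "\<lambda>(x,b,a,y,z). (a,y)" "\<lambda>(x,b,a,y,z). (x,a,y)"] by simp
  have m2: "ent UNIV p (\<lambda>w. (sU w, sV w, (sA w, sY w))) - ent UNIV p (\<lambda>w. (sV w, (sA w, sY w)))
      = ent UNIV p (\<lambda>w. (sU w, sV w, (sXt w, sA w))) - ent UNIV p (\<lambda>w. (sV w, (sXt w, sA w)))"
    using uv[of "\<lambda>(x,b,a,y,z). (a,y)" "\<lambda>(x,b,a,y,z). (b,a)"] by simp
  have m3: "ent UNIV p (\<lambda>w. (sU w, sV w, sA w)) - ent UNIV p (\<lambda>w. (sV w, sA w))
      = ent UNIV p (\<lambda>w. (sU w, sV w, (sXt w, sA w))) - ent UNIV p (\<lambda>w. (sV w, (sXt w, sA w)))"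
    using uv[of "\<lambda>(x,b,a,y,z). a" "\<lambda>(x,b,a,y,z). (b,a)"] by simp
  note m4 = ent_joint1_VY[OF J' st(3,2), folded p_def]
  note fin = finite_class.finite_UNIV[where 'a="'x \<times> 'b \<times> 'a \<times> 'y \<times> 'z \<times> 'v \<times> 'u"]
  \<comment> \<open>Each tuple is brought to one representative order, so that linear arithmetic
    recognises equal entropies.\<close>
  have q:
    "ent UNIV p (\<lambda>w. (sY w, (sA w, sU w, sV w))) = ent UNIV p (\<lambda>w. (sU w, sV w, (sA w, sY w)))"
    "ent UNIV p (\<lambda>w. (sV w, sY w, (sA w, sU w))) = ent UNIV p (\<lambda>w. (sU w, sV w, (sA w, sY w)))"
    "ent UNIV p (\<lambda>w. (sZ w, (sA w, sU w, sV w))) = ent UNIV p (\<lambda>w. (sV w, sZ w, (sA w, sU w)))"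
    "ent UNIV p (\<lambda>w. (sA w, sU w, sZ w)) = ent UNIV p (\<lambda>w. (sZ w, (sA w, sU w)))"
    "ent UNIV p (\<lambda>w. ((sX w, sZ w), (sA w, sU w))) = ent UNIV p (\<lambda>w. (sX w, sA w, sU w, sZ w))"
    "ent UNIV p (\<lambda>w. ((sX w, sZ w), (sA w, sU w, sV w))) = ent UNIV p (\<lambda>w. ((sV w, sX w), sZ w, (sA w, sU w)))"
    "ent UNIV p (\<lambda>w. ((sV w, sX w), sY w, (sA w, sU w))) = ent UNIV p (\<lambda>w. (sU w, sV w, (sX w, sA w, sY w)))"
    "ent UNIV p (\<lambda>w. (sX w, sA w, sV w, sY w)) = ent UNIV p (\<lambda>w. (sV w, (sX w, sA w, sY w)))"
    "ent UNIV p (\<lambda>w. (sA w, sV w, sY w)) = ent UNIV p (\<lambda>w. (sV w, (sA w, sY w)))"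
    "ent UNIV p (\<lambda>w. (sXt w, (sA w, sU w, sV w))) = ent UNIV p (\<lambda>w. (sU w, sV w, (sXt w, sA w)))"
    "ent UNIV p (\<lambda>w. (sXt w, sA w, sV w)) = ent UNIV p (\<lambda>w. (sV w, (sXt w, sA w)))"
    "ent UNIV p (\<lambda>w. (sV w, (sXt w, sA w), ())) = ent UNIV p (\<lambda>w. (sV w, (sXt w, sA w)))"
    "ent UNIV p (\<lambda>w. ((sXt w, sA w), ())) = ent UNIV p (\<lambda>w. (sXt w, sA w))"
    "ent UNIV p (\<lambda>w. ((sXt w, sA w), sY w)) = ent UNIV p (\<lambda>w. (sXt w, (sA w, sY w)))"
    "ent UNIV p (\<lambda>w. (sV w, (sXt w, sA w), sY w)) = ent UNIV p (\<lambda>w. (sV w, sXt w, (sA w, sY w)))"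
    "ent UNIV p (\<lambda>w. (sY w, sA w)) = ent UNIV p (\<lambda>w. (sA w, sY w))"
    "ent UNIV p (\<lambda>w. (sU w, sV w, sA w)) = ent UNIV p (\<lambda>w. (sV w, (sA w, sU w)))"
    "ent UNIV p (\<lambda>w. (sA w, sV w)) = ent UNIV p (\<lambda>w. (sV w, sA w))"
    "ent UNIV p (\<lambda>w. (sU w, sY w, sA w)) = ent UNIV p (\<lambda>w. (sY w, (sA w, sU w)))"
    "ent UNIV p (\<lambda>w. (sU w, sA w)) = ent UNIV p (\<lambda>w. (sA w, sU w))"
    by (rule ent_cong[OF fin], simp only: prod.inject simp_thms conj_ac)+
  note el = ent_letter_law[OF pmf(1,2), where PA=PA and PV=PV and PU=PU and PYZ=PYZ, folded p_def]
  note mm = mi_eq_ent[OF J] cmi_def pair2_def pair3_def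
  show ?g1 unfolding el prod.case RK_def mm q by linarith
  show ?g2 unfolding el prod.case mm q by linarith
  show ?g3 unfolding el prod.case mm q using m1 by linarith
  show ?g4 unfolding el prod.case RW_def mm q using m2 m4[unfolded q] by linarith
  show ?g5 unfolding RW_def RK_def mm q using m2 m3[unfolded q] m4[unfolded q] by linarith
qed

lemma gs_codes_joint1:
  fixes PX :: "'x::finite \<Rightarrow> real" and PXt :: "'x \<Rightarrow> 'b::finite \<Rightarrow> real" and PA :: "'b \<Rightarrow> 'a::finite \<Rightarrow> real"
    and PV :: "'b \<times> 'a \<Rightarrow> 'v::finite \<Rightarrow> real" and PU :: "'v \<Rightarrow> 'u::finite \<Rightarrow> real"
    and PYZ :: "'x \<times> 'b \<times> 'a \<Rightarrow> 'y::finite \<times> 'z::finite \<Rightarrow> real" and j m :: nat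
  assumes pmf: "is_pmf PX" "stoch PXt" "stoch PYZ" and st: "stoch PA" "stoch PV" "stoch PU"
  defines "p \<equiv> joint1 PX PXt PA PYZ PV PU"
  assumes cost: "expect UNIV p (\<lambda>w. \<Gamma> (sA w)) \<le> C"
    and Rs: "j = 0 \<or> real j / real m < cmi UNIV p sV sY (pair2 sA sU) - cmi UNIV p sV sZ (pair2 sA sU)"
    and Rl: "cmi UNIV p (pair2 sV sX) sZ (pair2 sA sU) + mi UNIV p sX (pair3 sA sV sY) - cmi UNIV p (pair2 sV sX) sY (pair2 sA sU) \<le> Rl"
      "mi UNIV p sX (pair3 sA sU sZ) \<le> Rl"
    and Rw: "mi UNIV p sXt sA + cmi UNIV p sV sXt (pair2 sA sY) \<le> Rw" and m: "m \<ge> 1" and d: "\<delta> > 0"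
  shows "\<exists>n\<ge>1. \<exists>K L f1 fa g. K \<ge> 1 \<and> real j / real m = log 2 (real K) / real n \<and>
      gs_good PX PXt PYZ \<Gamma> n K L f1 fa g \<delta> (real n * (Rl + \<delta>)) (C + \<delta>) \<and> log 2 (real L) \<le> real n * (Rw + \<delta>)"
proof -
  note r = joint1_rates[OF pmf st, folded p_def]
  have "\<exists>n\<ge>1. \<exists>K L f1 fa g. K \<ge> 1 \<and> real j / real m = log 2 (real K) / real n \<and>
      gs_good PX PXt PYZ \<Gamma> n K L f1 fa g \<delta> (real n * (max (cmi UNIV p (pair2 sV sX) sZ (pair2 sA sU)
        + mi UNIV p sX (pair3 sA sV sY) - cmi UNIV p (pair2 sV sX) sY (pair2 sA sU)) (mi UNIV p sX (pair3 sA sU sZ)) + \<delta>))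
        (expect UNIV p (\<lambda>w. \<Gamma> (sA w)) + \<delta>)
      \<and> log 2 (real L) \<le> real n * (mi UNIV p sXt sA + cmi UNIV p sV sXt (pair2 sA sY) + \<delta>)"
    unfolding p_def expect_letter_law[OF pmf] unfolding p_def[symmetric]
    by (rule gs_codes[OF pmf fprob_letter_law[OF pmf(1,2) st] prb_letter_law[OF st] d m, unfolded r, OF Rs])
  then obtain n K L f1 fa g where n: "n \<ge> 1" and K: "K \<ge> 1" and lK: "real j / real m = log 2 (real K) / real n"
    and good: "gs_good PX PXt PYZ \<Gamma> n K L f1 fa g \<delta> (real n * (max (cmi UNIV p (pair2 sV sX) sZ (pair2 sA sU)
        + mi UNIV p sX (pair3 sA sV sY) - cmi UNIV p (pair2 sV sX) sY (pair2 sA sU)) (mi UNIV p sX (pair3 sA sU sZ)) + \<delta>))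
        (expect UNIV p (\<lambda>w. \<Gamma> (sA w)) + \<delta>)"
    and L: "log 2 (real L) \<le> real n * (mi UNIV p sXt sA + cmi UNIV p sV sXt (pair2 sA sY) + \<delta>)"
    by (elim exE conjE) (rule that)
  have "real n * (max (cmi UNIV p (pair2 sV sX) sZ (pair2 sA sU)
        + mi UNIV p sX (pair3 sA sV sY) - cmi UNIV p (pair2 sV sX) sY (pair2 sA sU)) (mi UNIV p sX (pair3 sA sU sZ)) + \<delta>)
      \<le> real n * (Rl + \<delta>)"
    using Rl by (intro mult_left_mono add_right_mono max.boundedI) auto
  moreover have "expect UNIV p (\<lambda>w. \<Gamma> (sA w)) + \<delta> \<le> C + \<delta>" using cost by linarith
  ultimately have good': "gs_good PX PXt PYZ \<Gamma> n K L f1 fa g \<delta> (real n * (Rl + \<delta>)) (C + \<delta>)"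
    by (rule gs_good_mono[OF good])
  have L': "log 2 (real L) \<le> real n * (Rw + \<delta>)"
    by (rule order_trans[OF L]) (intro mult_left_mono add_right_mono Rw of_nat_0_le_iff)
  show ?thesis
    by (rule exI[of _ n], rule conjI[OF n], rule exI[of _ K], rule exI[of _ L], rule exI[of _ f1], rule exI[of _ fa], rule exI[of _ g])
      (intro conjI K lK good' L')
qed

lemma region_gsI:
  fixes PX :: "'x::finite \<Rightarrow> real" and PXt :: "'x \<Rightarrow> 'b::finite \<Rightarrow> real" and PA :: "'b \<Rightarrow> 'a::finite \<Rightarrow> real"
    and PV :: "'b \<times> 'a \<Rightarrow> 'v::finite \<Rightarrow> real" and PU :: "'v \<Rightarrow> 'u::finite \<Rightarrow> real"
    and PYZ :: "'x \<times> 'b \<times> 'a \<Rightarrow> 'y::finite \<times> 'z::finite \<Rightarrow> real"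
  assumes pmf: "is_pmf PX" "stoch PXt" "stoch PYZ" and st: "stoch PA" "stoch PV" "stoch PU"
  defines "p \<equiv> joint1 PX PXt PA PYZ PV PU"
  assumes cost: "expect UNIV p (\<lambda>w. \<Gamma> (sA w)) \<le> C"
    and Rs: "0 \<le> Rs" "Rs \<le> cmi UNIV p sV sY (pair2 sA sU) - cmi UNIV p sV sZ (pair2 sA sU)"
    and Rl: "max (max R1 (cmi UNIV p (pair2 sV sX) sZ (pair2 sA sU) + mi UNIV p sX (pair3 sA sV sY) - cmi UNIV p (pair2 sV sX) sY (pair2 sA sU)))
      (mi UNIV p sX (pair3 sA sU sZ)) \<le> Rl"
    and Rw: "mi UNIV p sXt sA + cmi UNIV p sV sXt (pair2 sA sY) \<le> Rw"
  shows "(Rs, Rl, Rw, C) \<in> region_gs PX PXt PYZ \<Gamma>"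
  unfolding region_gs_def
proof (rule closure_first_coordinate)
  fix \<eta> :: real assume "\<eta> > 0"
  from rational_below[OF Rs this] obtain j m :: nat where m: "m \<ge> 1"
    and j: "j = 0 \<or> real j / real m < cmi UNIV p sV sY (pair2 sA sU) - cmi UNIV p sV sZ (pair2 sA sU)"
    and jm: "real j / real m \<le> Rs" "Rs - \<eta> < real j / real m" by (elim exE conjE) (rule that)
  have Rl': "cmi UNIV p (pair2 sV sX) sZ (pair2 sA sU) + mi UNIV p sX (pair3 sA sV sY) - cmi UNIV p (pair2 sV sX) sY (pair2 sA sU) \<le> Rl"
      "mi UNIV p sX (pair3 sA sU sZ) \<le> Rl" using Rl by (simp_all only: max.bounded_iff)
  have "achievable_gs PX PXt PYZ \<Gamma> (real j / real m, Rl, Rw, C)"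
    by (rule achievable_gsI, rule gs_codes_joint1[OF pmf st, folded p_def, OF cost j Rl' Rw m])
  then show "\<exists>Rs'\<le>Rs. Rs - \<eta> < Rs' \<and> achievable_gs PX PXt PYZ \<Gamma> (Rs', Rl, Rw, C)" using jm by blast
qed

lemma region_csI:
  fixes PX :: "'x::finite \<Rightarrow> real" and PXt :: "'x \<Rightarrow> 'b::finite \<Rightarrow> real" and PA :: "'b \<Rightarrow> 'a::finite \<Rightarrow> real"
    and PV :: "'b \<times> 'a \<Rightarrow> 'v::finite \<Rightarrow> real" and PU :: "'v \<Rightarrow> 'u::finite \<Rightarrow> real"
    and PYZ :: "'x \<times> 'b \<times> 'a \<Rightarrow> 'y::finite \<times> 'z::finite \<Rightarrow> real"
  assumes pmf: "is_pmf PX" "stoch PXt" "stoch PYZ" and st: "stoch PA" "stoch PV" "stoch PU"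
  defines "p \<equiv> joint1 PX PXt PA PYZ PV PU"
  assumes cost: "expect UNIV p (\<lambda>w. \<Gamma> (sA w)) \<le> C"
    and Rs: "0 \<le> Rs" "Rs \<le> cmi UNIV p sV sY (pair2 sA sU) - cmi UNIV p sV sZ (pair2 sA sU)"
    and Rl: "max (max R1 (cmi UNIV p (pair2 sV sX) sZ (pair2 sA sU) + mi UNIV p sX (pair3 sA sV sY) - cmi UNIV p (pair2 sV sX) sY (pair2 sA sU)))
      (mi UNIV p sX (pair3 sA sU sZ)) \<le> Rl"
    and Rw: "mi UNIV p sXt (pair2 sA sV) - cmi UNIV p sU sY sA - cmi UNIV p sV sZ (pair2 sA sU) \<le> Rw"
  shows "(Rs, Rl, Rw, C) \<in> region_cs PX PXt PYZ \<Gamma>"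
  unfolding region_cs_def
proof (rule closure_first_coordinate)
  fix \<eta> :: real assume "\<eta> > 0"
  from rational_below[OF Rs this] obtain j m :: nat where m: "m \<ge> 1"
    and j: "j = 0 \<or> real j / real m < cmi UNIV p sV sY (pair2 sA sU) - cmi UNIV p sV sZ (pair2 sA sU)"
    and jm: "real j / real m \<le> Rs" "Rs - \<eta> < real j / real m" by (elim exE conjE) (rule that)
  have Rl': "cmi UNIV p (pair2 sV sX) sZ (pair2 sA sU) + mi UNIV p sX (pair3 sA sV sY) - cmi UNIV p (pair2 sV sX) sY (pair2 sA sU) \<le> Rl"
      "mi UNIV p sX (pair3 sA sU sZ) \<le> Rl" using Rl by (simp_all only: max.bounded_iff)
  \<comment> \<open>The hypothesis gives \<open>Rw\<close> at least the generated-secret storage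
    plus the full key rate, and \<open>j / m\<close> does not exceed that key rate.\<close>
  have Rw': "mi UNIV p sXt sA + cmi UNIV p sV sXt (pair2 sA sY) \<le> Rw - real j / real m"
    using joint1_rates(5)[OF pmf st, folded p_def] Rw jm(1) Rs(2) by linarith
  have "achievable_cs PX PXt PYZ \<Gamma> (real j / real m, Rl, Rw, C)"
    by (rule achievable_csI, rule gs_codes_joint1[OF pmf st, folded p_def, OF cost j Rl' Rw' m])
  then show "\<exists>Rs'\<le>Rs. Rs - \<eta> < Rs' \<and> achievable_cs PX PXt PYZ \<Gamma> (Rs', Rl, Rw, C)" using jm by blast
qed

theorem theorem1:
  fixes PX :: "'x::finite \<Rightarrow> real"
    and PXt :: "'x \<Rightarrow> 'xt::finite \<Rightarrow> real"
    and PYZ :: "'x \<times> 'xt \<times> 'a::finite \<Rightarrow> 'y::finite \<times> 'z::finite \<Rightarrow> real"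
    and \<Gamma> :: "'a \<Rightarrow> real"
  assumes "is_pmf PX" and "stoch PXt" and "stoch PYZ" and "\<forall>a. 0 \<le> \<Gamma> a"
  shows
   "(\<forall>(PA :: 'xt \<Rightarrow> 'a \<Rightarrow> real) (PV :: 'xt \<times> 'a \<Rightarrow> 'v::finite \<Rightarrow> real) (PU :: 'v \<Rightarrow> 'u::finite \<Rightarrow> real)
       Rs Rl Rw C.
      stoch PA \<and> stoch PV \<and> stoch PU \<and>
      (let p = joint1 PX PXt PA PYZ PV PU;
           Rl1 = cmi UNIV p (pair2 sV sX) sZ sA + mi UNIV p sX (pair3 sA sV sY)
                 - cmi UNIV p (pair2 sV sX) sY sA;
           Rl2 = cmi UNIV p (pair2 sV sX) sZ (pair2 sA sU) + mi UNIV p sX (pair3 sA sV sY)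
                 - cmi UNIV p (pair2 sV sX) sY (pair2 sA sU);
           Rl3 = mi UNIV p sX (pair3 sA sU sZ)
       in expect UNIV p (\<lambda>w. \<Gamma> (sA w)) \<le> C
        \<and> 0 \<le> Rs \<and> Rs \<le> cmi UNIV p sV sY (pair2 sA sU) - cmi UNIV p sV sZ (pair2 sA sU)
        \<and> Rl \<ge> max (max Rl1 Rl2) Rl3
        \<and> Rw \<ge> mi UNIV p sXt sA + cmi UNIV p sV sXt (pair2 sA sY))
      \<longrightarrow> (Rs, Rl, Rw, C) \<in> region_gs PX PXt PYZ \<Gamma>)
  \<and> (\<forall>(PA :: 'xt \<Rightarrow> 'a \<Rightarrow> real) (PV :: 'xt \<times> 'a \<Rightarrow> 'v \<Rightarrow> real) (PU :: 'v \<Rightarrow> 'u \<Rightarrow> real)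
       Rs Rl Rw C.
      stoch PA \<and> stoch PV \<and> stoch PU \<and>
      (let p = joint1 PX PXt PA PYZ PV PU;
           Rl1 = cmi UNIV p (pair2 sV sX) sZ sA + mi UNIV p sX (pair3 sA sV sY)
                 - cmi UNIV p (pair2 sV sX) sY sA;
           Rl2 = cmi UNIV p (pair2 sV sX) sZ (pair2 sA sU) + mi UNIV p sX (pair3 sA sV sY)
                 - cmi UNIV p (pair2 sV sX) sY (pair2 sA sU);
           Rl3 = mi UNIV p sX (pair3 sA sU sZ)
       in expect UNIV p (\<lambda>w. \<Gamma> (sA w)) \<le> C
        \<and> 0 \<le> Rs \<and> Rs \<le> cmi UNIV p sV sY (pair2 sA sU) - cmi UNIV p sV sZ (pair2 sA sU)
        \<and> Rl \<ge> max (max Rl1 Rl2) Rl3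
        \<and> Rw \<ge> mi UNIV p sXt (pair2 sA sV) - cmi UNIV p sU sY sA - cmi UNIV p sV sZ (pair2 sA sU))
      \<longrightarrow> (Rs, Rl, Rw, C) \<in> region_cs PX PXt PYZ \<Gamma>)"
proof (intro conjI allI impI, goal_cases)
  case (1 PA PV PU Rs Rl Rw C)
  then show ?case unfolding Let_def by (elim conjE) (rule region_gsI[OF assms(1-3)])
next
  case (2 PA PV PU Rs Rl Rw C)
  then show ?case unfolding Let_def by (elim conjE) (rule region_csI[OF assms(1-3)])
qed

end
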